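(* Assume that, for some constant $g>0$, $$\gamma_n-\gamma_{n-1}=o(\gamma_n^2)\qquad\text{and}\qquad \frac{\gamma_n}{\rho_n}=g+o(\gamma_n).$$ Then the sequence $\left(Y_n=(1-X_n)/\rho_n\right)_{n\ge 1}$ converges weakly to the unique stationary distribution of the Markov process on $[0,+\infty)$ with generator $L$ defined by $$Lf(y)=p_B\,y\,\frac{f(y+g)-f(y)}{g}+(1-p_A-p_A y)f'(y),\qquad y\ge 0,$$ for $f$ continuously differentiable and compactly supported in $[0,+\infty)$.
   Context: Let $0<p_B<p_A<1$ and $\pi=p_A-p_B$. Let $(\gamma_n)_{n\ge 1}$ be a non-increasing sequence of positive numbers with $\gamma_n<1$, $\sum_{n\ge 1}\gamma_n=+\infty$ and $\sum_{n}e^{-\vartheta/\gamma_n}<\infty$ for every $\vartheta>0$. Let $(\rho_n)_{n\ge 1}$ be a sequence of positive numbers with $\gamma_n\rho_n<1$. Let $(U_n)_{n\ge 1}$ be i.i.d. random variables uniformly distributed on $[0,1]$, and let $A_n,B_n$ ($n\ge1$) be events with $\mathbb{P}(A_n)=p_A$, $\mathbb{P}(B_n)=p_B$, such that the pairs $(\mathbf 1_{A_n},\mathbf 1_{B_n})$, $n\ge 1$, are independent of one another and the sequence $(\mathbf 1_{A_n},\mathbf 1_{B_n})_{n\ge1}$ is independent of $(U_n)_{n\ge1}$. The penalized two-armed bandit algorithm is the $[0,1]$-valued sequence $(X_n)_{n\ge0}$ with $X_0=x\in(0,1)$ and $$X_{n+1}=X_n+\gamma_{n+1}\left(\mathbf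 1_{\{U_{n+1}\le X_n\}\cap A_{n+1}}(1-X_n)-\mathbf 1_{\{U_{n+1}>X_n\}\cap B_{n+1}}X_n\right)-\gamma_{n+1}\rho_{n+1}\left(X_n\mathbf 1_{\{U_{n+1}\le X_n\}\cap A_{n+1}^c}-(1-X_n)\mathbf 1_{\{U_{n+1}>X_n\}\cap B_{n+1}^c}\right),\quad n\ge0.$$ The Markov process with generator $L$ is the càdlàg Markov process $(Y_t)_{t\ge0}$ on $[0,+\infty)$ solving the martingale problem for $L$: for every $f\in C^1$ with compact support in $[0,+\infty)$, $f(Y_t)-f(Y_0)-\int_0^tLf(Y_s)\,ds$ is a martingale. "Converges weakly" means convergence in distribution. *)

theory Defs
  imports "HOL-Probability.Probability"
begin

primrec penalized_bandit ::
  "(nat \<Rightarrow> real) \<Rightarrow> (nat \<Rightarrow> real) \<Rightarrow> (nat \<Rightarrow> 'a \<Rightarrow> real) \<Rightarrow> (nat \<Rightarrow> 'a set) \<Rightarrow> (nat \<Rightarrow> 'a set)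
    \<Rightarrow> real \<Rightarrow> nat \<Rightarrow> 'a \<Rightarrow> real"
where
  "penalized_bandit \<gamma> \<rho> U A B x 0 = (\<lambda>\<omega>. x)"
| "penalized_bandit \<gamma> \<rho> U A B x (Suc n) = (\<lambda>\<omega>.
     let X = penalized_bandit \<gamma> \<rho> U A B x n \<omega>; N = Suc n in
       X + \<gamma> N * (indicator ({\<omega>. U N \<omega> \<le> X} \<inter> A N) \<omega> * (1 - X)
                 - indicator ({\<omega>. U N \<omega> > X} \<inter> B N) \<omega> * X)
         - \<gamma> N * \<rho> N * (X * indicator ({\<omega>. U N \<omega> \<le> X} \<inter> - A N) \<omega>
                 - (1 - X) * indicator ({\<omega>. U N \<omega> > X} \<inter> - B N) \<omega>))"

text \<open>Independence of two random variables with values in possibly different types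
  (the two variables of \<open>prob_space.indep_var\<close> share one value type).\<close>

definition independent_rvs ::
  "'a measure \<Rightarrow> 'b measure \<Rightarrow> ('a \<Rightarrow> 'b) \<Rightarrow> 'c measure \<Rightarrow> ('a \<Rightarrow> 'c) \<Rightarrow> bool"
where
  "independent_rvs M N V N' W \<longleftrightarrow>
     V \<in> measurable M N \<and> W \<in> measurable M N' \<and>
     prob_space.indep_set M (sets (vimage_algebra (space M) V N))
                            (sets (vimage_algebra (space M) W N'))"

text \<open>Processes are indexed by real times, of which only the nonnegative ones matter.\<close>

definition cadlag :: "(real \<Rightarrow> real) \<Rightarrow> bool" where
  "cadlag w \<longleftrightarrow>
     (\<forall>t\<ge>0. (w \<longlongrightarrow> w t) (at_right t)) \<and> (\<forall>t>0. \<exists>l. (w \<longlongrightarrow> l) (at_left t))"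

definition natural_filtration ::
  "'a measure \<Rightarrow> 'b measure \<Rightarrow> (real \<Rightarrow> 'a \<Rightarrow> 'b) \<Rightarrow> real \<Rightarrow> 'a measure"
where
  "natural_filtration M S Y t =
     vimage_algebra (space M) (\<lambda>\<omega>. \<lambda>s\<in>{0..t}. Y s \<omega>) (PiM {0..t} (\<lambda>_. S))"

definition martingale_wrt ::
  "'a measure \<Rightarrow> (real \<Rightarrow> 'a measure) \<Rightarrow> (real \<Rightarrow> 'a \<Rightarrow> real) \<Rightarrow> bool"
where
  "martingale_wrt M F Z \<longleftrightarrow>
     (\<forall>t\<ge>0. Z t \<in> borel_measurable (F t) \<and> integrable M (Z t)) \<and>
     (\<forall>s t. 0 \<le> s \<and> s \<le> t \<longrightarrow> (AE \<omega> in M. real_cond_exp M (F s) (Z t) \<omega> = Z s \<omega>))"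

definition transition_function :: "'b measure \<Rightarrow> (real \<Rightarrow> 'b \<Rightarrow> 'b measure) \<Rightarrow> bool" where
  "transition_function S P \<longleftrightarrow>
     (\<forall>t\<ge>0. P t \<in> measurable S (prob_algebra S)) \<and>
     (\<forall>y\<in>space S. P 0 y = return S y) \<and>
     (\<forall>s\<ge>0. \<forall>t\<ge>0. \<forall>y\<in>space S. P (s + t) y = P s y \<bind> P t)"

definition markov_process ::
  "'a measure \<Rightarrow> 'b measure \<Rightarrow> (real \<Rightarrow> 'b \<Rightarrow> 'b measure) \<Rightarrow> (real \<Rightarrow> 'a \<Rightarrow> 'b) \<Rightarrow> bool"
where
  "markov_process M S P Y \<longleftrightarrow>
     (\<forall>t\<ge>0. Y t \<in> measurable M S) \<and>
     (\<forall>s\<ge>0. \<forall>t\<ge>0. \<forall>D\<in>sets S. AE \<omega> in M.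
        real_cond_exp M (natural_filtration M S Y s) (indicator {\<omega>. Y (s + t) \<omega> \<in> D}) \<omega>
          = measure (P t (Y s \<omega>)) D)"

definition stationary_distribution ::
  "'b measure \<Rightarrow> (real \<Rightarrow> 'b \<Rightarrow> 'b measure) \<Rightarrow> 'b measure \<Rightarrow> bool"
where
  "stationary_distribution S P \<mu> \<longleftrightarrow>
     prob_space \<mu> \<and> sets \<mu> = sets S \<and> (\<forall>t\<ge>0. \<mu> \<bind> P t = \<mu>)"

abbreviation half_line :: "real measure" where
  "half_line \<equiv> restrict_space borel {0..}"

text \<open>Only the values on the half-line matter; the derivative at 0 is one-sided, and the
  function need not vanish at 0.\<close>

definition C1_compact_half_line :: "(real \<Rightarrow> real) set" where
  "C1_compact_half_line = {f.
     (\<exists>f'. (\<forall>y\<ge>0. (f has_vector_derivative f' y) (at y within {0..})) \<and> continuous_on {0..} f') \<and>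
     (\<exists>K. \<forall>y\<ge>K. f y = 0)}"

definition solves_martingale_problem ::
  "((real \<Rightarrow> real) \<Rightarrow> real \<Rightarrow> real) \<Rightarrow> 'a measure \<Rightarrow> (real \<Rightarrow> 'a \<Rightarrow> real) \<Rightarrow> bool"
where
  "solves_martingale_problem L M Y \<longleftrightarrow>
     (\<forall>f\<in>C1_compact_half_line.
        martingale_wrt M (natural_filtration M half_line Y)
          (\<lambda>t \<omega>. f (Y t \<omega>) - f (Y 0 \<omega>) - (LINT s:{0..t}|lborel. L f (Y s \<omega>))))"

text \<open>The Markov process with generator \<open>L\<close> is given by its transition function \<open>P\<close>: from every
  starting point there is a cadlag Markov process with transition function \<open>P\<close> that solves the
  martingale problem. There is no loss of generality in realising it as the coordinate process on
  a space of paths, since any solution can be pushed forward to such a space.\<close>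

definition markov_process_with_generator ::
  "((real \<Rightarrow> real) \<Rightarrow> real \<Rightarrow> real) \<Rightarrow> (real \<Rightarrow> real \<Rightarrow> real measure) \<Rightarrow> bool"
where
  "markov_process_with_generator L P \<longleftrightarrow>
     transition_function half_line P \<and>
     (\<forall>y\<ge>0. \<exists>Q :: (real \<Rightarrow> real) measure.
        prob_space Q \<and>
        (\<forall>w\<in>space Q. cadlag w) \<and>
        markov_process Q half_line P (\<lambda>t w. w t) \<and>
        (AE w in Q. w 0 = y) \<and>
        solves_martingale_problem L Q (\<lambda>t w. w t))"

definition bandit_generator ::
  "real \<Rightarrow> real \<Rightarrow> real \<Rightarrow> (real \<Rightarrow> real) \<Rightarrow> real \<Rightarrow> real"
where
  "bandit_generator p\<^sub>A p\<^sub>B g f y =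
     p\<^sub>B * y * ((f (y + g) - f y) / g)
     + (1 - p\<^sub>A - p\<^sub>A * y) * vector_derivative f (at y within {0..})"

end

theory Submission
  imports Defs
begin

text \<open>
  The scaled distance \<open>Y n = (1 - X n) / \<rho> n\<close> to the good state changes in four ways. Arm A is drawn
  with probability close to one; a success multiplies \<open>Y\<close> by \<open>1 - \<gamma>\<close>, a failure adds about \<open>\<gamma>\<close>. Arm B
  is drawn with probability \<open>\<rho> n * Y n\<close>, which is about \<open>\<gamma> * Y n / g\<close>; a success adds \<open>\<gamma> / \<rho>\<close>, about
  \<open>g\<close>, and a failure is negligible. So one step acts on functions of \<open>Y\<close> like the identity plus
  \<open>\<gamma>\<close> times the generator. The proof uses this on the exponentials \<open>exp (- (l * y))\<close> only, on which the
  generator is the multiplication by \<open>- (y * R l) - (1 - p\<^sub>A) * l\<close> with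
  \<open>R l = p\<^sub>B * (1 - exp (- (l * g))) / g - p\<^sub>A * l\<close> (the constant \<open>branching_rate\<close>), negative for \<open>l > 0\<close>.
  A stationary law therefore has a Laplace transform \<open>h\<close> with \<open>R l * h' l = (1 - p\<^sub>A) * l * h l\<close> and
  \<open>h 0 = 1\<close>, and this equation has one solution, \<open>limit_transform\<close>, to which everything is
  compared.

  Convergence. The Laplace transform \<open>T n\<close> of \<open>Y n\<close> satisfies, up to \<open>o(\<gamma>)\<close> and uniformly for \<open>l\<close> in a
  compact part of the open half-line, \<open>T (n + 1) l = (1 - \<gamma> * (1 - p\<^sub>A) * l) * T n (l + \<gamma> * R l)\<close>, and
  \<open>limit_transform\<close> satisfies the same relation. The map \<open>l \<mapsto> l + \<gamma> * R l\<close> contracts towards \<open>0\<close> at least by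
  the factor \<open>1 - \<gamma> * (p\<^sub>A - p\<^sub>B)\<close>, and near \<open>0\<close> the two transforms differ by at most a constant times \<open>l\<close>
  as soon as the first moments of \<open>Y n\<close> are bounded; since the step sizes have an infinite sum, the
  difference tends to \<open>0\<close> (\<open>transform_tendsto\<close>). The first moments are controlled by the Lyapunov
  function \<open>(1 - x) / (x + K * \<rho>)\<close>, which on the whole of \<open>[0, 1]\<close> decreases in the mean by a fraction of
  order \<open>\<gamma>\<close>, up to an error of order \<open>\<gamma> * \<rho>\<close> (\<open>lyapunov_drift\<close>). They also give tightness, and the
  limit law then comes with its Laplace transform (\<open>limit_distribution\<close>).

  Stationarity. The martingale problem, extended to exponentials, describes how Laplace transforms evolve
  under any transition function \<open>P\<close> of the process. For a stationary law the evolution is constant,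
  which is the differential equation above. Conversely, if the initial law has transform
  \<open>limit_transform\<close>, the quotient of the transform at time \<open>t\<close> by \<open>limit_transform\<close> solves a transport
  equation with constant boundary values, and a maximum principle keeps it equal to \<open>1\<close>
  (\<open>transform_stationary\<close>).

  Existence. The process is built by hand from independent exponential variables: between jumps it
  follows the flow of \<open>y' = 1 - p\<^sub>A - p\<^sub>A * y\<close>, and it jumps by \<open>g\<close> when the integral of the rate
  \<open>p\<^sub>B * y / g\<close> along the path reaches the next variable. Absence of explosion and Dynkin's formula both
  come from one fact: a bounded function that is dominated by its own average at the first jump vanishes
  (\<open>renewal_zero\<close>). The Markov property comes from the lack of memory of the exponential law, by
  induction on the number of jumps before the time of conditioning.
\<close>

section \<open>Uniqueness of Laplace transforms\<close>

text \<open>The substitution \<open>x = exp (- y)\<close> maps the half-line into the unit interval, where polynomials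
  approximate continuous functions uniformly.\<close>
lemma integral_exp_minus_approx:
  fixes M :: "real measure" and u q :: "real \<Rightarrow> real"
  assumes M: "real_distribution M" and u: "continuous_on {0..1} u" and q: "continuous_on {0..1} q"
    and uq: "\<And>x. x \<in> {0..1} \<Longrightarrow> \<bar>u x - q x\<bar> \<le> d"
  shows "integrable M (\<lambda>y. u (exp (- max 0 y)))"
    "\<bar>(LINT y|M. u (exp (- max 0 y))) - (LINT y|M. q (exp (- max 0 y)))\<bar> \<le> d"
proof -
  interpret real_distribution M by (rule M)
  have int: "integrable M (\<lambda>y. w (exp (- max 0 y)))" if w: "continuous_on {0..1} w" for w :: "real \<Rightarrow> real"
  proof -
    obtain B where B: "\<And>x. x \<in> {0..1} \<Longrightarrow> \<bar>w x\<bar> \<le> B"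
      using compact_imp_bounded[OF compact_continuous_image[OF w compact_Icc]]
      by (auto simp: bounded_iff) (meson atLeastAtMost_iff)
    have "continuous_on UNIV (\<lambda>y. w (exp (- max 0 y)))"
      by (rule continuous_on_compose2[OF w]) (auto intro!: continuous_intros)
    hence [measurable]: "(\<lambda>y. w (exp (- max 0 y))) \<in> borel_measurable M"
      using borel_measurable_continuous_onI measurable_finite_borel by blast
    show ?thesis
      by (rule integrable_const_bound[of _ B]) (auto intro!: AE_I2 B)
  qed
  show "integrable M (\<lambda>y. u (exp (- max 0 y)))" by (rule int[OF u])
  have "\<bar>(LINT y|M. u (exp (- max 0 y))) - (LINT y|M. q (exp (- max 0 y)))\<bar>
      = \<bar>LINT y|M. u (exp (- max 0 y)) - q (exp (- max 0 y))\<bar>"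
    using int[OF u] int[OF q] by simp
  also have "\<dots> \<le> (LINT y|M. \<bar>u (exp (- max 0 y)) - q (exp (- max 0 y))\<bar>)"
    using integral_abs_bound by blast
  also have "\<dots> \<le> (LINT y|M. d)"
    using int[OF u] int[OF q] by (intro integral_mono) (auto intro!: uq)
  finally show "\<bar>(LINT y|M. u (exp (- max 0 y))) - (LINT y|M. q (exp (- max 0 y)))\<bar> \<le> d"
    using prob_space by simp
qed

text \<open>The values at positive integers are the moments of \<open>exp (- y)\<close>, hence give the integrals of all
  polynomials in it and, by Weierstrass, of all continuous functions of it; ramps then yield the
  distribution functions.\<close>
lemma Laplace_transform_determines_distribution:
  fixes M N :: "real measure"
  assumes M: "real_distribution M" "AE y in M. 0 \<le> y"
    and N: "real_distribution N" "AE y in N. 0 \<le> y"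
    and eq: "\<And>k::nat. k \<ge> 1 \<Longrightarrow> (LINT y|M. exp (- (real k * y))) = (LINT y|N. exp (- (real k * y)))"
  shows "M = N"
proof -
  interpret M: real_distribution M by (rule M)
  interpret N: real_distribution N by (rule N)
  have mono: "(LINT y|M. exp (- max 0 y) ^ k) = (LINT y|N. exp (- max 0 y) ^ k)" for k :: nat
  proof (cases "k = 0")
    case False
    have "(LINT y|P. exp (- max 0 y) ^ k) = (LINT y|P. exp (- (real k * y)))"
      if "AE y in P. 0 \<le> y" "sets P = sets borel" for P :: "real measure"
    proof (intro integral_cong_AE)
      show "AE y in P. exp (- max 0 y) ^ k = exp (- (real k * y))"
        using that(1) by eventually_elim (simp add: exp_of_nat_mult[symmetric])
    qed (auto simp: measurable_cong_sets[OF that(2) refl])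
    from this[OF M(2)] this[OF N(2)] eq[of k] False show ?thesis by simp
  qed (simp add: M.prob_space[simplified] N.prob_space[simplified])
  have cont: "(LINT y|M. u (exp (- max 0 y))) = (LINT y|N. u (exp (- max 0 y)))"
    if u: "continuous_on {0..1} u" for u :: "real \<Rightarrow> real"
  proof (rule ccontr)
    let ?I = "\<lambda>P::real measure. \<lambda>f::real\<Rightarrow>real. LINT y|P. f (exp (- max 0 y))"
    assume ne: "?I M u \<noteq> ?I N u"
    define d where "d = \<bar>?I M u - ?I N u\<bar>"
    have d: "d > 0" using ne by (simp add: d_def)
    obtain q where q: "real_polynomial_function q" "\<And>x. x \<in> {0..1} \<Longrightarrow> \<bar>u x - q x\<bar> < d / 3"
      using Stone_Weierstrass_real_polynomial_function[OF compact_Icc u, of "d/3"] d by auto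
    obtain a n where qa: "q = (\<lambda>x. \<Sum>i\<le>n. a i * x ^ i)"
      using q(1) real_polynomial_function_iff_sum by blast
    have cq: "continuous_on {0..1} q" unfolding qa by (intro continuous_intros)
    have cp: "continuous_on {0..1} (\<lambda>x::real. x ^ i)" for i :: nat by (intro continuous_intros)
    have "?I M q = (\<Sum>i\<le>n. a i * (LINT y|M. exp (- max 0 y) ^ i))"
      unfolding qa by (subst Bochner_Integration.integral_sum)
        (auto intro!: integrable_mult_right integral_exp_minus_approx(1)[OF M(1) cp cp, where d=0])
    moreover have "?I N q = (\<Sum>i\<le>n. a i * (LINT y|N. exp (- max 0 y) ^ i))"
      unfolding qa by (subst Bochner_Integration.integral_sum)
        (auto intro!: integrable_mult_right integral_exp_minus_approx(1)[OF N(1) cp cp, where d=0])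
    ultimately have "?I M q = ?I N q" by (simp add: mono)
    moreover have "\<bar>?I M u - ?I M q\<bar> \<le> d/3"
      by (rule integral_exp_minus_approx(2)[OF M(1) u cq]) (rule less_imp_le, rule q(2))
    moreover have "\<bar>?I N u - ?I N q\<bar> \<le> d/3"
      by (rule integral_exp_minus_approx(2)[OF N(1) u cq]) (rule less_imp_le, rule q(2))
    ultimately have "\<bar>?I M u - ?I N u\<bar> \<le> 2 * d / 3" by linarith
    thus False using d unfolding d_def[symmetric] by simp
  qed
  have "cdf M x = cdf N x" for x
  proof (cases "x < 0")
    case True
    have "cdf P x = 0" if "real_distribution P" "AE y in P. 0 \<le> y" for P
    proof -
      interpret P: real_distribution P by fact
      have "emeasure P {y \<in> space P. y \<le> x} = 0"
        by (rule emeasure_eq_0_AE, rule eventually_mono[OF that(2)]) (use True in auto)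
      hence "emeasure P {..x} = 0" by (simp add: atMost_def)
      thus ?thesis by (simp add: cdf_def P.emeasure_eq_measure)
    qed
    from this[OF M] this[OF N] show ?thesis by simp
  next
    case False
    \<comment> \<open>a ramp in the variable \<open>exp (- y)\<close>, decreasing to the indicator of \<open>{..x}\<close> as the slope grows\<close>
    define w where "w n s = max 0 (min 1 (1 + real n * (s - exp (- x))))" for n and s :: real
    have w: "continuous_on {0..1} (w n)" for n unfolding w_def by (intro continuous_intros)
    have wlim: "(\<lambda>n. w n (exp (- max 0 y))) \<longlonglongrightarrow> indicator {..x} y" for y
    proof (cases "y \<le> x")
      case True
      hence "exp (- max 0 y) \<ge> exp (- x)" using False by simp
      hence "w n (exp (- max 0 y)) = 1" for n unfolding w_def by simp
      thus ?thesis using True by simp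
    next
      case False2: False
      define c where "c = exp (- x) - exp (- max 0 y)"
      have c: "c > 0" using False False2 by (simp add: c_def)
      obtain n0 :: nat where n0: "1 / c < real n0" using reals_Archimedean2 by blast
      have "w n (exp (- max 0 y)) = 0" if "n \<ge> n0" for n
      proof -
        have "1 / c < real n" using n0 that by linarith
        hence "1 + real n * (exp (- max 0 y) - exp (- x)) < 0"
          using c by (simp add: field_simps c_def)
        thus ?thesis unfolding w_def by simp
      qed
      hence "eventually (\<lambda>n. w n (exp (- max 0 y)) = 0) sequentially"
        using eventually_sequentially by blast
      thus ?thesis using False2 by (simp add: tendsto_eventually)
    qed
    have "(\<lambda>n. LINT y|P. w n (exp (- max 0 y))) \<longlonglongrightarrow> cdf P x" if "real_distribution P" for P
    proof -
      interpret P: real_distribution P by fact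
      have "(\<lambda>n. LINT y|P. w n (exp (- max 0 y))) \<longlonglongrightarrow> (LINT y|P. indicator {..x} y)"
        by (rule integral_dominated_convergence[where w="\<lambda>_. 1"])
           (use wlim integral_exp_minus_approx(1)[OF that w w, where d=0] in \<open>auto simp: w_def\<close>)
      thus ?thesis by (simp add: cdf_def)
    qed
    from this[OF M(1)] this[OF N(1)] show ?thesis
      using cont[OF w] LIMSEQ_unique by auto
  qed
  thus ?thesis using cdf_unique[OF M(1) N(1)] by blast
qed

section \<open>The Laplace transform of the limit law\<close>

text \<open>The parameters of the generator, without the algorithm: existence and stationarity of the Markov process
  depend on them alone.\<close>
locale bandit_rates =
  fixes p\<^sub>A p\<^sub>B g :: real
  assumes pB_pos: "0 < p\<^sub>B" and pB_less_pA: "p\<^sub>B < p\<^sub>A" and pA_less_1: "p\<^sub>A < 1" and g_pos: "0 < g"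
begin

lemma pA_pos: "0 < p\<^sub>A" using pB_pos pB_less_pA by simp

text \<open>The generator maps \<open>\<lambda>y. exp (- (l * y))\<close> to \<open>\<lambda>y. - (y * branching_rate l + (1 - p\<^sub>A) * l) * exp (- (l * y))\<close>: the process
  is a branching process with immigration, and this is its branching mechanism.\<close>
definition branching_rate :: "real \<Rightarrow> real" where
  "branching_rate l = p\<^sub>B * (1 - exp (- (l * g))) / g - p\<^sub>A * l"

lemma branching_rate_0 [simp]: "branching_rate 0 = 0"
  by (simp add: branching_rate_def)

lemma branching_rate_le:
  assumes "0 \<le> l" shows "branching_rate l \<le> - ((p\<^sub>A - p\<^sub>B) * l)"
proof -
  have "1 - exp (- (l * g)) \<le> l * g" using exp_ge_add_one_self[of "- (l * g)"] by simp
  hence "p\<^sub>B * (1 - exp (- (l * g))) / g \<le> p\<^sub>B * (l * g) / g"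
    using pB_pos g_pos by (intro divide_right_mono mult_left_mono) auto
  thus ?thesis using g_pos unfolding branching_rate_def by (simp add: algebra_simps)
qed

lemma branching_rate_ge:
  assumes "0 \<le> l" shows "- (p\<^sub>A * l) \<le> branching_rate l"
  using assms pB_pos g_pos by (simp add: branching_rate_def)

lemma branching_rate_neg: "0 < l \<Longrightarrow> branching_rate l < 0"
  using branching_rate_le[of l] pB_less_pA by (smt (verit) mult_pos_pos)

lemma abs_branching_rate_le: "0 \<le> l \<Longrightarrow> \<bar>branching_rate l\<bar> \<le> l"
  using branching_rate_le[of l] branching_rate_ge[of l] pA_less_1 pB_less_pA pA_pos
  by (smt (verit) mult_left_le_one_le mult_nonneg_nonneg)

lemma DERIV_branching_rate:
  "(branching_rate has_real_derivative p\<^sub>B * exp (- (l * g)) - p\<^sub>A) (at l within S)"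
  unfolding branching_rate_def using g_pos
  by (auto intro!: derivative_eq_intros simp: field_simps)

text \<open>The integrand of the solution of \<open>branching_rate l * h' l = (1 - p\<^sub>A) * l * h l\<close>; the value at \<open>0\<close> is
  the continuous extension.\<close>
definition immigration_density :: "real \<Rightarrow> real" where
  "immigration_density u = (if u = 0 then 1 / (p\<^sub>A - p\<^sub>B) else - u / branching_rate u)"

lemma continuous_on_immigration_density: "continuous_on {0..} immigration_density"
  unfolding continuous_on_eq_continuous_within
proof
  fix x :: real assume "x \<in> {0..}"
  show "continuous (at x within {0..}) immigration_density"
  proof (cases "x = 0")
    case True
    have "((\<lambda>u. (branching_rate u - branching_rate 0) / (u - 0)) \<longlongrightarrow> p\<^sub>B - p\<^sub>A) (at 0)"
      using DERIV_branching_rate[of 0 UNIV] by (simp add: has_field_derivative_iff)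
    hence "((\<lambda>u. - inverse (branching_rate u / u)) \<longlongrightarrow> - inverse (p\<^sub>B - p\<^sub>A)) (at 0)"
      using pB_less_pA by (intro tendsto_intros) auto
    hence "(immigration_density \<longlongrightarrow> - inverse (p\<^sub>B - p\<^sub>A)) (at 0)"
      by (rule Lim_transform_eventually)
        (auto simp: eventually_at_filter immigration_density_def field_simps)
    hence "isCont immigration_density 0"
      using pB_less_pA minus_divide_right[of 1 "p\<^sub>B - p\<^sub>A"] unfolding isCont_def
      by (simp add: immigration_density_def inverse_eq_divide)
    thus ?thesis using True continuous_at_imp_continuous_at_within by blast
  next
    case False
    hence x: "x > 0" using \<open>x \<in> {0..}\<close> by simp
    have "isCont (\<lambda>u. - u / branching_rate u) x"
      using branching_rate_neg[OF x] DERIV_isCont[OF DERIV_branching_rate]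
      by (intro continuous_intros) auto
    moreover have "eventually (\<lambda>u. immigration_density u = - u / branching_rate u) (nhds x)"
      by (rule eventually_nhds_in_open[of "{0<..}", THEN eventually_mono])
        (auto simp: x immigration_density_def)
    ultimately have "isCont immigration_density x"
      using isCont_cong[of immigration_density "\<lambda>u. - u / branching_rate u" x] by simp
    thus ?thesis using continuous_at_imp_continuous_at_within by blast
  qed
qed

lemma immigration_density_bounds:
  assumes "0 \<le> u" shows "0 \<le> immigration_density u" "immigration_density u \<le> 1 / (p\<^sub>A - p\<^sub>B)"
proof -
  show "0 \<le> immigration_density u"
    using assms pB_less_pA branching_rate_neg[of u]
    by (cases "u = 0") (auto simp: immigration_density_def intro!: divide_nonneg_neg)
  show "immigration_density u \<le> 1 / (p\<^sub>A - p\<^sub>B)"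
    using assms pB_less_pA branching_rate_neg[of u] branching_rate_le[of u]
    by (cases "u = 0") (auto simp: immigration_density_def field_simps)
qed

definition limit_transform :: "real \<Rightarrow> real" where
  "limit_transform l = exp (- ((1 - p\<^sub>A) * integral {0..l} immigration_density))"

definition limit_transform_deriv :: "real \<Rightarrow> real" where
  "limit_transform_deriv l = - ((1 - p\<^sub>A) * immigration_density l) * limit_transform l"

lemma limit_transform_0 [simp]: "limit_transform 0 = 1"
  by (simp add: limit_transform_def)

lemma limit_transform_pos: "0 < limit_transform l"
  by (simp add: limit_transform_def)

lemma immigration_density_integrable: "0 \<le> l \<Longrightarrow> immigration_density integrable_on {0..l}"
  by (rule integrable_continuous_real)
    (rule continuous_on_subset[OF continuous_on_immigration_density], auto)

lemma DERIV_limit_transform: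
  assumes "0 < l" shows "(limit_transform has_real_derivative limit_transform_deriv l) (at l)"
proof -
  have "((\<lambda>x. integral {0..x} immigration_density) has_real_derivative immigration_density l) (at l within {0..l+1})"
    by (rule integral_has_real_derivative)
      (use assms in \<open>auto intro: continuous_on_subset[OF continuous_on_immigration_density]\<close>)
  moreover have "at l within {0..l+1} = at l"
    using assms by (intro at_within_interior) auto
  ultimately have "((\<lambda>x. integral {0..x} immigration_density) has_real_derivative immigration_density l) (at l)"
    by simp
  thus ?thesis unfolding limit_transform_def[abs_def] limit_transform_deriv_def
    by (auto intro!: derivative_eq_intros)
qed

lemma continuous_on_limit_transform: "continuous_on {0..} limit_transform"
proof -
  have "isCont limit_transform x" if "x > 0" for x
    using DERIV_limit_transform[OF that] by (rule DERIV_isCont)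
  moreover have "continuous (at 0 within {0..}) limit_transform"
  proof -
    have "continuous_on {0..1} (\<lambda>x. integral {0..x} immigration_density)"
      by (rule indefinite_integral_continuous_1[OF immigration_density_integrable]) simp
    hence "continuous_on {0..1} limit_transform"
      unfolding limit_transform_def by (intro continuous_intros)
    hence "continuous (at 0 within {0..1}) limit_transform"
      by (auto simp: continuous_on_eq_continuous_within)
    moreover have "at (0::real) within {0..1} = at 0 within {0..}"
      by (rule at_within_nhd[of _ "{..<1}"]) auto
    ultimately show ?thesis by (simp add: continuous_within)
  qed
  ultimately show ?thesis
    unfolding continuous_on_eq_continuous_within
    by (metis atLeast_iff continuous_at_imp_continuous_at_within less_eq_real_def)
qed

lemma continuous_on_limit_transform_deriv: "continuous_on {0..} limit_transform_deriv"
  unfolding limit_transform_deriv_def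
  by (intro continuous_intros continuous_on_limit_transform continuous_on_immigration_density)

lemma limit_transform_ODE:
  "0 \<le> l \<Longrightarrow> branching_rate l * limit_transform_deriv l = (1 - p\<^sub>A) * l * limit_transform l"
  using branching_rate_neg[of l]
  by (cases "l = 0") (auto simp: limit_transform_deriv_def immigration_density_def field_simps)

lemma limit_transform_bounds:
  assumes "0 \<le> l"
  shows "limit_transform l \<le> 1" "1 - limit_transform l \<le> l / (p\<^sub>A - p\<^sub>B)"
proof -
  let ?I = "integral {0..l} immigration_density"
  have I: "0 \<le> ?I"
    using immigration_density_bounds by (intro Henstock_Kurzweil_Integration.integral_nonneg immigration_density_integrable assms) auto
  show "limit_transform l \<le> 1" unfolding limit_transform_def using I pA_less_1 by simp
  have "?I \<le> integral {0..l} (\<lambda>_. 1 / (p\<^sub>A - p\<^sub>B))"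
    using immigration_density_bounds by (intro integral_le immigration_density_integrable assms) auto
  hence "?I \<le> l / (p\<^sub>A - p\<^sub>B)" using assms by simp
  moreover have "(1 - p\<^sub>A) * ?I \<le> ?I"
    using I pA_less_1 pA_pos by (intro mult_left_le_one_le) auto
  moreover have "1 - limit_transform l \<le> (1 - p\<^sub>A) * ?I"
    unfolding limit_transform_def using exp_ge_add_one_self[of "- ((1 - p\<^sub>A) * ?I)"] by simp
  ultimately show "1 - limit_transform l \<le> l / (p\<^sub>A - p\<^sub>B)" by linarith
qed

text \<open>The quotient of two solutions has derivative zero. Only the values for \<open>l > 0\<close> enter the equation, so
  continuity at \<open>0\<close> is what links \<open>H\<close> to its initial value.\<close>
lemma limit_transform_unique:
  assumes cont: "continuous_on {0..} H" and H0: "H 0 = 1"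
    and D: "\<And>l. 0 < l \<Longrightarrow> (H has_real_derivative H' l) (at l)"
    and ode: "\<And>l. 0 < l \<Longrightarrow> branching_rate l * H' l = (1 - p\<^sub>A) * l * H l"
    and l: "0 \<le> l"
  shows "H l = limit_transform l"
proof (cases "l = 0")
  case False
  let ?f = "\<lambda>x. H x / limit_transform x"
  have "?f l = ?f 0"
  proof (rule DERIV_isconst_end[where f = ?f])
    show "0 < l" using l False by simp
    show "continuous_on {0..l} ?f"
      using limit_transform_pos
      by (intro continuous_on_divide continuous_on_subset[OF cont]
          continuous_on_subset[OF continuous_on_limit_transform]) (auto simp: less_imp_neq[symmetric])
    fix x assume x: "0 < x" "x < l"
    have R: "branching_rate x \<noteq> 0" using branching_rate_neg[OF x(1)] by simp
    have "branching_rate x * (H' x * limit_transform x - H x * limit_transform_deriv x)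
        = (branching_rate x * H' x) * limit_transform x - H x * (branching_rate x * limit_transform_deriv x)"
      by (simp add: algebra_simps)
    also have "\<dots> = 0"
      unfolding ode[OF x(1)] limit_transform_ODE[OF less_imp_le[OF x(1)]] by simp
    finally have "H' x * limit_transform x - H x * limit_transform_deriv x = 0" using R by simp
    moreover have "(?f has_real_derivative
        (H' x * limit_transform x - H x * limit_transform_deriv x) / (limit_transform x * limit_transform x)) (at x)"
      using DERIV_divide[OF D[OF x(1)] DERIV_limit_transform[OF x(1)]] limit_transform_pos[of x] by simp
    ultimately show "(?f has_real_derivative 0) (at x)" by simp
  qed
  thus ?thesis using H0 limit_transform_pos[of l] by (simp add: field_simps)
qed (simp add: H0)

end

section \<open>One step of the algorithm\<close>

text \<open>The indices of the algorithm start at \<open>1\<close>, and the numeral is kept so that simplified index conditions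
  match the hypotheses.\<close>
declare One_nat_def [simp del]

locale penalized_bandit_model = prob_space M + bandit_rates p\<^sub>A p\<^sub>B g
  for M :: "'a measure" and p\<^sub>A p\<^sub>B g :: real +
  fixes U :: "nat \<Rightarrow> 'a \<Rightarrow> real"
    and A B :: "nat \<Rightarrow> 'a set"
    and \<gamma> \<rho> :: "nat \<Rightarrow> real"
    and x :: real
  assumes gamma: "\<And>n. n \<ge> 1 \<Longrightarrow> 0 < \<gamma> n \<and> \<gamma> n < 1"
    and rho: "\<And>n. n \<ge> 1 \<Longrightarrow> 0 < \<rho> n \<and> \<gamma> n * \<rho> n < 1"
    and indep_U: "indep_vars (\<lambda>_. borel) U {1..}"
    and distr_U: "\<And>n. n \<ge> 1 \<Longrightarrow> distr M borel (U n) = uniform_measure lborel {0..1}"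
    and A_event: "\<And>n. n \<ge> 1 \<Longrightarrow> A n \<in> sets M \<and> measure M (A n) = p\<^sub>A"
    and B_event: "\<And>n. n \<ge> 1 \<Longrightarrow> B n \<in> sets M \<and> measure M (B n) = p\<^sub>B"
    and indep_AB: "indep_vars (\<lambda>_. borel \<Otimes>\<^sub>M borel)
           (\<lambda>n \<omega>. (indicator (A n) \<omega> :: real, indicator (B n) \<omega> :: real)) {1..}"
    and indep_AB_U: "independent_rvs M
           (PiM {1..} (\<lambda>_::nat. borel \<Otimes>\<^sub>M borel))
           (\<lambda>\<omega>. \<lambda>n\<in>{1..}. (indicator (A n) \<omega> :: real, indicator (B n) \<omega> :: real))
           (PiM {1..} (\<lambda>_::nat. borel))
           (\<lambda>\<omega>. \<lambda>n\<in>{1..}. U n \<omega>)"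
    and x: "0 < x" "x < 1"
begin

abbreviation X :: "nat \<Rightarrow> 'a \<Rightarrow> real" where "X \<equiv> penalized_bandit \<gamma> \<rho> U A B x"

definition V :: "nat \<Rightarrow> 'a \<Rightarrow> real \<times> real" where
  "V n \<omega> = (indicator (A n) \<omega>, indicator (B n) \<omega>)"

definition W :: "nat \<Rightarrow> 'a \<Rightarrow> real \<times> real \<times> real" where
  "W n \<omega> = (U n \<omega>, V n \<omega>)"

abbreviation W_space :: "(real \<times> real \<times> real) measure" where
  "W_space \<equiv> borel \<Otimes>\<^sub>M (borel \<Otimes>\<^sub>M borel)"

lemma U_measurable: "n \<ge> 1 \<Longrightarrow> U n \<in> borel_measurable M"
  using indep_U unfolding indep_vars_def by auto

lemma V_measurable: "n \<ge> 1 \<Longrightarrow> V n \<in> M \<rightarrow>\<^sub>M borel \<Otimes>\<^sub>M borel"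
  using indep_AB unfolding indep_vars_def V_def by auto

lemma W_measurable: "n \<ge> 1 \<Longrightarrow> W n \<in> M \<rightarrow>\<^sub>M W_space"
  unfolding W_def[abs_def] using U_measurable V_measurable by (intro measurable_Pair) auto

text \<open>The two whole sequences are independent, which is used here on cylinder events.\<close>
lemma prob_U_V_inter:
  assumes J: "finite J" "J \<subseteq> {1..}" and S: "\<And>j. j \<in> J \<Longrightarrow> S j \<in> sets borel"
    and T: "\<And>j. j \<in> J \<Longrightarrow> T j \<in> sets (borel \<Otimes>\<^sub>M borel)"
  shows "prob (space M \<inter> (\<Inter>j\<in>J. U j -` S j \<inter> V j -` T j \<inter> space M))
    = prob (space M \<inter> (\<Inter>j\<in>J. U j -` S j \<inter> space M)) * prob (space M \<inter> (\<Inter>j\<in>J. V j -` T j \<inter> space M))"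
proof -
  let ?VV = "\<lambda>\<omega>. \<lambda>n\<in>{1..}. V n \<omega>" and ?UU = "\<lambda>\<omega>. \<lambda>n\<in>{1..}. U n \<omega>"
  let ?GV = "vimage_algebra (space M) ?VV (PiM {1..} (\<lambda>_::nat. borel \<Otimes>\<^sub>M borel))"
  let ?GU = "vimage_algebra (space M) ?UU (PiM {1..} (\<lambda>_::nat. borel))"
  have ind: "indep_set (sets ?GV) (sets ?GU)"
    using indep_AB_U unfolding independent_rvs_def V_def by simp
  have sp: "space M \<inter> (\<Inter>j\<in>J. f j) \<in> sets G"
    if "\<And>j. j \<in> J \<Longrightarrow> f j \<in> sets G" "finite J" "space G = space M" for f and G :: "'a measure"
  proof (cases "J = {}")
    case False
    have "(\<Inter>j\<in>J. f j) \<in> sets G" using that False by (intro sets.finite_INT) auto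
    thus ?thesis using that(3) sets.top[of G] by (metis sets.Int)
  qed (use that sets.top[of G] in simp)
  have mV: "V j \<in> ?GV \<rightarrow>\<^sub>M borel \<Otimes>\<^sub>M borel" if "j \<ge> 1" for j
  proof -
    have "?VV \<in> ?GV \<rightarrow>\<^sub>M PiM {1..} (\<lambda>_::nat. borel \<Otimes>\<^sub>M borel)"
      by (rule measurable_vimage_algebra1) (auto simp: space_PiM space_pair_measure)
    hence "(\<lambda>\<omega>. ?VV \<omega> j) \<in> ?GV \<rightarrow>\<^sub>M borel \<Otimes>\<^sub>M borel"
      by (rule measurable_compose[OF _ measurable_component_singleton]) (use that in auto)
    thus ?thesis using that by simp
  qed
  have mU: "U j \<in> ?GU \<rightarrow>\<^sub>M borel" if "j \<ge> 1" for j
  proof -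
    have "?UU \<in> ?GU \<rightarrow>\<^sub>M PiM {1..} (\<lambda>_::nat. borel)"
      by (rule measurable_vimage_algebra1) (auto simp: space_PiM)
    hence "(\<lambda>\<omega>. ?UU \<omega> j) \<in> ?GU \<rightarrow>\<^sub>M borel"
      by (rule measurable_compose[OF _ measurable_component_singleton]) (use that in auto)
    thus ?thesis using that by simp
  qed
  have "V j -` T j \<inter> space M \<in> sets ?GV" if "j \<in> J" for j
    using measurable_sets[OF mV T[OF that], of j] J that by auto
  hence "space M \<inter> (\<Inter>j\<in>J. V j -` T j \<inter> space M) \<in> sets ?GV"
    using J(1) sp[of "\<lambda>j. V j -` T j \<inter> space M" ?GV] by simp
  moreover have "U j -` S j \<inter> space M \<in> sets ?GU" if "j \<in> J" for j
    using measurable_sets[OF mU S[OF that], of j] J that by auto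
  hence "space M \<inter> (\<Inter>j\<in>J. U j -` S j \<inter> space M) \<in> sets ?GU"
    using J(1) sp[of "\<lambda>j. U j -` S j \<inter> space M" ?GU] by simp
  ultimately have "prob ((space M \<inter> (\<Inter>j\<in>J. V j -` T j \<inter> space M)) \<inter> (space M \<inter> (\<Inter>j\<in>J. U j -` S j \<inter> space M)))
    = prob (space M \<inter> (\<Inter>j\<in>J. V j -` T j \<inter> space M)) * prob (space M \<inter> (\<Inter>j\<in>J. U j -` S j \<inter> space M))"
    by (rule indep_setD[OF ind])
  moreover have "(space M \<inter> (\<Inter>j\<in>J. V j -` T j \<inter> space M)) \<inter> (space M \<inter> (\<Inter>j\<in>J. U j -` S j \<inter> space M))
      = space M \<inter> (\<Inter>j\<in>J. U j -` S j \<inter> V j -` T j \<inter> space M)" by auto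
  ultimately show ?thesis by (simp add: mult.commute)
qed

lemma prob_U_V:
  assumes "j \<ge> 1" "S \<in> sets borel" "T \<in> sets (borel \<Otimes>\<^sub>M borel)"
  shows "prob (U j -` S \<inter> V j -` T \<inter> space M) = prob (U j -` S \<inter> space M) * prob (V j -` T \<inter> space M)"
  using prob_U_V_inter[of "{j}" "\<lambda>_. S" "\<lambda>_. T"] assms by (simp add: Int_absorb1)

text \<open>A \<open>\<pi>\<close>-system argument on rectangles: independence between the two sequences and within each of them
  combine to independence of the innovations \<open>(U n, V n)\<close> in \<open>n\<close>.\<close>
lemma indep_W: "indep_vars (\<lambda>_. W_space) W {1..}"
proof -
  define F where "F j = {U j -` S \<inter> V j -` T \<inter> space M | S T. S \<in> sets borel \<and> T \<in> sets (borel \<Otimes>\<^sub>M borel)}" for j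
  have F_ev: "F j \<subseteq> events" if "j \<in> {1..}" for j
  proof
    fix a assume "a \<in> F j"
    then obtain S T where a: "a = (U j -` S \<inter> space M) \<inter> (V j -` T \<inter> space M)" "S \<in> sets borel" "T \<in> sets (borel \<Otimes>\<^sub>M borel)"
      unfolding F_def by blast
    show "a \<in> events" unfolding a(1)
      using measurable_sets[OF U_measurable a(2)] measurable_sets[OF V_measurable a(3)] that by auto
  qed
  have "indep_sets F {1..}"
  proof (rule indep_setsI[OF F_ev])
    fix a J assume J: "J \<noteq> {}" "J \<subseteq> {1..}" "finite J" "\<forall>j\<in>J. a j \<in> F j"
    have "\<exists>S T. a j = U j -` S \<inter> V j -` T \<inter> space M \<and> S \<in> sets borel \<and> T \<in> sets (borel \<Otimes>\<^sub>M borel)" if "j \<in> J" for j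
      using J(4) that unfolding F_def by blast
    then obtain S T where ST: "\<And>j. j \<in> J \<Longrightarrow> a j = U j -` S j \<inter> V j -` T j \<inter> space M"
      "\<And>j. j \<in> J \<Longrightarrow> S j \<in> sets borel" "\<And>j. j \<in> J \<Longrightarrow> T j \<in> sets (borel \<Otimes>\<^sub>M borel)"
      by metis
    have sp: "space M \<inter> (\<Inter>j\<in>J. f j \<inter> space M) = (\<Inter>j\<in>J. f j \<inter> space M)" for f using J(1) by auto
    have "prob (\<Inter>j\<in>J. a j) = prob (space M \<inter> (\<Inter>j\<in>J. U j -` S j \<inter> V j -` T j \<inter> space M))"
      unfolding sp using ST(1) by (intro arg_cong[of _ _ prob] INF_cong) auto
    also have "\<dots> = prob (\<Inter>j\<in>J. U j -` S j \<inter> space M) * prob (\<Inter>j\<in>J. V j -` T j \<inter> space M)"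
      using prob_U_V_inter[OF J(3,2) ST(2,3)] unfolding sp by simp
    also have "prob (\<Inter>j\<in>J. U j -` S j \<inter> space M) = (\<Prod>j\<in>J. prob (U j -` S j \<inter> space M))"
      by (rule indep_varsD[OF indep_U J(1) J(3) J(2)]) (use ST in auto)
    also have "prob (\<Inter>j\<in>J. V j -` T j \<inter> space M) = (\<Prod>j\<in>J. prob (V j -` T j \<inter> space M))"
      using ST(3) unfolding V_def[abs_def] by (intro indep_varsD[OF indep_AB J(1) J(3) J(2)]) auto
    also have "(\<Prod>j\<in>J. prob (U j -` S j \<inter> space M)) * (\<Prod>j\<in>J. prob (V j -` T j \<inter> space M)) = (\<Prod>j\<in>J. prob (a j))"
      unfolding prod.distrib[symmetric] using J(2) ST prob_U_V by (intro prod.cong) auto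
    finally show "prob (\<Inter>j\<in>J. a j) = (\<Prod>j\<in>J. prob (a j))" .
  qed
  moreover have "Int_stable (F j)" for j
  proof (rule Int_stableI)
    fix a b assume "a \<in> F j" "b \<in> F j"
    then obtain S T S' T' where "a = U j -` S \<inter> V j -` T \<inter> space M" "b = U j -` S' \<inter> V j -` T' \<inter> space M"
      "S \<in> sets borel" "T \<in> sets (borel \<Otimes>\<^sub>M borel)" "S' \<in> sets borel" "T' \<in> sets (borel \<Otimes>\<^sub>M borel)"
      unfolding F_def by blast
    thus "a \<inter> b \<in> F j" unfolding F_def
      by (intro CollectI exI[of _ "S \<inter> S'"] exI[of _ "T \<inter> T'"]) auto
  qed
  ultimately have ind: "indep_sets (\<lambda>j. sigma_sets (space M) (F j)) {1..}"
    by (intro indep_sets_sigma) auto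
  have sub: "{W j -` S \<inter> space M | S. S \<in> sets W_space} \<subseteq> sigma_sets (space M) (F j)" if "j \<in> {1..}" for j
  proof -
    have FP: "F j \<subseteq> Pow (space M)" unfolding F_def by auto
    let ?\<Sigma> = "sigma (space M) (F j)"
    have top: "(UNIV :: (real \<times> real) set) \<in> sets (borel \<Otimes>\<^sub>M borel)"
      using sets.top[of "borel \<Otimes>\<^sub>M borel :: (real \<times> real) measure"] by (simp add: space_pair_measure)
    have "U j -` S \<inter> space M \<in> F j" if "S \<in> sets borel" for S
      unfolding F_def using that by (intro CollectI exI[of _ S] exI[of _ UNIV]) (auto simp: top)
    hence "U j \<in> ?\<Sigma> \<rightarrow>\<^sub>M borel" using FP by (intro measurableI) (auto simp: sigma_sets.Basic)
    moreover have "V j -` S \<inter> space M \<in> F j" if "S \<in> sets (borel \<Otimes>\<^sub>M borel)" for S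
      unfolding F_def using that by (intro CollectI exI[of _ UNIV] exI[of _ S]) auto
    hence "V j \<in> ?\<Sigma> \<rightarrow>\<^sub>M borel \<Otimes>\<^sub>M borel" using FP
      by (intro measurableI) (auto simp: sigma_sets.Basic space_pair_measure)
    ultimately have "W j \<in> ?\<Sigma> \<rightarrow>\<^sub>M W_space" unfolding W_def[abs_def] by (rule measurable_Pair)
    from measurable_sets[OF this] show ?thesis using FP by auto
  qed
  show ?thesis unfolding indep_vars_def2
    using indep_sets_mono_sets[OF ind sub] W_measurable by auto
qed

definition step :: "nat \<Rightarrow> real \<Rightarrow> real \<times> real \<times> real \<Rightarrow> real" where
  "step N y = (\<lambda>(u, a, b). y + \<gamma> N * (if u \<le> y then a * (1 - y) else - (b * y))
     - \<gamma> N * \<rho> N * (if u \<le> y then y * (1 - a) else - ((1 - y) * (1 - b))))"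

text \<open>The algorithm as a deterministic function of the innovations, which exhibits \<open>X n\<close> as a function of the
  first \<open>n\<close> of them.\<close>
primrec state :: "nat \<Rightarrow> (nat \<Rightarrow> real \<times> real \<times> real) \<Rightarrow> real" where
  "state 0 w = x"
| "state (Suc n) w = step (Suc n) (state n w) (w (Suc n))"

lemma step_measurable [measurable]: "(\<lambda>(y, w). step N y w) \<in> borel \<Otimes>\<^sub>M W_space \<rightarrow>\<^sub>M borel"
  unfolding step_def by measurable

lemma X_Suc: "X (Suc n) \<omega> = step (Suc n) (X n \<omega>) (W (Suc n) \<omega>)"
  by (auto simp: step_def W_def V_def Let_def indicator_def algebra_simps)

lemma X_eq_state: "X n \<omega> = state n (\<lambda>i\<in>{1..n}. W i \<omega>)"
proof -
  have *: "state n w = state n w'" if "\<And>i. 1 \<le> i \<Longrightarrow> i \<le> n \<Longrightarrow> w i = w' i" for n w w'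
    using that by (induction n) auto
  have "X n \<omega> = state n (\<lambda>i. W i \<omega>)"
    by (induction n) (simp_all only: X_Suc state.simps penalized_bandit.simps(1))
  also have "\<dots> = state n (\<lambda>i\<in>{1..n}. W i \<omega>)" by (rule *) auto
  finally show ?thesis .
qed

lemma state_measurable: "n \<le> m \<Longrightarrow> state n \<in> PiM {1..m} (\<lambda>_. W_space) \<rightarrow>\<^sub>M borel"
proof (induction n)
  case 0
  have "state 0 = (\<lambda>w. x)" by auto
  thus ?case by simp
next
  case (Suc n)
  have [measurable]: "state n \<in> PiM {1..m} (\<lambda>_. W_space) \<rightarrow>\<^sub>M borel" using Suc by simp
  have [measurable]: "(\<lambda>w. w (Suc n)) \<in> PiM {1..m} (\<lambda>_. W_space) \<rightarrow>\<^sub>M W_space"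
    using Suc.prems by (intro measurable_component_singleton) auto
  have "(\<lambda>w. case (state n w, w (Suc n)) of (y, w) \<Rightarrow> step (Suc n) y w) \<in> PiM {1..m} (\<lambda>_. W_space) \<rightarrow>\<^sub>M borel"
    by measurable
  thus ?case by simp
qed

lemma X_measurable [measurable]: "X n \<in> borel_measurable M"
proof -
  have "(\<lambda>\<omega>. \<lambda>i\<in>{1..n}. W i \<omega>) \<in> M \<rightarrow>\<^sub>M PiM {1..n} (\<lambda>_. W_space)"
    using W_measurable by (intro measurable_restrict) auto
  from measurable_compose[OF this state_measurable[OF order.refl]]
  show ?thesis unfolding X_eq_state[abs_def] by simp
qed

lemma step_cases:
  assumes "u \<le> y"
  shows "step N y (u, 1, b) = y + \<gamma> N * (1 - y)" "step N y (u, 0, b) = y - \<gamma> N * \<rho> N * y"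
  using assms by (auto simp: step_def algebra_simps)

lemma step_cases':
  assumes "\<not> u \<le> y"
  shows "step N y (u, a, 1) = y - \<gamma> N * y" "step N y (u, a, 0) = y + \<gamma> N * \<rho> N * (1 - y)"
  using assms by (auto simp: step_def algebra_simps)

lemma X_bounds: "0 \<le> X n \<omega>" "X n \<omega> \<le> 1"
proof -
  have "0 \<le> X n \<omega> \<and> X n \<omega> \<le> 1"
  proof (induction n)
    case (Suc n)
    let ?N = "Suc n" and ?y = "X n \<omega>"
    have y: "0 \<le> ?y" "?y \<le> 1" using Suc by auto
    have conv: "0 \<le> (1 - s) * ?y" "(1 - s) * ?y \<le> 1" "0 \<le> (1 - s) * ?y + s" "(1 - s) * ?y + s \<le> 1"
      if "0 \<le> s" "s \<le> 1" for s
      using that y mult_left_le_one_le[of ?y "1 - s"] mult_left_mono[of ?y 1 "1 - s"]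
      by (auto intro!: add_nonneg_nonneg)
    have s: "0 \<le> \<gamma> ?N" "\<gamma> ?N \<le> 1" "0 \<le> \<gamma> ?N * \<rho> ?N" "\<gamma> ?N * \<rho> ?N \<le> 1"
      using gamma[of ?N] rho[of ?N] by auto
    show ?case
      unfolding X_Suc W_def V_def
      using conv[OF s(1,2)] conv[OF s(3,4)]
      by (cases "U ?N \<omega> \<le> ?y"; cases "\<omega> \<in> A ?N"; cases "\<omega> \<in> B ?N")
         (simp_all add: step_cases step_cases' algebra_simps)
  qed (use x in auto)
  thus "0 \<le> X n \<omega>" "X n \<omega> \<le> 1" by auto
qed

text \<open>The innovation at time \<open>n + 1\<close> is independent of \<open>X n\<close>, so Fubini freezes \<open>X n\<close>.\<close>
lemma expectation_X_W:
  fixes \<psi> :: "real \<Rightarrow> real \<times> real \<times> real \<Rightarrow> real"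
  assumes [measurable]: "(\<lambda>(y, w). \<psi> y w) \<in> borel \<Otimes>\<^sub>M W_space \<rightarrow>\<^sub>M borel"
    and bd: "\<And>y w. \<bar>\<psi> y w\<bar> \<le> C"
  shows "expectation (\<lambda>\<omega>. \<psi> (X n \<omega>) (W (Suc n) \<omega>)) = expectation (\<lambda>\<omega>. expectation (\<lambda>\<omega>'. \<psi> (X n \<omega>) (W (Suc n) \<omega>')))"
proof -
  let ?N = "Suc n"
  let ?P1 = "PiM {1..n} (\<lambda>_::nat. W_space)" and ?P2 = "PiM {?N} (\<lambda>_::nat. W_space)"
  let ?f1 = "\<lambda>\<omega>. \<lambda>i\<in>{1..n}. W i \<omega>" and ?f2 = "\<lambda>\<omega>. \<lambda>i\<in>{?N}. W i \<omega>"
  have "indep_var ?P1 ?f1 ?P2 ?f2"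
    by (rule indep_var_restrict[OF indep_W]) auto
  hence [measurable]: "?f1 \<in> M \<rightarrow>\<^sub>M ?P1" "?f2 \<in> M \<rightarrow>\<^sub>M ?P2"
    and joint: "distr M ?P1 ?f1 \<Otimes>\<^sub>M distr M ?P2 ?f2 = distr M (?P1 \<Otimes>\<^sub>M ?P2) (\<lambda>\<omega>. (?f1 \<omega>, ?f2 \<omega>))"
    unfolding indep_var_distribution_eq by auto
  have [measurable]: "state n \<in> ?P1 \<rightarrow>\<^sub>M borel" by (rule state_measurable) simp
  have [measurable]: "(\<lambda>w. w ?N) \<in> ?P2 \<rightarrow>\<^sub>M W_space" by (rule measurable_component_singleton) simp
  interpret S1: prob_space "distr M ?P1 ?f1" by (rule prob_space_distr) simp
  interpret S2: prob_space "distr M ?P2 ?f2" by (rule prob_space_distr) simp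
  interpret P: pair_prob_space "distr M ?P1 ?f1" "distr M ?P2 ?f2" ..
  let ?F = "\<lambda>(p, q). \<psi> (state n p) (q ?N)"
  have F [measurable]: "?F \<in> ?P1 \<Otimes>\<^sub>M ?P2 \<rightarrow>\<^sub>M borel"
  proof -
    have "(\<lambda>z. (\<lambda>(y, w). \<psi> y w) (state n (fst z), snd z ?N)) \<in> ?P1 \<Otimes>\<^sub>M ?P2 \<rightarrow>\<^sub>M borel"
      by (rule measurable_compose[OF _ assms(1)]) measurable
    thus ?thesis by (simp add: split_beta')
  qed
  have int: "integrable (distr M ?P1 ?f1 \<Otimes>\<^sub>M distr M ?P2 ?f2) ?F"
    by (rule P.integrable_const_bound[of _ C]) (auto simp: bd split_beta')
  have "expectation (\<lambda>\<omega>. \<psi> (X n \<omega>) (W ?N \<omega>)) = expectation (\<lambda>\<omega>. ?F (?f1 \<omega>, ?f2 \<omega>))"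
    unfolding X_eq_state by simp
  also have "\<dots> = integral\<^sup>L (distr M ?P1 ?f1 \<Otimes>\<^sub>M distr M ?P2 ?f2) ?F"
    unfolding joint by (subst integral_distr) auto
  also have "\<dots> = (LINT p|distr M ?P1 ?f1. LINT q|distr M ?P2 ?f2. ?F (p, q))"
    using P.integral_fst'[OF int] by simp
  also have "\<dots> = (LINT p|distr M ?P1 ?f1. expectation (\<lambda>\<omega>'. \<psi> (state n p) (W ?N \<omega>')))"
  proof (rule Bochner_Integration.integral_cong)
    fix p assume "p \<in> space (distr M ?P1 ?f1)"
    hence p: "p \<in> space ?P1" by simp
    have "(\<lambda>q. ?F (p, q)) \<in> borel_measurable ?P2"
      using measurable_compose[OF measurable_Pair1'[OF p] F] by simp
    thus "(LINT q|distr M ?P2 ?f2. ?F (p, q)) = expectation (\<lambda>\<omega>'. \<psi> (state n p) (W ?N \<omega>'))"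
      by (subst integral_distr) auto
  qed simp
  also have "\<dots> = expectation (\<lambda>\<omega>. expectation (\<lambda>\<omega>'. \<psi> (state n (?f1 \<omega>)) (W ?N \<omega>')))"
  proof (rule integral_distr)
    have mW: "W ?N \<in> M \<rightarrow>\<^sub>M W_space" by (rule W_measurable) simp
    have "(\<lambda>z. (\<lambda>(y, w). \<psi> y w) (state n (fst z), W ?N (snd z))) \<in> ?P1 \<Otimes>\<^sub>M M \<rightarrow>\<^sub>M borel"
      by (rule measurable_compose[OF _ assms(1)]) (use mW in measurable)
    hence "(\<lambda>(p, \<omega>'). \<psi> (state n p) (W ?N \<omega>')) \<in> borel_measurable (?P1 \<Otimes>\<^sub>M M)"
      by (simp add: split_beta')
    thus "(\<lambda>p. expectation (\<lambda>\<omega>'. \<psi> (state n p) (W ?N \<omega>'))) \<in> borel_measurable ?P1"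
      by (rule borel_measurable_lebesgue_integral)
  qed simp
  finally show ?thesis unfolding X_eq_state by simp
qed

lemma prob_U_le:
  assumes "n \<ge> 1" "0 \<le> y" "y \<le> 1"
  shows "prob (U n -` {..y} \<inter> space M) = y" "prob (U n -` {y<..} \<inter> space M) = 1 - y"
proof -
  have m: "U n \<in> borel_measurable M" using U_measurable assms by simp
  have "measure (distr M borel (U n)) {..y} = y"
    unfolding distr_U[OF assms(1)] using assms
    by (subst measure_uniform_measure) (auto simp: Int_atLeastAtMost min_def intro!: arg_cong2[of _ _ _ _ "(/)"])
  thus 1: "prob (U n -` {..y} \<inter> space M) = y" by (subst (asm) measure_distr) (use m in auto)
  have "U n -` {y<..} \<inter> space M = space M - (U n -` {..y} \<inter> space M)" by auto
  thus "prob (U n -` {y<..} \<inter> space M) = 1 - y"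
    using prob_compl[of "U n -` {..y} \<inter> space M"] measurable_sets[OF m] 1 by simp
qed

text \<open>The four outcomes: arm A with success or failure, arm B with failure or success. Only the
  marginal laws enter, because each outcome involves one of the two success events and the choice of the arm is
  independent of both.\<close>
lemma expectation_step:
  fixes F :: "real \<Rightarrow> real"
  assumes y: "0 \<le> y" "y \<le> 1" and N: "N \<ge> 1"
  shows "expectation (\<lambda>\<omega>. F (step N y (W N \<omega>)))
    = y * p\<^sub>A * F (y + \<gamma> N * (1 - y)) + y * (1 - p\<^sub>A) * F (y - \<gamma> N * \<rho> N * y)
      + (1 - y) * p\<^sub>B * F (y - \<gamma> N * y) + (1 - y) * (1 - p\<^sub>B) * F (y + \<gamma> N * \<rho> N * (1 - y))"
proof -
  have m: "U N \<in> borel_measurable M" "V N \<in> M \<rightarrow>\<^sub>M borel \<Otimes>\<^sub>M borel"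
    using U_measurable V_measurable N by auto
  define E where "E S T = U N -` S \<inter> V N -` T \<inter> space M" for S and T :: "(real \<times> real) set"
  have E: "E S T \<in> events" "prob (E S T) = prob (U N -` S \<inter> space M) * prob (V N -` T \<inter> space M)"
    if "S \<in> sets borel" "T \<in> sets (borel \<Otimes>\<^sub>M borel)" for S T
  proof -
    have "E S T = (U N -` S \<inter> space M) \<inter> (V N -` T \<inter> space M)" by (auto simp: E_def)
    thus "E S T \<in> events" using measurable_sets[OF m(1) that(1)] measurable_sets[OF m(2) that(2)] by auto
    show "prob (E S T) = prob (U N -` S \<inter> space M) * prob (V N -` T \<inter> space M)"
      unfolding E_def by (rule prob_U_V[OF N that])
  qed
  have AN: "A N \<in> events" "prob (A N) = p\<^sub>A" and BN: "B N \<in> events" "prob (B N) = p\<^sub>B"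
    using A_event B_event N by auto
  have VA: "V N -` ({1} \<times> UNIV) \<inter> space M = A N" "V N -` ({0} \<times> UNIV) \<inter> space M = space M - A N"
    and VB: "V N -` (UNIV \<times> {1}) \<inter> space M = B N" "V N -` (UNIV \<times> {0}) \<inter> space M = space M - B N"
    using sets.sets_into_space[OF AN(1)] sets.sets_into_space[OF BN(1)]
    by (auto simp: V_def indicator_def split: if_splits)
  have "prob (E {..y} ({1} \<times> UNIV)) = y * p\<^sub>A" "prob (E {..y} ({0} \<times> UNIV)) = y * (1 - p\<^sub>A)"
    "prob (E {y<..} (UNIV \<times> {1})) = (1 - y) * p\<^sub>B" "prob (E {y<..} (UNIV \<times> {0})) = (1 - y) * (1 - p\<^sub>B)"
    using y N AN BN by (subst E(2); simp add: VA VB prob_U_le prob_compl)+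
  note pr = this
  have pw: "F (step N y (W N \<omega>))
      = indicator (E {..y} ({1} \<times> UNIV)) \<omega> * F (y + \<gamma> N * (1 - y))
      + indicator (E {..y} ({0} \<times> UNIV)) \<omega> * F (y - \<gamma> N * \<rho> N * y)
      + indicator (E {y<..} (UNIV \<times> {1})) \<omega> * F (y - \<gamma> N * y)
      + indicator (E {y<..} (UNIV \<times> {0})) \<omega> * F (y + \<gamma> N * \<rho> N * (1 - y))" if "\<omega> \<in> space M" for \<omega>
    using that unfolding W_def V_def E_def
    by (cases "U N \<omega> \<le> y"; cases "\<omega> \<in> A N"; cases "\<omega> \<in> B N") (simp_all add: step_cases step_cases' V_def)
  have "expectation (\<lambda>\<omega>. F (step N y (W N \<omega>))) = expectation (\<lambda>\<omega>.
        indicator (E {..y} ({1} \<times> UNIV)) \<omega> * F (y + \<gamma> N * (1 - y))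
      + indicator (E {..y} ({0} \<times> UNIV)) \<omega> * F (y - \<gamma> N * \<rho> N * y)
      + indicator (E {y<..} (UNIV \<times> {1})) \<omega> * F (y - \<gamma> N * y)
      + indicator (E {y<..} (UNIV \<times> {0})) \<omega> * F (y + \<gamma> N * \<rho> N * (1 - y)))"
    by (rule Bochner_Integration.integral_cong[OF refl pw])
  also have "\<dots> = prob (E {..y} ({1} \<times> UNIV)) * F (y + \<gamma> N * (1 - y))
      + prob (E {..y} ({0} \<times> UNIV)) * F (y - \<gamma> N * \<rho> N * y)
      + prob (E {y<..} (UNIV \<times> {1})) * F (y - \<gamma> N * y)
      + prob (E {y<..} (UNIV \<times> {0})) * F (y + \<gamma> N * \<rho> N * (1 - y))"
  proof -
    have i: "integrable M (indicator (E S T) :: 'a \<Rightarrow> real)" "expectation (indicator (E S T)) = prob (E S T)"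
      if "S \<in> sets borel" "T \<in> sets (borel \<Otimes>\<^sub>M borel)" for S T
      using E(1)[OF that] sets.sets_into_space[OF E(1)[OF that]]
      by (auto simp: Int_absorb2 emeasure_eq_measure)
    have "E S T \<inter> space M = E S T" for S T by (auto simp: E_def)
    thus ?thesis by (simp add: i)
  qed
  finally show ?thesis unfolding pr .
qed

lemma expectation_X_Suc_bounded:
  fixes F :: "real \<Rightarrow> real"
  assumes [measurable]: "F \<in> borel_measurable borel" and bd: "\<And>y. \<bar>F y\<bar> \<le> C"
  shows "expectation (\<lambda>\<omega>. F (X (Suc n) \<omega>)) = expectation (\<lambda>\<omega>.
      X n \<omega> * p\<^sub>A * F (X n \<omega> + \<gamma> (Suc n) * (1 - X n \<omega>))
      + X n \<omega> * (1 - p\<^sub>A) * F (X n \<omega> - \<gamma> (Suc n) * \<rho> (Suc n) * X n \<omega>)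
      + (1 - X n \<omega>) * p\<^sub>B * F (X n \<omega> - \<gamma> (Suc n) * X n \<omega>)
      + (1 - X n \<omega>) * (1 - p\<^sub>B) * F (X n \<omega> + \<gamma> (Suc n) * \<rho> (Suc n) * (1 - X n \<omega>)))"
proof -
  have "expectation (\<lambda>\<omega>. F (X (Suc n) \<omega>)) = expectation (\<lambda>\<omega>. F (step (Suc n) (X n \<omega>) (W (Suc n) \<omega>)))"
    by (simp only: X_Suc)
  also have "\<dots> = expectation (\<lambda>\<omega>. expectation (\<lambda>\<omega>'. F (step (Suc n) (X n \<omega>) (W (Suc n) \<omega>'))))"
    by (rule expectation_X_W[where C=C]) (auto simp: bd split_beta' intro!: measurable_compose[OF step_measurable[unfolded split_beta']])
  also have "\<dots> = expectation (\<lambda>\<omega>.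
      X n \<omega> * p\<^sub>A * F (X n \<omega> + \<gamma> (Suc n) * (1 - X n \<omega>))
      + X n \<omega> * (1 - p\<^sub>A) * F (X n \<omega> - \<gamma> (Suc n) * \<rho> (Suc n) * X n \<omega>)
      + (1 - X n \<omega>) * p\<^sub>B * F (X n \<omega> - \<gamma> (Suc n) * X n \<omega>)
      + (1 - X n \<omega>) * (1 - p\<^sub>B) * F (X n \<omega> + \<gamma> (Suc n) * \<rho> (Suc n) * (1 - X n \<omega>)))"
    by (intro Bochner_Integration.integral_cong refl expectation_step X_bounds) simp
  finally show ?thesis .
qed

text \<open>The transition operator of \<open>X\<close>.\<close>
definition one_step :: "nat \<Rightarrow> (real \<Rightarrow> real) \<Rightarrow> real \<Rightarrow> real" where
  "one_step N F y = y * p\<^sub>A * F (y + \<gamma> N * (1 - y)) + y * (1 - p\<^sub>A) * F (y - \<gamma> N * \<rho> N * y)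
      + (1 - y) * p\<^sub>B * F (y - \<gamma> N * y) + (1 - y) * (1 - p\<^sub>B) * F (y + \<gamma> N * \<rho> N * (1 - y))"

lemma convex_move_bounds:
  fixes y s :: real
  assumes "0 \<le> y" "y \<le> 1" "0 \<le> s" "s \<le> 1"
  shows "0 \<le> y - s * y" "y - s * y \<le> 1" "0 \<le> y + s * (1 - y)" "y + s * (1 - y) \<le> 1"
proof -
  have "0 \<le> y * s" "0 \<le> (1 - s) * y" "0 \<le> (1 - y) * (1 - s)" "0 \<le> s * (1 - y)" using assms by auto
  thus "0 \<le> y - s * y" "y - s * y \<le> 1" "0 \<le> y + s * (1 - y)" "y + s * (1 - y) \<le> 1"
    using assms by (simp_all add: algebra_simps)
qed

text \<open>Bounds on the unit interval suffice because neither \<open>X\<close> nor a step leaves it; \<open>F\<close> is truncated outside.\<close>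
lemma expectation_X_Suc:
  fixes F :: "real \<Rightarrow> real"
  assumes [measurable]: "F \<in> borel_measurable borel" and bd: "\<And>y. 0 \<le> y \<Longrightarrow> y \<le> 1 \<Longrightarrow> \<bar>F y\<bar> \<le> C"
  shows "expectation (\<lambda>\<omega>. F (X (Suc n) \<omega>)) = expectation (\<lambda>\<omega>. one_step (Suc n) F (X n \<omega>))"
    "integrable M (\<lambda>\<omega>. F (X n \<omega>))" "integrable M (\<lambda>\<omega>. one_step (Suc n) F (X n \<omega>))"
proof -
  let ?c = "\<lambda>y::real. max 0 (min 1 y)"
  have c: "?c y = y" if "0 \<le> y" "y \<le> 1" for y using that by auto
  let ?N = "Suc n"
  have s: "0 \<le> \<gamma> ?N" "\<gamma> ?N \<le> 1" "0 \<le> \<gamma> ?N * \<rho> ?N" "\<gamma> ?N * \<rho> ?N \<le> 1"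
    using gamma[of ?N] rho[of ?N] by auto
  note mv = convex_move_bounds[OF X_bounds s(1,2)] convex_move_bounds[OF X_bounds s(3,4)]
  have "expectation (\<lambda>\<omega>. F (X ?N \<omega>)) = expectation (\<lambda>\<omega>. F (?c (X ?N \<omega>)))"
    by (simp only: c[OF X_bounds])
  also have "\<dots> = expectation (\<lambda>\<omega>. one_step ?N (\<lambda>y. F (?c y)) (X n \<omega>))"
    unfolding one_step_def by (rule expectation_X_Suc_bounded[where C=C]) (auto intro!: bd)
  also have "\<dots> = expectation (\<lambda>\<omega>. one_step ?N F (X n \<omega>))"
    unfolding one_step_def by (simp only: c[OF mv(1,2)] c[OF mv(3,4)] c[OF mv(5,6)] c[OF mv(7,8)])
  finally show "expectation (\<lambda>\<omega>. F (X (Suc n) \<omega>)) = expectation (\<lambda>\<omega>. one_step (Suc n) F (X n \<omega>))" .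
  have int: "integrable M (\<lambda>\<omega>. a \<omega> * F (b \<omega>))"
    if [measurable]: "a \<in> borel_measurable M" "b \<in> borel_measurable M"
      and ab: "\<And>\<omega>. \<bar>a \<omega>\<bar> \<le> 1" "\<And>\<omega>. 0 \<le> b \<omega>" "\<And>\<omega>. b \<omega> \<le> 1" for a b
  proof (rule integrable_const_bound[of _ C])
    have "\<bar>a \<omega> * F (b \<omega>)\<bar> \<le> 1 * C" for \<omega>
      unfolding abs_mult using ab(1)[of \<omega>] bd[OF ab(2,3)] by (intro mult_mono) auto
    thus "AE \<omega> in M. norm (a \<omega> * F (b \<omega>)) \<le> C" by simp
  qed measurable
  show "integrable M (\<lambda>\<omega>. F (X n \<omega>))"
    using int[of "\<lambda>_. 1" "X n"] X_bounds by simp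
  have ab: "\<bar>p * q\<bar> \<le> 1" if "0 \<le> p" "p \<le> 1" "0 \<le> q" "q \<le> 1" for p q :: real
    using that by (simp add: mult_le_one)
  show "integrable M (\<lambda>\<omega>. one_step (Suc n) F (X n \<omega>))"
    unfolding one_step_def
    by (intro Bochner_Integration.integrable_add int ab mv)
      (use X_bounds pA_pos pA_less_1 pB_pos pB_less_pA in \<open>auto simp: less_imp_le\<close>)
qed

end

section \<open>The critical regime of step sizes and penalties\<close>

lemma square_exp_bound:
  fixes d :: real shows "\<bar>exp (- d) - 1 + d\<bar> \<le> d\<^sup>2 * exp \<bar>d\<bar>"
proof (cases "d = 0")
  case False
  obtain t where t: "\<bar>t\<bar> \<le> \<bar>- d\<bar>" "exp (- d) = (\<Sum>m<2. (- d) ^ m / fact m) + exp t / fact 2 * (- d) ^ 2"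
    using Maclaurin_exp_le[of "-d" 2] by auto
  have "\<bar>exp (- d) - 1 + d\<bar> = exp t / 2 * d\<^sup>2"
    unfolding t(2) by (simp add: numeral_2_eq_2)
  also have "\<dots> \<le> exp \<bar>d\<bar> * d\<^sup>2"
  proof (rule mult_right_mono)
    have "exp t \<le> exp \<bar>d\<bar>" using t(1) by auto
    thus "exp t / 2 \<le> exp \<bar>d\<bar>" using exp_gt_zero[of t] by linarith
  qed simp
  finally show ?thesis by (simp add: mult.commute)
qed simp

lemma linear_exp_bound:
  fixes d :: real shows "\<bar>exp (- d) - 1\<bar> \<le> \<bar>d\<bar> * exp \<bar>d\<bar>"
proof -
  have *: "exp a - 1 \<le> a * exp a" for a :: real
    using exp_ge_add_one_self[of "-a"] mult_right_mono[of "1 - a" "exp (-a)" "exp a"]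
    by (simp add: algebra_simps exp_minus field_simps)
  show ?thesis
  proof (cases "d \<ge> 0")
    case True
    have "1 - exp (- d) \<le> d" using exp_ge_add_one_self[of "-d"] by simp
    also have "\<dots> \<le> d * exp d" using True mult_left_mono[of 1 "exp d" d] by simp
    finally show ?thesis using True by simp
  qed (use *[of "-d"] in auto)
qed

lemma power_exp_half_bound:
  fixes u :: real assumes "0 \<le> u" "k \<le> 2" shows "u ^ k * exp (- u / 2) \<le> 8"
proof -
  have "u ^ k \<le> 8 * exp (u / 2)"
  proof -
    have 1: "1 + u/2 + (u/2)^2/2 \<le> exp (u/2)" using exp_lower_Taylor_quadratic[of "u/2"] assms by simp
    have 0: "0 \<le> u * u" using assms by simp
    have "1 + u / 2 + u * u / 8 \<le> exp (u / 2)" using 1 by (simp add: power2_eq_square)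
    hence b: "1 \<le> 8 * exp (u / 2)" "u \<le> 8 * exp (u / 2)" "u * u \<le> 8 * exp (u / 2)"
      using 0 assms(1) by linarith+
    consider "k = 0" | "k = 1" | "k = 2" using assms by linarith
    thus ?thesis by cases (use b in \<open>simp_all add: power2_eq_square\<close>)
  qed
  thus ?thesis by (simp add: exp_minus field_simps)
qed

text \<open>Taylor bounds for the exponential in which the perturbation may grow like half the exponent; the factor
  \<open>exp (- u / 2)\<close> that remains absorbs powers of \<open>u\<close>.\<close>
lemma exp_shift_bounds:
  fixes u d c :: real
  assumes u: "0 \<le> u" and d: "\<bar>d\<bar> \<le> u / 2 + c"
  shows "\<bar>exp (- (u + d)) - exp (- u)\<bar> \<le> \<bar>d\<bar> * (exp c * exp (- u / 2))"
    "\<bar>exp (- (u + d)) - exp (- u) + d * exp (- u)\<bar> \<le> d\<^sup>2 * (exp c * exp (- u / 2))"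
proof -
  have e: "exp (- u) * exp \<bar>d\<bar> \<le> exp c * exp (- u / 2)"
    using d by (simp add: exp_add[symmetric])
  have "\<bar>exp (- (u + d)) - exp (- u)\<bar> = exp (- u) * \<bar>exp (- d) - 1\<bar>"
    unfolding minus_add_distrib exp_add
    by (metis abs_exp_cancel abs_mult mult.right_neutral right_diff_distrib)
  also have "\<dots> \<le> exp (- u) * (\<bar>d\<bar> * exp \<bar>d\<bar>)" by (intro mult_left_mono linear_exp_bound) auto
  also have "\<dots> = \<bar>d\<bar> * (exp (- u) * exp \<bar>d\<bar>)" by simp
  also have "\<dots> \<le> \<bar>d\<bar> * (exp c * exp (- u / 2))" by (intro mult_left_mono e) auto
  finally show "\<bar>exp (- (u + d)) - exp (- u)\<bar> \<le> \<bar>d\<bar> * (exp c * exp (- u / 2))" .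
  have "exp (- (u + d)) - exp (- u) + d * exp (- u) = exp (- u) * (exp (- d) - 1 + d)"
    unfolding minus_add_distrib exp_add by (simp add: algebra_simps)
  hence "\<bar>exp (- (u + d)) - exp (- u) + d * exp (- u)\<bar> = exp (- u) * \<bar>exp (- d) - 1 + d\<bar>"
    by (simp add: abs_mult)
  also have "\<dots> \<le> exp (- u) * (d\<^sup>2 * exp \<bar>d\<bar>)" by (intro mult_left_mono square_exp_bound) auto
  also have "\<dots> = d\<^sup>2 * (exp (- u) * exp \<bar>d\<bar>)" by simp
  also have "\<dots> \<le> d\<^sup>2 * (exp c * exp (- u / 2))" by (intro mult_left_mono e) auto
  finally show "\<bar>exp (- (u + d)) - exp (- u) + d * exp (- u)\<bar> \<le> d\<^sup>2 * (exp c * exp (- u / 2))" .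
qed

locale penalized_bandit_critical = penalized_bandit_model +
  assumes gamma_mono: "\<And>m n. 1 \<le> m \<Longrightarrow> m \<le> n \<Longrightarrow> \<gamma> n \<le> \<gamma> m"
    and gamma_sum: "filterlim (\<lambda>n. \<Sum>k=1..n. \<gamma> k) at_top sequentially"
    and gamma_exp: "\<And>\<theta>. \<theta> > 0 \<Longrightarrow> summable (\<lambda>n. exp (- \<theta> / \<gamma> (Suc n)))"
    and gamma_diff: "(\<lambda>n. \<gamma> n - \<gamma> (n - 1)) \<in> o(\<lambda>n. (\<gamma> n)\<^sup>2)"
    and gamma_rho: "(\<lambda>n. \<gamma> n / \<rho> n - g) \<in> o(\<gamma>)"
begin

lemma gamma_tendsto_0: "\<gamma> \<longlonglongrightarrow> 0"
proof -
  have "(\<lambda>n. exp (- 1 / \<gamma> (Suc n))) \<longlonglongrightarrow> 0"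
    using summable_LIMSEQ_zero[OF gamma_exp[of 1]] by simp
  hence *: "eventually (\<lambda>n. exp (- 1 / \<gamma> (Suc n)) < exp (- 1 / e)) sequentially" if "e > 0" for e
    by (rule order_tendstoD(2)) simp
  have "(\<lambda>n. \<gamma> (Suc n)) \<longlonglongrightarrow> 0"
  proof (rule order_tendstoI)
    fix e :: real assume "e > 0"
    show "eventually (\<lambda>n. \<gamma> (Suc n) < e) sequentially"
      using *[OF \<open>e > 0\<close>]
    proof eventually_elim
      case (elim n)
      hence "1 / e < 1 / \<gamma> (Suc n)" by simp
      thus ?case using gamma[of "Suc n"] \<open>e > 0\<close> by (simp add: field_simps)
    qed
  next
    fix e :: real assume "e < 0"
    thus "eventually (\<lambda>n. e < \<gamma> (Suc n)) sequentially"
      using gamma by (intro always_eventually) (metis le_add1 less_trans plus_1_eq_Suc)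
  qed
  thus ?thesis by (rule LIMSEQ_imp_Suc)
qed

text \<open>The asymptotic relations between \<open>\<gamma>\<close> and \<open>\<rho>\<close> that the one-step estimates use, quantified by \<open>\<eta>\<close>: the
  scale changes by \<open>o(\<gamma>)\<close> per step, and both \<open>\<gamma> (n + 1) / \<rho> (n + 1)\<close> and \<open>\<gamma> (n + 1) / \<rho> n\<close> are close to \<open>g\<close>.\<close>
definition small_step :: "real \<Rightarrow> nat \<Rightarrow> bool" where
  "small_step \<eta> n \<longleftrightarrow> n \<ge> 1 \<and> \<gamma> (Suc n) \<le> \<eta> \<and> \<rho> n \<le> \<eta> \<and> \<rho> (Suc n) \<le> \<eta>
     \<and> \<bar>\<rho> n / \<rho> (Suc n) - 1\<bar> \<le> \<eta> * \<gamma> (Suc n)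
     \<and> \<bar>\<gamma> (Suc n) / \<rho> (Suc n) - g\<bar> \<le> \<eta> \<and> \<bar>\<gamma> (Suc n) / \<rho> n - g\<bar> \<le> \<eta>"

text \<open>With \<open>\<gamma> / \<rho> = g + o(\<gamma>)\<close>, the relative change of \<open>\<rho>\<close> in one step is that of \<open>\<gamma>\<close> up to \<open>o(\<gamma>)\<close>, and
  the latter is \<open>o(\<gamma>)\<close> by assumption.\<close>
lemma eventually_small_step:
  assumes "\<eta> > 0" shows "eventually (small_step \<eta>) sequentially"
proof -
  define \<zeta> where "\<zeta> = min (min 1 (g / 2)) (min (\<eta> / 2) (\<eta> * g / 16))"
  have z: "0 < \<zeta>" "\<zeta> \<le> 1" "\<zeta> \<le> g / 2" "\<zeta> \<le> \<eta> / 2" "\<zeta> \<le> \<eta> * g / 16" "\<zeta> \<le> \<eta> * g / 2"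
  proof -
    show "0 < \<zeta>" "\<zeta> \<le> 1" "\<zeta> \<le> g / 2" "\<zeta> \<le> \<eta> / 2" and *: "\<zeta> \<le> \<eta> * g / 16"
      using assms g_pos by (auto simp: \<zeta>_def)
    have "0 < \<eta> * g" using assms g_pos by simp
    thus "\<zeta> \<le> \<eta> * g / 2" using * by linarith
  qed
  define \<epsilon> where "\<epsilon> = \<zeta> / (4 * (1 + g))"
  have e: "0 < \<epsilon>" "\<epsilon> \<le> \<zeta> / 4" "\<epsilon> * (g + 1) \<le> \<zeta> / 2"
    using z(1) g_pos by (auto simp: \<epsilon>_def field_simps)
  have ev1: "eventually (\<lambda>n. \<bar>\<gamma> (Suc n) - \<gamma> n\<bar> \<le> \<epsilon> * (\<gamma> (Suc n))\<^sup>2) sequentially"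
    using landau_o.smallD[OF gamma_diff e(1)] eventually_sequentially_Suc[of "\<lambda>n. norm (\<gamma> n - \<gamma> (n - 1)) \<le> \<epsilon> * norm ((\<gamma> n)\<^sup>2)"]
    by simp
  have ev2: "eventually (\<lambda>n. \<bar>\<gamma> n / \<rho> n - g\<bar> \<le> \<epsilon> * \<bar>\<gamma> n\<bar>) sequentially"
    using landau_o.smallD[OF gamma_rho e(1)] by simp
  have ev3: "eventually (\<lambda>n. \<bar>\<gamma> (Suc n) / \<rho> (Suc n) - g\<bar> \<le> \<epsilon> * \<bar>\<gamma> (Suc n)\<bar>) sequentially"
    using ev2 eventually_sequentially_Suc[of "\<lambda>n. \<bar>\<gamma> n / \<rho> n - g\<bar> \<le> \<epsilon> * \<bar>\<gamma> n\<bar>"] by simp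
  have ev4: "eventually (\<lambda>n. \<gamma> n < \<epsilon>) sequentially"
    using order_tendstoD(2)[OF gamma_tendsto_0 e(1)] .
  show ?thesis using ev1 ev2 ev3 ev4 eventually_ge_at_top[of 1]
  proof eventually_elim
    case (elim n)
    let ?N = "Suc n"
    have gp: "0 < \<gamma> n" "0 < \<gamma> ?N" "0 < \<rho> n" "0 < \<rho> ?N" "\<gamma> ?N < 1"
      using gamma rho elim(5) by auto
    have mono: "\<gamma> ?N \<le> \<gamma> n" using gamma_mono elim(5) by simp
    define a where "a = \<gamma> n / \<rho> n - g"
    define b where "b = \<gamma> ?N / \<rho> ?N - g"
    define r where "r = \<gamma> n / \<gamma> ?N"
    have r: "1 \<le> r" "r - 1 \<le> \<epsilon> * \<gamma> ?N" "r \<le> 2"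
    proof -
      show "1 \<le> r" using mono gp by (simp add: r_def)
      have "r - 1 = (\<gamma> n - \<gamma> ?N) / \<gamma> ?N" using gp by (simp add: r_def field_simps)
      also have "\<dots> \<le> (\<epsilon> * (\<gamma> ?N)\<^sup>2) / \<gamma> ?N" using elim(1) gp by (intro divide_right_mono) auto
      finally show *: "r - 1 \<le> \<epsilon> * \<gamma> ?N" using gp by (simp add: power2_eq_square)
      have "\<epsilon> * \<gamma> ?N \<le> 1 * 1" using e z gp by (intro mult_mono) auto
      thus "r \<le> 2" using * by simp
    qed
    have ab: "\<bar>a\<bar> \<le> 2 * \<epsilon> * \<gamma> ?N" "\<bar>b\<bar> \<le> \<epsilon> * \<gamma> ?N"
    proof -
      have "\<bar>a\<bar> \<le> \<epsilon> * \<gamma> n" using elim(2) gp by (simp add: a_def)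
      also have "\<gamma> n = r * \<gamma> ?N" using gp by (simp add: r_def)
      also have "\<epsilon> * (r * \<gamma> ?N) \<le> \<epsilon> * (2 * \<gamma> ?N)" using r e gp by (intro mult_left_mono mult_right_mono) auto
      finally show "\<bar>a\<bar> \<le> 2 * \<epsilon> * \<gamma> ?N" by simp
      show "\<bar>b\<bar> \<le> \<epsilon> * \<gamma> ?N" using elim(3) gp by (simp add: b_def)
    qed
    have eg: "\<epsilon> * \<gamma> ?N \<le> \<epsilon>" using e gp by (simp add: mult_left_le)
    have ag: "g / 2 \<le> g + a" "g / 2 \<le> g + b" using ab eg e(1,2) z(3) by linarith+
    have rn: "\<gamma> n / \<rho> n = g + a" and rN: "\<gamma> ?N / \<rho> ?N = g + b" by (auto simp: a_def b_def)
    have rho_n: "\<rho> n = \<gamma> n / (g + a)" and rho_N: "\<rho> ?N = \<gamma> ?N / (g + b)"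
      using rn rN gp ag g_pos by (auto simp: field_simps)
    have small: "\<rho> n \<le> \<eta>" "\<rho> ?N \<le> \<eta>"
    proof -
      have "\<rho> n \<le> \<epsilon> / (g / 2)" unfolding rho_n using elim(4) ag g_pos gp by (intro frac_le) auto
      moreover have "\<rho> ?N \<le> \<epsilon> / (g / 2)"
        unfolding rho_N using elim(4) mono ag g_pos gp by (intro frac_le) auto
      moreover have "\<epsilon> / (g / 2) \<le> \<eta>" using e z g_pos by (simp add: field_simps)
      ultimately show "\<rho> n \<le> \<eta>" "\<rho> ?N \<le> \<eta>" by auto
    qed
    have ratio: "\<rho> n / \<rho> ?N - 1 = (r - 1) * ((g + b) / (g + a)) + (b - a) / (g + a)"
    proof -
      have "\<rho> n / \<rho> ?N = r * ((g + b) / (g + a))" unfolding rho_n rho_N r_def by simp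
      moreover have "(b - a) / (g + a) = (g + b) / (g + a) - 1" using ag g_pos by (simp add: field_simps)
      ultimately show ?thesis by (simp only: left_diff_distrib)
    qed
    have "\<bar>\<rho> n / \<rho> ?N - 1\<bar> \<le> (r - 1) * \<bar>(g + b) / (g + a)\<bar> + \<bar>(b - a) / (g + a)\<bar>"
      unfolding ratio using r(1) abs_triangle_ineq[of "(r - 1) * ((g + b) / (g + a))" "(b - a) / (g + a)"] by (simp add: abs_mult)
    also have "\<dots> \<le> (\<epsilon> * \<gamma> ?N) * 4 + (3 * \<epsilon> * \<gamma> ?N) / (g / 2)"
    proof (intro add_mono mult_mono)
      have "g + b \<le> 2 * g" using ab eg e(1,2) z(3) by linarith
      hence "(g + b) / (g + a) \<le> (2 * g) / (g / 2)" using ag g_pos by (intro frac_le) auto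
      thus "\<bar>(g + b) / (g + a)\<bar> \<le> 4" using ag g_pos by simp
      show "\<bar>(b - a) / (g + a)\<bar> \<le> (3 * \<epsilon> * \<gamma> ?N) / (g / 2)"
        unfolding abs_divide using ab ag g_pos e gp by (intro frac_le) auto
    qed (use r e gp in auto)
    also have "\<dots> = (4 * \<epsilon> + 6 * \<epsilon> / g) * \<gamma> ?N" by (simp add: field_simps)
    also have "\<dots> \<le> \<eta> * \<gamma> ?N"
    proof (rule mult_right_mono)
      have "4 * \<epsilon> \<le> \<zeta>" "6 * \<epsilon> \<le> 2 * \<zeta>" using e by auto
      moreover have "2 * \<zeta> / g \<le> \<eta> / 8" using z(5) g_pos by (simp add: field_simps)
      moreover have "6 * \<epsilon> / g \<le> 2 * \<zeta> / g" using calculation g_pos by (intro divide_right_mono) auto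
      ultimately show "4 * \<epsilon> + 6 * \<epsilon> / g \<le> \<eta>" using z(4) assms by linarith
    qed (use gp in simp)
    finally have 1: "\<bar>\<rho> n / \<rho> ?N - 1\<bar> \<le> \<eta> * \<gamma> ?N" .
    have 2: "\<bar>\<gamma> ?N / \<rho> ?N - g\<bar> \<le> \<eta>"
      using ab(2) eg e(1,2) z(1,4) assms unfolding b_def by linarith
    have 3: "\<bar>\<gamma> ?N / \<rho> n - g\<bar> \<le> \<eta>"
    proof -
      have "\<gamma> ?N / \<rho> n = (g + a) / r" using rn gp r by (simp add: r_def field_simps)
      hence "\<gamma> ?N / \<rho> n - g = (a - g * (r - 1)) / r" using r by (simp add: field_simps)
      hence "\<bar>\<gamma> ?N / \<rho> n - g\<bar> \<le> \<bar>a - g * (r - 1)\<bar>"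
        using r(1) by (simp add: divide_le_eq mult_le_cancel_left1 abs_divide)
      also have "\<dots> \<le> \<bar>a\<bar> + g * (r - 1)" using r(1) g_pos abs_triangle_ineq4[of a "g * (r - 1)"] by (simp add: abs_mult)
      also have "\<dots> \<le> 2 * \<epsilon> + g * \<epsilon>"
        using ab(1) eg r(2) g_pos by (intro add_mono mult_left_mono) auto
      also have "\<dots> \<le> \<eta>" using e z g_pos by (simp add: algebra_simps)
      finally show ?thesis .
    qed
    have 4: "\<gamma> ?N \<le> \<eta>" using mono elim(4) e z by simp
    show ?case unfolding small_step_def using elim(5) 1 2 3 4 small by simp
  qed
qed

end

section \<open>Bounded first moments\<close>

context penalized_bandit_critical
begin

text \<open>For \<open>1 - x\<close> itself the drift \<open>- (p\<^sub>A - p\<^sub>B) * \<gamma> * x * (1 - x)\<close> degenerates at \<open>x = 0\<close>. Dividing by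
  \<open>x + K * \<rho>\<close> makes it uniform: for \<open>x\<close> above \<open>\<rho>\<close> the rewards give it, and for \<open>x\<close> below \<open>\<rho>\<close> the penalty on
  arm B moves the state away from \<open>0\<close> by \<open>\<gamma> * \<rho>\<close>, which is of the order \<open>\<gamma>\<close> relative to \<open>x + K * \<rho>\<close>. A
  step of size \<open>\<gamma>\<close> is a small fraction of the shift \<open>K * \<rho>\<close>, so the denominators vary little in one step.\<close>
lemma lyapunov_drift:
  obtains K c \<eta> where "K > 0" "c > 0" "\<eta> > 0"
    "\<And>n y. small_step \<eta> n \<Longrightarrow> 0 \<le> y \<Longrightarrow> y \<le> 1 \<Longrightarrow>
      one_step (Suc n) (\<lambda>z. (1 - z) / (z + K * \<rho> (Suc n))) y
      \<le> (1 - c * \<gamma> (Suc n)) * ((1 - y) / (y + K * \<rho> (Suc n))) + 4 * \<gamma> (Suc n) * \<rho> (Suc n)"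
proof -
  define d where "d = p\<^sub>A - p\<^sub>B"
  have d: "0 < d" "d < 1" using pB_less_pA pA_less_1 pB_pos by (auto simp: d_def)
  \<comment> \<open>With this \<open>K\<close> a step \<open>\<gamma> \<le> 2 * g * \<rho>\<close> is at most the fraction \<open>d / (4 * p\<^sub>A)\<close> of \<open>K * \<rho>\<close>, so that
    replacing the denominator after a success of arm A by \<open>w\<close> costs at most \<open>d / 4\<close>.\<close>
  define K where "K = 2 * g * p\<^sub>A / (d / 4)"
  have K: "K > 0" using g_pos pA_pos d by (simp add: K_def)
  define b where "b = 1 - p\<^sub>B"
  have b: "0 < b" using pB_less_pA pA_less_1 by (simp add: b_def)
  define c where "c = min ((d / 2) / (1 + K)) (b / (2 * (K + 2)))"
  have c: "c > 0" using d K b by (simp add: c_def)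
  define \<eta> where "\<eta> = min (min (1/4) (d / 8)) (min (1 / K) (g / 2))"
  have eta: "0 < \<eta>" "\<eta> \<le> 1/4" "\<eta> \<le> d / 8" "\<eta> \<le> 1 / K" "\<eta> \<le> g / 2"
    using d K g_pos by (auto simp: \<eta>_def)
  show thesis
  proof (rule that[of K c \<eta>])
    fix n and y :: real
    assume ss: "small_step \<eta> n" and y: "0 \<le> y" "y \<le> 1"
    let ?N = "Suc n"
    define \<gamma>' where "\<gamma>' = \<gamma> ?N" define \<rho>' where "\<rho>' = \<rho> ?N"
    have gr: "0 < \<gamma>'" "\<gamma>' \<le> \<eta>" "0 < \<rho>'" "\<rho>' \<le> \<eta>" "\<bar>\<gamma>' / \<rho>' - g\<bar> \<le> \<eta>"
      using ss gamma[of ?N] rho[of ?N] by (auto simp: small_step_def \<gamma>'_def \<rho>'_def)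
    define \<kappa> where "\<kappa> = K * \<rho>'"
    have k: "0 < \<kappa>" "\<kappa> \<le> 1"
    proof -
      show "0 < \<kappa>" using K gr by (simp add: \<kappa>_def)
      have "\<kappa> \<le> K * (1 / K)" unfolding \<kappa>_def using K gr eta by (intro mult_left_mono) auto
      thus "\<kappa> \<le> 1" using K by simp
    qed
    define w where "w = y + \<kappa>"
    have w: "0 < w" "\<kappa> \<le> w" "y \<le> w" using y k by (auto simp: w_def)
    have g2: "\<gamma>' \<le> 2 * g * \<rho>'"
    proof -
      have "\<gamma>' / \<rho>' \<le> 2 * g" using gr(5) eta(5) g_pos by linarith
      thus ?thesis using gr by (simp add: field_simps)
    qed
    have gr1: "\<gamma>' * \<rho>' \<le> 1/2"
    proof -
      have "\<gamma>' * \<rho>' \<le> 1 * (1/4)" using gr eta by (intro mult_mono) auto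
      thus ?thesis by simp
    qed
    have phi: "(1 - z) / (z + \<kappa>) = (1 + \<kappa>) * (1 / (z + \<kappa>)) - 1" if "0 \<le> z" for z
      using that k by (simp add: field_simps)
    have grb: "0 \<le> \<gamma>' * \<rho>'" "\<gamma>' * \<rho>' \<le> 1" "0 \<le> \<gamma>'" "\<gamma>' \<le> 1" using gr gr1 eta by auto
    note mv = convex_move_bounds[OF y grb(3,4)] convex_move_bounds[OF y grb(1,2)]
    define t1 where "t1 = - (\<gamma>' * (1 - y) * (p\<^sub>A * y / (w + \<gamma>' * (1 - y))) / w)"
    define t2 where "t2 = y * (1 - p\<^sub>A) * (\<gamma>' * \<rho>' * y / (w * (w - \<gamma>' * \<rho>' * y)))"
    define t3 where "t3 = \<gamma>' * (1 - y) * (p\<^sub>B * y / (w - \<gamma>' * y)) / w"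
    define t4 where "t4 = - (\<gamma>' * (1 - y) * (b * \<rho>' * (1 - y) / (w + \<gamma>' * \<rho>' * (1 - y))) / w)"
    have pos: "0 < w + \<gamma>' * (1 - y)" "0 < w - \<gamma>' * \<rho>' * y" "0 < w - \<gamma>' * y" "0 < w + \<gamma>' * \<rho>' * (1 - y)"
      using mv k unfolding w_def by linarith+
    have inv: "1 / (w + s) - 1 / w = - (s / (w * (w + s)))" if "0 < w + s" for s
      using that w by (simp add: field_simps)
    have eq: "one_step ?N (\<lambda>z. (1 - z) / (z + \<kappa>)) y - (1 - y) / (y + \<kappa>) = (1 + \<kappa>) * (t1 + t2 + t3 + t4)"
    proof -
      have "one_step ?N (\<lambda>z. (1 - z) / (z + \<kappa>)) y - (1 - y) / (y + \<kappa>)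
        = (1 + \<kappa>) * (y * p\<^sub>A * (1 / (w + \<gamma>' * (1 - y)) - 1 / w)
          + y * (1 - p\<^sub>A) * (1 / (w + (- (\<gamma>' * \<rho>' * y))) - 1 / w)
          + (1 - y) * p\<^sub>B * (1 / (w + (- (\<gamma>' * y))) - 1 / w)
          + (1 - y) * b * (1 / (w + \<gamma>' * \<rho>' * (1 - y)) - 1 / w))"
      proof -
        have ww: "y + \<gamma>' * (1 - y) + \<kappa> = w + \<gamma>' * (1 - y)" "y - \<gamma>' * \<rho>' * y + \<kappa> = w + (- (\<gamma>' * \<rho>' * y))"
          "y - \<gamma>' * y + \<kappa> = w + (- (\<gamma>' * y))" "y + \<gamma>' * \<rho>' * (1 - y) + \<kappa> = w + \<gamma>' * \<rho>' * (1 - y)"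
          by (simp_all add: w_def)
        have gen: "y * p\<^sub>A * ((1 + \<kappa>) * a1 - 1) + y * (1 - p\<^sub>A) * ((1 + \<kappa>) * a2 - 1)
            + (1 - y) * p\<^sub>B * ((1 + \<kappa>) * a3 - 1) + (1 - y) * (1 - p\<^sub>B) * ((1 + \<kappa>) * a4 - 1) - ((1 + \<kappa>) * a0 - 1)
          = (1 + \<kappa>) * (y * p\<^sub>A * (a1 - a0) + y * (1 - p\<^sub>A) * (a2 - a0) + (1 - y) * p\<^sub>B * (a3 - a0) + (1 - y) * b * (a4 - a0))"
          for a0 a1 a2 a3 a4 by (simp add: b_def algebra_simps)
        show ?thesis
          unfolding one_step_def \<gamma>'_def[symmetric] \<rho>'_def[symmetric] phi[OF mv(3)] phi[OF mv(5)] phi[OF mv(1)] phi[OF mv(7)] phi[OF y(1)]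
          unfolding ww w_def[symmetric] by (rule gen)
      qed
      also have "\<dots> = (1 + \<kappa>) * (t1 + t2 + t3 + t4)"
      proof -
        have i: "1 / (w + \<gamma>' * (1 - y)) - 1 / w = - (\<gamma>' * (1 - y) / (w * (w + \<gamma>' * (1 - y))))"
          "1 / (w + (- (\<gamma>' * \<rho>' * y))) - 1 / w = \<gamma>' * \<rho>' * y / (w * (w - \<gamma>' * \<rho>' * y))"
          "1 / (w + (- (\<gamma>' * y))) - 1 / w = \<gamma>' * y / (w * (w - \<gamma>' * y))"
          "1 / (w + \<gamma>' * \<rho>' * (1 - y)) - 1 / w = - (\<gamma>' * \<rho>' * (1 - y) / (w * (w + \<gamma>' * \<rho>' * (1 - y))))"
          using inv[of "\<gamma>' * (1 - y)"] inv[of "- (\<gamma>' * \<rho>' * y)"] inv[of "- (\<gamma>' * y)"] inv[of "\<gamma>' * \<rho>' * (1 - y)"] pos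
          by simp_all
        have "y * p\<^sub>A * (1 / (w + \<gamma>' * (1 - y)) - 1 / w) = t1"
          "y * (1 - p\<^sub>A) * (1 / (w + (- (\<gamma>' * \<rho>' * y))) - 1 / w) = t2"
          "(1 - y) * p\<^sub>B * (1 / (w + (- (\<gamma>' * y))) - 1 / w) = t3"
          "(1 - y) * b * (1 / (w + \<gamma>' * \<rho>' * (1 - y)) - 1 / w) = t4"
          unfolding i t1_def t2_def t3_def t4_def by (simp_all add: ac_simps)
        thus ?thesis by simp
      qed
      finally show ?thesis .
    qed
    have T2: "t2 \<le> 2 * \<gamma>' * \<rho>'"
    proof -
      have "w / 2 \<le> w - \<gamma>' * \<rho>' * y"
      proof -
        have "\<gamma>' * \<rho>' * y \<le> 1/2 * w" using gr1 w y by (intro mult_mono) auto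
        thus ?thesis by simp
      qed
      hence "\<gamma>' * \<rho>' * y / (w * (w - \<gamma>' * \<rho>' * y)) \<le> \<gamma>' * \<rho>' * w / (w * (w / 2))"
        using w gr y by (intro frac_le mult_left_mono mult_nonneg_nonneg mult_pos_pos) auto
      also have "\<dots> = 2 * \<gamma>' * \<rho>' / w" using w by (simp add: field_simps)
      finally have "t2 \<le> y * 1 * (2 * \<gamma>' * \<rho>' / w)"
        unfolding t2_def using y pA_less_1 pA_pos w gr pos by (intro mult_mono) (auto intro!: divide_nonneg_nonneg)
      also have "\<dots> = 2 * \<gamma>' * \<rho>' * (y / w)" by simp
      also have "\<dots> \<le> 2 * \<gamma>' * \<rho>' * 1" using w y gr by (intro mult_left_mono) auto
      finally show ?thesis by simp
    qed
    define q where "q = - (p\<^sub>A * y / (w + \<gamma>' * (1 - y))) + p\<^sub>B * y / (w - \<gamma>' * y)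
        - b * \<rho>' * (1 - y) / (w + \<gamma>' * \<rho>' * (1 - y))"
    have T134: "t1 + t3 + t4 = \<gamma>' * (1 - y) * q / w"
      unfolding t1_def t3_def t4_def q_def by (simp add: algebra_simps add_divide_distrib diff_divide_distrib)
    have q1: "- (p\<^sub>A * y / (w + \<gamma>' * (1 - y))) \<le> (d / 4 - p\<^sub>A) * (y / w)"
    proof -
      have "\<gamma>' * (1 - y) \<le> 2 * g * \<rho>'" using g2 y gr mult_left_mono[of "1 - y" 1 \<gamma>'] by linarith
      also have "\<dots> = (d / (4 * p\<^sub>A)) * \<kappa>" using d pA_pos by (simp add: \<kappa>_def K_def)
      also have "\<dots> \<le> (d / (4 * p\<^sub>A)) * w" using d pA_pos w by (intro mult_left_mono) auto
      finally have 1: "w + \<gamma>' * (1 - y) \<le> w * (1 + d / (4 * p\<^sub>A))" by (simp add: algebra_simps)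
      have "p\<^sub>A * y / (w + \<gamma>' * (1 - y)) \<ge> p\<^sub>A * y / (w * (1 + d / (4 * p\<^sub>A)))"
        using 1 pos pA_pos y by (intro divide_left_mono) (auto intro!: mult_pos_pos w add_pos_pos d)
      moreover have "p\<^sub>A * y / (w * (1 + d / (4 * p\<^sub>A))) = (p\<^sub>A / (1 + d / (4 * p\<^sub>A))) * (y / w)" by simp
      moreover have "p\<^sub>A - d / 4 \<le> p\<^sub>A / (1 + d / (4 * p\<^sub>A))"
      proof -
        have "(p\<^sub>A - d / 4) * (1 + d / (4 * p\<^sub>A)) = p\<^sub>A - d\<^sup>2 / (16 * p\<^sub>A)"
          using pA_pos by (simp add: field_simps power2_eq_square)
        also have "\<dots> \<le> p\<^sub>A" using pA_pos by simp
        finally show ?thesis using pA_pos d by (simp add: pos_le_divide_eq add_pos_pos)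
      qed
      hence "(p\<^sub>A - d / 4) * (y / w) \<le> (p\<^sub>A / (1 + d / (4 * p\<^sub>A))) * (y / w)" using y w by (intro mult_right_mono) auto
      ultimately show ?thesis by (simp add: algebra_simps)
    qed
    have q2: "p\<^sub>B * y / (w - \<gamma>' * y) \<le> (p\<^sub>B + d / 4) * (y / w)"
    proof -
      have "w * (1 - \<gamma>') \<le> w - \<gamma>' * y" using w gr by (simp add: algebra_simps)
      hence "p\<^sub>B * y / (w - \<gamma>' * y) \<le> p\<^sub>B * y / (w * (1 - \<gamma>'))"
        using pB_pos y w pos gr eta by (intro divide_left_mono mult_pos_pos) auto
      also have "\<dots> = (p\<^sub>B / (1 - \<gamma>')) * (y / w)" by simp
      also have "\<dots> \<le> (p\<^sub>B + d / 4) * (y / w)"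
      proof (rule mult_right_mono)
        have "p\<^sub>B + d / 4 \<le> 1" using pB_less_pA pA_less_1 by (simp add: d_def field_simps)
        hence "(p\<^sub>B + d / 4) * \<gamma>' \<le> 1 * (d / 8)" using gr eta pB_pos d pA_less_1 pB_less_pA by (intro mult_mono) auto
        hence "p\<^sub>B \<le> (p\<^sub>B + d / 4) * (1 - \<gamma>')" using d by (simp add: algebra_simps)
        thus "p\<^sub>B / (1 - \<gamma>') \<le> p\<^sub>B + d / 4" using gr eta by (simp add: pos_divide_le_eq)
      qed (use y w in auto)
      finally show ?thesis .
    qed
    have q3: "0 \<le> b * \<rho>' * (1 - y) / (w + \<gamma>' * \<rho>' * (1 - y))"
      using b gr y pos by (intro divide_nonneg_nonneg) auto
    have q12: "q \<le> - (d / 2) * (y / w) - b * \<rho>' * (1 - y) / (w + \<gamma>' * \<rho>' * (1 - y))"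
    proof -
      have "d / 4 - p\<^sub>A + (p\<^sub>B + d / 4) = - (d / 2)" by (simp add: d_def field_simps)
      hence "(d / 4 - p\<^sub>A) * (y / w) + (p\<^sub>B + d / 4) * (y / w) = - (d / 2) * (y / w)"
        unfolding distrib_right[symmetric] by (rule arg_cong)
      thus ?thesis unfolding q_def using q1 q2 by linarith
    qed
    \<comment> \<open>Near \<open>0\<close> the penalty term of \<open>q12\<close> is bounded away from zero, elsewhere the fraction \<open>y / w\<close> is.\<close>
    have q: "q \<le> - c"
    proof (cases "y \<le> \<rho>'")
      case True
      have "w + \<gamma>' * \<rho>' * (1 - y) \<le> \<rho>' * (K + 2)"
      proof -
        have "\<gamma>' * \<rho>' * (1 - y) \<le> 1 * \<rho>' * 1" using gr eta y by (intro mult_mono) auto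
        thus ?thesis using True by (simp add: w_def \<kappa>_def algebra_simps)
      qed
      moreover have "b * \<rho>' * (1/2) \<le> b * \<rho>' * (1 - y)"
        using True gr eta b by (intro mult_left_mono) auto
      ultimately have "b * \<rho>' * (1/2) / (\<rho>' * (K + 2)) \<le> b * \<rho>' * (1 - y) / (w + \<gamma>' * \<rho>' * (1 - y))"
        using b gr y pos K by (intro frac_le) auto
      moreover have "b * \<rho>' * (1/2) / (\<rho>' * (K + 2)) = b / (2 * (K + 2))" using gr by simp
      moreover have "0 \<le> (d / 2) * (y / w)" using d y w by simp
      moreover have "c \<le> b / (2 * (K + 2))" by (simp add: c_def)
      ultimately show ?thesis using q12 by linarith
    next
      case False
      have "w \<le> (1 + K) * y" using False K by (simp add: w_def \<kappa>_def algebra_simps)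
      hence "1 / (1 + K) \<le> y / w" using w K by (simp add: field_simps)
      hence "(d / 2) * (1 / (1 + K)) \<le> (d / 2) * (y / w)" using d by (intro mult_left_mono) auto
      moreover have "c \<le> (d / 2) * (1 / (1 + K))" by (simp add: c_def)
      ultimately show ?thesis using q12 q3 by linarith
    qed
    have "t1 + t3 + t4 \<le> \<gamma>' * (1 - y) * (- c) / w"
      unfolding T134 using q gr y w by (intro divide_right_mono mult_left_mono) auto
    also have "\<dots> = - (c * \<gamma>' * ((1 - y) / w))" by (simp add: ac_simps)
    finally have "t1 + t2 + t3 + t4 \<le> - (c * \<gamma>' * ((1 - y) / w)) + 2 * \<gamma>' * \<rho>'"
      using T2 by linarith
    hence "(1 + \<kappa>) * (t1 + t2 + t3 + t4) \<le> (1 + \<kappa>) * (- (c * \<gamma>' * ((1 - y) / w)) + 2 * \<gamma>' * \<rho>')"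
      using k by (intro mult_left_mono) auto
    also have "\<dots> = - (1 + \<kappa>) * (c * \<gamma>' * ((1 - y) / w)) + (1 + \<kappa>) * (2 * \<gamma>' * \<rho>')"
      by (simp only: distrib_left mult_minus_left mult_minus_right)
    also have "\<dots> \<le> - 1 * (c * \<gamma>' * ((1 - y) / w)) + 2 * (2 * \<gamma>' * \<rho>')"
      using k c gr y w by (intro add_mono mult_right_mono) auto
    finally have fin: "(1 + \<kappa>) * (t1 + t2 + t3 + t4) \<le> - 1 * (c * \<gamma>' * ((1 - y) / w)) + 2 * (2 * \<gamma>' * \<rho>')" .
    define Z where "Z = (1 - y) / (y + \<kappa>)"
    have "one_step ?N (\<lambda>z. (1 - z) / (z + \<kappa>)) y \<le> Z - c * \<gamma>' * Z + 4 * \<gamma>' * \<rho>'"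
      using fin eq unfolding w_def Z_def[symmetric] by linarith
    also have "\<dots> = (1 - c * \<gamma>') * Z + 4 * \<gamma>' * \<rho>'" by (simp add: algebra_simps)
    finally show "one_step (Suc n) (\<lambda>z. (1 - z) / (z + K * \<rho> (Suc n))) y
      \<le> (1 - c * \<gamma> (Suc n)) * ((1 - y) / (y + K * \<rho> (Suc n))) + 4 * \<gamma> (Suc n) * \<rho> (Suc n)"
      unfolding \<rho>'_def[symmetric] \<gamma>'_def[symmetric] \<kappa>_def[symmetric] Z_def .
  qed (use K c eta in auto)
qed

definition Y :: "nat \<Rightarrow> 'a \<Rightarrow> real" where "Y n \<omega> = (1 - X n \<omega>) / \<rho> n"

lemma Y_measurable [measurable]: "Y n \<in> borel_measurable M"
  unfolding Y_def[abs_def] by measurable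

lemma Y_nonneg: "n \<ge> 1 \<Longrightarrow> 0 \<le> Y n \<omega>"
  using X_bounds(2)[of n \<omega>] rho[of n] by (simp add: Y_def)

lemma Y_abs_le: "\<bar>Y n \<omega>\<bar> \<le> 1 / \<bar>\<rho> n\<bar>"
  unfolding Y_def abs_divide using X_bounds[of n \<omega>] by (intro divide_right_mono) auto

lemma Y_integrable: "integrable M (Y n)"
  by (rule integrable_const_bound[of _ "1 / \<bar>\<rho> n\<bar>"]) (auto simp: Y_abs_le)

text \<open>Divided by \<open>\<rho> n\<close>, the expected Lyapunov function satisfies \<open>u (n + 1) \<le> (1 - c * \<gamma> / 2) * u n + 4 * \<gamma>\<close>,
  the change of \<open>\<rho>\<close> from one step to the next costing half of the contraction; such a sequence stays below
  \<open>8 / c\<close> or its initial value.\<close>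
lemma first_moment_bounded:
  obtains C where "C > 0" "eventually (\<lambda>n. expectation (Y n) \<le> C) sequentially"
proof -
  obtain K c \<eta>0 where K: "K > 0" "c > 0" "\<eta>0 > 0" and drift:
    "\<And>n y. small_step \<eta>0 n \<Longrightarrow> 0 \<le> y \<Longrightarrow> y \<le> 1 \<Longrightarrow>
      one_step (Suc n) (\<lambda>z. (1 - z) / (z + K * \<rho> (Suc n))) y
      \<le> (1 - c * \<gamma> (Suc n)) * ((1 - y) / (y + K * \<rho> (Suc n))) + 4 * \<gamma> (Suc n) * \<rho> (Suc n)"
    using lyapunov_drift by blast
  define \<eta> where "\<eta> = min \<eta>0 (min 1 (min (c / 6) (1 / c)))"
  have eta: "0 < \<eta>" "\<eta> \<le> \<eta>0" "\<eta> \<le> 1" "\<eta> \<le> c / 6" "\<eta> \<le> 1 / c" using K by (auto simp: \<eta>_def)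
  define u where "u n = expectation (\<lambda>\<omega>. (1 - X n \<omega>) / (X n \<omega> + K * \<rho> n)) / \<rho> n" for n
  have bd: "\<bar>(1 - z) / (z + K * \<rho> m)\<bar> \<le> 1 / (K * \<rho> m)" if "0 \<le> z" "z \<le> 1" "m \<ge> 1" for z m
  proof -
    have "0 < K * \<rho> m" using K rho[OF that(3)] by simp
    thus ?thesis unfolding abs_divide using that by (intro frac_le) auto
  qed
  have int: "integrable M (\<lambda>\<omega>. (1 - X n \<omega>) / (X n \<omega> + K * \<rho> m))" if "m \<ge> 1" for n m
    by (rule expectation_X_Suc(2)[where C = "1 / (K * \<rho> m)"]) (use bd that in auto)
  have lin: "expectation (\<lambda>\<omega>. a * (s * f \<omega>) + b) = a * (s * expectation f) + b"
    if "integrable M f" for a s b :: real and f :: "'a \<Rightarrow> real" using that prob_space by simp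
  obtain n0 where n0: "\<And>n. n \<ge> n0 \<Longrightarrow> small_step \<eta> n"
    using eventually_small_step[OF eta(1)] unfolding eventually_sequentially by blast
  have rec: "u (Suc n) \<le> (1 - (c / 2) * \<gamma> (Suc n)) * u n + 4 * \<gamma> (Suc n)" "0 \<le> u n" "c / 2 * \<gamma> (Suc n) \<le> 1" if "n \<ge> n0" for n
  proof -
    let ?N = "Suc n"
    have ss: "small_step \<eta> n" using n0 that by simp
    hence ss0: "small_step \<eta>0 n"
    proof -
      have "\<eta> * \<gamma> ?N \<le> \<eta>0 * \<gamma> ?N" using eta gamma[of ?N] by (intro mult_right_mono) auto
      thus ?thesis using ss eta(2) unfolding small_step_def by auto
    qed
    have n1: "n \<ge> 1" using ss by (simp add: small_step_def)
    have gr: "0 < \<gamma> ?N" "\<gamma> ?N \<le> \<eta>" "0 < \<rho> ?N" "0 < \<rho> n" "\<bar>\<rho> n / \<rho> ?N - 1\<bar> \<le> \<eta> * \<gamma> ?N"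
      using ss gamma[of ?N] rho[of ?N] rho[OF n1] by (auto simp: small_step_def)
    have cg: "c * \<gamma> ?N \<le> 1"
    proof -
      have "c * \<gamma> ?N \<le> c * (1 / c)" using gr eta K by (intro mult_left_mono) auto
      thus ?thesis using K by simp
    qed
    thus "c / 2 * \<gamma> (Suc n) \<le> 1" using K gr by (simp add: mult.assoc)
    have G0: "0 \<le> (1 - X n \<omega>) / (X n \<omega> + K * \<rho> n)" for \<omega>
      using X_bounds[of n \<omega>] K gr by (intro divide_nonneg_nonneg) auto
    show u0: "0 \<le> u n" unfolding u_def using gr G0 by (intro divide_nonneg_nonneg integral_nonneg_AE) auto
    define s where "s = 1 + \<eta> * \<gamma> ?N"
    have s: "1 \<le> s" "\<rho> n / \<rho> ?N \<le> s" using gr eta by (auto simp: s_def)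
    have cmp: "(1 - X n \<omega>) / (X n \<omega> + K * \<rho> ?N) \<le> s * ((1 - X n \<omega>) / (X n \<omega> + K * \<rho> n))" for \<omega>
    proof -
      have "\<rho> n \<le> s * \<rho> ?N" using s(2) gr by (simp add: field_simps)
      hence "K * \<rho> n \<le> s * (K * \<rho> ?N)" using K by (simp add: mult.left_commute)
      moreover have "X n \<omega> \<le> s * X n \<omega>" using s X_bounds[of n \<omega>] by (simp add: mult_le_cancel_right1)
      ultimately have le: "X n \<omega> + K * \<rho> n \<le> s * (X n \<omega> + K * \<rho> ?N)" by (simp add: algebra_simps)
      have p: "0 < X n \<omega> + K * \<rho> n" "0 < X n \<omega> + K * \<rho> ?N"
        using X_bounds[of n \<omega>] K gr by (auto intro!: add_nonneg_pos)
      have "1 / (X n \<omega> + K * \<rho> ?N) \<le> s / (X n \<omega> + K * \<rho> n)" using le p by (simp add: field_simps)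
      from mult_left_mono[OF this, of "1 - X n \<omega>"] X_bounds[of n \<omega>]
      show ?thesis by (simp add: field_simps)
    qed
    have "expectation (\<lambda>\<omega>. (1 - X ?N \<omega>) / (X ?N \<omega> + K * \<rho> ?N))
      = expectation (\<lambda>\<omega>. one_step ?N (\<lambda>z. (1 - z) / (z + K * \<rho> ?N)) (X n \<omega>))"
      by (rule expectation_X_Suc(1)[where C = "1 / (K * \<rho> ?N)"]) (use bd in auto)
    also have "\<dots> \<le> expectation (\<lambda>\<omega>. (1 - c * \<gamma> ?N) * ((1 - X n \<omega>) / (X n \<omega> + K * \<rho> ?N)) + 4 * \<gamma> ?N * \<rho> ?N)"
      by (intro integral_mono expectation_X_Suc(3)[where C = "1 / (K * \<rho> ?N)"] drift ss0 X_bounds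
          Bochner_Integration.integrable_add integrable_mult_right int) (use bd in auto)
    also have "\<dots> \<le> expectation (\<lambda>\<omega>. (1 - c * \<gamma> ?N) * (s * ((1 - X n \<omega>) / (X n \<omega> + K * \<rho> n))) + 4 * \<gamma> ?N * \<rho> ?N)"
      by (intro integral_mono Bochner_Integration.integrable_add integrable_mult_right int add_mono
          mult_left_mono cmp order.refl integrable_const) (use cg n1 in auto)
    also have "\<dots> = (1 - c * \<gamma> ?N) * (s * (u n * \<rho> n)) + 4 * \<gamma> ?N * \<rho> ?N"
      unfolding lin[OF int[OF n1, of n]] using gr by (simp add: u_def)
    finally have "u ?N * \<rho> ?N \<le> (1 - c * \<gamma> ?N) * (s * (u n * \<rho> n)) + 4 * \<gamma> ?N * \<rho> ?N"
      using gr by (simp add: u_def)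
    hence "u ?N \<le> (1 - c * \<gamma> ?N) * (s * (u n * (\<rho> n / \<rho> ?N))) + 4 * \<gamma> ?N"
      using gr by (simp add: field_simps)
    also have "\<dots> \<le> (1 - c * \<gamma> ?N) * (s * (u n * s)) + 4 * \<gamma> ?N"
      using cg s u0 by (intro add_mono mult_left_mono) auto
    also have "\<dots> = ((1 - c * \<gamma> ?N) * s\<^sup>2) * u n + 4 * \<gamma> ?N" by (simp add: power2_eq_square)
    also have "\<dots> \<le> (1 - (c / 2) * \<gamma> ?N) * u n + 4 * \<gamma> ?N"
    proof (intro add_right_mono mult_right_mono u0)
      have "s\<^sup>2 \<le> 1 + 3 * (\<eta> * \<gamma> ?N)"
      proof -
        have "\<eta> * \<gamma> ?N \<le> 1 * 1" using gr eta by (intro mult_mono) auto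
        hence "(\<eta> * \<gamma> ?N) * (\<eta> * \<gamma> ?N) \<le> 1 * (\<eta> * \<gamma> ?N)" using gr eta by (intro mult_right_mono) auto
        thus ?thesis by (simp add: s_def power2_eq_square algebra_simps)
      qed
      also have "\<eta> * \<gamma> ?N \<le> c / 6 * \<gamma> ?N" using eta gr by (intro mult_right_mono) auto
      finally have "s\<^sup>2 \<le> 1 + c / 2 * \<gamma> ?N" by simp
      hence "(1 - c * \<gamma> ?N) * s\<^sup>2 \<le> (1 - c * \<gamma> ?N) * (1 + c / 2 * \<gamma> ?N)" using cg by (intro mult_left_mono) auto
      also have "\<dots> = 1 - c / 2 * \<gamma> ?N - c * \<gamma> ?N * (c / 2 * \<gamma> ?N)" by (simp add: field_simps)
      also have "\<dots> \<le> 1 - c / 2 * \<gamma> ?N" using K gr by simp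
      finally show "(1 - c * \<gamma> ?N) * s\<^sup>2 \<le> 1 - c / 2 * \<gamma> ?N" .
    qed
    finally show "u (Suc n) \<le> (1 - (c / 2) * \<gamma> (Suc n)) * u n + 4 * \<gamma> (Suc n)" .
  qed
  define C0 where "C0 = max (u n0) (8 / c)"
  have C0: "0 < C0" using K by (simp add: C0_def less_max_iff_disj)
  have u_le: "u n \<le> C0" if "n \<ge> n0" for n using that
  proof (induction n rule: dec_induct)
    case (step n)
    have "u (Suc n) \<le> (1 - (c / 2) * \<gamma> (Suc n)) * u n + 4 * \<gamma> (Suc n)" using rec(1) step by simp
    also have "\<dots> \<le> (1 - (c / 2) * \<gamma> (Suc n)) * C0 + (c / 2) * \<gamma> (Suc n) * C0"
    proof (intro add_mono mult_left_mono)
      have "8 / c \<le> C0" by (simp add: C0_def)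
      hence "4 \<le> c / 2 * C0" using K by (simp add: field_simps)
      thus "4 * \<gamma> (Suc n) \<le> c / 2 * \<gamma> (Suc n) * C0"
        using gamma[of "Suc n"] mult_right_mono[of 4 "c / 2 * C0" "\<gamma> (Suc n)"] by (simp add: ac_simps)
    qed (use step rec(3) gamma[of "Suc n"] in auto)
    also have "\<dots> = C0" by (simp add: algebra_simps)
    finally show ?case .
  qed (simp add: C0_def)
  have Y_le: "expectation (Y n) \<le> 2 * C0" if "n \<ge> n0" "K * \<rho> n \<le> 1" for n
  proof -
    have n1: "n \<ge> 1" using n0[OF that(1)] by (simp add: small_step_def)
    have p: "0 < \<rho> n" using rho n1 by simp
    have "expectation (Y n) \<le> expectation (\<lambda>\<omega>. (2 / \<rho> n) * ((1 - X n \<omega>) / (X n \<omega> + K * \<rho> n)))"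
    proof (intro integral_mono Y_integrable integrable_mult_right int n1)
      fix \<omega>
      have q: "0 < X n \<omega> + K * \<rho> n" "X n \<omega> + K * \<rho> n \<le> 2"
        using X_bounds[of n \<omega>] K p that(2) by (auto intro!: add_nonneg_pos)
      have "(1 - X n \<omega>) / 2 \<le> (1 - X n \<omega>) / (X n \<omega> + K * \<rho> n)"
        using q X_bounds[of n \<omega>] by (intro divide_left_mono) auto
      moreover have "a \<le> 2 * z" if "a / 2 \<le> z" for a z :: real using that by simp
      ultimately have "(1 - X n \<omega>) \<le> 2 * ((1 - X n \<omega>) / (X n \<omega> + K * \<rho> n))" by blast
      from divide_right_mono[OF this, of "\<rho> n"] p
      show "Y n \<omega> \<le> (2 / \<rho> n) * ((1 - X n \<omega>) / (X n \<omega> + K * \<rho> n))"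
        unfolding Y_def times_divide_eq_left by simp
    qed
    also have "\<dots> = 2 * u n" unfolding integral_mult_right_zero u_def by simp
    finally show ?thesis using u_le[OF that(1)] by simp
  qed
  have "eventually (\<lambda>n. K * \<rho> n \<le> 1) sequentially"
    using eventually_small_step[of "1 / K"] K
    by (auto elim!: eventually_mono simp: small_step_def field_simps)
  from eventually_conj[OF this eventually_ge_at_top[of n0]]
  have "eventually (\<lambda>n. expectation (Y n) \<le> 2 * C0) sequentially"
    by (rule eventually_mono) (use Y_le in blast)
  thus thesis using that[of "2 * C0"] C0 by simp
qed

end

section \<open>One step on exponentials\<close>

lemma abs_mult_le: "\<bar>a\<bar> \<le> c \<Longrightarrow> \<bar>b\<bar> \<le> d \<Longrightarrow> \<bar>a * b\<bar> \<le> c * d" for a b c d :: real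
  by (simp add: abs_mult mult_mono)

context penalized_bandit_critical
begin

text \<open>The error is bounded uniformly in \<open>y\<close>: every term that grows with \<open>y\<close> comes with \<open>exp (- (l * y))\<close>, and
  \<open>l \<ge> \<delta>\<close> makes the products bounded. The result is written with a shifted exponent, not as a first-order
  expansion, so that it turns into a relation between Laplace transforms at two points.\<close>
lemma one_step_exp_approx:
  assumes dL: "0 < \<delta>" "\<delta> \<le> \<Lambda>"
  obtains C \<eta>0 where "C > 0" "\<eta>0 > 0"
    "\<And>n \<eta> l y. small_step \<eta> n \<Longrightarrow> \<eta> \<le> \<eta>0 \<Longrightarrow> \<delta> \<le> l \<Longrightarrow> l \<le> \<Lambda> \<Longrightarrow> 0 \<le> y \<Longrightarrow> \<rho> n * y \<le> 1 \<Longrightarrow>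
      \<bar>one_step (Suc n) (\<lambda>z. exp (- (l * (1 - z) / \<rho> (Suc n)))) (1 - \<rho> n * y)
        - (1 - \<gamma> (Suc n) * (1 - p\<^sub>A) * l) * exp (- ((l + \<gamma> (Suc n) * branching_rate l) * y))\<bar> \<le> C * \<eta> * \<gamma> (Suc n)"
proof -
  \<comment> \<open>\<open>D\<close> bounds \<open>\<rho> n * y\<close> by \<open>D * \<gamma> (n + 1) * (l * y)\<close>; the constants \<open>Ca\<close> to \<open>Cd\<close> belong to the four outcomes.\<close>
  define D where "D = 2 / (g * \<delta>)"
  have D: "0 < D" using g_pos dL by (simp add: D_def)
  define E where "E = exp (\<Lambda> + \<Lambda> * g)"
  have E: "1 \<le> E" using dL g_pos by (simp add: E_def)
  have L: "0 < \<Lambda>" using dL by simp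
  define Ca where "Ca = 40 + 8 * D"
  define Cb where "Cb = 16 * E * (1 + \<Lambda>\<^sup>2) + 8 + 16 * \<Lambda> * D"
  define Cc where "Cc = 8 * D * E * (1 + \<Lambda> + \<Lambda> * g * D) + 8 * D / g"
  define Cd where "Cd = 16 * D"
  define Ce where "Ce = 8 + 8 * \<Lambda>"
  define \<eta>0 where "\<eta>0 = min (1/4) (min (g / 2) (1 / \<Lambda>))"
  have e0: "0 < \<eta>0" "\<eta>0 \<le> 1/4" "\<eta>0 \<le> g / 2" "\<eta>0 \<le> 1 / \<Lambda>" using g_pos L by (auto simp: \<eta>0_def)
  show thesis
  proof (rule that[of "Ca + Cb + Cc + Cd + Ce" \<eta>0])
    show "0 < Ca + Cb + Cc + Cd + Ce"
      using D E L g_pos unfolding Ca_def Cb_def Cc_def Cd_def Ce_def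
      by (intro add_pos_nonneg add_nonneg_nonneg mult_nonneg_nonneg divide_nonneg_pos) auto
    fix n \<eta> l y
    assume ss: "small_step \<eta> n" and eta0: "\<eta> \<le> \<eta>0" and l: "\<delta> \<le> l" "l \<le> \<Lambda>" and y: "0 \<le> y" "\<rho> n * y \<le> 1"
    define G where "G = \<gamma> (Suc n)" define r where "r = \<rho> n" define r' where "r' = \<rho> (Suc n)"
    have gr: "0 < G" "G \<le> \<eta>" "0 < r" "0 < r'" "r \<le> \<eta>" "r' \<le> \<eta>" "\<bar>r / r' - 1\<bar> \<le> \<eta> * G" "\<bar>G / r' - g\<bar> \<le> \<eta>" "\<bar>G / r - g\<bar> \<le> \<eta>"
      using ss gamma[of "Suc n"] rho[of "Suc n"] rho[of n] by (auto simp: small_step_def G_def r_def r'_def)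
    have eta: "0 < \<eta>" "\<eta> \<le> 1/4" "\<eta> \<le> g / 2" "\<eta> \<le> 1 / \<Lambda>" using gr e0 eta0 by auto
    have l0: "0 < l" using l dL by simp
    define \<theta> where "\<theta> = r / r' - 1"
    have th: "\<bar>\<theta>\<bar> \<le> \<eta> * G" "\<bar>\<theta>\<bar> \<le> G" "\<bar>\<theta>\<bar> \<le> 1/4"
    proof -
      show 1: "\<bar>\<theta>\<bar> \<le> \<eta> * G" using gr by (simp add: \<theta>_def)
      have "\<eta> * G \<le> 1 * G" by (rule mult_right_mono) (use eta gr in auto)
      thus "\<bar>\<theta>\<bar> \<le> G" "\<bar>\<theta>\<bar> \<le> 1/4" using 1 gr(2) eta(2) by linarith+
    qed
    define u where "u = l * y"
    have u0: "0 \<le> u" using l0 y by (simp add: u_def)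
    have sm: "G * u \<le> u / 4" "\<eta> * u \<le> u / 4" "G * \<Lambda> \<le> \<Lambda>" "\<eta> * \<Lambda> \<le> \<Lambda>"
      using mult_right_mono[of G "1/4" u] mult_right_mono[of \<eta> "1/4" u]
        mult_right_mono[of G 1 \<Lambda>] mult_right_mono[of \<eta> 1 \<Lambda>] gr(2) eta(1,2) u0 L by simp_all
    define P where "P = exp (- u / 2)"
    define e where "e = exp (- u)"
    have P: "0 < P" "P \<le> 8" "u * P \<le> 8" "u * u * P \<le> 8"
      using power_exp_half_bound[OF u0, of 0] power_exp_half_bound[OF u0, of 1] power_exp_half_bound[OF u0, of 2]
      by (auto simp: P_def power2_eq_square)
    have e: "0 < e" "e \<le> P" "e \<le> 1" using u0 by (auto simp: e_def P_def)
    have ue: "u * e \<le> 8" "u * u * e \<le> 8"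
      using P e u0 mult_left_mono[OF e(2), of u] mult_left_mono[OF e(2), of "u * u"] by auto
    define q where "q = r * y"
    have q: "0 \<le> q" "q \<le> 1" "q \<le> D * G * u"
    proof -
      show "0 \<le> q" "q \<le> 1" using y gr by (auto simp: q_def r_def)
      have "g / 2 \<le> G / r" using gr(9) eta(3) by linarith
      hence "r \<le> 2 / g * G" using gr g_pos by (simp add: field_simps)
      moreover have "y \<le> u / \<delta>" using l dL y mult_right_mono[OF l(1) y(1)] by (simp add: u_def field_simps)
      ultimately have "q \<le> (2 / g * G) * (u / \<delta>)"
        unfolding q_def using gr g_pos y by (intro mult_mono) auto
      thus "q \<le> D * G * u" by (simp add: D_def)
    qed
    have que: "q * e \<le> 8 * D * G" "q * (u * P) \<le> 8 * D * G" "q * P \<le> 8 * D * G"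
    proof -
      have "q * P \<le> D * G * u * P" using q P by (intro mult_right_mono) auto
      also have "\<dots> = D * G * (u * P)" by simp
      also have "\<dots> \<le> D * G * 8" using D gr P by (intro mult_left_mono) auto
      finally show 1: "q * P \<le> 8 * D * G" by simp
      show "q * e \<le> 8 * D * G" using 1 mult_left_mono[OF e(2) q(1)] by simp
      have "q * (u * P) \<le> D * G * u * (u * P)" using q P u0 by (intro mult_right_mono) auto
      also have "\<dots> = D * G * (u * u * P)" by simp
      also have "\<dots> \<le> D * G * 8" using D gr P by (intro mult_left_mono) auto
      finally show "q * (u * P) \<le> 8 * D * G" by simp
    qed
    have GG: "G * G \<le> \<eta> * G" using gr by (intro mult_right_mono) auto
    have p: "0 < p\<^sub>A" "p\<^sub>A < 1" "0 < p\<^sub>B" "p\<^sub>B < 1" using pA_pos pA_less_1 pB_pos pB_less_pA by auto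
    define X where "X = 1 - q"
    have X: "0 \<le> X" "X \<le> 1" using q by (auto simp: X_def)

    \<comment> \<open>A success of arm A (first-order effect: the drift \<open>- p\<^sub>A * y\<close>). The exponent \<open>u = l * y\<close> becomes \<open>u + da\<close>.\<close>
    define da where "da = u * ((1 - G) * (1 + \<theta>) - 1)"
    define Ta where "Ta = X * p\<^sub>A * (exp (- (u + da)) - e)"
    have Ta: "\<bar>Ta - p\<^sub>A * G * u * e\<bar> \<le> Ca * \<eta> * G"
    proof -
      have da2: "\<bar>(1 - G) * (1 + \<theta>) - 1\<bar> \<le> 2 * G"
      proof -
        have "(1 - G) * (1 + \<theta>) - 1 = \<theta> * (1 - G) - G" by (simp add: algebra_simps)
        moreover have "\<bar>\<theta> * (1 - G)\<bar> \<le> G * 1" unfolding abs_mult using th gr eta by (intro mult_mono) auto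
        ultimately show ?thesis using gr by linarith
      qed
      have da1: "\<bar>da\<bar> \<le> 2 * G * u" unfolding da_def abs_mult using mult_left_mono[OF da2 u0] u0 by (simp add: mult.commute)
      have "\<bar>da\<bar> \<le> u / 2 + 0" using da1 sm(1) by linarith
      from exp_shift_bounds(2)[OF u0 this]
      have 1: "\<bar>exp (- (u + da)) - e + da * e\<bar> \<le> da\<^sup>2 * P" by (simp add: e_def P_def)
      have "da\<^sup>2 \<le> (2 * G * u)\<^sup>2" using da1 by (metis abs_ge_zero power2_abs power_mono)
      hence "da\<^sup>2 * P \<le> (2 * G * u)\<^sup>2 * P" using P by (intro mult_right_mono) auto
      also have "\<dots> = 4 * (G * G) * (u * u * P)" by (simp add: power2_eq_square)
      also have "\<dots> \<le> 4 * (\<eta> * G) * 8" using GG gr P eta u0 by (intro mult_mono) auto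
      finally have 2: "da\<^sup>2 * P \<le> 32 * (\<eta> * G)" by simp
      have 3: "da * e = - (G * u * e) + \<theta> * (1 - G) * (u * e)" by (simp add: da_def algebra_simps)
      have 4: "\<bar>\<theta> * (1 - G) * (u * e)\<bar> \<le> (\<eta> * G) * 1 * 8"
        unfolding abs_mult using th gr eta u0 e ue by (intro mult_mono) auto
      have 5: "\<bar>exp (- (u + da)) - e - G * u * e\<bar> \<le> 40 * (\<eta> * G)" using 1 2 3 4 by linarith
      have "Ta - p\<^sub>A * G * u * e = p\<^sub>A * X * (exp (- (u + da)) - e - G * u * e) - p\<^sub>A * (q * (G * u * e))"
        by (simp add: Ta_def X_def algebra_simps)
      also have "\<bar>\<dots>\<bar> \<le> \<bar>p\<^sub>A * X * (exp (- (u + da)) - e - G * u * e)\<bar> + \<bar>p\<^sub>A * (q * (G * u * e))\<bar>"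
        by (rule abs_triangle_ineq4)
      also have "\<dots> \<le> 1 * 1 * (40 * (\<eta> * G)) + 1 * (8 * D * (\<eta> * G))"
      proof (intro add_mono)
        show "\<bar>p\<^sub>A * X * (exp (- (u + da)) - e - G * u * e)\<bar> \<le> 1 * 1 * (40 * (\<eta> * G))"
          unfolding abs_mult using p X 5 by (intro mult_mono) auto
        have "q * (u * e) \<le> q * (u * P)" using q u0 e by (intro mult_left_mono) auto
        hence "q * (u * e) \<le> 8 * D * G" using que by simp
        hence "G * (q * (u * e)) \<le> G * (8 * D * G)" using gr by (intro mult_left_mono) auto
        also have "\<dots> = 8 * D * (G * G)" by simp
        also have "\<dots> \<le> 8 * D * (\<eta> * G)" using D GG by (intro mult_left_mono) auto
        finally have z: "q * (G * u * e) \<le> 8 * D * (\<eta> * G)" by (simp only: ac_simps)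
        have z0: "0 \<le> q * (G * u * e)" using q gr u0 e by simp
        have "\<bar>q * (G * u * e)\<bar> \<le> 8 * D * (\<eta> * G)" unfolding abs_of_nonneg[OF z0] by (rule z)
        thus "\<bar>p\<^sub>A * (q * (G * u * e))\<bar> \<le> 1 * (8 * D * (\<eta> * G))"
          unfolding abs_mult[of "p\<^sub>A"] by (intro mult_mono) (use p in auto)
      qed
      finally show ?thesis by (simp add: Ca_def algebra_simps)
    qed

    \<comment> \<open>A failure of arm A (first-order effect: the drift \<open>1 - p\<^sub>A\<close>).\<close>
    define db where "db = u * \<theta> + l * G * X"
    define Tb where "Tb = X * (1 - p\<^sub>A) * (exp (- (u + db)) - e)"
    have Tb: "\<bar>Tb + (1 - p\<^sub>A) * l * G * e\<bar> \<le> Cb * \<eta> * G"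
    proof -
      have b1: "\<bar>l * G * X\<bar> \<le> \<Lambda> * G" unfolding abs_mult using l l0 gr X L
        using mult_mono[of "l * G" "\<Lambda> * G" X 1] by (simp add: mult_right_mono)
      have b2: "\<bar>u * \<theta>\<bar> \<le> u * G" unfolding abs_mult using u0 th by (intro mult_mono) auto
      have b3: "\<bar>db\<bar> \<le> G * (u + \<Lambda>)" unfolding db_def using b1 b2 abs_triangle_ineq[of "u * \<theta>" "l * G * X"] by (simp add: algebra_simps)
      have "\<bar>db\<bar> \<le> u / 2 + (\<Lambda> + \<Lambda> * g)"
        using b3 sm(1,3) u0 mult_pos_pos[OF L g_pos] unfolding distrib_left by linarith
      from exp_shift_bounds(2)[OF u0 this]
      have 1: "\<bar>exp (- (u + db)) - e + db * e\<bar> \<le> db\<^sup>2 * (E * P)" by (simp add: e_def P_def E_def)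
      have "db\<^sup>2 \<le> (G * (u + \<Lambda>))\<^sup>2" using b3 by (metis abs_ge_zero power2_abs power_mono)
      also have "\<dots> \<le> 2 * (G * G) * (u * u + \<Lambda>\<^sup>2)"
        using mult_left_mono[OF sum_squares_bound[of u \<Lambda>], of "G * G"] gr by (simp add: power2_eq_square algebra_simps)
      finally have "db\<^sup>2 * (E * P) \<le> 2 * (G * G) * (u * u + \<Lambda>\<^sup>2) * (E * P)"
        using E P by (intro mult_right_mono) auto
      also have "\<dots> = 2 * E * (G * G) * (u * u * P + \<Lambda>\<^sup>2 * P)" by (simp add: algebra_simps)
      also have "\<dots> \<le> 2 * E * (\<eta> * G) * (8 + \<Lambda>\<^sup>2 * 8)"
        using E GG P gr eta u0 by (intro mult_mono add_mono order.refl) auto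
      finally have 2: "db\<^sup>2 * (E * P) \<le> 16 * E * (1 + \<Lambda>\<^sup>2) * (\<eta> * G)" by (simp add: algebra_simps)
      have 3: "db * e = l * G * e - l * G * (q * e) + \<theta> * (u * e)" by (simp add: db_def X_def algebra_simps)
      have 4: "\<bar>\<theta> * (u * e)\<bar> \<le> (\<eta> * G) * 8" unfolding abs_mult using th gr eta u0 e ue by (intro mult_mono) auto
      have 5: "\<bar>l * G * (q * e)\<bar> \<le> 8 * \<Lambda> * D * (\<eta> * G)"
      proof -
        have "\<bar>l * G * (q * e)\<bar> \<le> \<Lambda> * G * (8 * D * G)"
        proof (rule abs_mult_le)
          show "\<bar>l * G\<bar> \<le> \<Lambda> * G" by (rule abs_mult_le) (use l l0 gr in auto)
          have "0 \<le> q * e" using q e by simp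
          thus "\<bar>q * e\<bar> \<le> 8 * D * G" using que(1) by linarith
        qed
        also have "\<dots> = 8 * \<Lambda> * D * (G * G)" by simp
        also have "\<dots> \<le> 8 * \<Lambda> * D * (\<eta> * G)" using D L GG by (intro mult_left_mono) auto
        finally show ?thesis .
      qed
      have 6: "\<bar>exp (- (u + db)) - e + l * G * e\<bar> \<le> (16 * E * (1 + \<Lambda>\<^sup>2) + 8 + 8 * \<Lambda> * D) * (\<eta> * G)"
        using 1 2 3 4 5 by (simp add: distrib_right)
      have "Tb + (1 - p\<^sub>A) * l * G * e = (1 - p\<^sub>A) * X * (exp (- (u + db)) - e + l * G * e) + (1 - p\<^sub>A) * (l * G * (q * e))"
        by (simp add: Tb_def X_def algebra_simps)
      also have "\<bar>\<dots>\<bar> \<le> \<bar>(1 - p\<^sub>A) * X * (exp (- (u + db)) - e + l * G * e)\<bar> + \<bar>(1 - p\<^sub>A) * (l * G * (q * e))\<bar>"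
        by (rule abs_triangle_ineq)
      also have "\<dots> \<le> 1 * 1 * ((16 * E * (1 + \<Lambda>\<^sup>2) + 8 + 8 * \<Lambda> * D) * (\<eta> * G)) + 1 * (8 * \<Lambda> * D * (\<eta> * G))"
        unfolding abs_mult[of "(1 - p\<^sub>A) * X"] abs_mult[of "1 - p\<^sub>A"]
        by (intro add_mono mult_mono 6 5) (use p X in auto)
      finally show ?thesis by (simp add: Cb_def algebra_simps)
    qed

    \<comment> \<open>A success of arm B has probability \<open>q * p\<^sub>B\<close>, about \<open>G * y / g * p\<^sub>B\<close>, and moves \<open>y\<close> by about \<open>g\<close>: the jump part.\<close>
    define v where "v = u + l * g"
    define dc where "dc = u * \<theta> + l * (G / r' - g) * X - l * g * q"
    define Tc where "Tc = q * p\<^sub>B * (exp (- (v + dc)) - e)"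
    have Tc: "\<bar>Tc - p\<^sub>B * G * y * ((exp (- (l * g)) - 1) / g) * e\<bar> \<le> Cc * \<eta> * G"
    proof -
      have c1: "\<bar>u * \<theta>\<bar> \<le> \<eta> * u" unfolding abs_mult
      proof -
        have "\<bar>u\<bar> * \<bar>\<theta>\<bar> \<le> u * \<eta>" using u0 th gr by (intro mult_mono) auto
        thus "\<bar>u\<bar> * \<bar>\<theta>\<bar> \<le> \<eta> * u" by (simp add: mult.commute)
      qed
      have c2: "\<bar>l * (G / r' - g) * X\<bar> \<le> \<eta> * \<Lambda>"
      proof -
        have "\<bar>l * (G / r' - g) * X\<bar> \<le> \<Lambda> * \<eta> * 1" unfolding abs_mult using l l0 L gr X by (intro mult_mono) auto
        thus ?thesis by (simp add: mult.commute)
      qed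
      have c3: "0 \<le> l * g * q" "l * g * q \<le> \<Lambda> * g * q" using l l0 g_pos q by (auto intro!: mult_right_mono)
      have c4: "\<Lambda> * g * q \<le> \<Lambda> * g * (D * \<eta> * u)"
      proof -
        have "D * G * u \<le> D * \<eta> * u" using D gr u0 by (intro mult_right_mono mult_left_mono) auto
        thus ?thesis using L g_pos q by (intro mult_left_mono) auto
      qed
      have c5: "\<bar>dc\<bar> \<le> \<eta> * (u + \<Lambda> + \<Lambda> * g * D * u)"
      proof -
        have "\<eta> * (u + \<Lambda> + \<Lambda> * g * D * u) = \<eta> * u + \<eta> * \<Lambda> + \<Lambda> * g * (D * \<eta> * u)" by (simp add: algebra_simps)
        thus ?thesis unfolding dc_def using c1 c2 c3 c4 by linarith
      qed
      have v0: "0 \<le> v" using u0 l0 g_pos by (simp add: v_def)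
      have "\<bar>dc\<bar> \<le> v / 2 + (\<Lambda> + \<Lambda> * g)"
      proof -
        have "\<Lambda> * g * q \<le> \<Lambda> * g" using L g_pos q by (simp add: mult_left_le)
        moreover have "u \<le> v" using l0 g_pos by (simp add: v_def)
        ultimately show ?thesis unfolding dc_def using c1 c2 c3 sm(2,4) u0 by linarith
      qed
      from exp_shift_bounds(1)[OF v0 this]
      have 1: "\<bar>exp (- (v + dc)) - exp (- v)\<bar> \<le> \<bar>dc\<bar> * (E * exp (- v / 2))" by (simp add: E_def)
      have "exp (- v / 2) \<le> P" using l0 g_pos by (simp add: P_def v_def)
      hence 2: "\<bar>dc\<bar> * (E * exp (- v / 2)) \<le> (\<eta> * (u + \<Lambda> + \<Lambda> * g * D * u)) * (E * P)"
        using E c5 by (intro mult_mono) auto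
      have "q * \<bar>exp (- (v + dc)) - exp (- v)\<bar> \<le> q * ((\<eta> * (u + \<Lambda> + \<Lambda> * g * D * u)) * (E * P))"
        using q 1 2 by (intro mult_left_mono) auto
      also have "\<dots> = \<eta> * E * ((1 + \<Lambda> * g * D) * (q * (u * P)) + \<Lambda> * (q * P))" by (simp add: algebra_simps)
      also have "\<dots> \<le> \<eta> * E * ((1 + \<Lambda> * g * D) * (8 * D * G) + \<Lambda> * (8 * D * G))"
        using eta E L g_pos D que by (intro mult_left_mono add_mono) auto
      also have "\<dots> = 8 * D * E * (1 + \<Lambda> + \<Lambda> * g * D) * \<eta> * G" by (simp add: algebra_simps)
      finally have 3: "q * \<bar>exp (- (v + dc)) - exp (- v)\<bar> \<le> 8 * D * E * (1 + \<Lambda> + \<Lambda> * g * D) * \<eta> * G" .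
      have ev: "exp (- v) = e * exp (- (l * g))" by (simp add: v_def e_def exp_add[symmetric])
      have x1: "\<bar>exp (- (l * g)) - 1\<bar> \<le> 1" using l0 g_pos by (simp add: abs_le_iff)
      have 4: "\<bar>q - G / g * y\<bar> * e \<le> 8 * D / g * \<eta> * G"
      proof -
        have "q - G / g * y = (q / g) * (g - G / r)" using gr g_pos by (simp add: q_def field_simps)
        hence "\<bar>q - G / g * y\<bar> = (q / g) * \<bar>G / r - g\<bar>" using q g_pos by (simp add: abs_mult abs_minus_commute)
        also have "\<dots> \<le> (q / g) * \<eta>" using q g_pos gr by (intro mult_left_mono) auto
        finally have "\<bar>q - G / g * y\<bar> * e \<le> (q / g) * \<eta> * e" using e by (intro mult_right_mono) auto
        also have "\<dots> = \<eta> / g * (q * e)" by simp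
        also have "\<dots> \<le> \<eta> / g * (8 * D * G)" using eta g_pos que by (intro mult_left_mono) auto
        finally show ?thesis by (simp add: ac_simps)
      qed
      have "Tc - p\<^sub>B * G * y * ((exp (- (l * g)) - 1) / g) * e
        = p\<^sub>B * (q * (exp (- (v + dc)) - exp (- v))) + p\<^sub>B * ((q - G / g * y) * e * (exp (- (l * g)) - 1))"
        unfolding Tc_def ev using g_pos by (simp add: field_simps)
      also have "\<bar>\<dots>\<bar> \<le> \<bar>p\<^sub>B * (q * (exp (- (v + dc)) - exp (- v)))\<bar> + \<bar>p\<^sub>B * ((q - G / g * y) * e * (exp (- (l * g)) - 1))\<bar>"
        by (rule abs_triangle_ineq)
      also have "\<dots> \<le> 1 * (8 * D * E * (1 + \<Lambda> + \<Lambda> * g * D) * \<eta> * G) + 1 * ((8 * D / g * \<eta> * G) * 1)"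
        unfolding abs_mult[of p\<^sub>B] abs_mult[of q] abs_mult[of "(q - G / g * y) * e"] abs_mult[of "q - G / g * y"]
      proof (intro add_mono mult_mono[of "\<bar>p\<^sub>B\<bar>" 1])
        show "\<bar>q\<bar> * \<bar>exp (- (v + dc)) - exp (- v)\<bar> \<le> 8 * D * E * (1 + \<Lambda> + \<Lambda> * g * D) * \<eta> * G"
          unfolding abs_of_nonneg[OF q(1)] by (rule 3)
        have "\<bar>q - G / g * y\<bar> * \<bar>e\<bar> \<le> 8 * D / g * \<eta> * G"
          unfolding abs_of_pos[OF e(1)] by (rule 4)
        thus "\<bar>q - G / g * y\<bar> * \<bar>e\<bar> * \<bar>exp (- (l * g)) - 1\<bar> \<le> 8 * D / g * \<eta> * G * 1"
          by (rule mult_mono[OF _ x1]) (use D g_pos eta gr in auto)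
      qed (use p q in auto)
      finally show ?thesis by (simp add: Cc_def algebra_simps)
    qed

    \<comment> \<open>A failure of arm B is negligible: it has a small probability and changes the exponent little.\<close>
    define dd where "dd = u * ((1 + \<theta>) * (1 - G * r') - 1)"
    define Td where "Td = q * (1 - p\<^sub>B) * (exp (- (u + dd)) - e)"
    have Td: "\<bar>Td\<bar> \<le> Cd * \<eta> * G"
    proof -
      have Gr: "0 \<le> G * r'" "G * r' \<le> \<eta> * G" "G * r' \<le> 1"
      proof -
        show "0 \<le> G * r'" using gr by simp
        show "G * r' \<le> \<eta> * G" using gr by (simp add: mult.commute)
        also have "\<eta> * G \<le> 1 * 1" using gr eta by (intro mult_mono) auto
        finally show "G * r' \<le> 1" by simp
      qed
      have "\<bar>(1 + \<theta>) * (1 - G * r') - 1\<bar> \<le> 2 * (\<eta> * G)"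
      proof -
        have "(1 + \<theta>) * (1 - G * r') - 1 = \<theta> * (1 - G * r') - G * r'" by (simp add: algebra_simps)
        moreover have "\<bar>\<theta> * (1 - G * r')\<bar> \<le> (\<eta> * G) * 1" unfolding abs_mult using th Gr by (intro mult_mono) auto
        ultimately show ?thesis using Gr by linarith
      qed
      hence d1: "\<bar>dd\<bar> \<le> u * (2 * (\<eta> * G))" unfolding dd_def abs_mult using u0 by (intro mult_mono) auto
      have "\<eta> * G \<le> 1/4 * 1" using gr eta by (intro mult_mono) auto
      hence "u * (2 * (\<eta> * G)) \<le> u * (1/2)" using u0 by (intro mult_left_mono) auto
      hence "\<bar>dd\<bar> \<le> u / 2 + 0" using d1 by simp
      from exp_shift_bounds(1)[OF u0 this]
      have "\<bar>exp (- (u + dd)) - e\<bar> \<le> \<bar>dd\<bar> * P" by (simp add: e_def P_def)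
      also have "\<dots> \<le> u * (2 * (\<eta> * G)) * P" using d1 P by (intro mult_right_mono) auto
      finally have 1: "q * \<bar>exp (- (u + dd)) - e\<bar> \<le> q * (u * (2 * (\<eta> * G)) * P)" using q by (intro mult_left_mono) auto
      also have "\<dots> = 2 * (\<eta> * G) * (q * (u * P))" by simp
      also have "\<dots> \<le> 2 * (\<eta> * G) * (8 * D * 1)"
      proof -
        have "8 * D * G \<le> 8 * D * 1" using D gr eta by (intro mult_left_mono) auto
        thus ?thesis using que eta gr by (intro mult_left_mono) auto
      qed
      finally have 2: "q * \<bar>exp (- (u + dd)) - e\<bar> \<le> 16 * D * (\<eta> * G)" by (simp add: ac_simps)
      have "\<bar>Td\<bar> = (1 - p\<^sub>B) * (q * \<bar>exp (- (u + dd)) - e\<bar>)" unfolding Td_def abs_mult using q p by simp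
      also have "\<dots> \<le> 1 * (16 * D * (\<eta> * G))" by (rule mult_mono[OF _ 2]) (use p q in auto)
      finally show ?thesis by (simp add: Cd_def)
    qed

    \<comment> \<open>The first-order terms add up to \<open>main\<close>, which is the first-order expansion of the shifted exponential.\<close>
    define R where "R = branching_rate l"
    define main where "main = e * (1 - G * (y * R) - G * (1 - p\<^sub>A) * l)"
    have Te: "\<bar>main - (1 - G * (1 - p\<^sub>A) * l) * exp (- ((l + G * R) * y))\<bar> \<le> Ce * \<eta> * G"
    proof -
      define d where "d = G * R * y"
      have d1: "\<bar>d\<bar> \<le> G * u"
      proof -
        have "\<bar>R\<bar> \<le> l" unfolding R_def using l0 by (intro abs_branching_rate_le) simp
        hence "\<bar>d\<bar> \<le> G * l * y" unfolding d_def abs_mult using gr y by (intro mult_mono) auto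
        thus ?thesis by (simp add: u_def)
      qed
      have "\<bar>d\<bar> \<le> u / 2 + 0" using d1 sm(1) u0 by linarith
      from exp_shift_bounds(2)[OF u0 this]
      have 1: "\<bar>exp (- (u + d)) - e + d * e\<bar> \<le> d\<^sup>2 * P" by (simp add: e_def P_def)
      have "d\<^sup>2 \<le> (G * u)\<^sup>2" using d1 by (metis abs_ge_zero power2_abs power_mono)
      hence "d\<^sup>2 * P \<le> (G * u)\<^sup>2 * P" using P by (intro mult_right_mono) auto
      also have "\<dots> = (G * G) * (u * u * P)" by (simp add: power2_eq_square)
      also have "\<dots> \<le> (\<eta> * G) * 8" using GG gr P eta u0 by (intro mult_mono) auto
      finally have 2: "\<bar>exp (- (u + d)) - e + d * e\<bar> \<le> 8 * (\<eta> * G)" using 1 by simp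
      define k where "k = G * (1 - p\<^sub>A) * l"
      have k: "0 \<le> k" "k \<le> 1" "k \<le> G * \<Lambda>"
      proof -
        show "0 \<le> k" using gr p l0 by (simp add: k_def)
        have "k \<le> G * 1 * \<Lambda>" unfolding k_def using gr p l l0 by (intro mult_mono) auto
        thus "k \<le> G * \<Lambda>" by simp
        also have "\<dots> \<le> (1 / \<Lambda>) * \<Lambda>" using gr eta L by (intro mult_right_mono) auto
        finally show "k \<le> 1" using L by simp
      qed
      have ued: "(l + G * R) * y = u + d" by (simp add: u_def d_def algebra_simps)
      have "main - (1 - k) * exp (- ((l + G * R) * y)) = - ((1 - k) * (exp (- (u + d)) - e + d * e)) - k * (d * e)"
        unfolding ued main_def k_def d_def by (simp add: algebra_simps)
      also have "\<bar>\<dots>\<bar> \<le> \<bar>(1 - k) * (exp (- (u + d)) - e + d * e)\<bar> + \<bar>k * (d * e)\<bar>"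
        by (metis abs_minus_cancel abs_triangle_ineq4)
      also have "\<dots> \<le> 1 * (8 * (\<eta> * G)) + 8 * \<Lambda> * (\<eta> * G)"
      proof (intro add_mono)
        show "\<bar>(1 - k) * (exp (- (u + d)) - e + d * e)\<bar> \<le> 1 * (8 * (\<eta> * G))"
          by (intro abs_mult_le 2) (use k in auto)
        have "\<bar>k * (d * e)\<bar> \<le> (G * \<Lambda>) * ((G * u) * e)"
          by (intro abs_mult_le d1) (use k e in auto)
        also have "\<dots> = \<Lambda> * (G * G) * (u * e)" by simp
        also have "\<dots> \<le> \<Lambda> * (\<eta> * G) * 8" using L GG ue u0 e gr eta by (intro mult_mono) auto
        finally show "\<bar>k * (d * e)\<bar> \<le> 8 * \<Lambda> * (\<eta> * G)" by simp
      qed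
      finally show ?thesis by (simp add: k_def Ce_def algebra_simps)
    qed

    have main_eq: "main = e + p\<^sub>A * G * u * e - (1 - p\<^sub>A) * l * G * e + p\<^sub>B * G * y * ((exp (- (l * g)) - 1) / g) * e"
      unfolding main_def R_def branching_rate_def u_def using g_pos by (simp add: field_simps)
    have rr: "r / r' = 1 + \<theta>" by (simp add: \<theta>_def)
    have q': "q / r' = y * (1 + \<theta>)" using rr gr by (simp add: q_def field_simps)
    have one: "one_step (Suc n) (\<lambda>z. exp (- (l * (1 - z) / r'))) (1 - r * y) = e + Ta + Tb + Tc + Td"
    proof -
      have ea: "l * (1 - (X + G * (1 - X))) / r' = u + da"
      proof -
        have "l * (1 - (X + G * (1 - X))) = l * (1 - G) * q" by (simp add: X_def algebra_simps)
        hence "l * (1 - (X + G * (1 - X))) / r' = l * (1 - G) * (q / r')" by simp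
        thus ?thesis unfolding q' by (simp add: da_def u_def algebra_simps)
      qed
      have eb: "l * (1 - (X - G * r' * X)) / r' = u + db"
      proof -
        have "l * (1 - (X - G * r' * X)) = l * q + l * G * X * r'" by (simp add: X_def algebra_simps)
        hence "l * (1 - (X - G * r' * X)) / r' = l * (q / r') + l * G * X" using gr by (simp add: add_divide_distrib)
        thus ?thesis unfolding q' by (simp add: db_def u_def algebra_simps)
      qed
      have ec: "l * (1 - (X - G * X)) / r' = v + dc"
      proof -
        have "l * (1 - (X - G * X)) = l * q + l * G * X" by (simp add: X_def algebra_simps)
        hence "l * (1 - (X - G * X)) / r' = l * (q / r') + l * (G / r') * X" by (simp add: add_divide_distrib)
        thus ?thesis unfolding q' by (simp add: dc_def v_def u_def X_def algebra_simps)
      qed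
      have ed: "l * (1 - (X + G * r' * (1 - X))) / r' = u + dd"
      proof -
        have "l * (1 - (X + G * r' * (1 - X))) = l * (1 - G * r') * q" by (simp add: X_def algebra_simps)
        hence "l * (1 - (X + G * r' * (1 - X))) / r' = l * (1 - G * r') * (q / r')" by simp
        thus ?thesis unfolding q' by (simp add: dd_def u_def algebra_simps)
      qed
      have "1 - r * y = X" by (simp add: X_def q_def)
      thus ?thesis unfolding one_step_def G_def[symmetric] r'_def[symmetric]
        by (simp only: ea eb ec ed) (simp add: Ta_def Tb_def Tc_def Td_def X_def algebra_simps)
    qed
    have "\<bar>e + Ta + Tb + Tc + Td - (1 - G * (1 - p\<^sub>A) * l) * exp (- ((l + G * R) * y))\<bar>
      \<le> Ca * \<eta> * G + Cb * \<eta> * G + Cc * \<eta> * G + Cd * \<eta> * G + Ce * \<eta> * G"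
    proof -
      have gen: "\<bar>e + a + b + c + d - z\<bar> \<le> c1 + c2 + c3 + c4 + c5"
        if "\<bar>a - x1\<bar> \<le> c1" "\<bar>b + x2\<bar> \<le> c2" "\<bar>c - x3\<bar> \<le> c3" "\<bar>d\<bar> \<le> c4" "\<bar>e + x1 - x2 + x3 - z\<bar> \<le> c5"
        for a b c d z x1 x2 x3 c1 c2 c3 c4 c5 :: real using that by linarith
      show ?thesis by (rule gen[OF Ta Tb Tc Td Te[unfolded main_eq]])
    qed
    thus "\<bar>one_step (Suc n) (\<lambda>z. exp (- (l * (1 - z) / \<rho> (Suc n)))) (1 - \<rho> n * y)
        - (1 - \<gamma> (Suc n) * (1 - p\<^sub>A) * l) * exp (- ((l + \<gamma> (Suc n) * branching_rate l) * y))\<bar>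
        \<le> (Ca + Cb + Cc + Cd + Ce) * \<eta> * \<gamma> (Suc n)"
      using one unfolding G_def r_def r'_def R_def by (simp add: algebra_simps)
  qed (use e0 in auto)
qed

end

section \<open>Convergence in distribution\<close>

context penalized_bandit_critical
begin

definition transform :: "nat \<Rightarrow> real \<Rightarrow> real" where
  "transform n l = expectation (\<lambda>\<omega>. exp (- (l * Y n \<omega>)))"

lemma transform_integrable:
  assumes "0 \<le> l" "n \<ge> 1" shows "integrable M (\<lambda>\<omega>. exp (- (l * Y n \<omega>)))"
  by (rule integrable_const_bound[of _ 1]) (use assms Y_nonneg in auto)

lemma transform_bounds:
  assumes "0 \<le> l" "n \<ge> 1"
  shows "0 \<le> transform n l" "transform n l \<le> 1" "1 - transform n l \<le> l * expectation (Y n)"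
proof -
  show "0 \<le> transform n l" unfolding transform_def by (rule integral_nonneg_AE) simp
  have "transform n l \<le> expectation (\<lambda>_. 1)" unfolding transform_def
    by (intro integral_mono transform_integrable assms) (use assms Y_nonneg in auto)
  thus "transform n l \<le> 1" using prob_space by simp
  have "expectation (\<lambda>\<omega>. 1 - l * Y n \<omega>) \<le> transform n l" unfolding transform_def
  proof (intro integral_mono transform_integrable assms)
    show "integrable M (\<lambda>\<omega>. 1 - l * Y n \<omega>)" using Y_integrable by simp
    show "1 - l * Y n \<omega> \<le> exp (- (l * Y n \<omega>))" for \<omega>
      using exp_ge_add_one_self[of "- (l * Y n \<omega>)"] by simp
  qed
  thus "1 - transform n l \<le> l * expectation (Y n)" using Y_integrable prob_space by simp
qed

lemma X_eq_Y: "n \<ge> 1 \<Longrightarrow> X n \<omega> = 1 - \<rho> n * Y n \<omega>"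
  using rho[of n] by (simp add: Y_def)

text \<open>The pointwise estimate, integrated over the law of \<open>Y n\<close>.\<close>
lemma transform_recursion:
  assumes dL: "0 < \<delta>" "\<delta> \<le> \<Lambda>" and eps: "\<epsilon> > 0"
  shows "eventually (\<lambda>n. \<forall>l. \<delta> \<le> l \<and> l \<le> \<Lambda> \<longrightarrow>
     \<bar>transform (Suc n) l - (1 - \<gamma> (Suc n) * (1 - p\<^sub>A) * l) * transform n (l + \<gamma> (Suc n) * branching_rate l)\<bar>
       \<le> \<epsilon> * \<gamma> (Suc n)) sequentially"
proof -
  obtain C \<eta>0 where C: "C > 0" "\<eta>0 > 0" and approx:
    "\<And>n \<eta> l y. small_step \<eta> n \<Longrightarrow> \<eta> \<le> \<eta>0 \<Longrightarrow> \<delta> \<le> l \<Longrightarrow> l \<le> \<Lambda> \<Longrightarrow> 0 \<le> y \<Longrightarrow> \<rho> n * y \<le> 1 \<Longrightarrow>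
      \<bar>one_step (Suc n) (\<lambda>z. exp (- (l * (1 - z) / \<rho> (Suc n)))) (1 - \<rho> n * y)
        - (1 - \<gamma> (Suc n) * (1 - p\<^sub>A) * l) * exp (- ((l + \<gamma> (Suc n) * branching_rate l) * y))\<bar> \<le> C * \<eta> * \<gamma> (Suc n)"
    by (rule one_step_exp_approx[OF dL], rule that)
  define \<eta> where "\<eta> = min \<eta>0 (\<epsilon> / C)"
  have eta: "0 < \<eta>" "\<eta> \<le> \<eta>0" "C * \<eta> \<le> \<epsilon>"
  proof -
    show "0 < \<eta>" "\<eta> \<le> \<eta>0" using C eps by (auto simp: \<eta>_def)
    have "\<eta> \<le> \<epsilon> / C" by (simp add: \<eta>_def)
    thus "C * \<eta> \<le> \<epsilon>" using C by (simp add: field_simps)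
  qed
  show ?thesis using eventually_small_step[OF eta(1)]
  proof eventually_elim
    case (elim n)
    let ?N = "Suc n"
    have n1: "n \<ge> 1" using elim by (simp add: small_step_def)
    have gN: "0 < \<gamma> ?N" "\<gamma> ?N < 1" "0 < \<rho> ?N" "0 < \<rho> n" using gamma[of ?N] rho[of ?N] rho[OF n1] by auto
    show ?case
    proof (intro allI impI, elim conjE)
      fix l assume l: "\<delta> \<le> l" "l \<le> \<Lambda>"
      have l0: "0 < l" using l dL by simp
      let ?F = "\<lambda>z. exp (- (l * (1 - z) / \<rho> ?N))"
      let ?l = "l + \<gamma> ?N * branching_rate l"
      have l': "0 \<le> ?l"
      proof -
        have "\<gamma> ?N * \<bar>branching_rate l\<bar> \<le> 1 * l" using gN abs_branching_rate_le[of l] l0 by (intro mult_mono) auto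
        hence "\<bar>\<gamma> ?N * branching_rate l\<bar> \<le> l" using gN by (simp add: abs_mult)
        thus ?thesis by linarith
      qed
      have bd: "\<bar>?F z\<bar> \<le> 1" if "0 \<le> z" "z \<le> 1" for z using that l0 gN by simp
      have m: "?F \<in> borel_measurable borel" by measurable
      have "transform ?N l = expectation (\<lambda>\<omega>. ?F (X ?N \<omega>))" by (simp add: transform_def Y_def)
      also have "\<dots> = expectation (\<lambda>\<omega>. one_step ?N ?F (X n \<omega>))"
        by (rule expectation_X_Suc(1)[OF m bd])
      finally have 1: "transform ?N l = expectation (\<lambda>\<omega>. one_step ?N ?F (X n \<omega>))" .
      have i1: "integrable M (\<lambda>\<omega>. one_step ?N ?F (X n \<omega>))" by (rule expectation_X_Suc(3)[OF m bd])
      have i2: "integrable M (\<lambda>\<omega>. exp (- (?l * Y n \<omega>)))" by (rule transform_integrable[OF l' n1])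
      let ?k = "1 - \<gamma> ?N * (1 - p\<^sub>A) * l"
      have e: "transform ?N l - ?k * transform n ?l
        = expectation (\<lambda>\<omega>. one_step ?N ?F (X n \<omega>) - ?k * exp (- (?l * Y n \<omega>)))"
        unfolding 1 transform_def[of n]
        by (simp only: Bochner_Integration.integral_diff[OF i1 integrable_mult_right[OF i2]] integral_mult_right_zero)
      have "\<bar>transform ?N l - ?k * transform n ?l\<bar> \<le> expectation (\<lambda>\<omega>. \<bar>one_step ?N ?F (X n \<omega>) - ?k * exp (- (?l * Y n \<omega>))\<bar>)"
        unfolding e by (rule integral_abs_bound)
      also have "\<dots> \<le> expectation (\<lambda>\<omega>. C * \<eta> * \<gamma> ?N)"
      proof (intro integral_mono integrable_abs Bochner_Integration.integrable_diff i1 integrable_mult_right i2 integrable_const)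
        fix \<omega>
        have "\<rho> n * Y n \<omega> \<le> 1" using X_bounds(1)[of n \<omega>] X_eq_Y[OF n1, of \<omega>] by simp
        from approx[OF elim eta(2) l Y_nonneg[OF n1] this]
        show "\<bar>one_step ?N ?F (X n \<omega>) - ?k * exp (- (?l * Y n \<omega>))\<bar> \<le> C * \<eta> * \<gamma> ?N"
          unfolding X_eq_Y[OF n1, of \<omega>] .
      qed
      also have "\<dots> = C * \<eta> * \<gamma> ?N" using prob_space by simp
      also have "\<dots> \<le> \<epsilon> * \<gamma> ?N" using eta gN by (intro mult_right_mono) auto
      finally show "\<bar>transform ?N l - ?k * transform n ?l\<bar> \<le> \<epsilon> * \<gamma> ?N" .
    qed
  qed
qed

text \<open>The mean value theorem and the differential equation: the segment from \<open>l\<close> to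
  \<open>l + \<gamma> * branching_rate l\<close> has length of order \<open>\<gamma>\<close>, and \<open>limit_transform\<close> and its derivative are uniformly continuous on
  compact intervals up to \<open>0\<close>.\<close>
lemma limit_transform_recursion:
  assumes L: "0 < \<Lambda>" and eps: "\<epsilon> > 0"
  shows "eventually (\<lambda>n. \<forall>l. 0 < l \<and> l \<le> \<Lambda> \<longrightarrow>
     \<bar>limit_transform l - (1 - \<gamma> (Suc n) * (1 - p\<^sub>A) * l) * limit_transform (l + \<gamma> (Suc n) * branching_rate l)\<bar>
       \<le> \<epsilon> * \<gamma> (Suc n)) sequentially"
proof -
  define e where "e = \<epsilon> / (2 * \<Lambda>)"
  have e: "e > 0" "\<Lambda> * e + \<Lambda> * e = \<epsilon>" using L eps by (auto simp: e_def field_simps)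
  have "uniformly_continuous_on {0..\<Lambda>} limit_transform" "uniformly_continuous_on {0..\<Lambda>} limit_transform_deriv"
    by (auto intro!: compact_uniformly_continuous continuous_on_subset[OF continuous_on_limit_transform]
        continuous_on_subset[OF continuous_on_limit_transform_deriv])
  then obtain d1 d2 where d: "d1 > 0" "d2 > 0"
    "\<And>x y. x \<in> {0..\<Lambda>} \<Longrightarrow> y \<in> {0..\<Lambda>} \<Longrightarrow> dist x y < d1 \<Longrightarrow> dist (limit_transform x) (limit_transform y) < e"
    "\<And>x y. x \<in> {0..\<Lambda>} \<Longrightarrow> y \<in> {0..\<Lambda>} \<Longrightarrow> dist x y < d2 \<Longrightarrow> dist (limit_transform_deriv x) (limit_transform_deriv y) < e"
    unfolding uniformly_continuous_on_def using e(1) by metis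
  define d0 where "d0 = min d1 d2 / \<Lambda>"
  have d0: "d0 > 0" using d L by (simp add: d0_def)
  have "eventually (\<lambda>n. \<gamma> (Suc n) < d0) sequentially"
    using order_tendstoD(2)[OF LIMSEQ_Suc[OF gamma_tendsto_0] d0] .
  thus ?thesis
  proof eventually_elim
    case (elim n)
    let ?N = "Suc n"
    have gN: "0 < \<gamma> ?N" "\<gamma> ?N < 1" using gamma[of ?N] by auto
    show ?case
    proof (intro allI impI, elim conjE)
      fix l assume l: "0 < l" "l \<le> \<Lambda>"
      define l' where "l' = l + \<gamma> ?N * branching_rate l"
      have R: "branching_rate l < 0" "\<bar>branching_rate l\<bar> \<le> l"
        using branching_rate_neg l abs_branching_rate_le by auto
      have l': "0 \<le> l'" "l' < l" "l - l' \<le> \<gamma> ?N * \<Lambda>"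
      proof -
        have "\<gamma> ?N * \<bar>branching_rate l\<bar> \<le> 1 * l" using gN R by (intro mult_mono) auto
        moreover have "\<gamma> ?N * \<bar>branching_rate l\<bar> \<le> \<gamma> ?N * \<Lambda>" using gN R l by (intro mult_left_mono) auto
        moreover have "\<gamma> ?N * branching_rate l < 0" using gN R by (simp add: mult_pos_neg)
        ultimately show "0 \<le> l'" "l' < l" "l - l' \<le> \<gamma> ?N * \<Lambda>" using R by (auto simp: l'_def)
      qed
      have "\<gamma> ?N * \<Lambda> < d0 * \<Lambda>" using elim L by simp
      hence dd: "l - l' < d1" "l - l' < d2" using l' L by (auto simp: d0_def)
      have "\<exists>D z. l' < z \<and> z < l \<and> DERIV limit_transform z :> D \<and> limit_transform l - limit_transform l' = (l - l') * D"
      proof (rule MVT[OF l'(2)])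
        show "continuous_on {l'..l} limit_transform"
          by (rule continuous_on_subset[OF continuous_on_limit_transform]) (use l' in auto)
        show "limit_transform differentiable at z" if "l' < z" "z < l" for z
          using DERIV_limit_transform[of z] that l' real_differentiable_def by fastforce
      qed
      then obtain D z where z: "l' < z" "z < l" "DERIV limit_transform z :> D"
        "limit_transform l - limit_transform l' = (l - l') * D" by blast
      have D: "D = limit_transform_deriv z"
        using DERIV_unique[OF z(3) DERIV_limit_transform] z l' by simp
      define a where "a = 1 - p\<^sub>A"
      have a: "0 \<le> a" "a \<le> 1" using pA_pos pA_less_1 by (auto simp: a_def)
      have ode: "branching_rate l * limit_transform_deriv l = a * l * limit_transform l"
        using limit_transform_ODE[of l] l by (simp add: a_def)
      have hl: "limit_transform l = limit_transform l' - \<gamma> ?N * branching_rate l * limit_transform_deriv z"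
        using z(4) unfolding D by (simp add: l'_def)
      have "limit_transform l - (1 - \<gamma> ?N * a * l) * limit_transform l'
        = - (\<gamma> ?N * (branching_rate l * limit_transform_deriv z)) + \<gamma> ?N * (a * l) * limit_transform l'"
        using hl by (simp add: algebra_simps)
      also have "\<dots> = - (\<gamma> ?N * (branching_rate l * limit_transform_deriv z)) + \<gamma> ?N * (a * l) * limit_transform l'
          + \<gamma> ?N * (branching_rate l * limit_transform_deriv l - a * l * limit_transform l)"
        by (simp add: ode)
      also have "\<dots> = \<gamma> ?N * (branching_rate l * (limit_transform_deriv l - limit_transform_deriv z)
          + (a * l) * (limit_transform l' - limit_transform l))"
        by (simp add: algebra_simps)
      finally have 1: "limit_transform l - (1 - \<gamma> ?N * a * l) * limit_transform l' = \<dots>" .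
      have b1: "\<bar>branching_rate l * (limit_transform_deriv l - limit_transform_deriv z)\<bar> \<le> \<Lambda> * e"
      proof (rule abs_mult_le)
        show "\<bar>branching_rate l\<bar> \<le> \<Lambda>" using R l by simp
        have "dist (limit_transform_deriv l) (limit_transform_deriv z) < e"
          using z l' l dd by (intro d(4)) (auto simp: dist_real_def)
        thus "\<bar>limit_transform_deriv l - limit_transform_deriv z\<bar> \<le> e" by (simp add: dist_real_def)
      qed
      have b2: "\<bar>(a * l) * (limit_transform l' - limit_transform l)\<bar> \<le> \<Lambda> * e"
      proof (rule abs_mult_le)
        have "a * l \<le> 1 * \<Lambda>" using a l by (intro mult_mono) auto
        thus "\<bar>a * l\<bar> \<le> \<Lambda>" using a l by simp
        have "dist (limit_transform l') (limit_transform l) < e"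
          using l' l dd by (intro d(3)) (auto simp: dist_real_def)
        thus "\<bar>limit_transform l' - limit_transform l\<bar> \<le> e" by (simp add: dist_real_def)
      qed
      have "\<bar>\<gamma> ?N * (branching_rate l * (limit_transform_deriv l - limit_transform_deriv z)
          + (a * l) * (limit_transform l' - limit_transform l))\<bar> \<le> \<gamma> ?N * \<epsilon>"
      proof (rule abs_mult_le)
        show "\<bar>branching_rate l * (limit_transform_deriv l - limit_transform_deriv z)
          + (a * l) * (limit_transform l' - limit_transform l)\<bar> \<le> \<epsilon>" using b1 b2 e(2) by linarith
      qed (use gN in simp)
      thus "\<bar>limit_transform l - (1 - \<gamma> ?N * (1 - p\<^sub>A) * l) * limit_transform (l + \<gamma> ?N * branching_rate l)\<bar> \<le> \<epsilon> * \<gamma> ?N"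
        using 1 unfolding l'_def[symmetric] a_def[symmetric] by (simp add: mult.commute)
    qed
  qed
qed

text \<open>The difference of the transforms is bounded by \<open>C1 * \<delta> + b n * s\<close> by induction on \<open>n\<close>. For \<open>s \<le> \<delta>\<close> this is the first
  moment bound. For \<open>s > \<delta>\<close> the recursion passes to the smaller argument \<open>s + \<gamma> * branching_rate s\<close>, which
  multiplies the slope \<open>b n\<close> by \<open>1 - c * \<gamma>\<close>; the errors, being at most \<open>\<delta> * c * \<gamma> * s\<close>, only keep the
  slope above \<open>\<delta>\<close>.\<close>
lemma transform_tendsto:
  assumes l: "0 \<le> l" shows "(\<lambda>n. transform n l) \<longlonglongrightarrow> limit_transform l"
proof -
  define c where "c = p\<^sub>A - p\<^sub>B"
  have c: "0 < c" "c < 1" using pB_less_pA pB_pos pA_less_1 by (auto simp: c_def)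
  obtain C where C: "C > 0" "eventually (\<lambda>n. expectation (Y n) \<le> C) sequentially"
    using first_moment_bounded by blast
  define C1 where "C1 = C + 1 / c"
  have C1: "C1 > 0" using C c by (simp add: C1_def add_pos_pos)
  define \<Lambda> where "\<Lambda> = max l 1"
  have L: "0 < \<Lambda>" "l \<le> \<Lambda>" by (auto simp: \<Lambda>_def)
  define D where "D n s = \<bar>transform n s - limit_transform s\<bar>" for n s
  have small: "D n s \<le> C1 * s" if "0 \<le> s" "n \<ge> 1" "expectation (Y n) \<le> C" for n s
  proof -
    have "transform n s \<le> 1" "1 - transform n s \<le> s * C" "limit_transform s \<le> 1" "1 - limit_transform s \<le> s / c"
      using transform_bounds[OF that(1,2)] mult_left_mono[OF that(3) that(1)] limit_transform_bounds[OF that(1)]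
      by (auto simp: c_def)
    moreover have "C1 * s = s * C + s / c" by (simp add: C1_def algebra_simps)
    moreover have "0 \<le> s * C" "0 \<le> s / c" using that C c by auto
    ultimately show ?thesis unfolding D_def by linarith
  qed
  define S where "S n = (\<Sum>k=1..n. \<gamma> k)" for n
  show ?thesis
  proof (rule LIMSEQ_I)
    fix r :: real assume r: "r > 0"
    define \<delta> where "\<delta> = min \<Lambda> (r / (2 * (C1 + 2 * \<Lambda>)))"
    have d: "0 < \<delta>" "\<delta> \<le> \<Lambda>" "(C1 + 2 * \<Lambda>) * \<delta> \<le> r / 2"
    proof -
      define p where "p = C1 + 2 * \<Lambda>"
      have p: "0 < p" using C1 L by (simp add: p_def)
      have dp: "\<delta> = min \<Lambda> (r / (2 * p))" by (simp only: \<delta>_def p_def)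
      show "0 < \<delta>" "\<delta> \<le> \<Lambda>" using L r p by (auto simp: dp)
      have "p * \<delta> \<le> p * (r / (2 * p))" using p by (intro mult_left_mono) (auto simp: dp)
      also have "\<dots> = r / 2" using p by simp
      finally show "(C1 + 2 * \<Lambda>) * \<delta> \<le> r / 2" by (simp only: p_def)
    qed
    \<comment> \<open>Two errors of size \<open>\<epsilon> * \<gamma>\<close> then cost at most \<open>\<delta> * c * \<gamma> * s\<close> for \<open>s \<ge> \<delta>\<close>.\<close>
    define \<epsilon> where "\<epsilon> = \<delta>\<^sup>2 * c / 2"
    have eps: "\<epsilon> > 0" using d c by (simp add: \<epsilon>_def)
    have ev: "eventually (\<lambda>n. (\<forall>s. \<delta> \<le> s \<and> s \<le> \<Lambda> \<longrightarrow>
     \<bar>transform (Suc n) s - (1 - \<gamma> (Suc n) * (1 - p\<^sub>A) * s) * transform n (s + \<gamma> (Suc n) * branching_rate s)\<bar>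
       \<le> \<epsilon> * \<gamma> (Suc n)) \<and> (\<forall>s. 0 < s \<and> s \<le> \<Lambda> \<longrightarrow>
     \<bar>limit_transform s - (1 - \<gamma> (Suc n) * (1 - p\<^sub>A) * s) * limit_transform (s + \<gamma> (Suc n) * branching_rate s)\<bar>
       \<le> \<epsilon> * \<gamma> (Suc n)) \<and> expectation (Y n) \<le> C \<and> \<gamma> (Suc n) < 1 / \<Lambda> \<and> n \<ge> 1) sequentially"
      using L by (intro eventually_conj transform_recursion limit_transform_recursion d eps C(2) eventually_ge_at_top
          order_tendstoD(2)[OF LIMSEQ_Suc[OF gamma_tendsto_0]]) auto
    then obtain n0 where n0:
      "\<And>n s. n \<ge> n0 \<Longrightarrow> \<delta> \<le> s \<Longrightarrow> s \<le> \<Lambda> \<Longrightarrow> \<bar>transform (Suc n) s - (1 - \<gamma> (Suc n) * (1 - p\<^sub>A) * s) * transform n (s + \<gamma> (Suc n) * branching_rate s)\<bar> \<le> \<epsilon> * \<gamma> (Suc n)"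
      "\<And>n s. n \<ge> n0 \<Longrightarrow> 0 < s \<Longrightarrow> s \<le> \<Lambda> \<Longrightarrow> \<bar>limit_transform s - (1 - \<gamma> (Suc n) * (1 - p\<^sub>A) * s) * limit_transform (s + \<gamma> (Suc n) * branching_rate s)\<bar> \<le> \<epsilon> * \<gamma> (Suc n)"
      "\<And>n. n \<ge> n0 \<Longrightarrow> expectation (Y n) \<le> C" "\<And>n. n \<ge> n0 \<Longrightarrow> \<gamma> (Suc n) < 1 / \<Lambda>" "\<And>n. n \<ge> n0 \<Longrightarrow> n \<ge> 1"
      unfolding eventually_sequentially by blast
    define b where "b n = \<delta> + C1 * exp (- (c * (S n - S n0)))" for n
    have b_pos: "0 \<le> b n" for n using d C1 by (simp add: b_def)
    have main: "\<forall>s. 0 \<le> s \<and> s \<le> \<Lambda> \<longrightarrow> D n s \<le> C1 * \<delta> + b n * s" if "n \<ge> n0" for n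
      using that
    proof (induction n rule: dec_induct)
      case base
      have "D n0 s \<le> C1 * \<delta> + b n0 * s" if s: "0 \<le> s" "s \<le> \<Lambda>" for s
      proof -
        have "D n0 s \<le> C1 * s" using small n0(3,5) s by simp
        also have "\<dots> \<le> C1 * \<delta> + b n0 * s" using s d C1 by (simp add: b_def algebra_simps)
        finally show ?thesis .
      qed
      thus ?case by blast
    next
      case (step n)
      let ?N = "Suc n"
      have nn: "n \<ge> n0" using step by simp
      have gN: "0 < \<gamma> ?N" "\<gamma> ?N < 1" using gamma[of ?N] by auto
      have "D ?N s \<le> C1 * \<delta> + b ?N * s" if s: "0 \<le> s" "s \<le> \<Lambda>" for s
      proof (cases "s \<le> \<delta>")
        case True
        have "D ?N s \<le> C1 * s" using small n0(3,5)[of ?N] s nn by simp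
        also have "\<dots> \<le> C1 * \<delta>" using True C1 by (intro mult_left_mono) auto
        also have "\<dots> \<le> C1 * \<delta> + b ?N * s" using b_pos s by simp
        finally show ?thesis .
      next
        case False
        hence s\<delta>: "\<delta> \<le> s" "0 < s" using d by auto
        define s' where "s' = s + \<gamma> ?N * branching_rate s"
        define k where "k = 1 - \<gamma> ?N * (1 - p\<^sub>A) * s"
        have k: "0 \<le> k" "k \<le> 1"
        proof -
          have "\<gamma> ?N * (1 - p\<^sub>A) * s \<le> (1 / \<Lambda>) * 1 * \<Lambda>"
            using n0(4)[OF nn] s pA_pos pA_less_1 gN L by (intro mult_mono) auto
          thus "0 \<le> k" using L by (simp add: k_def)
          show "k \<le> 1" using gN pA_less_1 s by (simp add: k_def)
        qed
        have s': "0 \<le> s'" "s' \<le> (1 - c * \<gamma> ?N) * s"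
        proof -
          have "\<gamma> ?N * (- s) \<le> \<gamma> ?N * branching_rate s"
            using gN abs_branching_rate_le[of s] s by (intro mult_left_mono) auto
          moreover have "\<gamma> ?N * s \<le> 1 * s" using gN s by (intro mult_right_mono) auto
          ultimately show "0 \<le> s'" by (simp add: s'_def)
          have "\<gamma> ?N * branching_rate s \<le> \<gamma> ?N * (- (c * s))"
            using gN branching_rate_le[of s] s by (intro mult_left_mono) (auto simp: c_def)
          thus "s' \<le> (1 - c * \<gamma> ?N) * s" by (simp add: s'_def algebra_simps)
        qed
        have cg: "0 \<le> 1 - c * \<gamma> ?N" using c gN mult_le_one[of c "\<gamma> ?N"] by simp
        have s'L: "s' \<le> \<Lambda>" using s' s c gN mult_right_mono[of "1 - c * \<gamma> ?N" 1 s] by simp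
        have "D ?N s \<le> \<bar>transform ?N s - k * transform n s'\<bar> + k * D n s' + \<bar>limit_transform s - k * limit_transform s'\<bar>"
        proof -
          have "transform ?N s - limit_transform s = (transform ?N s - k * transform n s')
            + k * (transform n s' - limit_transform s') - (limit_transform s - k * limit_transform s')"
            by (simp add: algebra_simps)
          moreover have "\<bar>k * (transform n s' - limit_transform s')\<bar> = k * D n s'" using k by (simp add: abs_mult D_def)
          ultimately show ?thesis unfolding D_def by linarith
        qed
        also have "\<dots> \<le> \<epsilon> * \<gamma> ?N + 1 * D n s' + \<epsilon> * \<gamma> ?N"
          using n0(1)[OF nn s\<delta>(1) s(2)] n0(2)[OF nn s\<delta>(2) s(2)] k unfolding s'_def[symmetric] k_def[symmetric]
          by (intro add_mono mult_right_mono) (auto simp: D_def)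
        also have "\<dots> \<le> \<epsilon> * \<gamma> ?N + 1 * (C1 * \<delta> + b n * s') + \<epsilon> * \<gamma> ?N"
          using step.IH s' s'L by simp
        also have "\<dots> \<le> C1 * \<delta> + (b n * (1 - c * \<gamma> ?N) + \<delta> * c * \<gamma> ?N) * s"
        proof -
          have "b n * s' \<le> b n * ((1 - c * \<gamma> ?N) * s)" using s' b_pos by (intro mult_left_mono) auto
          moreover have "2 * \<epsilon> * \<gamma> ?N \<le> \<delta> * c * \<gamma> ?N * s"
          proof -
            have "2 * \<epsilon> * \<gamma> ?N = \<delta> * c * \<gamma> ?N * \<delta>" by (simp add: \<epsilon>_def power2_eq_square)
            also have "\<dots> \<le> \<delta> * c * \<gamma> ?N * s" using s\<delta> d c gN by (intro mult_left_mono) auto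
            finally show ?thesis .
          qed
          ultimately show ?thesis by (simp add: algebra_simps)
        qed
        also have "\<dots> \<le> C1 * \<delta> + b ?N * s"
        proof (intro add_left_mono mult_right_mono)
          have "S ?N = S n + \<gamma> ?N" by (simp add: S_def)
          hence "exp (- (c * (S ?N - S n0))) = exp (- (c * (S n - S n0))) * exp (- (c * \<gamma> ?N))"
            by (simp add: exp_add[symmetric] algebra_simps)
          moreover have "1 - c * \<gamma> ?N \<le> exp (- (c * \<gamma> ?N))" using exp_ge_add_one_self[of "- (c * \<gamma> ?N)"] by simp
          ultimately have "exp (- (c * (S n - S n0))) * (1 - c * \<gamma> ?N) \<le> exp (- (c * (S ?N - S n0)))"
            by (simp add: mult_left_mono)
          from mult_left_mono[OF this, of C1] C1
          show "b n * (1 - c * \<gamma> ?N) + \<delta> * c * \<gamma> ?N \<le> b ?N" by (simp add: b_def algebra_simps)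
        qed (use s in simp)
        finally show ?thesis .
      qed
      thus ?case by blast
    qed
    have "filterlim (\<lambda>n. S n - S n0) at_top sequentially"
      using filterlim_tendsto_add_at_top[OF tendsto_const[of "- S n0"] gamma_sum] by (simp add: S_def)
    hence "filterlim (\<lambda>n. c * (S n - S n0)) at_top sequentially"
      by (rule filterlim_tendsto_pos_mult_at_top[OF tendsto_const c(1)])
    hence "(\<lambda>n. exp (- (c * (S n - S n0)))) \<longlonglongrightarrow> 0"
      by (intro filterlim_compose[OF exp_at_bot] filterlim_uminus_at_top[THEN iffD1])
    hence "eventually (\<lambda>n. exp (- (c * (S n - S n0))) < \<delta> / C1) sequentially"
      using d C1 by (intro order_tendstoD) auto
    with eventually_ge_at_top[of n0]
    have "eventually (\<lambda>n. norm (transform n l - limit_transform l) < r) sequentially"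
    proof eventually_elim
      case (elim n)
      have "b n \<le> 2 * \<delta>" using elim(2) C1 by (simp add: b_def field_simps)
      hence "b n * l \<le> (2 * \<delta>) * \<Lambda>" using l L d by (intro mult_mono) auto
      moreover have "D n l \<le> C1 * \<delta> + b n * l" using main[OF elim(1)] l L by simp
      ultimately have "D n l \<le> (C1 + 2 * \<Lambda>) * \<delta>" by (simp add: algebra_simps)
      thus ?case using d(3) r unfolding D_def by simp
    qed
    thus "\<exists>no. \<forall>n\<ge>no. norm (transform n l - limit_transform l) < r"
      unfolding eventually_sequentially .
  qed
qed

text \<open>Markov's inequality. The finitely many first moments before the bound sets in are finite.\<close>
lemma Y_tight: "tight (\<lambda>n. distr M borel (Y n))"
proof -
  obtain C where C: "C > 0" "eventually (\<lambda>n. expectation (Y n) \<le> C) sequentially"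
    using first_moment_bounded by blast
  have C': "eventually (\<lambda>n. expectation (\<lambda>\<omega>. \<bar>Y n \<omega>\<bar>) \<le> C) sequentially"
    using C(2) eventually_ge_at_top[of 1]
  proof eventually_elim
    case (elim n)
    thus ?case using Y_nonneg[OF elim(2)] by simp
  qed
  then obtain n0 where n0: "\<And>n. n \<ge> n0 \<Longrightarrow> expectation (\<lambda>\<omega>. \<bar>Y n \<omega>\<bar>) \<le> C"
    unfolding eventually_sequentially by blast
  define B where "B = C + (\<Sum>n<n0. expectation (\<lambda>\<omega>. \<bar>Y n \<omega>\<bar>))"
  have pos: "0 \<le> expectation (\<lambda>\<omega>. \<bar>Y n \<omega>\<bar>)" for n by (rule integral_nonneg_AE) simp
  have B: "expectation (\<lambda>\<omega>. \<bar>Y n \<omega>\<bar>) \<le> B" for n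
  proof (cases "n < n0")
    case True
    hence "expectation (\<lambda>\<omega>. \<bar>Y n \<omega>\<bar>) \<le> (\<Sum>n<n0. expectation (\<lambda>\<omega>. \<bar>Y n \<omega>\<bar>))"
      by (intro member_le_sum pos) auto
    thus ?thesis using C by (simp add: B_def)
  next
    case False
    thus ?thesis using n0[of n] sum_nonneg[of "{..<n0}" "\<lambda>n. expectation (\<lambda>\<omega>. \<bar>Y n \<omega>\<bar>)"] pos by (simp add: B_def)
  qed
  have B0: "0 < B" using C sum_nonneg[of "{..<n0}" "\<lambda>n. expectation (\<lambda>\<omega>. \<bar>Y n \<omega>\<bar>)"] pos by (simp add: B_def add_pos_nonneg)
  show ?thesis unfolding tight_def
  proof (intro conjI allI impI)
    fix n show "real_distribution (distr M borel (Y n))" by simp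
  next
    fix \<epsilon> :: real assume e: "\<epsilon> > 0"
    define K where "K = 2 * B / \<epsilon>"
    have K: "K > 0" using e B0 by (simp add: K_def)
    show "\<exists>a b. a < b \<and> (\<forall>n. 1 - \<epsilon> < measure (distr M borel (Y n)) {a<..b})"
    proof (intro exI conjI allI)
      show "- K < K" using K by simp
      fix n
      have i: "integrable M (\<lambda>\<omega>. \<bar>Y n \<omega>\<bar>)" using Y_integrable by simp
      have "prob {\<omega> \<in> space M. K \<le> \<bar>Y n \<omega>\<bar>} \<le> expectation (\<lambda>\<omega>. \<bar>Y n \<omega>\<bar>) / K"
        by (rule integral_Markov_inequality_measure[OF i, where A="{}"]) (use K in auto)
      also have "\<dots> \<le> B / K" using B K by (intro divide_right_mono) auto
      also have "\<dots> = \<epsilon> / 2" using B0 e by (simp add: K_def)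
      finally have 1: "prob {\<omega> \<in> space M. K \<le> \<bar>Y n \<omega>\<bar>} \<le> \<epsilon> / 2" .
      have "1 - prob {\<omega> \<in> space M. K \<le> \<bar>Y n \<omega>\<bar>} = prob (space M - {\<omega> \<in> space M. K \<le> \<bar>Y n \<omega>\<bar>})"
        by (subst prob_compl) auto
      also have "\<dots> \<le> prob (Y n -` {- K<..K} \<inter> space M)"
        by (rule finite_measure_mono) auto
      also have "\<dots> = measure (distr M borel (Y n)) {- K<..K}" by (subst measure_distr) auto
      finally show "1 - \<epsilon> < measure (distr M borel (Y n)) {- K<..K}" using 1 e by linarith
    qed
  qed
qed

text \<open>The exponential is not bounded on the line, so weak convergence is applied to \<open>exp (- (l * max 0 y))\<close>, which
  agrees with it on the support of the laws.\<close>
lemma subsequential_limit: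
  assumes s: "strict_mono s" and N: "real_distribution N" and w: "weak_conv_m ((\<lambda>n. distr M borel (Y n)) \<circ> s) N"
  shows "AE y in N. 0 \<le> y" "0 \<le> l \<Longrightarrow> (LINT y|N. exp (- (l * y))) = limit_transform l"
proof -
  interpret N: real_distribution N by (rule N)
  have mu: "\<And>n. real_distribution (((\<lambda>n. distr M borel (Y n)) \<circ> s) n)" by simp
  have conv: "(\<lambda>n. expectation (\<lambda>\<omega>. f (Y (s n) \<omega>))) \<longlonglongrightarrow> (LINT y|N. f y)"
    if f: "\<And>x. isCont f x" "\<And>x. \<bar>f x\<bar> \<le> 1" for f :: "real \<Rightarrow> real"
  proof -
    have fm: "f \<in> borel_measurable borel"
      by (intro borel_measurable_continuous_onI continuous_at_imp_continuous_on) (use f in auto)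
    have "(\<lambda>n. integral\<^sup>L (((\<lambda>n. distr M borel (Y n)) \<circ> s) n) f) \<longlonglongrightarrow> integral\<^sup>L N f"
      by (rule weak_conv_imp_integral_bdd_continuous_conv[OF mu N w, where B=1]) (use f in auto)
    moreover have "integral\<^sup>L (((\<lambda>n. distr M borel (Y n)) \<circ> s) n) f = expectation (\<lambda>\<omega>. f (Y (s n) \<omega>))" for n
      using fm by (simp add: integral_distr)
    ultimately show ?thesis by simp
  qed
  have ev: "eventually (\<lambda>n. s n \<ge> 1) sequentially"
    using eventually_ge_at_top[of 1] by (rule eventually_mono) (use seq_suble[OF s] order_trans in blast)
  let ?f = "\<lambda>y::real. min 1 (max 0 (- y))"
  have "(\<lambda>n. expectation (\<lambda>\<omega>. ?f (Y (s n) \<omega>))) \<longlonglongrightarrow> (LINT y|N. ?f y)"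
    by (rule conv) (auto intro!: continuous_intros)
  moreover have "(\<lambda>n. expectation (\<lambda>\<omega>. ?f (Y (s n) \<omega>))) \<longlonglongrightarrow> 0"
    using ev by (intro tendsto_eventually, eventually_elim) (simp add: Y_nonneg)
  ultimately have "(LINT y|N. ?f y) = 0" by (rule LIMSEQ_unique)
  moreover have "integrable N ?f" by (rule N.integrable_const_bound[of _ 1]) auto
  ultimately have "AE y in N. ?f y = 0" by (subst (asm) integral_nonneg_eq_0_iff_AE) auto
  thus pos: "AE y in N. 0 \<le> y" by eventually_elim (auto simp: min_def max_def split: if_splits)
  show "(LINT y|N. exp (- (l * y))) = limit_transform l" if l: "0 \<le> l"
  proof -
    let ?g = "\<lambda>y. exp (- (l * max 0 y))"
    have "(\<lambda>n. expectation (\<lambda>\<omega>. ?g (Y (s n) \<omega>))) \<longlonglongrightarrow> (LINT y|N. ?g y)"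
      by (rule conv) (use l in \<open>auto intro!: continuous_intros\<close>)
    moreover have "(\<lambda>n. expectation (\<lambda>\<omega>. ?g (Y (s n) \<omega>))) \<longlonglongrightarrow> limit_transform l"
    proof (rule Lim_transform_eventually)
      show "(\<lambda>n. transform (s n) l) \<longlonglongrightarrow> limit_transform l"
        using LIMSEQ_subseq_LIMSEQ[OF transform_tendsto[OF l] s] by (simp add: o_def)
      show "eventually (\<lambda>n. transform (s n) l = expectation (\<lambda>\<omega>. ?g (Y (s n) \<omega>))) sequentially"
        using ev by eventually_elim (simp add: transform_def max_def Y_nonneg)
    qed
    ultimately have "(LINT y|N. ?g y) = limit_transform l" by (rule LIMSEQ_unique)
    moreover have "(LINT y|N. ?g y) = (LINT y|N. exp (- (l * y)))"
    proof (rule integral_cong_AE)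
      show "AE y in N. ?g y = exp (- (l * y))" using pos by eventually_elim (simp only: max_absorb2)
    qed simp_all
    ultimately show ?thesis by simp
  qed
qed

text \<open>By tightness and Laplace uniqueness all subsequential limits exist and coincide. This is also where the
  existence of a probability law with transform \<open>limit_transform\<close> comes from.\<close>
lemma limit_distribution:
  obtains N where "real_distribution N" "AE y in N. 0 \<le> y"
    "\<And>l. 0 \<le> l \<Longrightarrow> (LINT y|N. exp (- (l * y))) = limit_transform l"
    "weak_conv_m (\<lambda>n. distr M borel (Y n)) N"
proof -
  let ?\<mu> = "\<lambda>n. distr M borel (Y n)"
  obtain r N where r: "strict_mono (r :: nat \<Rightarrow> nat)" "real_distribution N" "weak_conv_m (?\<mu> \<circ> id \<circ> r) N"
    using tight_imp_convergent_subsubsequence[OF Y_tight, of id] strict_mono_id by blast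
  have w: "weak_conv_m (?\<mu> \<circ> r) N" using r(3) by (simp add: o_def)
  note N = subsequential_limit[OF r(1,2) w]
  have "weak_conv_m ?\<mu> N"
  proof (rule tight_subseq_weak_converge[OF _ r(2) Y_tight])
    show "real_distribution (?\<mu> n)" for n by simp
    fix s N' assume s: "strict_mono s" "real_distribution N'" "weak_conv_m (?\<mu> \<circ> s) N'"
    note N' = subsequential_limit[OF s]
    have "N' = N"
      by (rule Laplace_transform_determines_distribution[OF s(2) N'(1) r(2) N(1)]) (simp add: N(2) N'(2))
    thus "weak_conv_m (?\<mu> \<circ> s) N" using s(3) by simp
  qed
  thus thesis using that r(2) N by blast
qed

end

section \<open>Time integrals, natural filtrations and the generator\<close>

lemma at_within_half_line_not_bot:
  assumes "0 \<le> y" shows "at y within {0::real..} \<noteq> bot"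
proof
  assume "at y within {0..} = bot"
  moreover have "at_right y \<le> at y within {0..}" by (rule at_le) (use assms in auto)
  ultimately show False using trivial_limit_at_right_real[of y] by (simp add: bot_unique)
qed

text \<open>The process is the limit of its values at the next point of a grid; that point is kept inside \<open>[0, t]\<close>, so that the
  approximations are measurable with respect to what is known at time \<open>t\<close>.\<close>
lemma right_continuous_joint_measurable:
  fixes Y :: "real \<Rightarrow> 'a \<Rightarrow> real"
  assumes t: "0 \<le> t" and meas: "\<And>s. 0 \<le> s \<Longrightarrow> s \<le> t \<Longrightarrow> Y s \<in> borel_measurable N"
    and rc: "\<And>\<omega> s. \<omega> \<in> space N \<Longrightarrow> 0 \<le> s \<Longrightarrow> s < t \<Longrightarrow> ((\<lambda>s. Y s \<omega>) \<longlongrightarrow> Y s \<omega>) (at_right s)"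
  shows "(\<lambda>(s, \<omega>). indicator {0..t} s * Y s \<omega>) \<in> borel_measurable (borel \<Otimes>\<^sub>M N)"
proof -
  define grid where "grid n i = max 0 (min t (real_of_int (i + 1) / real (Suc n)))" for n and i :: int
  have grid: "0 \<le> grid n i" "grid n i \<le> t" for n i using t by (auto simp: grid_def)
  define a where "a n s = grid n \<lfloor>s * real (Suc n)\<rfloor>" for n s
  define F where "F n = (\<lambda>(s, \<omega>). indicator {0..t} s * Y (a n s) \<omega>)" for n
  have lim: "(\<lambda>n. F n x) \<longlonglongrightarrow> (case x of (s, \<omega>) \<Rightarrow> indicator {0..t} s * Y s \<omega>)"
    if x: "x \<in> space ((borel :: real measure) \<Otimes>\<^sub>M N)" for x
  proof -
  obtain s \<omega> where sw: "x = (s, \<omega>)" "\<omega> \<in> space N" using x by (auto simp: space_pair_measure)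
  show ?thesis
  proof (cases "0 \<le> s \<and> s < t")
    case True
    have gt: "s < real_of_int (\<lfloor>s * real (Suc n)\<rfloor> + 1) / real (Suc n)" for n
    proof -
      have "s * real (Suc n) < real_of_int \<lfloor>s * real (Suc n)\<rfloor> + 1" by linarith
      thus ?thesis by (simp add: pos_less_divide_eq)
    qed
    have a_gt: "s < a n s" for n using gt[of n] True unfolding a_def grid_def by (simp add: less_max_iff_disj)
    have a_le: "a n s \<le> s + 1 / real (Suc n)" for n
    proof -
      have "real_of_int \<lfloor>s * real (Suc n)\<rfloor> + 1 \<le> s * real (Suc n) + 1" by linarith
      hence "(real_of_int \<lfloor>s * real (Suc n)\<rfloor> + 1) / real (Suc n) \<le> (s * real (Suc n) + 1) / real (Suc n)"
        by (rule divide_right_mono) simp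
      also have "\<dots> = s + 1 / real (Suc n)" by (simp add: add_divide_distrib)
      finally show ?thesis using True unfolding a_def grid_def by (simp add: min_le_iff_disj)
    qed
    have "(\<lambda>n. a n s) \<longlonglongrightarrow> s"
    proof (rule tendsto_sandwich)
      show "(\<lambda>_. s) \<longlonglongrightarrow> s" by simp
      show "(\<lambda>n. s + 1 / real (Suc n)) \<longlonglongrightarrow> s"
        using tendsto_add[OF tendsto_const LIMSEQ_inverse_real_of_nat, of s] by (simp add: inverse_eq_divide)
    qed (use a_gt a_le in \<open>auto intro!: always_eventually simp: less_imp_le\<close>)
    hence "filterlim (\<lambda>n. a n s) (at_right s) sequentially"
      unfolding filterlim_at using a_gt by (auto intro!: always_eventually) (metis less_irrefl)
    from filterlim_compose[OF rc[OF sw(2)] this] True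
    show ?thesis using sw(1) by (simp add: F_def)
  next
    case False
    have "a n s = t" if "s = t" for n
    proof -
      have "t * real (Suc n) < real_of_int \<lfloor>t * real (Suc n)\<rfloor> + 1" by linarith
      hence "t < (real_of_int \<lfloor>t * real (Suc n)\<rfloor> + 1) / real (Suc n)" by (simp add: pos_less_divide_eq)
      thus ?thesis using that t by (simp add: a_def grid_def)
    qed
    hence e: "indicator {0..t} s * Y (a n s) \<omega> = indicator {0..t} s * Y s \<omega>" for n
      using False by (cases "s = t") (auto simp: indicator_def)
    have "F n x = indicator {0..t} s * Y s \<omega>" for n
      unfolding F_def sw(1) prod.case by (rule e)
    thus ?thesis by (simp add: sw(1))
  qed
  qed
  have meas_F: "F n \<in> borel_measurable (borel \<Otimes>\<^sub>M N)" for n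
  proof -
  have "(\<lambda>x. (\<lambda>i x. indicator {0..t} (fst x) * Y (grid n i) (snd x)) \<lfloor>fst x * real (Suc n)\<rfloor> x) \<in> borel_measurable (borel \<Otimes>\<^sub>M N)"
  proof (rule measurable_compose_countable)
    fix i
    have [measurable]: "Y (grid n i) \<in> borel_measurable N" using grid by (intro meas)
    show "(\<lambda>x. indicator {0..t} (fst x) * Y (grid n i) (snd x)) \<in> borel_measurable (borel \<Otimes>\<^sub>M N)" by measurable
  qed measurable
  thus ?thesis by (simp add: F_def a_def split_beta')
  qed
  show ?thesis by (rule borel_measurable_LIMSEQ_real[OF lim meas_F])
qed

lemma time_integral_Fubini:
  fixes Y :: "real \<Rightarrow> 'a \<Rightarrow> real"
  assumes Q: "prob_space Q" and t: "0 \<le> t"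
    and meas: "(\<lambda>(s, \<omega>). indicator {0..t} s * Y s \<omega>) \<in> borel_measurable (borel \<Otimes>\<^sub>M Q)"
    and bd: "\<And>s \<omega>. 0 \<le> s \<Longrightarrow> s \<le> t \<Longrightarrow> \<omega> \<in> space Q \<Longrightarrow> \<bar>Y s \<omega>\<bar> \<le> C"
  shows "(LINT \<omega>|Q. (LINT s:{0..t}|lborel. Y s \<omega>)) = (LINT s:{0..t}|lborel. (LINT \<omega>|Q. Y s \<omega>))"
    and "set_integrable lborel {0..t} (\<lambda>s. LINT \<omega>|Q. Y s \<omega>)"
    and "(\<lambda>\<omega>. LINT s:{0..t}|lborel. Y s \<omega>) \<in> borel_measurable Q"
    and "integrable Q (\<lambda>\<omega>. LINT s:{0..t}|lborel. Y s \<omega>)"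
    and "\<And>\<omega>. \<omega> \<in> space Q \<Longrightarrow> set_integrable lborel {0..t} (\<lambda>s. Y s \<omega>)"
    and "\<And>\<omega>. \<omega> \<in> space Q \<Longrightarrow> \<bar>LINT s:{0..t}|lborel. Y s \<omega>\<bar> \<le> C * t"
proof -
  interpret Q: prob_space Q by (rule Q)
  interpret P: pair_sigma_finite "lborel :: real measure" Q ..
  let ?f = "\<lambda>s \<omega>. indicator {0..t} s * Y s \<omega>"
  have m: "case_prod ?f \<in> borel_measurable ((lborel :: real measure) \<Otimes>\<^sub>M Q)"
    using meas by (subst measurable_cong_sets[OF sets_pair_measure_cong[OF sets_lborel refl] refl])
  have i: "integrable ((lborel :: real measure) \<Otimes>\<^sub>M Q) (case_prod ?f)"
  proof (rule Bochner_Integration.integrable_bound[OF _ m])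
    have "emeasure ((lborel :: real measure) \<Otimes>\<^sub>M Q) ({0..t} \<times> space Q) = ennreal t"
      using t by (subst Q.emeasure_pair_measure_Times) (auto simp: Q.emeasure_space_1)
    hence "integrable ((lborel :: real measure) \<Otimes>\<^sub>M Q) (indicator ({0..t} \<times> space Q) :: _ \<Rightarrow> real)"
      by (intro integrable_real_indicator) auto
    thus "integrable ((lborel :: real measure) \<Otimes>\<^sub>M Q) (\<lambda>x. \<bar>C\<bar> * indicator ({0..t} \<times> space Q) x)" by simp
    show "AE x in (lborel :: real measure) \<Otimes>\<^sub>M Q. norm (case_prod ?f x) \<le> norm (\<bar>C\<bar> * indicator ({0..t} \<times> space Q) x)"
    proof (rule AE_I2)
      fix x assume x: "x \<in> space ((lborel :: real measure) \<Otimes>\<^sub>M Q)"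
      obtain s \<omega> where sw: "x = (s, \<omega>)" "\<omega> \<in> space Q" using x by (auto simp: space_pair_measure)
      show "norm (case_prod ?f x) \<le> norm (\<bar>C\<bar> * indicator ({0..t} \<times> space Q) x)"
        using bd[of s \<omega>] sw by (auto simp: indicator_def)
    qed
  qed
  have *: "(LINT s:{0..t}|lborel. Z s) = (LINT s|lborel. indicator {0..t} s * Z s)" for Z :: "real \<Rightarrow> real"
    by (simp add: set_lebesgue_integral_def)
  have in_eq: "indicator {0..t} s * (LINT \<omega>|Q. Y s \<omega>) = (LINT \<omega>|Q. ?f s \<omega>)" for s by simp
  show "(LINT \<omega>|Q. (LINT s:{0..t}|lborel. Y s \<omega>)) = (LINT s:{0..t}|lborel. (LINT \<omega>|Q. Y s \<omega>))"
    unfolding * in_eq by (rule P.Fubini_integral[OF i])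
  show "set_integrable lborel {0..t} (\<lambda>s. LINT \<omega>|Q. Y s \<omega>)"
    unfolding set_integrable_def real_scaleR_def in_eq using P.integrable_fst'[OF i] by simp
  show i2: "integrable Q (\<lambda>\<omega>. LINT s:{0..t}|lborel. Y s \<omega>)"
    unfolding * using P.integrable_snd[OF i] .
  thus "(\<lambda>\<omega>. LINT s:{0..t}|lborel. Y s \<omega>) \<in> borel_measurable Q" by simp
  fix \<omega> assume w: "\<omega> \<in> space Q"
  have mw: "(\<lambda>s. ?f s \<omega>) \<in> borel_measurable lborel"
    using measurable_compose[OF measurable_Pair2'[OF w, of lborel] m] by simp
  have iC: "integrable lborel (\<lambda>s. C * indicator {0..t} s)"
    using t by (intro integrable_mult_right integrable_real_indicator) auto
  have bC: "\<bar>?f s \<omega>\<bar> \<le> C * indicator {0..t} s" for s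
    using bd[of s \<omega>] w by (auto simp: indicator_def)
  have iw: "integrable lborel (\<lambda>s. ?f s \<omega>)"
    by (rule Bochner_Integration.integrable_bound[OF iC mw], intro AE_I2, unfold real_norm_def, rule order_trans[OF bC abs_ge_self])
  thus "set_integrable lborel {0..t} (\<lambda>s. Y s \<omega>)" by (simp add: set_integrable_def)
  have "\<bar>LINT s|lborel. ?f s \<omega>\<bar> \<le> (LINT s|lborel. C * indicator {0..t} s)"
    using integral_abs_bound[of lborel "\<lambda>s. ?f s \<omega>"] integral_mono[OF integrable_abs[OF iw] iC bC] by linarith
  thus "\<bar>LINT s:{0..t}|lborel. Y s \<omega>\<bar> \<le> C * t"
    unfolding * using t by simp
qed

lemma natural_filtration_subalgebra:
  assumes "\<And>s. 0 \<le> s \<Longrightarrow> Y s \<in> Q \<rightarrow>\<^sub>M S"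
  shows "subalgebra Q (natural_filtration Q S Y t)"
  unfolding subalgebra_def natural_filtration_def
proof
  have "(\<lambda>\<omega>. \<lambda>s\<in>{0..t}. Y s \<omega>) \<in> Q \<rightarrow>\<^sub>M PiM {0..t} (\<lambda>_. S)"
    by (rule measurable_restrict) (use assms in auto)
  thus "sets (vimage_algebra (space Q) (\<lambda>\<omega>. \<lambda>s\<in>{0..t}. Y s \<omega>) (PiM {0..t} (\<lambda>_. S))) \<subseteq> sets Q"
    by (rule sets_image_in_sets[OF refl])
qed simp

lemma natural_filtration_sigma_finite:
  assumes "prob_space Q" "\<And>s. 0 \<le> s \<Longrightarrow> Y s \<in> Q \<rightarrow>\<^sub>M S"
  shows "sigma_finite_subalgebra Q (natural_filtration Q S Y t)"
proof (rule finite_measure_subalgebra_is_sigma_finite)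
  interpret prob_space Q by fact
  show "finite_measure_subalgebra Q (natural_filtration Q S Y t)"
    by unfold_locales (rule natural_filtration_subalgebra[OF assms(2)])
qed

lemma natural_filtration_measurable:
  assumes Y: "\<And>s. 0 \<le> s \<Longrightarrow> Y s \<in> Q \<rightarrow>\<^sub>M S" and s: "0 \<le> s" "s \<le> t"
  shows "Y s \<in> natural_filtration Q S Y t \<rightarrow>\<^sub>M S"
proof -
  have "(\<lambda>\<omega>. \<lambda>s\<in>{0..t}. Y s \<omega>) \<in> natural_filtration Q S Y t \<rightarrow>\<^sub>M PiM {0..t} (\<lambda>_. S)"
    unfolding natural_filtration_def
    by (rule measurable_vimage_algebra1) (use measurable_space[OF Y] in \<open>auto simp: space_PiM\<close>)
  hence "(\<lambda>\<omega>. (\<lambda>s\<in>{0..t}. Y s \<omega>) s) \<in> natural_filtration Q S Y t \<rightarrow>\<^sub>M S"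
    by (rule measurable_compose[OF _ measurable_component_singleton]) (use s in auto)
  thus ?thesis using s by simp
qed

lemma borel_measurable_half_line:
  "continuous_on {0..} k \<Longrightarrow> k \<in> borel_measurable half_line" for k :: "real \<Rightarrow> real"
  by (rule borel_measurable_continuous_on_restrict)

lemma space_half_line [simp]: "space half_line = {0..}"
  by (simp add: space_restrict_space)

context bandit_rates
begin

abbreviation generator :: "(real \<Rightarrow> real) \<Rightarrow> real \<Rightarrow> real" where
  "generator \<equiv> bandit_generator p\<^sub>A p\<^sub>B g"

lemma generator_eq:
  assumes "0 \<le> y" "(f has_vector_derivative d) (at y within {0..})"
  shows "generator f y = p\<^sub>B * y * ((f (y + g) - f y) / g) + (1 - p\<^sub>A - p\<^sub>A * y) * d"
  using vector_derivative_within[OF at_within_half_line_not_bot[OF assms(1)] assms(2)]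
  by (simp add: bandit_generator_def)

text \<open>Since \<open>f\<close> vanishes for large arguments, both \<open>f\<close> and the generator applied to \<open>f\<close> are continuous with compact
  support, hence bounded, although the coefficients of the generator are unbounded.\<close>
lemma C1_compact_half_line_facts:
  assumes "f \<in> C1_compact_half_line"
  obtains f' B where "continuous_on {0..} f'" "continuous_on {0..} f" "continuous_on {0..} (generator f)"
    "\<And>y. 0 \<le> y \<Longrightarrow> (f has_vector_derivative f' y) (at y within {0..})"
    "\<And>y. 0 \<le> y \<Longrightarrow> generator f y = p\<^sub>B * y * ((f (y + g) - f y) / g) + (1 - p\<^sub>A - p\<^sub>A * y) * f' y"
    "\<And>y. 0 \<le> y \<Longrightarrow> \<bar>f y\<bar> \<le> B" "\<And>y. 0 \<le> y \<Longrightarrow> \<bar>generator f y\<bar> \<le> B" "0 \<le> B"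
proof -
  obtain f' K where f': "\<And>y. 0 \<le> y \<Longrightarrow> (f has_vector_derivative f' y) (at y within {0..})"
    "continuous_on {0..} f'" and K: "\<And>y. y \<ge> K \<Longrightarrow> f y = 0"
    using assms unfolding C1_compact_half_line_def by blast
  have cf: "continuous_on {0..} f"
    unfolding continuous_on_eq_continuous_within
    using f'(1) has_vector_derivative_continuous by blast
  have gf: "generator f y = p\<^sub>B * y * ((f (y + g) - f y) / g) + (1 - p\<^sub>A - p\<^sub>A * y) * f' y" if "0 \<le> y" for y
    using generator_eq[OF that f'(1)[OF that]] .
  have cg: "continuous_on {0..} (generator f)"
  proof -
    have "continuous_on {0..} (\<lambda>y. f (y + g))"
      by (rule continuous_on_compose2[OF cf]) (use g_pos in \<open>auto intro!: continuous_intros\<close>)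
    hence "continuous_on {0..} (\<lambda>y. p\<^sub>B * y * ((f (y + g) - f y) / g) + (1 - p\<^sub>A - p\<^sub>A * y) * f' y)"
      using g_pos by (intro continuous_intros cf f'(2)) auto
    thus ?thesis by (rule continuous_on_eq) (use gf in auto)
  qed
  define K' where "K' = max K 0 + 1"
  have f'0: "f' y = 0" if "y > max K 0" for y
  proof -
    have y: "0 \<le> y" using that by simp
    have "((\<lambda>_. 0) has_vector_derivative 0) (at y within {0..})" by simp
    hence "(f has_vector_derivative 0) (at y within {0..})"
      by (rule has_vector_derivative_transform_within[of _ _ _ _ "y - max K 0"])
        (use that K y in \<open>auto simp: dist_real_def\<close>)
    thus ?thesis
      using vector_derivative_unique_within[OF at_within_half_line_not_bot[OF y]] f'(1)[OF y] by blast
  qed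
  have "bounded (f ` {0..K'})" "bounded (generator f ` {0..K'})"
    by (auto intro!: compact_imp_bounded compact_continuous_image continuous_on_subset[OF cf] continuous_on_subset[OF cg])
  then obtain B1 B2 where B: "\<And>y. y \<in> {0..K'} \<Longrightarrow> \<bar>f y\<bar> \<le> B1" "\<And>y. y \<in> {0..K'} \<Longrightarrow> \<bar>generator f y\<bar> \<le> B2"
    unfolding bounded_iff by (metis imageI real_norm_def)
  have big: "f y = 0 \<and> generator f y = 0" if "y > K'" for y
  proof -
    have "0 \<le> y" "y > max K 0" "y \<ge> K" "y + g \<ge> K" using that g_pos by (auto simp: K'_def)
    thus ?thesis using gf f'0 K by simp
  qed
  define B where "B = max 0 (max B1 B2)"
  have "\<bar>f y\<bar> \<le> B \<and> \<bar>generator f y\<bar> \<le> B" if "0 \<le> y" for y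
  proof (cases "y \<le> K'")
    case True
    thus ?thesis using B[of y] that unfolding B_def by auto
  next
    case False
    thus ?thesis using big[of y] by (simp add: B_def)
  qed
  moreover have "0 \<le> B" by (simp add: B_def)
  ultimately show thesis using that f' cf cg gf by blast
qed

end

section \<open>Paths built from a flow and exponential clocks\<close>

definition exp_noise :: "real measure" where
  "exp_noise = density lborel (exponential_density 1)"

lemma sets_exp_noise [simp, measurable_cong]: "sets exp_noise = sets borel"
  by (simp add: exp_noise_def)

lemma space_exp_noise [simp]: "space exp_noise = UNIV"
  by (simp add: exp_noise_def)

interpretation exp_noise: prob_space exp_noise
  unfolding exp_noise_def by (rule prob_space_exponential_density) simp

lemma nn_integral_exp_noise:
  assumes [measurable]: "f \<in> borel_measurable borel"
  shows "(\<integral>\<^sup>+e. f e \<partial>exp_noise) = (\<integral>\<^sup>+e. indicator {0<..} e * (ennreal (exp (- e)) * f e) \<partial>lborel)"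
proof -
  have "(\<integral>\<^sup>+e. f e \<partial>exp_noise) = (\<integral>\<^sup>+e. ennreal (exponential_density 1 e) * f e \<partial>lborel)"
    unfolding exp_noise_def by (rule nn_integral_density) (auto simp: exponential_density_def)
  also have "\<dots> = (\<integral>\<^sup>+e. indicator {0<..} e * (ennreal (exp (- e)) * f e) \<partial>lborel)"
  proof (rule nn_integral_cong_AE)
    show "AE e in lborel. ennreal (exponential_density 1 e) * f e = indicator {0<..} e * (ennreal (exp (- e)) * f e)"
      using AE_lborel_singleton[of 0] by eventually_elim (auto simp: exponential_density_def indicator_def)
  qed
  finally show ?thesis .
qed

lemma AE_exp_noise_pos: "AE e in exp_noise. 0 < e"
proof -
  have "(\<integral>\<^sup>+e. indicator {..0} e \<partial>exp_noise) = 0"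
    by (subst nn_integral_exp_noise) (auto simp: nn_integral_0_iff_AE indicator_def)
  hence "AE e in exp_noise. indicator {..0} e = (0::ennreal)"
    by (subst (asm) nn_integral_0_iff_AE) auto
  thus ?thesis by eventually_elim (auto simp: indicator_def split: if_splits)
qed

text \<open>Lack of memory in integral form: given \<open>e > c\<close>, the excess \<open>e - c\<close> has the original law.\<close>
lemma exp_noise_memoryless:
  assumes [measurable]: "f \<in> borel_measurable borel" and c: "0 \<le> c"
  shows "(\<integral>\<^sup>+e. indicator {c<..} e * f (e - c) \<partial>exp_noise) = ennreal (exp (- c)) * (\<integral>\<^sup>+e. f e \<partial>exp_noise)"
proof -
  have "(\<integral>\<^sup>+e. indicator {c<..} e * f (e - c) \<partial>exp_noise)
      = (\<integral>\<^sup>+e. indicator {0<..} e * (ennreal (exp (- e)) * (indicator {c<..} e * f (e - c))) \<partial>lborel)"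
    by (rule nn_integral_exp_noise) measurable
  also have "\<dots> = (\<integral>\<^sup>+u. indicator {0<..} (c + 1 * u) * (ennreal (exp (- (c + 1 * u))) * (indicator {c<..} (c + 1 * u) * f (c + 1 * u - c))) \<partial>lborel)"
    by (subst nn_integral_real_affine[where c=1 and t=c]) auto
  also have "\<dots> = (\<integral>\<^sup>+u. ennreal (exp (- c)) * (indicator {0<..} u * (ennreal (exp (- u)) * f u)) \<partial>lborel)"
  proof (rule nn_integral_cong)
    fix u :: real
    have "ennreal (exp (- (c + u))) = ennreal (exp (- c)) * ennreal (exp (- u))"
      by (simp add: ennreal_mult[symmetric] exp_add[symmetric])
    thus "indicator {0<..} (c + 1 * u) * (ennreal (exp (- (c + 1 * u))) * (indicator {c<..} (c + 1 * u) * f (c + 1 * u - c)))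
      = ennreal (exp (- c)) * (indicator {0<..} u * (ennreal (exp (- u)) * f u))"
      using c by (auto simp: indicator_def mult_ac)
  qed
  also have "\<dots> = ennreal (exp (- c)) * (\<integral>\<^sup>+u. indicator {0<..} u * (ennreal (exp (- u)) * f u) \<partial>lborel)"
    by (rule nn_integral_cmult) measurable
  finally show ?thesis by (simp add: nn_integral_exp_noise)
qed

lemma nn_integral_exp_noise_exp:
  assumes b: "0 \<le> b" shows "(\<integral>\<^sup>+e. ennreal (exp (- (b * e))) \<partial>exp_noise) = ennreal (1 / (1 + b))"
proof -
  have "(\<integral>\<^sup>+e. ennreal (exp (- (b * e))) \<partial>exp_noise)
    = (\<integral>\<^sup>+e. indicator {0<..} e * (ennreal (exp (- e)) * ennreal (exp (- (b * e)))) \<partial>lborel)"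
    by (rule nn_integral_exp_noise) measurable
  also have "\<dots> = (\<integral>\<^sup>+e. ennreal (1 / (1 + b)) * ennreal (exponential_density (1 + b) e) \<partial>lborel)"
  proof (rule nn_integral_cong_AE)
    show "AE e in lborel. indicator {0<..} e * (ennreal (exp (- e)) * ennreal (exp (- (b * e))))
      = ennreal (1 / (1 + b)) * ennreal (exponential_density (1 + b) e)"
      using AE_lborel_singleton[of 0]
    proof eventually_elim
      case (elim e)
      have "exp (- e) * exp (- (b * e)) = 1 / (1 + b) * ((1 + b) * exp (- e * (1 + b)))"
      proof -
        have "exp (- e) * exp (- (b * e)) = exp (- e * (1 + b))" by (simp add: exp_add[symmetric] algebra_simps)
        thus ?thesis using b by simp
      qed
      thus ?case using elim b
        by (auto simp: exponential_density_def indicator_def ennreal_mult[symmetric] simp del: mult_minus_left)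
    qed
  qed
  also have "\<dots> = ennreal (1 / (1 + b)) * (\<integral>\<^sup>+e. ennreal (exponential_density (1 + b) e) \<partial>lborel)"
    by (rule nn_integral_cmult) (simp add: exponential_density_def)
  also have "(\<integral>\<^sup>+e. ennreal (exponential_density (1 + b) e) \<partial>lborel) = 1"
  proof -
    interpret p: prob_space "density lborel (exponential_density (1 + b))"
      by (rule prob_space_exponential_density) (use b in simp)
    have "emeasure (density lborel (exponential_density (1 + b))) UNIV = 1" using p.emeasure_space_1 by simp
    thus ?thesis by (subst (asm) emeasure_density) (auto simp: exponential_density_def)
  qed
  finally show ?thesis by simp
qed

definition noise :: "real stream measure" where "noise = stream_space exp_noise"

interpretation noise: prob_space noise
  unfolding noise_def by (rule exp_noise.prob_space_stream_space)

lemma sets_noise [measurable_cong]: "sets noise = sets (stream_space borel)"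
  unfolding noise_def by (rule sets_stream_space_cong) simp

lemma space_noise [simp]: "space noise = UNIV"
  by (simp add: noise_def space_stream_space)

lemma nn_integral_noise:
  "f \<in> borel_measurable noise \<Longrightarrow> (\<integral>\<^sup>+\<omega>. f \<omega> \<partial>noise) = (\<integral>\<^sup>+e. (\<integral>\<^sup>+\<omega>. f (e ## \<omega>) \<partial>noise) \<partial>exp_noise)"
  unfolding noise_def by (rule exp_noise.nn_integral_stream_space)

lemma Stream_noise_measurable [measurable]: "(\<lambda>(e, \<omega>). e ## \<omega>) \<in> exp_noise \<Otimes>\<^sub>M noise \<rightarrow>\<^sub>M noise"
  unfolding noise_def by measurable

context bandit_rates
begin

text \<open>The equilibrium of the flow \<open>y' = 1 - p\<^sub>A - p\<^sub>A * y\<close>.\<close>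
definition rest_point :: real where "rest_point = (1 - p\<^sub>A) / p\<^sub>A"

lemma rest_point_pos: "0 < rest_point" using pA_pos pA_less_1 by (simp add: rest_point_def)

definition flow :: "real \<Rightarrow> real \<Rightarrow> real" where
  "flow t y = rest_point + (y - rest_point) * exp (- (p\<^sub>A * t))"

text \<open>The integral of the jump rate \<open>p\<^sub>B * y / g\<close> along the flow up to time \<open>t\<close>; see \<open>hazard_DERIV\<close>.\<close>
definition hazard :: "real \<Rightarrow> real \<Rightarrow> real" where
  "hazard t y = p\<^sub>B / g * (rest_point * t + (y - rest_point) * (1 - exp (- (p\<^sub>A * t))) / p\<^sub>A)"

lemma flow_0 [simp]: "flow 0 y = y" by (simp add: flow_def)

lemma flow_add: "flow (s + t) y = flow t (flow s y)"
  by (simp add: flow_def exp_add[symmetric] algebra_simps)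

lemma flow_DERIV: "((\<lambda>t. flow t y) has_real_derivative 1 - p\<^sub>A - p\<^sub>A * flow t y) (at t within S)"
proof -
  have "((\<lambda>t. flow t y) has_real_derivative (y - rest_point) * (- p\<^sub>A * exp (- (p\<^sub>A * t)))) (at t within S)"
    unfolding flow_def by (auto intro!: derivative_eq_intros)
  moreover have "(y - rest_point) * (- p\<^sub>A * exp (- (p\<^sub>A * t))) = 1 - p\<^sub>A - p\<^sub>A * flow t y"
    using pA_pos by (simp add: flow_def rest_point_def field_simps)
  ultimately show ?thesis by simp
qed

text \<open>The flow moves towards the equilibrium along a segment, hence preserves the half-line and every interval that
  contains the equilibrium.\<close>
lemma flow_convex: "flow t y = (1 - exp (- (p\<^sub>A * t))) * rest_point + exp (- (p\<^sub>A * t)) * y"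
  by (simp add: flow_def algebra_simps)

lemma flow_nonneg: "0 \<le> y \<Longrightarrow> 0 \<le> t \<Longrightarrow> 0 \<le> flow t y"
  unfolding flow_convex using rest_point_pos pA_pos by (intro add_nonneg_nonneg mult_nonneg_nonneg) auto

lemma flow_pos: "0 \<le> y \<Longrightarrow> 0 < t \<Longrightarrow> 0 < flow t y"
  unfolding flow_convex using rest_point_pos pA_pos by (intro add_pos_nonneg mult_pos_pos mult_nonneg_nonneg) auto

lemma flow_le: "y \<le> b \<Longrightarrow> rest_point \<le> b \<Longrightarrow> 0 \<le> t \<Longrightarrow> flow t y \<le> b"
proof -
  assume a: "y \<le> b" "rest_point \<le> b" "0 \<le> t"
  have "flow t y \<le> (1 - exp (- (p\<^sub>A * t))) * b + exp (- (p\<^sub>A * t)) * b"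
    unfolding flow_convex using a pA_pos by (intro add_mono mult_left_mono) auto
  thus ?thesis by (simp add: algebra_simps)
qed

lemma hazard_0 [simp]: "hazard 0 y = 0" by (simp add: hazard_def)

lemma hazard_add: "hazard (s + t) y = hazard s y + hazard t (flow s y)"
  using pA_pos g_pos unfolding hazard_def flow_def
  by (simp add: field_simps exp_add[symmetric])

lemma hazard_DERIV: "((\<lambda>t. hazard t y) has_real_derivative p\<^sub>B * flow t y / g) (at t within S)"
  unfolding hazard_def flow_def using pA_pos g_pos
  by (auto intro!: derivative_eq_intros simp: field_simps)

lemma continuous_on_flow: "continuous_on S (\<lambda>t. flow t y)"
  using flow_DERIV by (rule DERIV_continuous_on)

lemma continuous_on_hazard: "continuous_on S (\<lambda>t. hazard t y)"
  using hazard_DERIV by (rule DERIV_continuous_on)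

lemma hazard_strict_mono:
  assumes "0 \<le> y" "0 \<le> s" "s < t" shows "hazard s y < hazard t y"
proof (rule DERIV_pos_imp_increasing_open[OF assms(3)])
  fix u assume "s < u" "u < t"
  hence "0 < p\<^sub>B * flow u y / g" using flow_pos[of y u] assms pB_pos g_pos by simp
  thus "\<exists>d. ((\<lambda>t. hazard t y) has_real_derivative d) (at u) \<and> 0 < d" using hazard_DERIV by blast
qed (rule continuous_on_hazard)

lemma hazard_mono: "0 \<le> y \<Longrightarrow> 0 \<le> s \<Longrightarrow> s \<le> t \<Longrightarrow> hazard s y \<le> hazard t y"
  using hazard_strict_mono[of y s t] by (cases "s = t") auto

lemma hazard_nonneg: "0 \<le> y \<Longrightarrow> 0 \<le> t \<Longrightarrow> 0 \<le> hazard t y"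
  using hazard_mono[of y 0 t] by simp

lemma hazard_le:
  assumes "y \<le> b" "rest_point \<le> b" "0 \<le> t" shows "hazard t y \<le> p\<^sub>B * b / g * t"
proof (cases "t = 0")
  case False
  have "\<exists>u. 0 < u \<and> u < t \<and> hazard t y - hazard 0 y = (t - 0) * (p\<^sub>B * flow u y / g)"
    by (rule MVT2) (use False assms hazard_DERIV in auto)
  then obtain u where u: "0 < u" "hazard t y = t * (p\<^sub>B * flow u y / g)" by auto
  have "p\<^sub>B * flow u y / g \<le> p\<^sub>B * b / g"
    using flow_le[OF assms(1,2), of u] u pB_pos g_pos by (intro divide_right_mono mult_left_mono) auto
  from mult_left_mono[OF this assms(3)] show ?thesis unfolding u(2) by (simp add: mult_ac)
qed simp

text \<open>The path approaches the positive equilibrium, so the integrated rate grows linearly and every clock rings.\<close>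
lemma hazard_unbounded:
  assumes "0 \<le> y" shows "\<exists>t\<ge>0. e \<le> hazard t y"
proof -
  have lb: "p\<^sub>B / g * (rest_point * t - rest_point / p\<^sub>A) \<le> hazard t y" if t: "0 \<le> t" for t
  proof -
    have x: "0 \<le> 1 - exp (- (p\<^sub>A * t))" "1 - exp (- (p\<^sub>A * t)) \<le> 1" using pA_pos t by auto
    have "- rest_point * 1 \<le> - rest_point * (1 - exp (- (p\<^sub>A * t)))" using rest_point_pos x by simp
    also have "\<dots> \<le> (y - rest_point) * (1 - exp (- (p\<^sub>A * t)))" using x assms by (intro mult_right_mono) auto
    finally have "- rest_point / p\<^sub>A \<le> (y - rest_point) * (1 - exp (- (p\<^sub>A * t))) / p\<^sub>A"
      using pA_pos by (intro divide_right_mono) auto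
    thus ?thesis unfolding hazard_def using pB_pos g_pos by (intro mult_left_mono) auto
  qed
  define t where "t = max 0 ((\<bar>e\<bar> * g / p\<^sub>B + rest_point / p\<^sub>A) / rest_point)"
  have t: "0 \<le> t" by (simp add: t_def)
  have "(\<bar>e\<bar> * g / p\<^sub>B + rest_point / p\<^sub>A) / rest_point \<le> t" by (simp add: t_def)
  hence "\<bar>e\<bar> * g / p\<^sub>B \<le> rest_point * t - rest_point / p\<^sub>A"
    using rest_point_pos by (simp add: pos_divide_le_eq mult.commute)
  hence "p\<^sub>B / g * (\<bar>e\<bar> * g / p\<^sub>B) \<le> p\<^sub>B / g * (rest_point * t - rest_point / p\<^sub>A)"
    using pB_pos g_pos by (intro mult_left_mono) auto
  hence "e \<le> hazard t y" using lb[OF t] pB_pos g_pos by simp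
  thus ?thesis using t by blast
qed

definition jump_time :: "real \<Rightarrow> real \<Rightarrow> real" where
  "jump_time y e = Inf {t. 0 \<le> t \<and> e \<le> hazard t y}"

lemma jump_time_attained:
  assumes y: "0 \<le> y" shows "0 \<le> jump_time y e" "e \<le> hazard (jump_time y e) y"
proof -
  let ?S = "{t. 0 \<le> t \<and> e \<le> hazard t y}"
  have "closed ({0..} \<inter> (\<lambda>t. hazard t y) -` {e..})"
    by (rule continuous_closed_preimage[OF continuous_on_hazard]) auto
  moreover have "{0..} \<inter> (\<lambda>t. hazard t y) -` {e..} = ?S" by auto
  ultimately have "Inf ?S \<in> ?S"
    using hazard_unbounded[OF y, of e] by (intro closed_contains_Inf) (auto intro!: bdd_belowI[of _ 0])
  thus "0 \<le> jump_time y e" "e \<le> hazard (jump_time y e) y" by (auto simp: jump_time_def)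
qed

text \<open>The defining property of the jump time: the clock \<open>e\<close> has not rung at time \<open>t\<close> if and only if the
  integrated rate is still below \<open>e\<close>.\<close>
lemma less_jump_time_iff:
  assumes y: "0 \<le> y" and t: "0 \<le> t" shows "t < jump_time y e \<longleftrightarrow> hazard t y < e"
proof
  assume "t < jump_time y e"
  moreover have "bdd_below {t. 0 \<le> t \<and> e \<le> hazard t y}" by (auto intro!: bdd_belowI[of _ 0])
  ultimately have "t \<notin> {t. 0 \<le> t \<and> e \<le> hazard t y}"
    unfolding jump_time_def using cInf_lower[of t "{t. 0 \<le> t \<and> e \<le> hazard t y}"] by linarith
  thus "hazard t y < e" using t by auto
next
  assume h: "hazard t y < e"
  show "t < jump_time y e"
  proof (rule ccontr)
    assume "\<not> t < jump_time y e"
    hence "hazard (jump_time y e) y \<le> hazard t y" using jump_time_attained(1)[OF y] y by (intro hazard_mono) auto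
    thus False using jump_time_attained(2)[OF y, of e] h by simp
  qed
qed

lemma hazard_jump_time:
  assumes y: "0 \<le> y" and e: "0 \<le> e" shows "hazard (jump_time y e) y = e"
proof (rule ccontr)
  assume "hazard (jump_time y e) y \<noteq> e"
  hence gt: "e < hazard (jump_time y e) y" using jump_time_attained(2)[OF y, of e] by simp
  have J: "0 \<le> jump_time y e" by (rule jump_time_attained(1)[OF y])
  have "\<exists>t\<ge>0. t \<le> jump_time y e \<and> hazard t y = e"
    by (rule IVT') (use gt e J continuous_on_hazard in auto)
  then obtain t where t: "0 \<le> t" "t \<le> jump_time y e" "hazard t y = e" by blast
  have "\<not> t < jump_time y e" using less_jump_time_iff[OF y t(1)] t(3) by simp
  hence "t = jump_time y e" using t(2) by simp
  thus False using t(3) gt by simp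
qed

text \<open>A clock that has not rung at time \<open>s\<close> continues with the remainder \<open>e - hazard s y\<close> from the state reached.\<close>
lemma jump_time_shift:
  assumes y: "0 \<le> y" and s: "0 \<le> s" and h: "hazard s y < e"
  shows "jump_time (flow s y) (e - hazard s y) = jump_time y e - s"
proof (rule ccontr)
  let ?a = "jump_time (flow s y) (e - hazard s y)" and ?b = "jump_time y e - s"
  assume ne: "?a \<noteq> ?b"
  have fy: "0 \<le> flow s y" by (rule flow_nonneg[OF y s])
  have nn: "0 \<le> ?a" "0 \<le> ?b" using jump_time_attained(1)[OF fy] less_jump_time_iff[OF y s, of e] h by auto
  have eq: "t < ?a \<longleftrightarrow> t < ?b" if t: "0 \<le> t" for t
  proof -
    have "t < ?a \<longleftrightarrow> hazard t (flow s y) < e - hazard s y" by (rule less_jump_time_iff[OF fy t])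
    also have "\<dots> \<longleftrightarrow> hazard (s + t) y < e" by (auto simp: hazard_add)
    also have "\<dots> \<longleftrightarrow> s + t < jump_time y e" using less_jump_time_iff[OF y, of "s + t" e] s t by simp
    finally show ?thesis by auto
  qed
  show False using eq[OF nn(1)] eq[OF nn(2)] ne by auto
qed

lemma flow_measurable [measurable]:
  assumes [measurable]: "t \<in> borel_measurable N" "y \<in> borel_measurable N"
  shows "(\<lambda>x. flow (t x) (y x)) \<in> borel_measurable N"
  unfolding flow_def by measurable

lemma hazard_measurable [measurable]:
  assumes [measurable]: "t \<in> borel_measurable N" "y \<in> borel_measurable N"
  shows "(\<lambda>x. hazard (t x) (y x)) \<in> borel_measurable N"
  unfolding hazard_def by measurable

lemma jump_time_measurable:
  assumes [measurable]: "y \<in> borel_measurable N" "e \<in> borel_measurable N"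
    and y: "\<And>x. x \<in> space N \<Longrightarrow> 0 \<le> y x"
  shows "(\<lambda>x. jump_time (y x) (e x)) \<in> borel_measurable N"
proof (rule borel_measurableI_greater)
  fix c :: real
  show "{x \<in> space N. c < jump_time (y x) (e x)} \<in> sets N"
  proof (cases "c < 0")
    case True
    hence "{x \<in> space N. c < jump_time (y x) (e x)} = space N"
      using jump_time_attained(1)[OF y] less_le_trans by blast
    thus ?thesis by simp
  next
    case False
    hence "{x \<in> space N. c < jump_time (y x) (e x)} = {x \<in> space N. hazard c (y x) < e x}"
      using less_jump_time_iff[OF y] by auto
    moreover have "{x \<in> space N. hazard c (y x) < e x} \<in> sets N" by measurable
    ultimately show ?thesis by simp
  qed
qed

text \<open>The path with at most \<open>k\<close> flow pieces; \<open>-1\<close> marks the times beyond them. The marker cannot be confused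
  with a state, and it makes the limit in \<open>k\<close> exist also for exploding paths.\<close>
primrec path_upto :: "nat \<Rightarrow> real \<Rightarrow> real stream \<Rightarrow> real \<Rightarrow> real" where
  "path_upto 0 y \<omega> t = - 1"
| "path_upto (Suc k) y \<omega> t = (if t < jump_time y (shd \<omega>) then flow t y
     else path_upto k (flow (jump_time y (shd \<omega>)) y + g) (stl \<omega>) (t - jump_time y (shd \<omega>)))"

abbreviation after_jump :: "real \<Rightarrow> real \<Rightarrow> real" where
  "after_jump y e \<equiv> flow (jump_time y e) y + g"

lemma after_jump_nonneg: "0 \<le> y \<Longrightarrow> 0 \<le> after_jump y e"
  using flow_nonneg jump_time_attained(1) g_pos by (simp add: add_nonneg_nonneg)

lemma path_upto_measurable:
  assumes "y \<in> borel_measurable N" "w \<in> N \<rightarrow>\<^sub>M stream_space borel" "t \<in> borel_measurable N"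
    and "\<And>x. x \<in> space N \<Longrightarrow> 0 \<le> y x"
  shows "(\<lambda>x. path_upto k (y x) (w x) (t x)) \<in> borel_measurable N"
  using assms
proof (induction k arbitrary: y w t)
  case (Suc k)
  note [measurable] = Suc.prems(1,2,3)
  have [measurable]: "(\<lambda>x. jump_time (y x) (shd (w x))) \<in> borel_measurable N"
    by (rule jump_time_measurable) (use Suc.prems(4) in auto)
  have [measurable]: "(\<lambda>x. path_upto k (after_jump (y x) (shd (w x))) (stl (w x)) (t x - jump_time (y x) (shd (w x)))) \<in> borel_measurable N"
    by (rule Suc.IH) (use Suc.prems(4) after_jump_nonneg in auto)
  show ?case by simp
qed simp

lemma path_upto_dead_or_nonneg:
  "0 \<le> y \<Longrightarrow> 0 \<le> t \<Longrightarrow> path_upto k y \<omega> t = - 1 \<or> 0 \<le> path_upto k y \<omega> t"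
proof (induction k arbitrary: y \<omega> t)
  case (Suc k)
  show ?case using Suc.IH[OF after_jump_nonneg[OF Suc.prems(1)], of "t - jump_time y (shd \<omega>)"] flow_nonneg[OF Suc.prems]
    by auto
qed simp

lemma path_upto_Suc: "0 \<le> path_upto k y \<omega> t \<Longrightarrow> path_upto (Suc k) y \<omega> t = path_upto k y \<omega> t"
proof (induction k arbitrary: y \<omega> t)
  case (Suc k)
  show ?case
  proof (cases "t < jump_time y (shd \<omega>)")
    case False
    with Suc.prems have "0 \<le> path_upto k (after_jump y (shd \<omega>)) (stl \<omega>) (t - jump_time y (shd \<omega>))" by simp
    from Suc.IH[OF this] False show ?thesis by simp
  qed simp
qed simp

lemma path_upto_add: "0 \<le> path_upto k y \<omega> t \<Longrightarrow> path_upto (k + n) y \<omega> t = path_upto k y \<omega> t"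
  by (induction n) (simp_all add: path_upto_Suc del: path_upto.simps)

lemma path_upto_alive_before:
  "0 \<le> y \<Longrightarrow> 0 \<le> s \<Longrightarrow> s \<le> t \<Longrightarrow> 0 \<le> path_upto k y \<omega> t \<Longrightarrow> 0 \<le> path_upto k y \<omega> s"
proof (induction k arbitrary: y \<omega> s t)
  case (Suc k)
  show ?case
  proof (cases "s < jump_time y (shd \<omega>)")
    case True
    thus ?thesis using flow_nonneg Suc.prems by simp
  next
    case False
    thus ?thesis using Suc.IH[OF after_jump_nonneg[OF Suc.prems(1)], of "s - jump_time y (shd \<omega>)" "t - jump_time y (shd \<omega>)"] Suc.prems
      by simp
  qed
qed simp

definition path :: "real \<Rightarrow> real stream \<Rightarrow> real \<Rightarrow> real" where
  "path y \<omega> t = lim (\<lambda>k. path_upto k y \<omega> t)"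

lemma path_eq_path_upto:
  assumes "0 \<le> path_upto k y \<omega> t"
  shows "(\<lambda>k. path_upto k y \<omega> t) \<longlonglongrightarrow> path y \<omega> t" "path y \<omega> t = path_upto k y \<omega> t"
proof -
  have "eventually (\<lambda>n. path_upto n y \<omega> t = path_upto k y \<omega> t) sequentially"
    unfolding eventually_sequentially using path_upto_add[OF assms] by (metis le_add_diff_inverse)
  hence l: "(\<lambda>n. path_upto n y \<omega> t) \<longlonglongrightarrow> path_upto k y \<omega> t" by (rule tendsto_eventually)
  thus e: "path y \<omega> t = path_upto k y \<omega> t" unfolding path_def by (rule limI)
  show "(\<lambda>k. path_upto k y \<omega> t) \<longlonglongrightarrow> path y \<omega> t" unfolding e by (rule l)
qed

lemma path_dead:
  assumes "\<And>k. path_upto k y \<omega> t = - 1"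
  shows "(\<lambda>k. path_upto k y \<omega> t) \<longlonglongrightarrow> path y \<omega> t" "path y \<omega> t = - 1"
proof -
  have l: "(\<lambda>n. path_upto n y \<omega> t) \<longlonglongrightarrow> - 1" unfolding assms by (rule tendsto_const)
  thus e: "path y \<omega> t = - 1" unfolding path_def by (rule limI)
  show "(\<lambda>k. path_upto k y \<omega> t) \<longlonglongrightarrow> path y \<omega> t" unfolding e by (rule l)
qed

lemma path_tendsto:
  assumes "0 \<le> y" "0 \<le> t" shows "(\<lambda>k. path_upto k y \<omega> t) \<longlonglongrightarrow> path y \<omega> t"
  using path_upto_dead_or_nonneg[OF assms] path_eq_path_upto(1) path_dead(1) by blast

lemma path_alive_iff:
  assumes "0 \<le> y" "0 \<le> t" shows "0 \<le> path y \<omega> t \<longleftrightarrow> (\<exists>k. 0 \<le> path_upto k y \<omega> t)"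
proof
  assume a: "0 \<le> path y \<omega> t"
  show "\<exists>k. 0 \<le> path_upto k y \<omega> t"
  proof (rule ccontr)
    assume "\<nexists>k. 0 \<le> path_upto k y \<omega> t"
    hence "path y \<omega> t = - 1" using path_upto_dead_or_nonneg[OF assms] by (intro path_dead(2)) blast
    thus False using a by simp
  qed
next
  assume "\<exists>k. 0 \<le> path_upto k y \<omega> t"
  then obtain k where "0 \<le> path_upto k y \<omega> t" ..
  thus "0 \<le> path y \<omega> t" using path_eq_path_upto(2) by simp
qed

lemma path_rec:
  assumes y: "0 \<le> y" and t: "0 \<le> t"
  shows "path y \<omega> t = (if t < jump_time y (shd \<omega>) then flow t y
     else path (after_jump y (shd \<omega>)) (stl \<omega>) (t - jump_time y (shd \<omega>)))"
proof -
  have 1: "(\<lambda>k. path_upto (Suc k) y \<omega> t) \<longlonglongrightarrow> path y \<omega> t"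
    by (rule LIMSEQ_Suc) (rule path_tendsto[OF assms])
  show ?thesis
  proof (cases "t < jump_time y (shd \<omega>)")
    case True
    hence "(\<lambda>k. path_upto (Suc k) y \<omega> t) \<longlonglongrightarrow> flow t y" by simp
    from LIMSEQ_unique[OF 1 this] True show ?thesis by simp
  next
    case False
    hence "0 \<le> t - jump_time y (shd \<omega>)" by simp
    from path_tendsto[OF after_jump_nonneg[OF y] this, of "shd \<omega>" "stl \<omega>"]
    have "(\<lambda>k. path_upto (Suc k) y \<omega> t) \<longlonglongrightarrow> path (after_jump y (shd \<omega>)) (stl \<omega>) (t - jump_time y (shd \<omega>))"
      using False by simp
    from LIMSEQ_unique[OF 1 this] False show ?thesis by simp
  qed
qed

lemma path_measurable:
  assumes "y \<in> borel_measurable N" "w \<in> N \<rightarrow>\<^sub>M stream_space borel" "t \<in> borel_measurable N"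
    and "\<And>x. x \<in> space N \<Longrightarrow> 0 \<le> y x"
  shows "(\<lambda>x. path (y x) (w x) (t x)) \<in> borel_measurable N"
  unfolding path_def
  by (rule borel_measurable_lim_metric, rule path_upto_measurable) (use assms in auto)

lemma path_alive_before:
  assumes "0 \<le> y" "0 \<le> s" "s \<le> t" "0 \<le> path y \<omega> t" shows "0 \<le> path y \<omega> s"
proof -
  have "0 \<le> t" using assms(2,3) by simp
  then obtain k where "0 \<le> path_upto k y \<omega> t" using path_alive_iff assms(1,4) by blast
  hence "0 \<le> path_upto k y \<omega> s" by (rule path_upto_alive_before[OF assms(1-3)])
  thus ?thesis using path_alive_iff assms(1,2) by blast
qed

lemma path_upto_shift:
  assumes y: "0 \<le> y" and s: "0 \<le> s" and h: "hazard s y < e"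
  shows "path_upto k y (e ## \<omega>) (s + r) = path_upto k (flow s y) ((e - hazard s y) ## \<omega>) r"
proof (cases k)
  case (Suc n)
  note J = jump_time_shift[OF y s h]
  have f: "flow (jump_time y e - s) (flow s y) = flow (jump_time y e) y"
    using flow_add[of s "jump_time y e - s" y] by simp
  have c: "s + r < jump_time y e \<longleftrightarrow> r < jump_time y e - s" by auto
  have d: "s + r - jump_time y e = r - (jump_time y e - s)" by simp
  show ?thesis unfolding Suc path_upto.simps stream.sel J f c d flow_add by (rule refl)
qed simp

lemma path_shift:
  assumes y: "0 \<le> y" and s: "0 \<le> s" and h: "hazard s y < e"
  shows "path y (e ## \<omega>) (s + r) = path (flow s y) ((e - hazard s y) ## \<omega>) r"
  unfolding path_def path_upto_shift[OF assms] by (rule refl)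

text \<open>Iterating the hypothesis bounds \<open>v\<close> by a multiple of the probability of many jumps before \<open>T\<close>. If \<open>y \<le> a * g\<close>, with
  the equilibrium below \<open>a * g\<close> too, the jump rate is at most \<open>p\<^sub>B * a\<close> until the next jump, after which the
  state is at most \<open>(a + 1) * g\<close>. With the weight \<open>exp (p\<^sub>B * t)\<close> the first jump contributes the factor
  \<open>a / (a + 1)\<close>, and the product \<open>a / (a + 1) * (a + 1) / (a + 2) * \<dots>\<close> telescopes to zero.\<close>
lemma renewal_zero:
  fixes v :: "real \<Rightarrow> real \<Rightarrow> ennreal"
  assumes C: "0 \<le> C" and bd: "\<And>y t. 0 \<le> y \<Longrightarrow> 0 \<le> t \<Longrightarrow> t \<le> T \<Longrightarrow> v y t \<le> ennreal C"
    and rec: "\<And>y t. 0 \<le> y \<Longrightarrow> 0 \<le> t \<Longrightarrow> t \<le> T \<Longrightarrow>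
      v y t \<le> (\<integral>\<^sup>+e. indicator {..hazard t y} e * v (after_jump y e) (t - jump_time y e) \<partial>exp_noise)"
    and y: "0 \<le> y" and t: "0 \<le> t" "t \<le> T"
  shows "v y t = 0"
proof -
  have claim: "v y t \<le> ennreal (C * exp (p\<^sub>B * t) * (a / (a + real k)))"
    if "0 < a" "rest_point \<le> a * g" "0 \<le> y" "y \<le> a * g" "0 \<le> t" "t \<le> T" for k a y t
    using that
  proof (induction k arbitrary: a y t)
    case 0
    have "C * 1 \<le> C * exp (p\<^sub>B * t)" using C 0 pB_pos by (intro mult_left_mono) auto
    thus ?case using bd[OF 0(3,5,6)] 0 by (auto intro: order_trans ennreal_leI)
  next
    case (Suc k)
    define D where "D = C * exp (p\<^sub>B * t) * ((a + 1) / (a + 1 + real k))"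
    have D: "0 \<le> D" using C Suc.prems by (simp add: D_def)
    have "v y t \<le> (\<integral>\<^sup>+e. indicator {..hazard t y} e * v (after_jump y e) (t - jump_time y e) \<partial>exp_noise)"
      by (rule rec) (use Suc.prems in auto)
    also have "\<dots> \<le> (\<integral>\<^sup>+e. ennreal D * ennreal (exp (- (1 / a * e))) \<partial>exp_noise)"
    proof (rule nn_integral_mono_AE)
      show "AE e in exp_noise. indicator {..hazard t y} e * v (after_jump y e) (t - jump_time y e)
        \<le> ennreal D * ennreal (exp (- (1 / a * e)))"
        using AE_exp_noise_pos
      proof eventually_elim
        case (elim e)
        show ?case
        proof (cases "e \<le> hazard t y")
          case True
          let ?J = "jump_time y e"
          have J: "0 \<le> ?J" "?J \<le> t"
            using jump_time_attained(1)[OF Suc.prems(3)] less_jump_time_iff[OF Suc.prems(3,5), of e] True by auto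
          have "flow ?J y \<le> a * g" by (rule flow_le[OF Suc.prems(4,2) J(1)])
          hence aj: "after_jump y e \<le> (a + 1) * g" by (simp add: algebra_simps)
          have "v (after_jump y e) (t - ?J) \<le> ennreal (C * exp (p\<^sub>B * (t - ?J)) * ((a + 1) / (a + 1 + real k)))"
            by (rule Suc.IH) (use Suc.prems J aj after_jump_nonneg g_pos in \<open>auto simp: algebra_simps\<close>)
          also have "\<dots> \<le> ennreal (D * exp (- (1 / a * e)))"
          proof (rule ennreal_leI)
            have "e = hazard ?J y" using hazard_jump_time[OF Suc.prems(3)] elim by simp
            also have "\<dots> \<le> p\<^sub>B * (a * g) / g * ?J" by (rule hazard_le[OF Suc.prems(4,2) J(1)])
            also have "\<dots> = a * (p\<^sub>B * ?J)" using g_pos by simp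
            finally have "1 / a * e \<le> p\<^sub>B * ?J" using Suc.prems by (simp add: field_simps)
            hence "exp (- (p\<^sub>B * ?J)) \<le> exp (- (1 / a * e))" by simp
            hence "D * exp (- (p\<^sub>B * ?J)) \<le> D * exp (- (1 / a * e))" by (rule mult_left_mono[OF _ D])
            moreover have "C * exp (p\<^sub>B * (t - ?J)) * ((a + 1) / (a + 1 + real k)) = D * exp (- (p\<^sub>B * ?J))"
              unfolding D_def right_diff_distrib exp_diff exp_minus by (simp add: field_simps)
            ultimately show "C * exp (p\<^sub>B * (t - ?J)) * ((a + 1) / (a + 1 + real k)) \<le> D * exp (- (1 / a * e))" by simp
          qed
          finally show ?thesis using True D by (simp add: ennreal_mult)
        qed simp
      qed
    qed
    also have "\<dots> = ennreal D * (\<integral>\<^sup>+e. ennreal (exp (- (1 / a * e))) \<partial>exp_noise)"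
      by (rule nn_integral_cmult) measurable
    also have "\<dots> = ennreal D * ennreal (1 / (1 + 1 / a))"
      using Suc.prems by (subst nn_integral_exp_noise_exp) auto
    also have "\<dots> = ennreal (D * (1 / (1 + 1 / a)))" using D Suc.prems by (intro ennreal_mult[symmetric]) auto
    also have "D * (1 / (1 + 1 / a)) = C * exp (p\<^sub>B * t) * (a / (a + real (Suc k)))"
    proof -
      have a1: "1 / (1 + 1 / a) = a / (a + 1)" using Suc.prems(1) by (simp add: field_simps)
      have "a + 1 \<noteq> 0" "a + real (Suc k) = a + 1 + real k" using Suc.prems(1) by auto
      hence "(a + 1) / (a + 1 + real k) * (1 / (1 + 1 / a)) = a / (a + real (Suc k))"
        unfolding a1 by simp
      thus ?thesis unfolding D_def mult.assoc by simp
    qed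
    finally show ?case .
  qed
  \<comment> \<open>large enough for both the starting point and the equilibrium\<close>
  define a where "a = max (max 1 (rest_point / g)) (y / g)"
  have a: "0 < a" "rest_point \<le> a * g" "y \<le> a * g"
  proof -
    show "0 < a" by (simp add: a_def less_max_iff_disj)
    have "rest_point / g \<le> a" "y / g \<le> a" by (auto simp: a_def)
    thus "rest_point \<le> a * g" "y \<le> a * g" using g_pos by (auto simp: pos_divide_le_eq)
  qed
  have "(\<lambda>k. C * exp (p\<^sub>B * t) * (a / (a + real k))) \<longlonglongrightarrow> C * exp (p\<^sub>B * t) * 0"
  proof (intro tendsto_mult tendsto_const)
    have "filterlim (\<lambda>k. a + real k) at_top sequentially"
      by (rule filterlim_tendsto_add_at_top[OF tendsto_const filterlim_real_sequentially])
    thus "(\<lambda>k. a / (a + real k)) \<longlonglongrightarrow> 0"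
      by (rule tendsto_divide_0[OF tendsto_const filterlim_at_top_imp_at_infinity])
  qed
  hence "(\<lambda>k. ennreal (C * exp (p\<^sub>B * t) * (a / (a + real k)))) \<longlonglongrightarrow> ennreal (C * exp (p\<^sub>B * t) * 0)"
    by (rule tendsto_ennrealI)
  hence "v y t \<le> ennreal (C * exp (p\<^sub>B * t) * 0)"
    by (rule LIMSEQ_le_const) (use claim[OF a(1,2) y a(3) t] in auto)
  thus ?thesis by simp
qed

end

section \<open>The Markov property and the transition function\<close>

context bandit_rates
begin

lemma path_measurable_noise:
  assumes "y \<in> borel_measurable N" "w \<in> N \<rightarrow>\<^sub>M noise" "t \<in> borel_measurable N"
    and "\<And>x. x \<in> space N \<Longrightarrow> 0 \<le> y x"
  shows "(\<lambda>x. path (y x) (w x) (t x)) \<in> borel_measurable N"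
proof (rule path_measurable)
  show "w \<in> N \<rightarrow>\<^sub>M stream_space borel" using assms(2) unfolding measurable_cong_sets[OF refl sets_noise] .
qed (use assms in auto)

lemma path_upto_measurable_noise [measurable]:
  assumes "0 \<le> y" shows "(\<lambda>\<omega>. path_upto k y \<omega> t) \<in> borel_measurable noise"
proof (rule path_upto_measurable)
  show "(\<lambda>\<omega>. \<omega>) \<in> noise \<rightarrow>\<^sub>M stream_space borel" by (rule measurable_ident_sets[OF sets_noise])
qed (use assms in auto)

text \<open>The probability of explosion before time \<open>t\<close> is its own average at the first jump.\<close>
lemma AE_path_alive:
  assumes "0 \<le> y" "0 \<le> t" shows "AE \<omega> in noise. 0 \<le> path y \<omega> t"
proof -
  define v where "v y t = (\<integral>\<^sup>+\<omega>. indicator {..<0} (path y \<omega> t) \<partial>noise)" for y t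
  have pm: "(\<lambda>\<omega>. path y \<omega> t) \<in> borel_measurable noise" if "0 \<le> y" for y t
    by (rule path_measurable_noise) (use that in auto)
  have "v y t = 0"
  proof (rule renewal_zero[where C=1 and T=t])
    show "v y t \<le> ennreal 1" for y t
    proof -
      have "v y t \<le> (\<integral>\<^sup>+\<omega>. 1 \<partial>noise)" unfolding v_def by (rule nn_integral_mono) (simp split: split_indicator)
      thus ?thesis using noise.emeasure_space_1 by simp
    qed
    fix y' t' :: real assume y': "0 \<le> y'" and t': "0 \<le> t'" "t' \<le> t"
    have [measurable]: "(\<lambda>\<omega>. path y' \<omega> t') \<in> borel_measurable noise" by (rule pm[OF y'])
    have "v y' t' = (\<integral>\<^sup>+e. \<integral>\<^sup>+\<omega>. indicator {..<0} (path y' (e ## \<omega>) t') \<partial>noise \<partial>exp_noise)"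
      unfolding v_def by (rule nn_integral_noise) measurable
    also have "\<dots> = (\<integral>\<^sup>+e. indicator {..hazard t' y'} e * v (after_jump y' e) (t' - jump_time y' e) \<partial>exp_noise)"
    proof (rule nn_integral_cong)
      fix e
      show "(\<integral>\<^sup>+\<omega>. indicator {..<0} (path y' (e ## \<omega>) t') \<partial>noise)
        = indicator {..hazard t' y'} e * v (after_jump y' e) (t' - jump_time y' e)"
      proof (cases "hazard t' y' < e")
        case True
        have p: "path y' (e ## \<omega>) t' = flow t' y'" for \<omega>
          using path_rec[OF y' t'(1), of "e ## \<omega>"] less_jump_time_iff[OF y' t'(1)] True by simp
        show ?thesis unfolding p using flow_nonneg[OF y' t'(1)] True by simp
      next
        case False
        have p: "path y' (e ## \<omega>) t' = path (after_jump y' e) \<omega> (t' - jump_time y' e)" for \<omega>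
          using path_rec[OF y' t'(1), of "e ## \<omega>"] less_jump_time_iff[OF y' t'(1)] False by simp
        show ?thesis unfolding p v_def using False by simp
      qed
    qed
    finally show "v y' t' \<le> (\<integral>\<^sup>+e. indicator {..hazard t' y'} e * v (after_jump y' e) (t' - jump_time y' e) \<partial>exp_noise)"
      by simp
  qed (use assms in auto)
  moreover have [measurable]: "(\<lambda>\<omega>. path y \<omega> t) \<in> borel_measurable noise" by (rule pm[OF assms(1)])
  ultimately have "AE \<omega> in noise. indicator {..<0} (path y \<omega> t) = (0::ennreal)"
    unfolding v_def by (subst (asm) nn_integral_0_iff_AE) auto
  thus ?thesis by eventually_elim (auto simp: indicator_def split: if_splits)
qed

text \<open>Explosions, a null event, are mapped to the state \<open>0\<close>, and negative times to time \<open>0\<close>, so that the values are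
  states for all arguments.\<close>
definition trajectory :: "real \<Rightarrow> real stream \<Rightarrow> real \<Rightarrow> real" where
  "trajectory y \<omega> t = max 0 (path y \<omega> (max 0 t))"

lemma trajectory_nonneg [simp]: "0 \<le> trajectory y \<omega> t" by (simp add: trajectory_def)

lemma trajectory_measurable:
  assumes [measurable]: "y \<in> borel_measurable N" "w \<in> N \<rightarrow>\<^sub>M noise" "t \<in> borel_measurable N"
    and "\<And>x. x \<in> space N \<Longrightarrow> 0 \<le> y x"
  shows "(\<lambda>x. trajectory (y x) (w x) (t x)) \<in> borel_measurable N"
proof -
  have [measurable]: "(\<lambda>x. path (y x) (w x) (max 0 (t x))) \<in> borel_measurable N"
    by (rule path_measurable_noise) (use assms in auto)
  show ?thesis unfolding trajectory_def by measurable
qed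

text \<open>The arguments are cut off at \<open>0\<close> to match \<open>trajectory\<close>, which is constant at negative times.\<close>
definition concat_path :: "real \<Rightarrow> (real \<Rightarrow> real) \<Rightarrow> (real \<Rightarrow> real) \<Rightarrow> real \<Rightarrow> real" where
  "concat_path \<tau> u w t = (if max 0 t < \<tau> then u (max 0 t) else w (max 0 t - \<tau>))"

definition stop_path :: "real \<Rightarrow> (real \<Rightarrow> real) \<Rightarrow> real \<Rightarrow> real" where
  "stop_path s w t = w (min s t)"

definition shift_path :: "real \<Rightarrow> (real \<Rightarrow> real) \<Rightarrow> real \<Rightarrow> real" where
  "shift_path s w t = w (s + max 0 t)"

lemma trajectory_Stream:
  assumes y: "0 \<le> y"
  shows "trajectory y (e ## \<omega>) = concat_path (jump_time y e) (\<lambda>t. flow t y) (trajectory (after_jump y e) \<omega>)"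
proof
  fix t :: real
  have t: "0 \<le> max 0 t" by simp
  show "trajectory y (e ## \<omega>) t = concat_path (jump_time y e) (\<lambda>t. flow t y) (trajectory (after_jump y e) \<omega>) t"
    unfolding trajectory_def concat_path_def path_rec[OF y t] stream.sel
    using flow_nonneg[OF y t] by (simp add: max_def)
qed

text \<open>Up to a time before the first jump the path is deterministic, and its continuation is a path of the same kind with
  the shortened first clock.\<close>
lemma trajectory_before_jump:
  assumes y: "0 \<le> y" and s: "0 \<le> s" and h: "hazard s y < e"
  shows "shift_path s (trajectory y (e ## \<omega>)) = trajectory (flow s y) ((e - hazard s y) ## \<omega>)"
    and "stop_path s (trajectory y (e ## \<omega>)) = (\<lambda>t. flow (max 0 (min s t)) y)"
    and "trajectory y (e ## \<omega>) s = flow s y"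
proof -
  have J: "s < jump_time y e" using less_jump_time_iff[OF y s] h by simp
  show "shift_path s (trajectory y (e ## \<omega>)) = trajectory (flow s y) ((e - hazard s y) ## \<omega>)"
  proof
    fix t show "shift_path s (trajectory y (e ## \<omega>)) t = trajectory (flow s y) ((e - hazard s y) ## \<omega>) t"
      unfolding shift_path_def trajectory_def using s path_shift[OF y s h, of \<omega> "max 0 t"] by (simp add: max_absorb2)
  qed
  show "stop_path s (trajectory y (e ## \<omega>)) = (\<lambda>t. flow (max 0 (min s t)) y)"
    using J s unfolding trajectory_Stream[OF y] stop_path_def concat_path_def by (auto simp: fun_eq_iff)
  show "trajectory y (e ## \<omega>) s = flow s y"
    using J s unfolding trajectory_Stream[OF y] concat_path_def by simp
qed

text \<open>Stopping and shifting at a time after the first jump commute with passing to the path after that jump.\<close>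
lemma trajectory_after_jump:
  assumes y: "0 \<le> y" and s: "0 \<le> s" and h: "e \<le> hazard s y"
  shows "shift_path s (trajectory y (e ## \<omega>)) = shift_path (s - jump_time y e) (trajectory (after_jump y e) \<omega>)"
    and "stop_path s (trajectory y (e ## \<omega>)) = concat_path (jump_time y e) (\<lambda>t. flow t y)
        (stop_path (s - jump_time y e) (trajectory (after_jump y e) \<omega>))"
    and "trajectory y (e ## \<omega>) s = trajectory (after_jump y e) \<omega> (s - jump_time y e)"
proof -
  have J: "jump_time y e \<le> s" using less_jump_time_iff[OF y s, of e] h by simp
  have J0: "0 \<le> jump_time y e" by (rule jump_time_attained(1)[OF y])
  show "shift_path s (trajectory y (e ## \<omega>)) = shift_path (s - jump_time y e) (trajectory (after_jump y e) \<omega>)"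
    using J s unfolding trajectory_Stream[OF y] shift_path_def concat_path_def
    by (auto simp: fun_eq_iff max_def algebra_simps)
  show "stop_path s (trajectory y (e ## \<omega>)) = concat_path (jump_time y e) (\<lambda>t. flow t y)
        (stop_path (s - jump_time y e) (trajectory (after_jump y e) \<omega>))"
  proof
    fix t
    have "max 0 (min s t) < jump_time y e \<longleftrightarrow> max 0 t < jump_time y e" using J s by auto
    moreover have "max 0 t < jump_time y e \<Longrightarrow> max 0 (min s t) = max 0 t" using J s by auto
    moreover have "max 0 (min s t) - jump_time y e = min (s - jump_time y e) (max 0 t - jump_time y e)"
      using s by (auto simp: max_def min_def)
    ultimately show "stop_path s (trajectory y (e ## \<omega>)) t = concat_path (jump_time y e) (\<lambda>t. flow t y)
        (stop_path (s - jump_time y e) (trajectory (after_jump y e) \<omega>)) t"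
      unfolding trajectory_Stream[OF y] stop_path_def concat_path_def by simp
  qed
  show "trajectory y (e ## \<omega>) s = trajectory (after_jump y e) \<omega> (s - jump_time y e)"
    using J s unfolding trajectory_Stream[OF y] concat_path_def by simp
qed

abbreviation path_space :: "(real \<Rightarrow> real) measure" where
  "path_space \<equiv> PiM UNIV (\<lambda>_. borel)"

lemma trajectory_in_path_space:
  assumes "0 \<le> y" shows "(\<lambda>\<omega>. trajectory y \<omega>) \<in> noise \<rightarrow>\<^sub>M path_space"
  by (rule measurable_abs_UNIV, rule trajectory_measurable) (use assms in auto)

lemma stop_path_measurable [measurable]: "stop_path s \<in> path_space \<rightarrow>\<^sub>M path_space"
  unfolding stop_path_def[abs_def] by (rule measurable_abs_UNIV) measurable

lemma concat_path_measurable [measurable]: "concat_path \<tau> u \<in> path_space \<rightarrow>\<^sub>M path_space"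
  unfolding concat_path_def[abs_def] by (rule measurable_abs_UNIV) measurable

lemma nn_integral_noise_split:
  assumes [measurable]: "f \<in> borel_measurable noise"
  shows "(\<integral>\<^sup>+\<omega>. f \<omega> \<partial>noise) = (\<integral>\<^sup>+e. indicator {c<..} e * (\<integral>\<^sup>+\<omega>. f (e ## \<omega>) \<partial>noise) \<partial>exp_noise)
    + (\<integral>\<^sup>+e. indicator {..c} e * (\<integral>\<^sup>+\<omega>. f (e ## \<omega>) \<partial>noise) \<partial>exp_noise)"
proof -
  have [measurable]: "(\<lambda>e. \<integral>\<^sup>+\<omega>. f (e ## \<omega>) \<partial>noise) \<in> borel_measurable exp_noise"
    by (rule noise.borel_measurable_nn_integral) measurable
  have "(\<integral>\<^sup>+\<omega>. f \<omega> \<partial>noise) = (\<integral>\<^sup>+e. indicator {c<..} e * (\<integral>\<^sup>+\<omega>. f (e ## \<omega>) \<partial>noise)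
    + indicator {..c} e * (\<integral>\<^sup>+\<omega>. f (e ## \<omega>) \<partial>noise) \<partial>exp_noise)"
    unfolding nn_integral_noise[OF assms] by (rule nn_integral_cong) (auto split: split_indicator)
  also have "\<dots> = (\<integral>\<^sup>+e. indicator {c<..} e * (\<integral>\<^sup>+\<omega>. f (e ## \<omega>) \<partial>noise) \<partial>exp_noise)
    + (\<integral>\<^sup>+e. indicator {..c} e * (\<integral>\<^sup>+\<omega>. f (e ## \<omega>) \<partial>noise) \<partial>exp_noise)"
    by (rule nn_integral_add) measurable
  finally show ?thesis .
qed

text \<open>The functionals of the future for which the Markov property holds. Measurability is required only along the constructed
  paths: time integrals qualify, although they are not measurable functions of all coordinates of an
  arbitrary path.\<close>
definition trajectory_functional :: "((real \<Rightarrow> real) \<Rightarrow> ennreal) \<Rightarrow> bool" where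
  "trajectory_functional F \<longleftrightarrow>
    (\<forall>s\<ge>0. (\<lambda>(y, \<omega>). F (shift_path s (trajectory y \<omega>))) \<in> borel_measurable (half_line \<Otimes>\<^sub>M noise))"

lemma shift_path_0 [simp]: "shift_path 0 (trajectory y \<omega>) = trajectory y \<omega>"
  by (simp add: shift_path_def trajectory_def fun_eq_iff)

lemma trajectory_functional_measurable:
  assumes F: "trajectory_functional F"
  shows "0 \<le> y \<Longrightarrow> 0 \<le> s \<Longrightarrow> (\<lambda>\<omega>. F (shift_path s (trajectory y \<omega>))) \<in> borel_measurable noise"
    and "0 \<le> y \<Longrightarrow> (\<lambda>\<omega>. F (trajectory y \<omega>)) \<in> borel_measurable noise"
    and "(\<lambda>y. \<integral>\<^sup>+\<omega>. F (trajectory y \<omega>) \<partial>noise) \<in> borel_measurable half_line"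
proof -
  have m: "(\<lambda>(y, \<omega>). F (shift_path s (trajectory y \<omega>))) \<in> borel_measurable (half_line \<Otimes>\<^sub>M noise)" if "0 \<le> s" for s
    using F that by (simp add: trajectory_functional_def)
  show 1: "(\<lambda>\<omega>. F (shift_path s (trajectory y \<omega>))) \<in> borel_measurable noise" if "0 \<le> y" "0 \<le> s" for y s
    using measurable_compose[OF measurable_Pair1'[of y half_line noise] m[OF that(2)]] that(1) by simp
  show "(\<lambda>\<omega>. F (trajectory y \<omega>)) \<in> borel_measurable noise" if "0 \<le> y" for y
    using 1[OF that order_refl] by simp
  show "(\<lambda>y. \<integral>\<^sup>+\<omega>. F (trajectory y \<omega>) \<partial>noise) \<in> borel_measurable half_line"
    by (rule noise.borel_measurable_nn_integral) (use m[OF order_refl] in simp)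
qed

lemma trajectory_half_line:
  assumes "0 \<le> y" shows "(\<lambda>\<omega>. trajectory y \<omega> t) \<in> noise \<rightarrow>\<^sub>M half_line"
  by (rule measurable_restrict_space2, force, rule trajectory_measurable) (use assms in auto)

lemma trajectory_at_measurable:
  assumes k: "k \<in> borel_measurable half_line" and y: "0 \<le> y"
  shows "(\<lambda>\<omega>. k (trajectory y \<omega> s)) \<in> borel_measurable noise"
proof (rule measurable_compose[OF _ k])
  show "(\<lambda>\<omega>. trajectory y \<omega> s) \<in> noise \<rightarrow>\<^sub>M half_line"
    by (rule trajectory_half_line[OF y])
qed

text \<open>Induction on \<open>k\<close> through the first clock \<open>e\<close>. If it rings after time \<open>s\<close>, the past is deterministic and the lack of
  memory restarts the clock. If it rings before, both sides are the same statement for the path after the jump,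
  with the first piece absorbed into the functional \<open>G\<close> of the past; this is why \<open>G\<close> is arbitrary.\<close>
lemma markov_upto:
  assumes y: "0 \<le> y" and s: "0 \<le> s" and G: "G \<in> borel_measurable path_space" and F: "trajectory_functional F"
  shows "(\<integral>\<^sup>+\<omega>. indicator {0..} (path_upto k y \<omega> s) * (G (stop_path s (trajectory y \<omega>)) * F (shift_path s (trajectory y \<omega>))) \<partial>noise)
    = (\<integral>\<^sup>+\<omega>. indicator {0..} (path_upto k y \<omega> s) * (G (stop_path s (trajectory y \<omega>)) * (\<integral>\<^sup>+\<omega>'. F (trajectory (trajectory y \<omega> s) \<omega>') \<partial>noise)) \<partial>noise)"
  using y s G
proof (induction k arbitrary: y s G)
  case (Suc k)
  note y = Suc.prems(1) and s = Suc.prems(2) and [measurable] = Suc.prems(3)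
  define \<Phi> where "\<Phi> z = (\<integral>\<^sup>+\<omega>'. F (trajectory z \<omega>') \<partial>noise)" for z
  define c where "c = hazard s y"
  define u where "u = (\<lambda>t. flow (max 0 (min s t)) y)"
  define L where "L \<omega> = indicator {0..} (path_upto (Suc k) y \<omega> s) * (G (stop_path s (trajectory y \<omega>)) * F (shift_path s (trajectory y \<omega>)))" for \<omega>
  define R where "R \<omega> = indicator {0..} (path_upto (Suc k) y \<omega> s) * (G (stop_path s (trajectory y \<omega>)) * \<Phi> (trajectory y \<omega> s))" for \<omega>
  note [measurable] = trajectory_in_path_space[OF y] path_upto_measurable_noise[OF y]
    trajectory_functional_measurable(1)[OF F y s]
  have [measurable]: "(\<lambda>\<omega>. \<Phi> (trajectory y \<omega> s)) \<in> borel_measurable noise"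
    unfolding \<Phi>_def by (rule trajectory_at_measurable[OF trajectory_functional_measurable(3)[OF F] y])
  have Lm: "L \<in> borel_measurable noise" unfolding L_def by measurable
  have Rm: "R \<in> borel_measurable noise" unfolding R_def by measurable
  have c0: "0 \<le> c" unfolding c_def by (rule hazard_nonneg[OF y s])
  have fy: "0 \<le> flow s y" by (rule flow_nonneg[OF y s])
  define K where "K e = (\<integral>\<^sup>+\<omega>. F (trajectory (flow s y) (e ## \<omega>)) \<partial>noise)" for e
  note [measurable] = trajectory_functional_measurable(2)[OF F fy]
  have Km [measurable]: "K \<in> borel_measurable borel"
  proof -
    have "K \<in> borel_measurable exp_noise"
      unfolding K_def by (rule noise.borel_measurable_nn_integral) measurable
    thus ?thesis by simp
  qed
  have KPhi: "(\<integral>\<^sup>+e. K e \<partial>exp_noise) = \<Phi> (flow s y)"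
    unfolding K_def \<Phi>_def by (rule nn_integral_noise[symmetric]) measurable
  have alive: "indicator {0..} (path_upto (Suc k) y (e ## \<omega>) s) = (1::ennreal)" if "c < e" for e \<omega>
    using that less_jump_time_iff[OF y s, of e] fy by (simp add: c_def)
  have L1: "(\<integral>\<^sup>+\<omega>. L (e ## \<omega>) \<partial>noise) = G u * K (e - c)" if e: "c < e" for e
  proof -
    have fy': "(\<lambda>\<omega>. F (trajectory (flow s y) ((e - hazard s y) ## \<omega>))) \<in> borel_measurable noise" by measurable
    have "L (e ## \<omega>) = G u * F (trajectory (flow s y) ((e - c) ## \<omega>))" for \<omega>
      unfolding L_def alive[OF e] u_def using trajectory_before_jump(1,2)[OF y s, of e \<omega>] e by (simp add: c_def)
    thus ?thesis unfolding K_def by (simp add: nn_integral_cmult fy'[folded c_def])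
  qed
  have R1: "(\<integral>\<^sup>+\<omega>. R (e ## \<omega>) \<partial>noise) = G u * \<Phi> (flow s y)" if e: "c < e" for e
  proof -
    have "R (e ## \<omega>) = G u * \<Phi> (flow s y)" for \<omega>
      unfolding R_def alive[OF e] u_def using trajectory_before_jump(2,3)[OF y s, of e \<omega>] e by (simp add: c_def)
    thus ?thesis using noise.emeasure_space_1 by simp
  qed
  have "(\<integral>\<^sup>+e. indicator {c<..} e * (\<integral>\<^sup>+\<omega>. L (e ## \<omega>) \<partial>noise) \<partial>exp_noise)
      = (\<integral>\<^sup>+e. indicator {c<..} e * (G u * K (e - c)) \<partial>exp_noise)"
    by (rule nn_integral_cong) (simp add: L1 split: split_indicator)
  also have "\<dots> = ennreal (exp (- c)) * (\<integral>\<^sup>+e. G u * K e \<partial>exp_noise)"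
    by (rule exp_noise_memoryless[of "\<lambda>e. G u * K e", OF _ c0]) measurable
  also have "\<dots> = ennreal (exp (- c)) * (G u * \<Phi> (flow s y))" by (simp add: nn_integral_cmult KPhi)
  finally have LL: "(\<integral>\<^sup>+e. indicator {c<..} e * (\<integral>\<^sup>+\<omega>. L (e ## \<omega>) \<partial>noise) \<partial>exp_noise)
    = ennreal (exp (- c)) * (G u * \<Phi> (flow s y))" .
  have "(\<integral>\<^sup>+e. indicator {c<..} e * (\<integral>\<^sup>+\<omega>. R (e ## \<omega>) \<partial>noise) \<partial>exp_noise)
      = (\<integral>\<^sup>+e. indicator {c<..} e * (G u * \<Phi> (flow s y)) \<partial>exp_noise)"
    by (rule nn_integral_cong) (simp add: R1 split: split_indicator)
  also have "\<dots> = ennreal (exp (- c)) * (\<integral>\<^sup>+e. G u * \<Phi> (flow s y) \<partial>exp_noise)"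
    by (rule exp_noise_memoryless[of "\<lambda>e. G u * \<Phi> (flow s y)", OF _ c0]) measurable
  also have "\<dots> = ennreal (exp (- c)) * (G u * \<Phi> (flow s y))"
    using exp_noise.emeasure_space_1 by simp
  finally have RR: "(\<integral>\<^sup>+e. indicator {c<..} e * (\<integral>\<^sup>+\<omega>. R (e ## \<omega>) \<partial>noise) \<partial>exp_noise)
    = ennreal (exp (- c)) * (G u * \<Phi> (flow s y))" .
  have "(\<integral>\<^sup>+\<omega>. L (e ## \<omega>) \<partial>noise) = (\<integral>\<^sup>+\<omega>. R (e ## \<omega>) \<partial>noise)" if e: "e \<le> c" for e
  proof -
    let ?J = "jump_time y e" and ?y = "after_jump y e"
    have nJ: "\<not> s < ?J" using less_jump_time_iff[OF y s, of e] e by (simp add: c_def)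
    have Gm: "(\<lambda>w. G (concat_path ?J (\<lambda>t. flow t y) w)) \<in> borel_measurable path_space" by measurable
    have A: "L (e ## \<omega>) = indicator {0..} (path_upto k ?y \<omega> (s - ?J)) *
        (G (concat_path ?J (\<lambda>t. flow t y) (stop_path (s - ?J) (trajectory ?y \<omega>))) * F (shift_path (s - ?J) (trajectory ?y \<omega>)))" for \<omega>
      unfolding L_def using trajectory_after_jump(1,2)[OF y s, of e \<omega>] e nJ by (simp add: c_def)
    have B: "R (e ## \<omega>) = indicator {0..} (path_upto k ?y \<omega> (s - ?J)) *
        (G (concat_path ?J (\<lambda>t. flow t y) (stop_path (s - ?J) (trajectory ?y \<omega>))) * \<Phi> (trajectory ?y \<omega> (s - ?J)))" for \<omega>
      unfolding R_def using trajectory_after_jump(2,3)[OF y s, of e \<omega>] e nJ by (simp add: c_def)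
    show ?thesis unfolding A B \<Phi>_def
      by (rule Suc.IH[OF after_jump_nonneg[OF y] _ Gm]) (use nJ in simp)
  qed
  hence "(\<integral>\<^sup>+e. indicator {..c} e * (\<integral>\<^sup>+\<omega>. L (e ## \<omega>) \<partial>noise) \<partial>exp_noise)
    = (\<integral>\<^sup>+e. indicator {..c} e * (\<integral>\<^sup>+\<omega>. R (e ## \<omega>) \<partial>noise) \<partial>exp_noise)"
    by (intro nn_integral_cong) (simp split: split_indicator)
  hence "(\<integral>\<^sup>+\<omega>. L \<omega> \<partial>noise) = (\<integral>\<^sup>+\<omega>. R \<omega> \<partial>noise)"
    unfolding nn_integral_noise_split[OF Lm, of c] nn_integral_noise_split[OF Rm, of c] LL RR by simp
  thus ?case unfolding L_def R_def \<Phi>_def .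
qed simp

text \<open>Almost every path has finitely many jumps before \<open>s\<close>.\<close>
lemma nn_integral_alive_SUP:
  assumes y: "0 \<le> y" and s: "0 \<le> s" and [measurable]: "f \<in> borel_measurable noise"
  shows "(\<integral>\<^sup>+\<omega>. f \<omega> \<partial>noise) = (SUP k. \<integral>\<^sup>+\<omega>. indicator {0..} (path_upto k y \<omega> s) * f \<omega> \<partial>noise)"
proof -
  note [measurable] = path_upto_measurable_noise[OF y]
  have "(\<integral>\<^sup>+\<omega>. f \<omega> \<partial>noise) = (\<integral>\<^sup>+\<omega>. (SUP k. indicator {0..} (path_upto k y \<omega> s) * f \<omega>) \<partial>noise)"
  proof (rule nn_integral_cong_AE)
    show "AE \<omega> in noise. f \<omega> = (SUP k. indicator {0..} (path_upto k y \<omega> s) * f \<omega>)"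
      using AE_path_alive[OF y s]
    proof eventually_elim
      case (elim \<omega>)
      then obtain k where k: "0 \<le> path_upto k y \<omega> s" using path_alive_iff[OF y s] by blast
      have "f \<omega> = indicator {0..} (path_upto k y \<omega> s) * f \<omega>" using k by simp
      also have "\<dots> \<le> (SUP k. indicator {0..} (path_upto k y \<omega> s) * f \<omega>)" by (rule SUP_upper) simp
      finally have "f \<omega> \<le> (SUP k. indicator {0..} (path_upto k y \<omega> s) * f \<omega>)" .
      moreover have "(SUP k. indicator {0..} (path_upto k y \<omega> s) * f \<omega>) \<le> f \<omega>"
        by (rule SUP_least) (simp split: split_indicator)
      ultimately show ?case by (rule antisym)
    qed
  qed
  also have "\<dots> = (SUP k. \<integral>\<^sup>+\<omega>. indicator {0..} (path_upto k y \<omega> s) * f \<omega> \<partial>noise)"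
  proof (rule nn_integral_monotone_convergence_SUP)
    show "incseq (\<lambda>k \<omega>. indicator {0..} (path_upto k y \<omega> s) * f \<omega>)"
    proof (rule incseq_SucI, rule le_funI)
      fix k \<omega> show "indicator {0..} (path_upto k y \<omega> s) * f \<omega> \<le> indicator {0..} (path_upto (Suc k) y \<omega> s) * f \<omega>"
        using path_upto_Suc[of k y \<omega> s] by (cases "0 \<le> path_upto k y \<omega> s") (simp_all del: path_upto.simps)
    qed
  qed measurable
  finally show ?thesis .
qed

theorem markov_property:
  assumes y: "0 \<le> y" and s: "0 \<le> s" and G: "G \<in> borel_measurable path_space" and F: "trajectory_functional F"
  shows "(\<integral>\<^sup>+\<omega>. G (stop_path s (trajectory y \<omega>)) * F (shift_path s (trajectory y \<omega>)) \<partial>noise)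
    = (\<integral>\<^sup>+\<omega>. G (stop_path s (trajectory y \<omega>)) * (\<integral>\<^sup>+\<omega>'. F (trajectory (trajectory y \<omega> s) \<omega>') \<partial>noise) \<partial>noise)"
proof -
  note [measurable] = G trajectory_in_path_space[OF y] trajectory_functional_measurable(1)[OF F y s]
    trajectory_at_measurable[OF trajectory_functional_measurable(3)[OF F] y]
  show ?thesis
    by (subst (1 2) nn_integral_alive_SUP[OF y s]) (measurable, simp only: markov_upto[OF assms])
qed

lemma AE_trajectory_start:
  assumes y: "0 \<le> y" shows "AE \<omega> in noise. trajectory y \<omega> 0 = y"
proof -
  have [measurable]: "(\<lambda>\<omega>. trajectory y \<omega> 0) \<in> borel_measurable noise"
    by (rule trajectory_measurable) (use y in auto)
  have "AE e in exp_noise. AE \<omega> in noise. trajectory y (e ## \<omega>) 0 = y"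
    using AE_exp_noise_pos
  proof eventually_elim
    case (elim e)
    show ?case using trajectory_before_jump(3)[OF y order_refl, of e] elim by simp
  qed
  moreover have "Measurable.pred (stream_space exp_noise) (\<lambda>\<omega>. trajectory y \<omega> 0 = y)"
    unfolding noise_def[symmetric] by measurable
  ultimately show ?thesis unfolding noise_def by (subst exp_noise.AE_stream_space) auto
qed

definition kernel :: "real \<Rightarrow> real \<Rightarrow> real measure" where
  "kernel t y = distr noise half_line (\<lambda>\<omega>. trajectory y \<omega> t)"

lemma kernel_measurable: "kernel t \<in> half_line \<rightarrow>\<^sub>M prob_algebra half_line"
  unfolding kernel_def
proof (rule measurable_distr_prob_space2)
  show "(\<lambda>_. noise) \<in> half_line \<rightarrow>\<^sub>M prob_algebra noise"
    by (rule measurable_const) (simp add: space_prob_algebra noise.prob_space_axioms)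
  show "(\<lambda>(y, \<omega>). trajectory y \<omega> t) \<in> half_line \<Otimes>\<^sub>M noise \<rightarrow>\<^sub>M half_line"
  proof (rule measurable_restrict_space2)
    have [measurable]: "fst \<in> borel_measurable (half_line \<Otimes>\<^sub>M noise)"
      by (rule measurable_compose[OF measurable_fst]) (rule borel_measurable_half_line, rule continuous_on_id)
    show "(\<lambda>(y, \<omega>). trajectory y \<omega> t) \<in> borel_measurable (half_line \<Otimes>\<^sub>M noise)"
      unfolding case_prod_beta by (rule trajectory_measurable) (auto simp: space_pair_measure)
  qed (auto simp: space_pair_measure)
qed

lemma trajectory_functional_at:
  assumes D: "D \<in> sets half_line" and t: "0 \<le> t"
  shows "trajectory_functional (\<lambda>w. indicator D (w t))"
  unfolding trajectory_functional_def
proof (intro allI impI)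
  fix s :: real
  have [measurable]: "fst \<in> borel_measurable (half_line \<Otimes>\<^sub>M noise)"
    by (rule measurable_compose[OF measurable_fst]) (rule borel_measurable_half_line, rule continuous_on_id)
  have "(\<lambda>x. trajectory (fst x) (snd x) (s + max 0 t)) \<in> half_line \<Otimes>\<^sub>M noise \<rightarrow>\<^sub>M half_line"
    by (rule measurable_restrict_space2, force, rule trajectory_measurable) (auto simp: space_pair_measure)
  from measurable_compose[OF this borel_measurable_indicator[OF D]]
  show "(\<lambda>(y, \<omega>). indicator D (shift_path s (trajectory y \<omega>) t) :: ennreal) \<in> borel_measurable (half_line \<Otimes>\<^sub>M noise)"
    unfolding shift_path_def case_prod_beta .
qed

lemma emeasure_kernel:
  assumes "0 \<le> y" "D \<in> sets half_line"
  shows "emeasure (kernel t y) D = (\<integral>\<^sup>+\<omega>. indicator D (trajectory y \<omega> t) \<partial>noise)"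
proof -
  have "emeasure (kernel t y) D = (\<integral>\<^sup>+z. indicator D z \<partial>kernel t y)" using assms(2) by (simp add: kernel_def)
  also have "\<dots> = (\<integral>\<^sup>+\<omega>. indicator D (trajectory y \<omega> t) \<partial>noise)"
    unfolding kernel_def by (rule nn_integral_distr[OF trajectory_half_line[OF assms(1)]]) (use assms(2) in measurable)
  finally show ?thesis .
qed

lemma transition_function_kernel: "transition_function half_line kernel"
  unfolding transition_function_def
proof (intro conjI allI impI ballI)
  show "kernel t \<in> half_line \<rightarrow>\<^sub>M prob_algebra half_line" for t by (rule kernel_measurable)
next
  fix y :: real assume "y \<in> space half_line" hence y: "0 \<le> y" by simp
  have "kernel 0 y = distr noise half_line (\<lambda>\<omega>. y)"
    unfolding kernel_def by (rule distr_cong_AE[OF refl refl AE_trajectory_start[OF y]])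
      (use trajectory_half_line[OF y] y in auto)
  also have "\<dots> = return half_line y" by (rule noise.distr_const) (use y in simp)
  finally show "kernel 0 y = return half_line y" .
next
  fix s t y :: real assume st: "0 \<le> s" "0 \<le> t" and "y \<in> space half_line" hence y: "0 \<le> y" by simp
  have kp: "prob_space (kernel s y)" unfolding kernel_def by (rule noise.prob_space_distr[OF trajectory_half_line[OF y]])
  have sk: "sets (kernel s y) = sets half_line" by (simp add: kernel_def)
  have km: "kernel t \<in> kernel s y \<rightarrow>\<^sub>M subprob_algebra half_line"
    using measurable_prob_algebraD[OF kernel_measurable] unfolding measurable_cong_sets[OF sk refl] .
  have ne: "space (kernel s y) \<noteq> {}" using sets_eq_imp_space_eq[OF sk] by auto
  show "kernel (s + t) y = kernel s y \<bind> kernel t"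
  proof (rule measure_eqI)
    show "sets (kernel (s + t) y) = sets (kernel s y \<bind> kernel t)"
      using sets_bind[OF sets_kernel[OF km] ne] by (simp add: kernel_def)
    fix D assume "D \<in> sets (kernel (s + t) y)"
    hence D: "D \<in> sets half_line" by (simp add: kernel_def)
    have em: "(\<lambda>z. emeasure (kernel t z) D) \<in> borel_measurable half_line"
      by (rule measurable_emeasure_kernel[OF measurable_prob_algebraD[OF kernel_measurable] D])
    have "emeasure (kernel s y \<bind> kernel t) D = (\<integral>\<^sup>+z. emeasure (kernel t z) D \<partial>kernel s y)"
      by (rule emeasure_bind[OF ne km D])
    also have "\<dots> = (\<integral>\<^sup>+\<omega>. emeasure (kernel t (trajectory y \<omega> s)) D \<partial>noise)"
      unfolding kernel_def[of s] by (rule nn_integral_distr[OF trajectory_half_line[OF y]]) (use em in simp)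
    also have "\<dots> = (\<integral>\<^sup>+\<omega>. (\<integral>\<^sup>+\<omega>'. indicator D (trajectory (trajectory y \<omega> s) \<omega>' t) \<partial>noise) \<partial>noise)"
      by (rule nn_integral_cong) (rule emeasure_kernel[OF trajectory_nonneg D])
    also have "\<dots> = (\<integral>\<^sup>+\<omega>. indicator D (shift_path s (trajectory y \<omega>) t) \<partial>noise)"
      using markov_property[OF y st(1) measurable_const[of 1] trajectory_functional_at[OF D st(2)]] by simp
    also have "\<dots> = emeasure (kernel (s + t) y) D"
      unfolding emeasure_kernel[OF y D] shift_path_def using st by simp
    finally show "emeasure (kernel (s + t) y) D = emeasure (kernel s y \<bind> kernel t) D" by simp
  qed
qed

end

section \<open>The Dynkin formula\<close>

text \<open>The first clock and the remaining ones are independent; in this form the stream law allows Bochner integrals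
  to be disintegrated.\<close>
lemma noise_eq_distr: "noise = distr (exp_noise \<Otimes>\<^sub>M noise) noise (\<lambda>(e, \<omega>). e ## \<omega>)"
proof (rule measure_eqI)
  fix X assume X: "X \<in> sets noise"
  have "emeasure noise X = (\<integral>\<^sup>+\<omega>. indicator X \<omega> \<partial>noise)" using X by simp
  also have "\<dots> = (\<integral>\<^sup>+e. (\<integral>\<^sup>+\<omega>. indicator X (e ## \<omega>) \<partial>noise) \<partial>exp_noise)"
    by (rule nn_integral_noise) (use X in measurable)
  also have "\<dots> = (\<integral>\<^sup>+z. indicator X (case z of (e, \<omega>) \<Rightarrow> e ## \<omega>) \<partial>(exp_noise \<Otimes>\<^sub>M noise))"
  proof -
    have [measurable]: "(\<lambda>z. indicator X (case z of (e, \<omega>) \<Rightarrow> e ## \<omega>) :: ennreal) \<in> borel_measurable (exp_noise \<Otimes>\<^sub>M noise)"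
      by (rule measurable_compose[OF Stream_noise_measurable borel_measurable_indicator[OF X]])
    show ?thesis by (subst noise.nn_integral_fst[symmetric]) simp_all
  qed
  also have "\<dots> = (\<integral>\<^sup>+\<omega>. indicator X \<omega> \<partial>distr (exp_noise \<Otimes>\<^sub>M noise) noise (\<lambda>(e, \<omega>). e ## \<omega>))"
    by (rule nn_integral_distr[symmetric, OF Stream_noise_measurable]) (use X in simp)
  also have "\<dots> = emeasure (distr (exp_noise \<Otimes>\<^sub>M noise) noise (\<lambda>(e, \<omega>). e ## \<omega>)) X" using X by simp
  finally show "emeasure noise X = emeasure (distr (exp_noise \<Otimes>\<^sub>M noise) noise (\<lambda>(e, \<omega>). e ## \<omega>)) X" .
qed simp

interpretation exp_noise_pair: pair_prob_space exp_noise noise ..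

lemma integral_noise:
  fixes f :: "real stream \<Rightarrow> real"
  assumes f [measurable]: "f \<in> borel_measurable noise" and bd: "\<And>\<omega>. \<bar>f \<omega>\<bar> \<le> C"
  shows "(LINT \<omega>|noise. f \<omega>) = (LINT e|exp_noise. (LINT \<omega>|noise. f (e ## \<omega>)))"
    and "integrable exp_noise (\<lambda>e. LINT \<omega>|noise. f (e ## \<omega>))"
proof -
  have m: "(\<lambda>z. f (case z of (e, \<omega>) \<Rightarrow> e ## \<omega>)) \<in> borel_measurable (exp_noise \<Otimes>\<^sub>M noise)"
    by (rule measurable_compose[OF Stream_noise_measurable f])
  have i: "integrable (exp_noise \<Otimes>\<^sub>M noise) (\<lambda>z. f (case z of (e, \<omega>) \<Rightarrow> e ## \<omega>))"
    by (rule exp_noise_pair.P.integrable_const_bound[OF _ m, of C]) (use bd in auto)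
  have "(LINT \<omega>|noise. f \<omega>) = (LINT z|(exp_noise \<Otimes>\<^sub>M noise). f (case z of (e, \<omega>) \<Rightarrow> e ## \<omega>))"
    by (subst noise_eq_distr) (rule integral_distr[OF Stream_noise_measurable f])
  also have "\<dots> = (LINT e|exp_noise. (LINT \<omega>|noise. f (e ## \<omega>)))"
    using exp_noise_pair.integral_fst'[OF i] by simp
  finally show "(LINT \<omega>|noise. f \<omega>) = (LINT e|exp_noise. (LINT \<omega>|noise. f (e ## \<omega>)))" .
  show "integrable exp_noise (\<lambda>e. LINT \<omega>|noise. f (e ## \<omega>))"
    using exp_noise_pair.integrable_fst'[OF i] by simp
qed

lemma exp_noise_tail: "0 \<le> c \<Longrightarrow> measure exp_noise {c<..} = exp (- c)"
  using exp_noise_memoryless[of "\<lambda>_. 1" c] exp_noise.emeasure_space_1 by (simp add: measure_def)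

lemma set_integrable_bounded:
  fixes h :: "real \<Rightarrow> real"
  assumes [measurable]: "h \<in> borel_measurable borel" and "\<And>r. a \<le> r \<Longrightarrow> r \<le> b \<Longrightarrow> \<bar>h r\<bar> \<le> B"
  shows "set_integrable lborel {a..b} h"
  unfolding set_integrable_def
  by (rule integrableI_bounded_set_indicator[where B=B]) (use assms(2) in \<open>auto simp: emeasure_lborel_Icc_eq\<close>)

context bandit_rates
begin

lemma trajectory_measurable_half_line:
  assumes "y \<in> borel_measurable N" "w \<in> N \<rightarrow>\<^sub>M noise" "t \<in> borel_measurable N"
    and "\<And>x. x \<in> space N \<Longrightarrow> 0 \<le> y x"
  shows "(\<lambda>x. trajectory (y x) (w x) (t x)) \<in> N \<rightarrow>\<^sub>M half_line"
  by (rule measurable_restrict_space2, force, rule trajectory_measurable) (use assms in auto)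

lemma time_integral_trajectory_measurable:
  fixes k :: "real \<Rightarrow> real"
  assumes k: "k \<in> borel_measurable half_line" and [measurable]: "y \<in> borel_measurable N" "w \<in> N \<rightarrow>\<^sub>M noise"
    and y: "\<And>x. x \<in> space N \<Longrightarrow> 0 \<le> y x"
  shows "(\<lambda>x. LINT r:{0..t}|lborel. k (trajectory (y x) (w x) (s + r))) \<in> borel_measurable N"
proof -
  have [measurable]: "(\<lambda>z. k (trajectory (y (fst z)) (w (fst z)) (s + snd z))) \<in> borel_measurable (N \<Otimes>\<^sub>M lborel)"
    by (rule measurable_compose[OF trajectory_measurable_half_line k]) (auto simp: space_pair_measure y)
  show ?thesis unfolding set_lebesgue_integral_def
    by (rule lborel.borel_measurable_lebesgue_integral) (simp add: case_prod_beta)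
qed

lemma trajectory_time_integrable:
  fixes k :: "real \<Rightarrow> real"
  assumes k: "k \<in> borel_measurable half_line" and bd: "\<And>z. 0 \<le> z \<Longrightarrow> \<bar>k z\<bar> \<le> B" and y: "0 \<le> y"
  shows "set_integrable lborel {a..b} (\<lambda>r. k (trajectory y \<omega> r))"
proof (rule set_integrable_bounded[where B=B])
  show "(\<lambda>r. k (trajectory y \<omega> r)) \<in> borel_measurable borel"
    by (rule measurable_compose[OF trajectory_measurable_half_line k]) (use y in auto)
qed (use bd in auto)

lemma time_integral_bound:
  fixes h :: "real \<Rightarrow> real"
  assumes "\<And>r. \<bar>h r\<bar> \<le> B" "0 \<le> t" "set_integrable lborel {0..t} h"
  shows "\<bar>LINT r:{0..t}|lborel. h r\<bar> \<le> B * t"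
proof -
  have "\<bar>LINT r:{0..t}|lborel. h r\<bar> \<le> (LINT r|lborel. \<bar>indicator {0..t} r *\<^sub>R h r\<bar>)"
    unfolding set_lebesgue_integral_def by (rule integral_abs_bound)
  also have "\<dots> \<le> (LINT r|lborel. indicator {0..t} r *\<^sub>R B)"
  proof (rule integral_mono)
    show "integrable lborel (\<lambda>r. \<bar>indicator {0..t} r *\<^sub>R h r\<bar>)"
      using assms(3) unfolding set_integrable_def by (rule integrable_abs)
    show "\<bar>indicator {0..t} r *\<^sub>R h r\<bar> \<le> indicator {0..t} r *\<^sub>R B" for r
      using assms(1)[of r] by (simp split: split_indicator)
  qed (use assms(2) in simp)
  also have "\<dots> = B * t" using assms(2) by simp
  finally show ?thesis .
qed

lemma jump_time_hazard:
  assumes y: "0 \<le> y" and r: "0 \<le> r" shows "jump_time y (hazard r y) = r"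
proof (rule antisym)
  show "jump_time y (hazard r y) \<le> r" using less_jump_time_iff[OF y r, of "hazard r y"] by simp
  show "r \<le> jump_time y (hazard r y)"
  proof (rule ccontr)
    assume "\<not> r \<le> jump_time y (hazard r y)"
    hence "hazard (jump_time y (hazard r y)) y < hazard r y"
      using hazard_strict_mono[OF y jump_time_attained(1)[OF y]] by simp
    thus False using jump_time_attained(2)[OF y, of "hazard r y"] by simp
  qed
qed

text \<open>Substitution \<open>e = hazard r y\<close>: the jump time has density \<open>exp (- hazard r y) * (p\<^sub>B * flow r y / g)\<close>.\<close>
lemma integral_jump_time:
  fixes k :: "real \<Rightarrow> real"
  assumes y: "0 \<le> y" and t: "0 \<le> t" and k: "continuous_on {0..t} k"
  shows "integrable exp_noise (\<lambda>e. indicator {..hazard t y} e * k (jump_time y e))"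
    and "(LINT e|exp_noise. indicator {..hazard t y} e * k (jump_time y e))
      = (LINT r:{0..t}|lborel. exp (- hazard r y) * k r * (p\<^sub>B * flow r y / g))"
proof -
  define c where "c = hazard t y"
  have c: "0 \<le> c" unfolding c_def by (rule hazard_nonneg[OF y t])
  \<comment> \<open>a Borel extension of \<open>k\<close>, which is only assumed continuous on \<open>[0, t]\<close>\<close>
  define kk where "kk r = k (max 0 (min t r))" for r
  have "continuous_on UNIV kk"
    unfolding kk_def by (rule continuous_on_compose2[OF k]) (use t in \<open>auto intro!: continuous_intros\<close>)
  hence [measurable]: "kk \<in> borel_measurable borel" by (rule borel_measurable_continuous_onI)
  obtain B where "\<forall>x\<in>k ` {0..t}. norm x \<le> B"
    using compact_imp_bounded[OF compact_continuous_image[OF k compact_Icc]] unfolding bounded_iff by blast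
  hence B: "\<And>r. r \<in> {0..t} \<Longrightarrow> \<bar>k r\<bar> \<le> B" by simp
  have kkB: "\<bar>kk r\<bar> \<le> B" for r unfolding kk_def by (rule B) (use t in auto)
  have [measurable]: "(\<lambda>e. jump_time y e) \<in> borel_measurable borel"
    by (rule jump_time_measurable) (use y in auto)
  have Jt: "kk (jump_time y e) = k (jump_time y e)" if "e \<le> c" for e
  proof -
    have "jump_time y e \<le> t" using less_jump_time_iff[OF y t, of e] that by (simp add: c_def)
    thus ?thesis using jump_time_attained(1)[OF y, of e] by (simp add: kk_def)
  qed
  have kk: "(\<lambda>e. indicator {..c} e * k (jump_time y e)) = (\<lambda>e. indicator {..c} e * kk (jump_time y e))"
    by (rule ext) (simp add: Jt split: split_indicator)
  have int: "integrable exp_noise (\<lambda>e. indicator {..c} e * kk (jump_time y e))"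
  proof (rule exp_noise.integrable_const_bound[where B=B])
    show "AE e in exp_noise. norm (indicator {..c} e * kk (jump_time y e)) \<le> B"
      by (rule AE_I2) (use kkB order_trans[OF abs_ge_zero kkB] in \<open>auto simp: indicator_def\<close>)
  qed measurable
  thus "integrable exp_noise (\<lambda>e. indicator {..hazard t y} e * k (jump_time y e))"
    unfolding c_def[symmetric] kk .
  have "(LINT e|exp_noise. indicator {..c} e * kk (jump_time y e))
     = (LINT e|lborel. exponential_density 1 e *\<^sub>R (indicator {..c} e * kk (jump_time y e)))"
    unfolding exp_noise_def by (rule integral_density) (auto simp: exponential_density_def)
  also have "\<dots> = (LINT e|lborel. (exp (- e) * kk (jump_time y e)) * indicator {hazard 0 y..hazard t y} e)"
    by (rule Bochner_Integration.integral_cong) (auto simp: exponential_density_def indicator_def c_def)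
  also have "\<dots> = (LINT r|lborel. (exp (- hazard r y) * kk (jump_time y (hazard r y))) * (p\<^sub>B * flow r y / g) * indicator {0..t} r)"
  proof (rule integral_substitution(2)[where g="\<lambda>r. hazard r y" and g'="\<lambda>r. p\<^sub>B * flow r y / g", OF _ hazard_DERIV _ _ t])
    show "set_integrable lborel {hazard 0 y..hazard t y} (\<lambda>e. exp (- e) * kk (jump_time y e))"
    proof (rule set_integrable_bounded[where B=B])
      fix e assume "hazard 0 y \<le> e" "e \<le> hazard t y"
      hence "0 \<le> e" by simp
      have "\<bar>exp (- e) * kk (jump_time y e)\<bar> \<le> 1 * B"
        unfolding abs_mult using kkB \<open>0 \<le> e\<close> by (intro mult_mono) auto
      thus "\<bar>exp (- e) * kk (jump_time y e)\<bar> \<le> B" by simp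
    qed measurable
    show "continuous_on {0..t} (\<lambda>r. p\<^sub>B * flow r y / g)" using g_pos by (intro continuous_intros continuous_on_flow) auto
    show "0 \<le> p\<^sub>B * flow r y / g" if "r \<in> {0..t}" for r
      using flow_nonneg[OF y, of r] that pB_pos g_pos by simp
  qed
  also have "\<dots> = (LINT r:{0..t}|lborel. exp (- hazard r y) * k r * (p\<^sub>B * flow r y / g))"
    unfolding set_lebesgue_integral_def
    by (rule Bochner_Integration.integral_cong[OF refl])
      (use y in \<open>auto simp: jump_time_hazard kk_def split: split_indicator\<close>)
  finally show "(LINT e|exp_noise. indicator {..hazard t y} e * k (jump_time y e))
      = (LINT r:{0..t}|lborel. exp (- hazard r y) * k r * (p\<^sub>B * flow r y / g))"
    unfolding c_def[symmetric] kk .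
qed

text \<open>The increment of the martingale of the martingale problem along the flow, without jumps.\<close>
definition flow_increment :: "(real \<Rightarrow> real) \<Rightarrow> real \<Rightarrow> real \<Rightarrow> real" where
  "flow_increment f y t = f (flow t y) - f y - (LINT r:{0..t}|lborel. generator f (flow r y))"

definition jump_increment :: "(real \<Rightarrow> real) \<Rightarrow> real \<Rightarrow> real \<Rightarrow> real" where
  "jump_increment f y t = f (flow t y + g) - f (flow t y)"

lemma flow_image_subset: "0 \<le> y \<Longrightarrow> (\<lambda>r. flow r y) ` {0..t} \<subseteq> {0..}"
  by (simp add: image_subset_iff flow_nonneg)

text \<open>Along the flow the transport part of the generator is the derivative of \<open>f\<close>, so only the jump part remains.\<close>
lemma flow_increment_derivative:
  assumes f: "f \<in> C1_compact_half_line" and y: "0 \<le> y" and r: "0 \<le> r" "r \<le> t"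
  shows "(flow_increment f y has_real_derivative - (p\<^sub>B * flow r y / g * jump_increment f y r)) (at r within {0..t})"
proof -
  obtain f' where cg: "continuous_on {0..} (generator f)"
    and f': "\<And>y. 0 \<le> y \<Longrightarrow> (f has_vector_derivative f' y) (at y within {0..})"
    and gf: "\<And>y. 0 \<le> y \<Longrightarrow> generator f y = p\<^sub>B * y * ((f (y + g) - f y) / g) + (1 - p\<^sub>A - p\<^sub>A * y) * f' y"
    by (rule C1_compact_half_line_facts[OF f], rule that)
  have fn: "0 \<le> flow r y" if "0 \<le> r" for r by (rule flow_nonneg[OF y that])
  have "(f has_real_derivative f' (flow r y)) (at (flow r y) within (\<lambda>r. flow r y) ` {0..t})"
    using f'[OF fn[OF r(1)]] unfolding has_real_derivative_iff_has_vector_derivative[symmetric]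
    by (rule has_field_derivative_subset[OF _ flow_image_subset[OF y]])
  from DERIV_image_chain[OF this flow_DERIV]
  have 1: "((\<lambda>r. f (flow r y)) has_real_derivative f' (flow r y) * (1 - p\<^sub>A - p\<^sub>A * flow r y)) (at r within {0..t})"
    by (simp add: o_def)
  have c: "continuous_on {0..t} (\<lambda>r. generator f (flow r y))"
    by (rule continuous_on_compose2[OF cg continuous_on_flow flow_image_subset[OF y]])
  have HK: "((\<lambda>u. integral {0..u} (\<lambda>r. generator f (flow r y))) has_real_derivative generator f (flow r y)) (at r within {0..t})"
    by (rule integral_has_real_derivative[OF c]) (use r in auto)
  have "integral {0..u} (\<lambda>r. generator f (flow r y)) = (LINT r:{0..u}|lborel. generator f (flow r y))"
    if u: "u \<in> {0..t}" for u
  proof -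
    have "set_integrable lborel {0..u} (\<lambda>r. generator f (flow r y))"
      by (rule borel_integrable_atLeastAtMost') (rule continuous_on_subset[OF c], use u in auto)
    from set_borel_integral_eq_integral(2)[OF this] show ?thesis by simp
  qed
  note I = this
  have 2: "((\<lambda>u. LINT r:{0..u}|lborel. generator f (flow r y)) has_real_derivative generator f (flow r y)) (at r within {0..t})"
    by (rule has_field_derivative_transform_within[OF HK zero_less_one]) (use r I in auto)
  have e: "f' (flow r y) * (1 - p\<^sub>A - p\<^sub>A * flow r y) - 0 - generator f (flow r y) = - (p\<^sub>B * flow r y / g * jump_increment f y r)"
    unfolding gf[OF fn[OF r(1)]] jump_increment_def by (simp add: mult.commute)
  show ?thesis unfolding flow_increment_def[abs_def] e[symmetric]
    by (rule DERIV_diff[OF DERIV_diff[OF 1 DERIV_const] 2])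
qed

text \<open>The mean of the martingale at the first jump or at time \<open>t\<close>, whichever comes first, is zero: the expected jump
  compensates the drift of the jump part. By the density of the jump time this is the fundamental theorem of calculus
  for \<open>exp (- hazard r y) * flow_increment f y r\<close>.\<close>
lemma flow_jump_balance:
  assumes f: "f \<in> C1_compact_half_line" and y: "0 \<le> y" and t: "0 \<le> t"
  defines "k \<equiv> (\<lambda>r. flow_increment f y r + jump_increment f y r)"
  shows "integrable exp_noise (\<lambda>e. if hazard t y < e then flow_increment f y t else k (jump_time y e))"
    and "(LINT e|exp_noise. (if hazard t y < e then flow_increment f y t else k (jump_time y e))) = 0"
proof -
  let ?d = "flow_increment f y" and ?H = "\<lambda>r. hazard r y"
  have cf: "continuous_on {0..} f" using C1_compact_half_line_facts[OF f] by metis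
  have c: "0 \<le> ?H t" by (rule hazard_nonneg[OF y t])
  have dc: "continuous_on {0..t} ?d"
    by (rule DERIV_continuous_on[OF flow_increment_derivative[OF f y]]) auto
  have jc: "continuous_on {0..t} (jump_increment f y)"
    unfolding jump_increment_def
  proof (rule continuous_on_diff)
    show "continuous_on {0..t} (\<lambda>r. f (flow r y + g))"
    proof (rule continuous_on_compose2[OF cf continuous_on_add[OF continuous_on_flow continuous_on_const]])
      show "(\<lambda>r. flow r y + g) ` {0..t} \<subseteq> {0..}"
        using g_pos flow_nonneg[OF y] by (simp add: image_subset_iff add_nonneg_nonneg)
    qed
    show "continuous_on {0..t} (\<lambda>r. f (flow r y))"
      by (rule continuous_on_compose2[OF cf continuous_on_flow flow_image_subset[OF y]])
  qed
  have kc: "continuous_on {0..t} k" unfolding k_def by (rule continuous_on_add[OF dc jc])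
  have "(LINT r:{0..0}|lborel. generator f (flow r y)) = 0"
    unfolding set_lebesgue_integral_def
  proof (rule integral_eq_zero_AE)
    show "AE r in lborel. indicator {0..0} r *\<^sub>R generator f (flow r y) = 0"
      using AE_lborel_singleton[of 0] by eventually_elim (simp split: split_indicator)
  qed
  hence d0: "?d 0 = 0" by (simp add: flow_increment_def)
  have "(LINT r:{0..t}|lborel. exp (- ?H r) * k r * (p\<^sub>B * flow r y / g)) = - (exp (- ?H t) * ?d t) - - (exp (- ?H 0) * ?d 0)"
    unfolding set_lebesgue_integral_def
  proof (rule integral_FTC_Icc[OF t])
    show "continuous_on {0..t} (\<lambda>r. exp (- ?H r) * k r * (p\<^sub>B * flow r y / g))"
      using g_pos by (intro continuous_intros kc continuous_on_flow continuous_on_hazard) auto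
    fix r assume r: "0 \<le> r" "r \<le> t"
    have "((\<lambda>r. exp (- ?H r)) has_real_derivative exp (- ?H r) * - (p\<^sub>B * flow r y / g)) (at r within {0..t})"
      by (rule DERIV_chain2[OF DERIV_exp DERIV_minus[OF hazard_DERIV]])
    from DERIV_minus[OF DERIV_mult[OF this flow_increment_derivative[OF f y r]]]
    have "((\<lambda>r. - (exp (- ?H r) * ?d r)) has_real_derivative
      - (exp (- ?H r) * - (p\<^sub>B * flow r y / g) * ?d r + - (p\<^sub>B * flow r y / g * jump_increment f y r) * exp (- ?H r))) (at r within {0..t})" .
    moreover have "- (exp (- ?H r) * - (p\<^sub>B * flow r y / g) * ?d r + - (p\<^sub>B * flow r y / g * jump_increment f y r) * exp (- ?H r))
      = exp (- ?H r) * k r * (p\<^sub>B * flow r y / g)"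
      unfolding k_def by (simp add: algebra_simps add_divide_distrib)
    ultimately show "((\<lambda>r. - (exp (- ?H r) * ?d r)) has_vector_derivative exp (- ?H r) * k r * (p\<^sub>B * flow r y / g)) (at r within {0..t})"
      unfolding has_real_derivative_iff_has_vector_derivative[symmetric] by metis
  qed
  hence J: "(LINT e|exp_noise. indicator {..?H t} e * k (jump_time y e)) = - (exp (- ?H t) * ?d t)"
    unfolding integral_jump_time(2)[OF y t kc] using d0 by simp
  note iJ = integral_jump_time(1)[OF y t kc]
  have iT: "integrable exp_noise (\<lambda>e. indicator {?H t<..} e * ?d t)"
    by (rule integrable_mult_left) (simp add: exp_noise.emeasure_eq_measure)
  have T: "(LINT e|exp_noise. indicator {?H t<..} e * ?d t) = exp (- ?H t) * ?d t"
    using exp_noise_tail[OF c] by simp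
  have e: "(\<lambda>e. if ?H t < e then ?d t else k (jump_time y e))
    = (\<lambda>e. indicator {?H t<..} e * ?d t + indicator {..?H t} e * k (jump_time y e))"
    by (rule ext) (auto split: split_indicator)
  show "integrable exp_noise (\<lambda>e. if ?H t < e then ?d t else k (jump_time y e))"
    unfolding e by (rule Bochner_Integration.integrable_add[OF iT iJ])
  show "(LINT e|exp_noise. (if ?H t < e then ?d t else k (jump_time y e))) = 0"
    unfolding e Bochner_Integration.integral_add[OF iT iJ] T J by simp
qed

definition increment :: "(real \<Rightarrow> real) \<Rightarrow> real \<Rightarrow> real \<Rightarrow> real stream \<Rightarrow> real" where
  "increment f y t \<omega> = f (trajectory y \<omega> t) - f y - (LINT r:{0..t}|lborel. generator f (trajectory y \<omega> r))"

lemma increment_before_jump: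
  assumes y: "0 \<le> y" and t: "0 \<le> t" and e: "hazard t y < e"
  shows "increment f y t (e ## \<omega>) = flow_increment f y t"
proof -
  have r: "trajectory y (e ## \<omega>) r = flow r y" if "0 \<le> r" "r \<le> t" for r
    by (rule trajectory_before_jump(3)[OF y that(1)]) (use hazard_mono[OF y that] e in simp)
  have "(LINT r:{0..t}|lborel. generator f (trajectory y (e ## \<omega>) r)) = (LINT r:{0..t}|lborel. generator f (flow r y))"
    by (rule set_lebesgue_integral_cong) (use r in auto)
  thus ?thesis unfolding increment_def flow_increment_def using r[OF t order_refl] by simp
qed

lemma increment_after_jump:
  assumes f: "f \<in> C1_compact_half_line" and y: "0 \<le> y" and t: "0 \<le> t" and e: "e \<le> hazard t y"
  shows "increment f y t (e ## \<omega>) = flow_increment f y (jump_time y e) + jump_increment f y (jump_time y e)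
    + increment f (after_jump y e) (t - jump_time y e) \<omega>"
proof -
  let ?J = "jump_time y e" and ?y = "after_jump y e" and ?L = "generator f"
  obtain f' B where cg: "continuous_on {0..} ?L" and B: "\<And>y. 0 \<le> y \<Longrightarrow> \<bar>?L y\<bar> \<le> B"
    using C1_compact_half_line_facts[OF f] by metis
  have J: "0 \<le> ?J" "?J \<le> t" using jump_time_attained(1)[OF y] less_jump_time_iff[OF y t, of e] e by auto
  have km: "?L \<in> borel_measurable half_line" by (rule borel_measurable_half_line[OF cg])
  note y1 = after_jump_nonneg[OF y, of e]
  have i1: "integrable lborel (\<lambda>r. indicator {0..?J} r *\<^sub>R ?L (flow r y))"
    using borel_integrable_atLeastAtMost'[OF continuous_on_compose2[OF cg continuous_on_flow flow_image_subset[OF y]]]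
    unfolding set_integrable_def .
  have i2: "integrable lborel (\<lambda>r. indicator {0..t - ?J} (- ?J + 1 * r) *\<^sub>R ?L (trajectory ?y \<omega> (- ?J + 1 * r)))"
    using trajectory_time_integrable[OF km B y1, of 0 "t - ?J" \<omega>] unfolding set_integrable_def
    by (intro lborel_integrable_real_affine) auto
  have "(LINT r:{0..t}|lborel. ?L (trajectory y (e ## \<omega>) r))
    = (LINT r|lborel. indicator {0..?J} r *\<^sub>R ?L (flow r y) + indicator {0..t - ?J} (- ?J + 1 * r) *\<^sub>R ?L (trajectory ?y \<omega> (- ?J + 1 * r)))"
    unfolding set_lebesgue_integral_def
  proof (rule integral_cong_AE)
    have [measurable]: "(\<lambda>r. ?L (trajectory y (e ## \<omega>) r)) \<in> borel_measurable borel"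
      by (rule measurable_compose[OF trajectory_measurable_half_line km]) (use y in auto)
    show "(\<lambda>r. indicator {0..t} r *\<^sub>R ?L (trajectory y (e ## \<omega>) r)) \<in> borel_measurable lborel" by measurable
    show "(\<lambda>r. indicator {0..?J} r *\<^sub>R ?L (flow r y) + indicator {0..t - ?J} (- ?J + 1 * r) *\<^sub>R ?L (trajectory ?y \<omega> (- ?J + 1 * r))) \<in> borel_measurable lborel"
      using i1 i2 by (intro borel_measurable_add borel_measurable_integrable)
    show "AE r in lborel. indicator {0..t} r *\<^sub>R ?L (trajectory y (e ## \<omega>) r)
      = indicator {0..?J} r *\<^sub>R ?L (flow r y) + indicator {0..t - ?J} (- ?J + 1 * r) *\<^sub>R ?L (trajectory ?y \<omega> (- ?J + 1 * r))"
      using AE_lborel_singleton[of ?J]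
    proof eventually_elim
      case (elim r)
      consider "r < 0" | "0 \<le> r" "r < ?J" | "?J < r" "r \<le> t" | "t < r" using elim by linarith
      thus ?case
      proof cases
        case 2
        thus ?thesis using J unfolding trajectory_Stream[OF y] concat_path_def by simp
      next
        case 3
        thus ?thesis using J unfolding trajectory_Stream[OF y] concat_path_def by simp
      qed (use J in auto)
    qed
  qed
  also have "\<dots> = (LINT r:{0..?J}|lborel. ?L (flow r y)) + (LINT r:{0..t - ?J}|lborel. ?L (trajectory ?y \<omega> r))"
    unfolding Bochner_Integration.integral_add[OF i1 i2] set_lebesgue_integral_def
    by (subst lborel_integral_real_affine[of 1 "\<lambda>r. indicator {0..t - ?J} r *\<^sub>R ?L (trajectory ?y \<omega> r)" "- ?J"]) simp_all
  finally show ?thesis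
    unfolding increment_def flow_increment_def jump_increment_def
    using trajectory_after_jump(3)[OF y t e] by simp
qed

lemma increment_measurable:
  assumes f: "f \<in> C1_compact_half_line" and y: "0 \<le> y"
  shows "increment f y t \<in> borel_measurable noise"
proof -
  have cf: "continuous_on {0..} f" and cg: "continuous_on {0..} (generator f)"
    using C1_compact_half_line_facts[OF f] by metis+
  have [measurable]: "(\<lambda>\<omega>. f (trajectory y \<omega> t)) \<in> borel_measurable noise"
    by (rule trajectory_at_measurable[OF borel_measurable_half_line[OF cf] y])
  have [measurable]: "(\<lambda>\<omega>. LINT r:{0..t}|lborel. generator f (trajectory y \<omega> r)) \<in> borel_measurable noise"
    using time_integral_trajectory_measurable[OF borel_measurable_half_line[OF cg], of "\<lambda>_. y" noise "\<lambda>\<omega>. \<omega>" t 0] y by simp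
  show ?thesis unfolding increment_def[abs_def] by measurable
qed

text \<open>Conditioning on the first clock splits the mean into the part up to the first jump, which is zero by
  \<open>flow_jump_balance\<close>, and the mean for the path after the jump. So the absolute value is dominated by its own
  average at the first jump.\<close>
theorem dynkin_formula:
  assumes f: "f \<in> C1_compact_half_line" and y: "0 \<le> y" and t: "0 \<le> t"
  shows "(LINT \<omega>|noise. increment f y t \<omega>) = 0"
proof -
  obtain f' B where cg: "continuous_on {0..} (generator f)"
    and B: "\<And>y. 0 \<le> y \<Longrightarrow> \<bar>f y\<bar> \<le> B" "\<And>y. 0 \<le> y \<Longrightarrow> \<bar>generator f y\<bar> \<le> B" "0 \<le> B"
    using C1_compact_half_line_facts[OF f] by metis
  define C where "C = 2 * B + B * t"
  have bd: "\<bar>increment f y s \<omega>\<bar> \<le> C" if "0 \<le> y" "0 \<le> s" "s \<le> t" for y s \<omega>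
  proof -
    have "\<bar>LINT r:{0..s}|lborel. generator f (trajectory y \<omega> r)\<bar> \<le> B * s"
      by (rule time_integral_bound[OF B(2)[OF trajectory_nonneg] that(2)
        trajectory_time_integrable[OF borel_measurable_half_line[OF cg] B(2) that(1)]])
    also have "\<dots> \<le> B * t" using that B(3) by (intro mult_left_mono)
    finally have "\<bar>LINT r:{0..s}|lborel. generator f (trajectory y \<omega> r)\<bar> \<le> B * t" .
    thus ?thesis using B(1)[OF that(1)] B(1)[OF trajectory_nonneg[of y \<omega> s]] unfolding increment_def C_def by linarith
  qed
  define m where "m y s = (LINT \<omega>|noise. increment f y s \<omega>)" for y s
  have "ennreal \<bar>m y t\<bar> = 0"
  proof (rule renewal_zero[where v="\<lambda>y s. ennreal \<bar>m y s\<bar>" and C=C and T=t])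
    show "0 \<le> C" using B(3) t by (simp add: C_def)
    fix y s :: real assume ys: "0 \<le> y" "0 \<le> s" "s \<le> t"
    note im = increment_measurable[OF f ys(1), of s]
    have ii: "integrable noise (increment f y s)"
      by (rule noise.integrable_const_bound[OF _ im, of C]) (use bd[OF ys] in auto)
    have "\<bar>m y s\<bar> \<le> (LINT \<omega>|noise. \<bar>increment f y s \<omega>\<bar>)" unfolding m_def by (rule integral_abs_bound)
    also have "\<dots> \<le> (LINT \<omega>|noise. C)"
      by (rule integral_mono) (use ii bd[OF ys] in auto)
    also have "\<dots> = C" using noise.prob_space by simp
    finally show "ennreal \<bar>m y s\<bar> \<le> ennreal C" by (rule ennreal_leI)
    \<comment> \<open>the part of the conditional mean given the first clock that is due to the path up to the first jump\<close>
    define det where "det e = (if hazard s y < e then flow_increment f y s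
      else flow_increment f y (jump_time y e) + jump_increment f y (jump_time y e))" for e
    define inner where "inner e = (LINT \<omega>|noise. increment f y s (e ## \<omega>))" for e
    have idet: "integrable exp_noise det" "(LINT e|exp_noise. det e) = 0"
      unfolding det_def using flow_jump_balance[OF f ys(1,2)] by auto
    have iin: "m y s = (LINT e|exp_noise. inner e)" "integrable exp_noise inner"
      unfolding m_def inner_def using integral_noise[OF im bd[OF ys]] by auto
    have diff: "inner e - det e = indicator {..hazard s y} e * m (after_jump y e) (s - jump_time y e)" for e
    proof (cases "hazard s y < e")
      case True
      thus ?thesis unfolding inner_def det_def using increment_before_jump[OF ys(1,2) True] noise.prob_space by simp
    next
      case False
      hence e: "e \<le> hazard s y" by simp
      let ?y = "after_jump y e" and ?s = "s - jump_time y e"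
      have y1: "0 \<le> ?y" by (rule after_jump_nonneg[OF ys(1)])
      have s1: "0 \<le> ?s" "?s \<le> t"
        using less_jump_time_iff[OF ys(1,2), of e] e jump_time_attained(1)[OF ys(1), of e] ys(3) by auto
      have i1: "integrable noise (increment f ?y ?s)"
        by (rule noise.integrable_const_bound[OF _ increment_measurable[OF f y1], where B=C]) (use bd[OF y1 s1] in auto)
      have "inner e = (flow_increment f y (jump_time y e) + jump_increment f y (jump_time y e)) + m ?y ?s"
        unfolding inner_def increment_after_jump[OF f ys(1,2) e] m_def
        using i1 noise.prob_space by simp
      thus ?thesis using False by (simp add: det_def)
    qed
    have eq: "m y s = (LINT e|exp_noise. inner e - det e)"
      unfolding iin(1) using Bochner_Integration.integral_diff[OF iin(2) idet(1)] idet(2) by simp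
    have "ennreal \<bar>m y s\<bar> \<le> (\<integral>\<^sup>+e. ennreal \<bar>inner e - det e\<bar> \<partial>exp_noise)"
      unfolding eq using integral_norm_bound_ennreal[OF Bochner_Integration.integrable_diff[OF iin(2) idet(1)]] by simp
    also have "\<dots> = (\<integral>\<^sup>+e. indicator {..hazard s y} e * ennreal \<bar>m (after_jump y e) (s - jump_time y e)\<bar> \<partial>exp_noise)"
      unfolding diff by (rule nn_integral_cong) (simp split: split_indicator)
    finally show "ennreal \<bar>m y s\<bar> \<le> (\<integral>\<^sup>+e. indicator {..hazard s y} e * ennreal \<bar>m (after_jump y e) (s - jump_time y e)\<bar> \<partial>exp_noise)" .
  qed (use y t in auto)
  thus ?thesis unfolding m_def by simp
qed

end

section \<open>Existence of the Markov process\<close>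

lemma time_integral_measurable:
  fixes Y :: "real \<Rightarrow> 'a \<Rightarrow> real"
  assumes "(\<lambda>(s, \<omega>). indicator {0..t} s * Y s \<omega>) \<in> borel_measurable (borel \<Otimes>\<^sub>M N)"
  shows "(\<lambda>\<omega>. LINT s:{0..t}|lborel. Y s \<omega>) \<in> borel_measurable N"
proof -
  have "(\<lambda>z. indicator {0..t} (snd z) * Y (snd z) (fst z)) \<in> borel_measurable (N \<Otimes>\<^sub>M borel)"
    using measurable_compose[OF measurable_pair_swap' assms] by (simp add: case_prod_beta)
  hence [measurable]: "(\<lambda>z. indicator {0..t} (snd z) * Y (snd z) (fst z)) \<in> borel_measurable (N \<Otimes>\<^sub>M lborel)"
    by simp
  show ?thesis unfolding set_lebesgue_integral_def
    by (rule lborel.borel_measurable_lebesgue_integral) (simp add: case_prod_beta)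
qed

lemma time_integral_split:
  fixes h :: "real \<Rightarrow> real"
  assumes h: "set_integrable lborel {0..t} h" and s: "0 \<le> s" "s \<le> t"
  shows "(LINT r:{0..t}|lborel. h r) = (LINT r:{0..s}|lborel. h r) + (LINT r:{0..t - s}|lborel. h (s + r))"
proof -
  have i1: "integrable lborel (\<lambda>r. indicator {0..s} r *\<^sub>R h r)"
    using set_integrable_subset[OF h, of "{0..s}"] s unfolding set_integrable_def by auto
  have i2: "integrable lborel (\<lambda>r. indicator {s..t} r *\<^sub>R h r)"
    using set_integrable_subset[OF h, of "{s..t}"] s unfolding set_integrable_def by auto
  have "(LINT r:{0..t}|lborel. h r) = (LINT r|lborel. indicator {0..s} r *\<^sub>R h r + indicator {s..t} r *\<^sub>R h r)"
    unfolding set_lebesgue_integral_def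
  proof (rule integral_cong_AE)
    show "AE r in lborel. indicator {0..t} r *\<^sub>R h r = indicator {0..s} r *\<^sub>R h r + indicator {s..t} r *\<^sub>R h r"
      using AE_lborel_singleton[of s] by eventually_elim (use s in \<open>auto simp: indicator_def\<close>)
    show "(\<lambda>r. indicator {0..t} r *\<^sub>R h r) \<in> borel_measurable lborel"
      using h unfolding set_integrable_def by (rule borel_measurable_integrable)
    show "(\<lambda>r. indicator {0..s} r *\<^sub>R h r + indicator {s..t} r *\<^sub>R h r) \<in> borel_measurable lborel"
      using i1 i2 by (intro borel_measurable_add borel_measurable_integrable)
  qed
  also have "\<dots> = (LINT r|lborel. indicator {0..s} r *\<^sub>R h r) + (LINT r|lborel. indicator {s..t} r *\<^sub>R h r)"
    by (rule Bochner_Integration.integral_add[OF i1 i2])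
  also have "(LINT r|lborel. indicator {s..t} r *\<^sub>R h r) = (LINT r|lborel. indicator {0..t - s} r *\<^sub>R h (s + r))"
    by (subst lborel_integral_real_affine[of 1 "\<lambda>r. indicator {s..t} r *\<^sub>R h r" s])
      (auto intro!: Bochner_Integration.integral_cong split: split_indicator)
  finally show ?thesis unfolding set_lebesgue_integral_def .
qed

lemma cadlag_path_compose_right_continuous:
  fixes k :: "real \<Rightarrow> real"
  assumes "cadlag w" "0 \<le> s" "\<And>t. 0 \<le> t \<Longrightarrow> 0 \<le> w t" "continuous_on {0..} k"
  shows "((\<lambda>s. k (w s)) \<longlongrightarrow> k (w s)) (at_right s)"
proof -
  have "(w \<longlongrightarrow> w s) (at_right s)" using assms(1,2) unfolding cadlag_def by blast
  moreover have "eventually (\<lambda>t. w t \<in> {0..}) (at_right s)"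
    using assms(2,3) by (auto simp: eventually_at_filter intro!: always_eventually)
  ultimately show ?thesis
    using continuous_on_tendsto_compose[OF assms(4)] assms(2,3) by auto
qed

context bandit_rates
begin

lemma flow_tendsto: "((\<lambda>r. flow r y) \<longlongrightarrow> flow t y) (at t within S)"
  using DERIV_continuous[OF flow_DERIV] unfolding continuous_within .

lemma concat_flow_right:
  assumes "0 \<le> t" "0 \<le> \<tau>" and w: "\<tau> \<le> t \<Longrightarrow> (w \<longlongrightarrow> w (t - \<tau>)) (at_right (t - \<tau>))"
  shows "(concat_path \<tau> (\<lambda>r. flow r y) w \<longlongrightarrow> concat_path \<tau> (\<lambda>r. flow r y) w t) (at_right t)"
proof (cases "t < \<tau>")
  case True
  have "eventually (\<lambda>r. flow r y = concat_path \<tau> (\<lambda>r. flow r y) w r) (at_right t)"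
    by (rule eventually_at_rightI[of t \<tau>]) (use True assms(1) in \<open>auto simp: concat_path_def\<close>)
  note ev = this
  have e: "concat_path \<tau> (\<lambda>r. flow r y) w t = flow t y" using True assms(1) by (simp add: concat_path_def)
  show ?thesis unfolding e by (rule Lim_transform_eventually[OF flow_tendsto ev])
next
  case False
  have "eventually (\<lambda>r. w (r - \<tau>) = concat_path \<tau> (\<lambda>r. flow r y) w r) (at_right t)"
    by (rule eventually_at_rightI[of t "t + 1"]) (use False assms(1,2) in \<open>auto simp: concat_path_def max_def\<close>)
  moreover have "((\<lambda>r. w (r - \<tau>)) \<longlongrightarrow> w (t - \<tau>)) (at_right t)"
  proof (rule filterlim_compose[OF w])
    have "eventually (\<lambda>r. r - \<tau> \<in> {t - \<tau><..} \<and> r - \<tau> \<noteq> t - \<tau>) (at_right t)"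
      by (rule eventually_at_rightI[of t "t + 1"]) auto
    moreover have "((\<lambda>r. r - \<tau>) \<longlongrightarrow> t - \<tau>) (at_right t)" by (intro tendsto_intros)
    ultimately show "filterlim (\<lambda>r. r - \<tau>) (at_right (t - \<tau>)) (at_right t)" unfolding filterlim_at by blast
  qed (use False in simp)
  ultimately have "(concat_path \<tau> (\<lambda>r. flow r y) w \<longlongrightarrow> w (t - \<tau>)) (at_right t)"
    by (rule Lim_transform_eventually[rotated])
  thus ?thesis using False assms(1) by (simp add: concat_path_def)
qed

lemma concat_flow_left:
  assumes "0 < t" "0 \<le> \<tau>" and w: "\<tau> < t \<Longrightarrow> \<exists>l. (w \<longlongrightarrow> l) (at_left (t - \<tau>))"
  shows "\<exists>l. (concat_path \<tau> (\<lambda>r. flow r y) w \<longlongrightarrow> l) (at_left t)"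
proof (cases "t \<le> \<tau>")
  case True
  have "eventually (\<lambda>r. flow r y = concat_path \<tau> (\<lambda>r. flow r y) w r) (at_left t)"
    by (rule eventually_at_leftI[of 0 t]) (use True assms(1) in \<open>auto simp: concat_path_def\<close>)
  from Lim_transform_eventually[OF flow_tendsto this] show ?thesis by blast
next
  case False
  then obtain l where l: "(w \<longlongrightarrow> l) (at_left (t - \<tau>))" using w by auto
  have "eventually (\<lambda>r. w (r - \<tau>) = concat_path \<tau> (\<lambda>r. flow r y) w r) (at_left t)"
    by (rule eventually_at_leftI[of \<tau> t]) (use False assms(1,2) in \<open>auto simp: concat_path_def max_def\<close>)
  moreover have "((\<lambda>r. w (r - \<tau>)) \<longlongrightarrow> l) (at_left t)"
  proof (rule filterlim_compose[OF l])
    have "eventually (\<lambda>r. r - \<tau> \<in> {..<t - \<tau>} \<and> r - \<tau> \<noteq> t - \<tau>) (at_left t)"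
      by (rule eventually_at_leftI[of "t - 1" t]) auto
    moreover have "((\<lambda>r. r - \<tau>) \<longlongrightarrow> t - \<tau>) (at_left t)" by (intro tendsto_intros)
    ultimately show "filterlim (\<lambda>r. r - \<tau>) (at_left (t - \<tau>)) (at_left t)" unfolding filterlim_at by blast
  qed
  ultimately have "(concat_path \<tau> (\<lambda>r. flow r y) w \<longlongrightarrow> l) (at_left t)"
    by (rule Lim_transform_eventually[rotated])
  thus ?thesis by blast
qed

text \<open>A path with finitely many pieces is a concatenation of flows; the time \<open>T\<close> lies within those pieces.\<close>
lemma trajectory_cadlag_upto:
  assumes "0 \<le> y" "0 \<le> path_upto k y \<omega> T"
  shows "0 \<le> t \<Longrightarrow> t < T \<Longrightarrow> (trajectory y \<omega> \<longlongrightarrow> trajectory y \<omega> t) (at_right t)"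
    and "0 < t \<Longrightarrow> t < T \<Longrightarrow> \<exists>l. (trajectory y \<omega> \<longlongrightarrow> l) (at_left t)"
proof -
  have "(0 \<le> t \<longrightarrow> t < T \<longrightarrow> (trajectory y \<omega> \<longlongrightarrow> trajectory y \<omega> t) (at_right t)) \<and>
    (0 < t \<longrightarrow> t < T \<longrightarrow> (\<exists>l. (trajectory y \<omega> \<longlongrightarrow> l) (at_left t)))"
    using assms
  proof (induction k arbitrary: y \<omega> T t)
    case (Suc k)
    let ?e = "shd \<omega>"
    let ?J = "jump_time y ?e" and ?w = "trajectory (after_jump y ?e) (stl \<omega>)"
    note y1 = after_jump_nonneg[OF Suc.prems(1), of ?e]
    have J: "0 \<le> ?J" by (rule jump_time_attained(1)[OF Suc.prems(1)])
    have tr: "trajectory y \<omega> = concat_path ?J (\<lambda>r. flow r y) ?w"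
      using trajectory_Stream[OF Suc.prems(1), of ?e "stl \<omega>"] by simp
    have al: "0 \<le> path_upto k (after_jump y ?e) (stl \<omega>) (T - ?J)" if "?J \<le> t" "t < T"
    proof -
      have "\<not> T < ?J" using that by simp
      thus ?thesis using Suc.prems(2) by simp
    qed
    show ?case unfolding tr
    proof (intro conjI impI)
      assume t: "0 \<le> t" "t < T"
      show "(concat_path ?J (\<lambda>r. flow r y) ?w \<longlongrightarrow> concat_path ?J (\<lambda>r. flow r y) ?w t) (at_right t)"
      proof (rule concat_flow_right[OF t(1) J])
        assume "?J \<le> t"
        thus "(?w \<longlongrightarrow> ?w (t - ?J)) (at_right (t - ?J))"
          using Suc.IH[OF y1 al, of "t - ?J"] t(2) by simp
      qed
    next
      assume t: "0 < t" "t < T"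
      show "\<exists>l. (concat_path ?J (\<lambda>r. flow r y) ?w \<longlongrightarrow> l) (at_left t)"
      proof (rule concat_flow_left[OF t(1) J])
        assume "?J < t"
        thus "\<exists>l. (?w \<longlongrightarrow> l) (at_left (t - ?J))"
          using Suc.IH[OF y1 al, of "t - ?J"] t(2) by simp
      qed
    qed
  qed simp
  thus "0 \<le> t \<Longrightarrow> t < T \<Longrightarrow> (trajectory y \<omega> \<longlongrightarrow> trajectory y \<omega> t) (at_right t)"
    and "0 < t \<Longrightarrow> t < T \<Longrightarrow> \<exists>l. (trajectory y \<omega> \<longlongrightarrow> l) (at_left t)" by blast+
qed

text \<open>Integer times suffice, because a path that is alive at some time was alive before.\<close>
definition immortal :: "real \<Rightarrow> real stream \<Rightarrow> bool" where
  "immortal y \<omega> \<longleftrightarrow> (\<forall>n::nat. 0 \<le> path y \<omega> (real n))"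

lemma AE_immortal: "0 \<le> y \<Longrightarrow> AE \<omega> in noise. immortal y \<omega>"
  unfolding immortal_def by (simp add: AE_all_countable AE_path_alive)

lemma trajectory_cadlag:
  assumes y: "0 \<le> y" and i: "immortal y \<omega>" shows "cadlag (trajectory y \<omega>)"
proof -
  have alive: "\<exists>k. 0 \<le> path_upto k y \<omega> (t + 1)" if t: "0 \<le> t" for t
  proof -
    obtain n :: nat where n: "t + 1 \<le> real n" using real_arch_simple by blast
    have "0 \<le> path y \<omega> (t + 1)"
      by (rule path_alive_before[OF y _ n]) (use t i in \<open>auto simp: immortal_def\<close>)
    thus ?thesis using path_alive_iff[OF y, of "t + 1" \<omega>] t by simp
  qed
  show ?thesis unfolding cadlag_def
  proof (intro conjI allI impI)
    fix t :: real assume t: "0 \<le> t"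
    obtain k where k: "0 \<le> path_upto k y \<omega> (t + 1)" using alive[OF t] ..
    show "(trajectory y \<omega> \<longlongrightarrow> trajectory y \<omega> t) (at_right t)"
      by (rule trajectory_cadlag_upto(1)[OF y k t]) simp
  next
    fix t :: real assume t: "0 < t"
    obtain k where k: "0 \<le> path_upto k y \<omega> (t + 1)" using alive t by force
    show "\<exists>l. (trajectory y \<omega> \<longlongrightarrow> l) (at_left t)"
      by (rule trajectory_cadlag_upto(2)[OF y k t]) simp
  qed
qed

text \<open>Replacing the trajectories with infinitely many jumps in finite time, a null set, by a
  constant makes every path cadlag.\<close>
definition safe_trajectory :: "real \<Rightarrow> real stream \<Rightarrow> real \<Rightarrow> real" where
  "safe_trajectory y \<omega> = (if immortal y \<omega> then trajectory y \<omega> else (\<lambda>_. 0))"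

lemma safe_trajectory_nonneg: "0 \<le> safe_trajectory y \<omega> t"
  by (simp add: safe_trajectory_def)

lemma cadlag_safe_trajectory: "0 \<le> y \<Longrightarrow> cadlag (safe_trajectory y \<omega>)"
  using trajectory_cadlag by (auto simp: safe_trajectory_def cadlag_def)

lemma AE_safe_trajectory: "0 \<le> y \<Longrightarrow> AE \<omega> in noise. safe_trajectory y \<omega> = trajectory y \<omega>"
  using AE_immortal by (rule AE_mp) (auto simp: safe_trajectory_def)

abbreviation cadlag_space :: "(real \<Rightarrow> real) measure" where
  "cadlag_space \<equiv> restrict_space path_space {w. cadlag w \<and> (\<forall>t. 0 \<le> w t)}"

definition law :: "real \<Rightarrow> (real \<Rightarrow> real) measure" where
  "law y = distr noise cadlag_space (safe_trajectory y)"

lemma safe_trajectory_measurable: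
  assumes y: "0 \<le> y" shows "safe_trajectory y \<in> noise \<rightarrow>\<^sub>M cadlag_space"
proof (rule measurable_restrict_space2)
  show "safe_trajectory y \<in> space noise \<rightarrow> {w. cadlag w \<and> (\<forall>t. 0 \<le> w t)}"
    using cadlag_safe_trajectory[OF y] safe_trajectory_nonneg by auto
  have [measurable]: "(\<lambda>\<omega>. path y \<omega> t) \<in> borel_measurable noise" for t
    by (rule path_measurable_noise) (use y in auto)
  have [measurable]: "Measurable.pred noise (immortal y)"
    unfolding immortal_def[abs_def] by measurable
  have [measurable]: "(\<lambda>\<omega>. trajectory y \<omega> t) \<in> borel_measurable noise" for t
    by (rule trajectory_measurable) (use y in auto)
  have "(\<lambda>\<omega>. \<lambda>t. if immortal y \<omega> then trajectory y \<omega> t else 0) \<in> noise \<rightarrow>\<^sub>M path_space"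
    by (rule measurable_abs_UNIV) measurable
  moreover have "(\<lambda>\<omega>. \<lambda>t. if immortal y \<omega> then trajectory y \<omega> t else 0) = safe_trajectory y"
    by (simp add: safe_trajectory_def fun_eq_iff)
  ultimately show "safe_trajectory y \<in> noise \<rightarrow>\<^sub>M path_space" by simp
qed

lemma space_law: "w \<in> space (law y) \<longleftrightarrow> cadlag w \<and> (\<forall>t. 0 \<le> w t)"
  by (auto simp: law_def space_restrict_space space_PiM)

lemma prob_space_law: "0 \<le> y \<Longrightarrow> prob_space (law y)"
  unfolding law_def by (rule noise.prob_space_distr[OF safe_trajectory_measurable])

lemma coordinate_measurable: "(\<lambda>w. w t) \<in> law y \<rightarrow>\<^sub>M half_line"
proof (rule measurable_restrict_space2)
  show "(\<lambda>w. w t) \<in> borel_measurable (law y)"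
    unfolding law_def measurable_distr_eq1 by (rule measurable_restrict_space1) measurable
qed (simp add: space_law)

lemma nn_integral_law:
  assumes y: "0 \<le> y" and h: "h \<in> borel_measurable (law y)"
  shows "(\<integral>\<^sup>+w. h w \<partial>law y) = (\<integral>\<^sup>+\<omega>. h (safe_trajectory y \<omega>) \<partial>noise)"
  unfolding law_def by (rule nn_integral_distr[OF safe_trajectory_measurable[OF y]])
    (use h in \<open>simp add: law_def\<close>)

abbreviation past :: "real \<Rightarrow> real \<Rightarrow> (real \<Rightarrow> real) measure" where
  "past y \<equiv> natural_filtration (law y) half_line (\<lambda>t w. w t)"

text \<open>An event of the natural filtration at time \<open>s\<close> is decided by the path stopped at \<open>s\<close>.\<close>
lemma past_event:
  assumes s: "0 \<le> s" and A: "A \<in> sets (past y s)"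
  obtains G :: "(real \<Rightarrow> real) \<Rightarrow> ennreal" where "G \<in> borel_measurable path_space"
    "\<And>w. w \<in> space (law y) \<Longrightarrow> indicator A w = G (stop_path s w)"
proof -
  have "(\<lambda>w. \<lambda>r\<in>{0..s}. w r) \<in> space (law y) \<rightarrow> space (PiM {0..s} (\<lambda>_. half_line))"
    by (auto simp: space_PiM space_law)
  then obtain D where D: "D \<in> sets (PiM {0..s} (\<lambda>_. half_line))"
    and AD: "A = (\<lambda>w. \<lambda>r\<in>{0..s}. w r) -` D \<inter> space (law y)"
    using A unfolding natural_filtration_def by (auto simp: sets_vimage_algebra2)
  have m: "(\<lambda>v. \<lambda>r\<in>{0..s}. max 0 (v r)) \<in> path_space \<rightarrow>\<^sub>M PiM {0..s} (\<lambda>_. half_line)"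
  proof (rule measurable_restrict)
    show "(\<lambda>v. max 0 (v r)) \<in> path_space \<rightarrow>\<^sub>M half_line" for r
      by (rule measurable_restrict_space2) auto
  qed
  show thesis
  proof (rule that)
    show "(\<lambda>v. indicator D (\<lambda>r\<in>{0..s}. max 0 (v r)) :: ennreal) \<in> borel_measurable path_space"
      by (rule measurable_compose[OF m borel_measurable_indicator[OF D]])
    fix w assume w: "w \<in> space (law y)"
    have "(\<lambda>r\<in>{0..s}. max 0 (stop_path s w r)) = (\<lambda>r\<in>{0..s}. w r)"
      using w s by (auto simp: stop_path_def space_law restrict_def fun_eq_iff min_absorb2 max_absorb2)
    thus "indicator A w = indicator D (\<lambda>r\<in>{0..s}. max 0 (stop_path s w r))"
      using w unfolding AD by (simp add: indicator_def)
  qed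
qed

lemma markov_property_law:
  assumes y: "0 \<le> y" and s: "0 \<le> s" and A: "A \<in> sets (past y s)" and F: "trajectory_functional F"
    and Fm: "(\<lambda>w. F (shift_path s w)) \<in> borel_measurable (law y)"
  shows "(\<integral>\<^sup>+w. indicator A w * F (shift_path s w) \<partial>law y)
    = (\<integral>\<^sup>+w. indicator A w * (\<integral>\<^sup>+\<omega>. F (trajectory (w s) \<omega>) \<partial>noise) \<partial>law y)"
proof -
  obtain G :: "(real \<Rightarrow> real) \<Rightarrow> ennreal" where G: "G \<in> borel_measurable path_space"
    and AG: "\<And>w. w \<in> space (law y) \<Longrightarrow> indicator A w = G (stop_path s w)"
    using past_event[OF s A] by blast
  have "A \<in> sets (law y)"
    using natural_filtration_subalgebra[of "\<lambda>t w. w t" "law y" half_line s] coordinate_measurable A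
    by (auto simp: subalgebra_def)
  hence [measurable]: "(\<lambda>w. indicator A w :: ennreal) \<in> borel_measurable (law y)" by (rule borel_measurable_indicator)
  note [measurable] = Fm measurable_compose[OF coordinate_measurable trajectory_functional_measurable(3)[OF F], of s y]
  have AG': "indicator A (safe_trajectory y \<omega>) = G (stop_path s (safe_trajectory y \<omega>))" for \<omega>
    by (rule AG) (simp add: space_law cadlag_safe_trajectory[OF y] safe_trajectory_nonneg)
  have "(\<integral>\<^sup>+w. indicator A w * F (shift_path s w) \<partial>law y)
    = (\<integral>\<^sup>+\<omega>. indicator A (safe_trajectory y \<omega>) * F (shift_path s (safe_trajectory y \<omega>)) \<partial>noise)"
    by (rule nn_integral_law[OF y]) measurable
  also have "\<dots> = (\<integral>\<^sup>+\<omega>. G (stop_path s (trajectory y \<omega>)) * F (shift_path s (trajectory y \<omega>)) \<partial>noise)"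
    unfolding AG' by (rule nn_integral_cong_AE) (use AE_safe_trajectory[OF y] in \<open>eventually_elim, simp\<close>)
  also have "\<dots> = (\<integral>\<^sup>+\<omega>. G (stop_path s (trajectory y \<omega>)) * (\<integral>\<^sup>+\<omega>'. F (trajectory (trajectory y \<omega> s) \<omega>') \<partial>noise) \<partial>noise)"
    by (rule markov_property[OF y s G F])
  also have "\<dots> = (\<integral>\<^sup>+\<omega>. indicator A (safe_trajectory y \<omega>) * (\<integral>\<^sup>+\<omega>'. F (trajectory (safe_trajectory y \<omega> s) \<omega>') \<partial>noise) \<partial>noise)"
    unfolding AG' by (rule nn_integral_cong_AE) (use AE_safe_trajectory[OF y] in \<open>eventually_elim, simp\<close>)
  also have "\<dots> = (\<integral>\<^sup>+w. indicator A w * (\<integral>\<^sup>+\<omega>. F (trajectory (w s) \<omega>) \<partial>noise) \<partial>law y)"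
    by (rule nn_integral_law[OF y, symmetric]) measurable
  finally show ?thesis .
qed

lemma past_sets: "A \<in> sets (past y s) \<Longrightarrow> A \<in> sets (law y)"
  using natural_filtration_subalgebra[of "\<lambda>t w. w t" "law y" half_line s] coordinate_measurable
  by (auto simp: subalgebra_def)

lemma space_past [simp]: "space (past y s) = space (law y)"
  by (simp add: natural_filtration_def)

lemma markov_process_law:
  assumes y: "0 \<le> y" shows "markov_process (law y) half_line kernel (\<lambda>t w. w t)"
  unfolding markov_process_def
proof (intro conjI allI impI ballI)
  show "(\<lambda>w. w t) \<in> law y \<rightarrow>\<^sub>M half_line" for t by (rule coordinate_measurable)
next
  fix s t :: real and D assume s: "0 \<le> s" and t: "0 \<le> t" and D: "D \<in> sets half_line"
  interpret law: prob_space "law y" by (rule prob_space_law[OF y])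
  interpret sub: sigma_finite_subalgebra "law y" "past y s"
    by (rule natural_filtration_sigma_finite[OF prob_space_law[OF y] coordinate_measurable])
  have km: "(\<lambda>z. measure (kernel t z) D) \<in> borel_measurable half_line"
    unfolding measure_def
    by (rule measurable_compose[OF measurable_emeasure_kernel[OF measurable_prob_algebraD[OF kernel_measurable] D]]) measurable
  have f_m [measurable]: "(indicator {w. w (s + t) \<in> D} :: _ \<Rightarrow> real) \<in> borel_measurable (law y)"
  proof -
    have "(\<lambda>w. indicator D (w (s + t)) :: real) \<in> borel_measurable (law y)"
      by (rule measurable_compose[OF coordinate_measurable borel_measurable_indicator[OF D]])
    moreover have "(\<lambda>w. indicator D (w (s + t)) :: real) = indicator {w. w (s + t) \<in> D}"
      by (auto simp: indicator_def)
    ultimately show ?thesis by simp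
  qed
  have g_m [measurable]: "(\<lambda>w. measure (kernel t (w s)) D) \<in> borel_measurable (law y)"
    by (rule measurable_compose[OF coordinate_measurable km])
  have k1: "prob_space (kernel t z)" if "0 \<le> z" for z
    unfolding kernel_def by (rule noise.prob_space_distr[OF trajectory_half_line[OF that]])
  show "AE w in law y. real_cond_exp (law y) (past y s) (indicator {w. w (s + t) \<in> D}) w = measure (kernel t (w s)) D"
  proof (rule sub.real_cond_exp_charact)
    show "integrable (law y) (indicator {w. w (s + t) \<in> D} :: _ \<Rightarrow> real)"
      by (rule law.integrable_const_bound[where B=1]) (auto simp: indicator_def)
    show "integrable (law y) (\<lambda>w. measure (kernel t (w s)) D)"
      by (rule law.integrable_const_bound[where B=1])
        (auto intro!: AE_I2 prob_space.prob_le_1 k1 simp: space_law)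
    show "(\<lambda>w. measure (kernel t (w s)) D) \<in> borel_measurable (past y s)"
      by (rule measurable_compose[OF natural_filtration_measurable km]) (use coordinate_measurable s in auto)
    fix A assume A: "A \<in> sets (past y s)"
    have [measurable]: "A \<in> sets (law y)" by (rule past_sets[OF A])
    have "(\<integral>\<^sup>+w. ennreal (indicator A w * indicator {w. w (s + t) \<in> D} w) \<partial>law y)
      = (\<integral>\<^sup>+w. indicator A w * indicator D (shift_path s w t) \<partial>law y)"
      by (rule nn_integral_cong) (use t in \<open>auto simp: indicator_def shift_path_def\<close>)
    also have "\<dots> = (\<integral>\<^sup>+w. indicator A w * (\<integral>\<^sup>+\<omega>. indicator D (trajectory (w s) \<omega> t) \<partial>noise) \<partial>law y)"
    proof (rule markov_property_law[OF y s A trajectory_functional_at[OF D t]])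
      show "(\<lambda>w. indicator D (shift_path s w t) :: ennreal) \<in> borel_measurable (law y)"
        unfolding shift_path_def by (rule measurable_compose[OF coordinate_measurable borel_measurable_indicator[OF D]])
    qed
    also have "\<dots> = (\<integral>\<^sup>+w. ennreal (indicator A w * measure (kernel t (w s)) D) \<partial>law y)"
    proof (rule nn_integral_cong)
      fix w assume "w \<in> space (law y)"
      hence ws: "0 \<le> w s" by (simp add: space_law)
      interpret k: prob_space "kernel t (w s)" by (rule k1[OF ws])
      show "indicator A w * (\<integral>\<^sup>+\<omega>. indicator D (trajectory (w s) \<omega> t) \<partial>noise) = ennreal (indicator A w * measure (kernel t (w s)) D)"
        unfolding emeasure_kernel[OF ws D, symmetric] k.emeasure_eq_measure by (simp split: split_indicator)
    qed
    finally have e: "(\<integral>\<^sup>+w. ennreal (indicator A w * indicator {w. w (s + t) \<in> D} w) \<partial>law y)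
      = (\<integral>\<^sup>+w. ennreal (indicator A w * measure (kernel t (w s)) D) \<partial>law y)" .
    show "(LINT w:A|law y. indicator {w. w (s + t) \<in> D} w) = (LINT w:A|law y. measure (kernel t (w s)) D)"
      unfolding set_lebesgue_integral_def real_scaleR_def
      by (subst (1 2) integral_eq_nn_integral) (auto simp: e)
  qed
qed

text \<open>The increment after time \<open>s\<close> is a functional of the shifted path, and by the Markov property its conditional mean is the
  one given by Dynkin's formula, zero. Since the Markov property is available for nonnegative functionals, a constant
  \<open>b\<close> is added.\<close>
lemma C1_martingale:
  assumes y: "0 \<le> y" and f: "f \<in> C1_compact_half_line"
  shows "martingale_wrt (law y) (past y) (\<lambda>t w. f (w t) - f (w 0) - (LINT s:{0..t}|lborel. generator f (w s)))"
proof -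
  obtain f' B where cf: "continuous_on {0..} f" and cg: "continuous_on {0..} (generator f)"
    and B: "\<And>y. 0 \<le> y \<Longrightarrow> \<bar>f y\<bar> \<le> B" "\<And>y. 0 \<le> y \<Longrightarrow> \<bar>generator f y\<bar> \<le> B" "0 \<le> B"
    by (rule C1_compact_half_line_facts[OF f], rule that)
  interpret law: prob_space "law y" by (rule prob_space_law[OF y])
  note fm = borel_measurable_half_line[OF cf] and gm = borel_measurable_half_line[OF cg]
  define Z where "Z t w = f (w t) - f (w 0) - (LINT s:{0..t}|lborel. generator f (w s))" for t and w :: "real \<Rightarrow> real"
  have pos: "0 \<le> w t" and cad: "cadlag w" if "w \<in> space (law y)" for w t using that by (auto simp: space_law)
  have coord: "(\<lambda>w. w s) \<in> past y t \<rightarrow>\<^sub>M half_line" if "0 \<le> s" "s \<le> t" for s t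
    by (rule natural_filtration_measurable[OF coordinate_measurable that])
  have joint: "(\<lambda>(s, w). indicator {0..t} s * generator f (w s)) \<in> borel_measurable (borel \<Otimes>\<^sub>M past y t)" if t: "0 \<le> t" for t
  proof (rule right_continuous_joint_measurable[OF t])
    show "(\<lambda>w. generator f (w s)) \<in> borel_measurable (past y t)" if "0 \<le> s" "s \<le> t" for s
      by (rule measurable_compose[OF coord[OF that] gm])
    show "((\<lambda>s. generator f (w s)) \<longlongrightarrow> generator f (w s)) (at_right s)" if "w \<in> space (past y t)" "0 \<le> s" for w s
      by (rule cadlag_path_compose_right_continuous[OF cad that(2) pos cg]) (use that in auto)
  qed
  have timeint: "set_integrable lborel {0..t} (\<lambda>s. generator f (w s))" if t: "0 \<le> t" and w: "w \<in> space (law y)" for t w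
  proof -
    have "(\<lambda>s. indicator {0..t} s * generator f (w s)) \<in> borel_measurable borel"
      using measurable_compose[OF measurable_Pair2'[of w "past y t" borel] joint[OF t]] w by simp
    hence "set_integrable lborel {0..t} (\<lambda>s. indicator {0..t} s * generator f (w s))"
      by (rule set_integrable_bounded[where B=B]) (use B(2)[OF pos[OF w]] in \<open>auto simp: indicator_def\<close>)
    thus ?thesis by (rule set_integrable_cong[THEN iffD1, OF refl refl, rotated]) simp
  qed
  have Zm: "Z t \<in> borel_measurable (past y t)" if t: "0 \<le> t" for t
  proof -
    have [measurable]: "(\<lambda>w. f (w t)) \<in> borel_measurable (past y t)" "(\<lambda>w. f (w 0)) \<in> borel_measurable (past y t)"
      using measurable_compose[OF coord fm] t by auto
    note [measurable] = time_integral_measurable[OF joint[OF t]]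
    show ?thesis unfolding Z_def[abs_def] by measurable
  qed
  have Zm': "Z t \<in> borel_measurable (law y)" if t: "0 \<le> t" for t
    by (rule measurable_from_subalg[OF natural_filtration_subalgebra[OF coordinate_measurable] Zm[OF t]])
  have Zb: "\<bar>Z t w\<bar> \<le> 2 * B + B * t" if t: "0 \<le> t" and w: "w \<in> space (law y)" for t w
  proof -
    have "\<bar>LINT s:{0..t}|lborel. generator f (w s)\<bar> \<le> B * t"
      by (rule time_integral_bound[OF B(2)[OF pos[OF w]] t timeint[OF t w]])
    thus ?thesis using B(1)[OF pos[OF w]] B(1)[OF pos[OF w, of 0]] unfolding Z_def
      by (smt (verit))
  qed
  have Zi: "integrable (law y) (Z t)" if t: "0 \<le> t" for t
    by (rule law.integrable_const_bound[OF _ Zm'[OF t], where B="2 * B + B * t"]) (use Zb[OF t] in auto)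
  have mart: "AE w in law y. real_cond_exp (law y) (past y s) (Z t) w = Z s w" if s: "0 \<le> s" and st: "s \<le> t" for s t
  proof -
    interpret sub: sigma_finite_subalgebra "law y" "past y s"
      by (rule natural_filtration_sigma_finite[OF prob_space_law[OF y] coordinate_measurable])
    have t: "0 \<le> t" "0 \<le> t - s" using s st by auto
    define b where "b = 2 * (2 * B + B * t)"
    have b0: "0 \<le> b" using B(3) t by (simp add: b_def)
    define F where "F v = ennreal (b + (f (v (t - s)) - f (v 0) - (LINT r:{0..t - s}|lborel. generator f (v r))))" for v :: "real \<Rightarrow> real"
    have Fs: "F (shift_path s w) = ennreal (b + (Z t w - Z s w))" if w: "w \<in> space (law y)" for w
    proof -
      have "(LINT r:{0..t - s}|lborel. generator f (shift_path s w r)) = (LINT r:{0..t - s}|lborel. generator f (w (s + r)))"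
        by (rule set_lebesgue_integral_cong) (auto simp: shift_path_def)
      note e = this
      show ?thesis unfolding F_def e Z_def time_integral_split[OF timeint[OF t(1) w] s st]
        by (rule arg_cong[where f=ennreal]) (use s st in \<open>simp add: shift_path_def\<close>)
    qed
    have F: "trajectory_functional F" unfolding trajectory_functional_def
    proof (intro allI impI)
      fix q :: real
      have [measurable]: "fst \<in> borel_measurable (half_line \<Otimes>\<^sub>M noise)"
        by (rule measurable_compose[OF measurable_fst]) (rule borel_measurable_half_line, rule continuous_on_id)
      have at [measurable]: "(\<lambda>z. f (trajectory (fst z) (snd z) r)) \<in> borel_measurable (half_line \<Otimes>\<^sub>M noise)" for r
        by (rule measurable_compose[OF trajectory_measurable_half_line fm]) (auto simp: space_pair_measure)
      have [measurable]: "(\<lambda>z. LINT r:{0..t - s}|lborel. generator f (trajectory (fst z) (snd z) (q + r))) \<in> borel_measurable (half_line \<Otimes>\<^sub>M noise)"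
        by (rule time_integral_trajectory_measurable[OF gm]) (auto simp: space_pair_measure)
      have "(LINT r:{0..t - s}|lborel. generator f (shift_path q w r)) = (LINT r:{0..t - s}|lborel. generator f (w (q + r)))" for w
        by (rule set_lebesgue_integral_cong) (auto simp: shift_path_def)
      hence "(\<lambda>(y, \<omega>). F (shift_path q (trajectory y \<omega>))) =
        (\<lambda>z. ennreal (b + (f (trajectory (fst z) (snd z) (q + (t - s))) - f (trajectory (fst z) (snd z) (q + 0))
          - (LINT r:{0..t - s}|lborel. generator f (trajectory (fst z) (snd z) (q + r))))))"
        using t(2) unfolding F_def by (simp add: case_prod_beta shift_path_def fun_eq_iff)
      also have "\<dots> \<in> borel_measurable (half_line \<Otimes>\<^sub>M noise)" by measurable
      finally show "(\<lambda>(y, \<omega>). F (shift_path q (trajectory y \<omega>))) \<in> borel_measurable (half_line \<Otimes>\<^sub>M noise)" .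
    qed
    have Phi: "(\<integral>\<^sup>+\<omega>. F (trajectory z \<omega>) \<partial>noise) = ennreal b" if z: "0 \<le> z" for z
    proof -
      have bd: "\<bar>increment f z (t - s) \<omega>\<bar> \<le> b" for \<omega>
      proof -
        have "\<bar>LINT r:{0..t - s}|lborel. generator f (trajectory z \<omega> r)\<bar> \<le> B * (t - s)"
          by (rule time_integral_bound[OF B(2)[OF trajectory_nonneg] t(2) trajectory_time_integrable[OF gm B(2) z]])
        also have "\<dots> \<le> B * t" using s B(3) by (intro mult_left_mono) auto
        finally show ?thesis using B(1)[OF z] B(1)[OF trajectory_nonneg[of z \<omega> "t - s"]] B(3)
            mult_nonneg_nonneg[OF B(3) t(1)] unfolding increment_def b_def by (smt (verit))
      qed
      have im: "integrable noise (increment f z (t - s))"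
        by (rule noise.integrable_const_bound[OF _ increment_measurable[OF f z], where B=b]) (use bd in auto)
      have "(\<integral>\<^sup>+\<omega>. F (trajectory z \<omega>) \<partial>noise) = (\<integral>\<^sup>+\<omega>. ennreal (b + increment f z (t - s) \<omega>) \<partial>noise)"
        by (rule nn_integral_cong_AE) (use AE_trajectory_start[OF z] in \<open>eventually_elim, simp add: F_def increment_def\<close>)
      also have "\<dots> = ennreal (LINT \<omega>|noise. b + increment f z (t - s) \<omega>)"
      proof (rule nn_integral_eq_integral)
        show "integrable noise (\<lambda>\<omega>. b + increment f z (t - s) \<omega>)" using im by simp
        show "AE \<omega> in noise. 0 \<le> b + increment f z (t - s) \<omega>"
          by (rule AE_I2) (use bd in \<open>simp add: abs_le_iff\<close>, smt (verit) bd)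
      qed
      also have "(LINT \<omega>|noise. b + increment f z (t - s) \<omega>) = b"
        using im dynkin_formula[OF f z t(2)] noise.prob_space by simp
      finally show ?thesis .
    qed
    show ?thesis
    proof (rule sub.real_cond_exp_charact)
      show "integrable (law y) (Z t)" "integrable (law y) (Z s)" using Zi t s by auto
      show "Z s \<in> borel_measurable (past y s)" by (rule Zm[OF s])
      fix A assume A: "A \<in> sets (past y s)"
      have A' [measurable]: "A \<in> sets (law y)" by (rule past_sets[OF A])
      note [measurable] = Zm'[OF t(1)] Zm'[OF s]
      have zb: "0 \<le> b + (Z t w - Z s w)" if w: "w \<in> space (law y)" for w
      proof -
        have "B * s \<le> B * t" using B(3) st by (rule mult_left_mono[rotated])
        moreover have "- Z t w \<le> 2 * B + B * t" "Z s w \<le> 2 * B + B * s"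
          using abs_le_D2[OF Zb[OF t(1) w]] abs_le_D1[OF Zb[OF s w]] .
        ultimately have "0 \<le> (2 * B + B * t) + (2 * B + B * t) + (Z t w - Z s w)" by linarith
        thus ?thesis unfolding b_def mult_2 .
      qed
      have "(\<integral>\<^sup>+w. ennreal (indicator A w * (b + (Z t w - Z s w))) \<partial>law y) = (\<integral>\<^sup>+w. indicator A w * F (shift_path s w) \<partial>law y)"
        by (rule nn_integral_cong) (simp add: Fs split: split_indicator)
      also have "\<dots> = (\<integral>\<^sup>+w. indicator A w * (\<integral>\<^sup>+\<omega>. F (trajectory (w s) \<omega>) \<partial>noise) \<partial>law y)"
      proof (rule markov_property_law[OF y s A F])
        have "(\<lambda>w. ennreal (b + (Z t w - Z s w))) \<in> borel_measurable (law y)" by measurable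
        thus "(\<lambda>w. F (shift_path s w)) \<in> borel_measurable (law y)"
          by (rule measurable_cong[THEN iffD1, rotated]) (simp add: Fs)
      qed
      also have "\<dots> = (\<integral>\<^sup>+w. ennreal (indicator A w * b) \<partial>law y)"
        by (rule nn_integral_cong) (simp add: Phi pos split: split_indicator)
      finally have e: "(\<integral>\<^sup>+w. ennreal (indicator A w * (b + (Z t w - Z s w))) \<partial>law y) = (\<integral>\<^sup>+w. ennreal (indicator A w * b) \<partial>law y)" .
      have iA: "integrable (law y) (\<lambda>w. indicator A w * b)"
        by (rule integrable_mult_left) (simp add: law.emeasure_eq_measure)
      have it: "integrable (law y) (\<lambda>w. indicator A w * Z t w)" "integrable (law y) (\<lambda>w. indicator A w * Z s w)"
        using integrable_mult_indicator[OF A' Zi[OF t(1)]] integrable_mult_indicator[OF A' Zi[OF s]] by auto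
      have "(LINT w|law y. indicator A w * (b + (Z t w - Z s w))) = (LINT w|law y. indicator A w * b)"
        using zb b0 by (subst (1 2) integral_eq_nn_integral) (auto simp: e split: split_indicator)
      moreover have "(\<lambda>w. indicator A w * (b + (Z t w - Z s w))) = (\<lambda>w. indicator A w * b + (indicator A w * Z t w - indicator A w * Z s w))"
        by (rule ext) (simp add: algebra_simps)
      ultimately have "(LINT w|law y. indicator A w * Z t w) = (LINT w|law y. indicator A w * Z s w)"
        using iA it by simp
      thus "(LINT w:A|law y. Z t w) = (LINT w:A|law y. Z s w)"
        unfolding set_lebesgue_integral_def real_scaleR_def .
    qed
  qed
  have "martingale_wrt (law y) (past y) Z"
    unfolding martingale_wrt_def using Zm Zi mart by blast
  thus ?thesis unfolding Z_def[abs_def] .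
qed

theorem exists_markov_process: "\<exists>P. markov_process_with_generator generator P"
proof (intro exI)
  show "markov_process_with_generator generator kernel"
    unfolding markov_process_with_generator_def
  proof (intro conjI allI impI exI)
    show "transition_function half_line kernel" by (rule transition_function_kernel)
    fix y :: real assume y: "0 \<le> y"
    show "prob_space (law y)" by (rule prob_space_law[OF y])
    show "\<forall>w\<in>space (law y). cadlag w" by (simp add: space_law)
    show "markov_process (law y) half_line kernel (\<lambda>t w. w t)" by (rule markov_process_law[OF y])
    show "solves_martingale_problem generator (law y) (\<lambda>t w. w t)"
      unfolding solves_martingale_problem_def using C1_martingale[OF y] by blast
    have "{w \<in> space cadlag_space. w 0 = y} \<in> sets cadlag_space"
    proof -
      have [measurable]: "(\<lambda>w. w 0) \<in> borel_measurable cadlag_space" by (rule measurable_restrict_space1) measurable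
      show ?thesis by measurable
    qed
    moreover have "AE \<omega> in noise. safe_trajectory y \<omega> 0 = y"
      using AE_safe_trajectory[OF y] AE_trajectory_start[OF y] by eventually_elim simp
    ultimately show "AE w in law y. w 0 = y"
      unfolding law_def by (subst AE_distr_iff[OF safe_trajectory_measurable[OF y]]) auto
  qed
qed

end

section \<open>Stationary distributions\<close>

text \<open>Squaring smooths the kink of the positive part.\<close>
lemma pos_part_square_DERIV:
  "((\<lambda>x::real. (max 0 x)\<^sup>2) has_real_derivative 2 * max 0 x) (at x)"
proof (cases "x = 0")
  case True
  have "((\<lambda>h. ((max 0 (0 + h))\<^sup>2 - (max 0 0)\<^sup>2) / h) \<longlongrightarrow> 0) (at (0::real))"
  proof (rule Lim_null_comparison)
    show "eventually (\<lambda>h. norm (((max 0 (0 + h))\<^sup>2 - (max 0 0)\<^sup>2) / h) \<le> \<bar>h\<bar>) (at (0::real))"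
      by (rule always_eventually) (auto simp: max_def power2_eq_square)
    show "((\<lambda>h::real. \<bar>h\<bar>) \<longlongrightarrow> 0) (at 0)" by (auto intro!: tendsto_eq_intros)
  qed
  thus ?thesis using True by (simp add: DERIV_def)
next
  case False
  show ?thesis
  proof (cases "x > 0")
    case True
    have "((\<lambda>x. x\<^sup>2) has_real_derivative 2 * x) (at x)" by (auto intro!: derivative_eq_intros)
    moreover have "eventually (\<lambda>z. z\<^sup>2 = (max 0 z)\<^sup>2) (nhds x)"
      by (rule eventually_nhds_in_open[of "{0<..}", THEN eventually_mono]) (use True in auto)
    ultimately show ?thesis using True by (simp add: DERIV_cong_ev)
  next
    case neg: False
    have "((\<lambda>x. 0) has_real_derivative 0) (at x)" by simp
    moreover have "eventually (\<lambda>z. 0 = (max 0 z)\<^sup>2) (nhds x)"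
      by (rule eventually_nhds_in_open[of "{..<0}", THEN eventually_mono]) (use neg False in auto)
    ultimately show ?thesis using neg False DERIV_cong_ev[OF refl, of "\<lambda>_. 0" "\<lambda>z. (max 0 z)\<^sup>2" x 0 0] by simp
  qed
qed

context bandit_rates
begin

text \<open>The generator applied to \<open>\<lambda>z. exp (- (l * z))\<close>, which is not compactly supported.\<close>
definition exp_generator :: "real \<Rightarrow> real \<Rightarrow> real" where
  "exp_generator l z = exp (- (l * z)) * (- (z * branching_rate l) - (1 - p\<^sub>A) * l)"

lemma exp_generator_bound:
  assumes "0 \<le> l" "0 \<le> z" shows "\<bar>exp_generator l z\<bar> \<le> 1 + l"
proof -
  have "\<bar>z * branching_rate l\<bar> \<le> z * l"
    unfolding abs_mult using assms abs_branching_rate_le[of l] by (intro mult_mono) auto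
  moreover have "\<bar>(1 - p\<^sub>A) * l\<bar> \<le> l"
    using assms pA_pos pA_less_1 by (simp add: abs_mult mult_left_le_one_le)
  ultimately have "\<bar>- (z * branching_rate l) - (1 - p\<^sub>A) * l\<bar> \<le> l * z + l" by (simp add: mult.commute)
  hence "\<bar>exp_generator l z\<bar> \<le> exp (- (l * z)) * (l * z + l)"
    unfolding exp_generator_def abs_mult by (simp add: mult_left_mono)
  also have "\<dots> = (l * z) * exp (- (l * z)) + l * exp (- (l * z))" by (simp add: algebra_simps)
  also have "\<dots> \<le> 1 + l"
  proof (intro add_mono)
    have "l * z \<le> exp (l * z)" using exp_ge_add_one_self[of "l * z"] by linarith
    hence "l * z * exp (- (l * z)) \<le> exp (l * z) * exp (- (l * z))" by (rule mult_right_mono) simp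
    thus "l * z * exp (- (l * z)) \<le> 1" by (simp add: exp_minus)
    show "l * exp (- (l * z)) \<le> l" using assms by (simp add: mult_left_le)
  qed
  finally show ?thesis .
qed

lemma continuous_on_exp_generator: "continuous_on S (exp_generator l)"
  unfolding exp_generator_def by (intro continuous_intros)

text \<open>Compactly supported and continuously differentiable functions that increase to \<open>\<lambda>z. exp (- (l * z))\<close>.\<close>
definition truncated_exp :: "real \<Rightarrow> nat \<Rightarrow> real \<Rightarrow> real" where
  "truncated_exp l n z = (max 0 (exp (- (l * z / 2)) - 1 / real (Suc n)))\<^sup>2"

definition truncated_exp_deriv :: "real \<Rightarrow> nat \<Rightarrow> real \<Rightarrow> real" where
  "truncated_exp_deriv l n z = - l * max 0 (exp (- (l * z / 2)) - 1 / real (Suc n)) * exp (- (l * z / 2))"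

lemma truncated_exp_DERIV: "(truncated_exp l n has_real_derivative truncated_exp_deriv l n z) (at z)"
proof -
  let ?w = "\<lambda>z. exp (- (l * z / 2)) - 1 / real (Suc n)"
  have "(?w has_real_derivative - l / 2 * exp (- (l * z / 2))) (at z)"
    by (auto intro!: derivative_eq_intros)
  from DERIV_chain2[OF pos_part_square_DERIV this]
  show ?thesis unfolding truncated_exp_def[abs_def] truncated_exp_deriv_def by (simp add: algebra_simps)
qed

lemma truncated_exp_C1:
  assumes l: "0 < l" shows "truncated_exp l n \<in> C1_compact_half_line"
  unfolding C1_compact_half_line_def
proof (intro CollectI conjI exI allI impI)
  show "(truncated_exp l n has_vector_derivative truncated_exp_deriv l n y) (at y within {0..})" for y
    using truncated_exp_DERIV[of l n y]
    by (simp add: has_real_derivative_iff_has_vector_derivative has_vector_derivative_at_within)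
  show "continuous_on {0..} (truncated_exp_deriv l n)"
    unfolding truncated_exp_deriv_def by (intro continuous_intros) auto
  fix y assume y: "y \<ge> 2 * ln (real (Suc n)) / l"
  hence "ln (real (Suc n)) \<le> l * y / 2" using l by (simp add: field_simps)
  hence "exp (- (l * y / 2)) \<le> exp (- ln (real (Suc n)))" by simp
  also have "\<dots> = 1 / real (Suc n)" by (simp add: exp_minus inverse_eq_divide del: of_nat_Suc)
  finally show "truncated_exp l n y = 0" by (simp add: truncated_exp_def)
qed

lemma truncated_exp_bounds:
  assumes l: "0 < l" and z: "0 \<le> z"
  shows "0 \<le> truncated_exp l n z" "truncated_exp l n z \<le> exp (- (l * z))"
    "\<bar>truncated_exp_deriv l n z\<bar> \<le> l * exp (- (l * z))"
proof -
  have e: "exp (- (l * z)) = exp (- (l * z / 2)) * exp (- (l * z / 2))" by (simp add: exp_add[symmetric])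
  have m: "0 \<le> max 0 (exp (- (l * z / 2)) - 1 / real (Suc n))"
    "max 0 (exp (- (l * z / 2)) - 1 / real (Suc n)) \<le> exp (- (l * z / 2))" by auto
  show "0 \<le> truncated_exp l n z" by (simp add: truncated_exp_def)
  show "truncated_exp l n z \<le> exp (- (l * z))"
    unfolding truncated_exp_def power2_eq_square e by (intro mult_mono m) auto
  show "\<bar>truncated_exp_deriv l n z\<bar> \<le> l * exp (- (l * z))"
    unfolding truncated_exp_deriv_def e abs_mult mult.assoc using l m by (intro mult_mono) auto
qed

lemma truncated_exp_tendsto:
  "(\<lambda>n. truncated_exp l n z) \<longlonglongrightarrow> exp (- (l * z))"
  "(\<lambda>n. truncated_exp_deriv l n z) \<longlonglongrightarrow> - l * exp (- (l * z))"
proof -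
  have "(\<lambda>n. exp (- (l * z / 2)) - 1 / real (Suc n)) \<longlonglongrightarrow> exp (- (l * z / 2)) - 0"
    by (intro tendsto_diff tendsto_const) (use LIMSEQ_inverse_real_of_nat in \<open>simp add: inverse_eq_divide\<close>)
  hence m: "(\<lambda>n. max 0 (exp (- (l * z / 2)) - 1 / real (Suc n))) \<longlonglongrightarrow> max 0 (exp (- (l * z / 2)) - 0)"
    by (intro tendsto_max tendsto_const)
  have e: "exp (- (l * z)) = (exp (- (l * z / 2)))\<^sup>2" by (simp add: power2_eq_square exp_add[symmetric])
  show "(\<lambda>n. truncated_exp l n z) \<longlonglongrightarrow> exp (- (l * z))"
    unfolding truncated_exp_def e using tendsto_power[OF m, of 2] by simp
  show "(\<lambda>n. truncated_exp_deriv l n z) \<longlonglongrightarrow> - l * exp (- (l * z))"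
    unfolding truncated_exp_deriv_def e power2_eq_square mult.assoc
    using tendsto_mult[OF tendsto_const[of "- l"] tendsto_mult[OF m tendsto_const[of "exp (- (l * z / 2))"]]]
    by simp
qed

lemma generator_truncated_exp:
  assumes "0 \<le> z"
  shows "generator (truncated_exp l n) z = p\<^sub>B * z * ((truncated_exp l n (z + g) - truncated_exp l n z) / g)
    + (1 - p\<^sub>A - p\<^sub>A * z) * truncated_exp_deriv l n z"
  using assms truncated_exp_DERIV[of l n z]
  by (intro generator_eq) (simp_all add: has_real_derivative_iff_has_vector_derivative has_vector_derivative_at_within)

lemma generator_truncated_exp_tendsto:
  assumes "0 \<le> z" shows "(\<lambda>n. generator (truncated_exp l n) z) \<longlonglongrightarrow> exp_generator l z"
proof -
  have e: "exp (- (l * (z + g))) = exp (- (l * z)) * exp (- (l * g))" by (simp add: exp_add[symmetric] algebra_simps)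
  have "(\<lambda>n. p\<^sub>B * z * ((truncated_exp l n (z + g) - truncated_exp l n z) / g)
    + (1 - p\<^sub>A - p\<^sub>A * z) * truncated_exp_deriv l n z)
    \<longlonglongrightarrow> p\<^sub>B * z * ((exp (- (l * (z + g))) - exp (- (l * z))) / g) + (1 - p\<^sub>A - p\<^sub>A * z) * (- l * exp (- (l * z)))"
    using g_pos by (intro tendsto_intros truncated_exp_tendsto) auto
  also have "p\<^sub>B * z * ((exp (- (l * (z + g))) - exp (- (l * z))) / g) + (1 - p\<^sub>A - p\<^sub>A * z) * (- l * exp (- (l * z))) = exp_generator l z"
    unfolding exp_generator_def branching_rate_def e using g_pos by (simp add: field_simps)
  finally show ?thesis using assms by (simp add: generator_truncated_exp)
qed

text \<open>A bound uniform in \<open>n\<close> and \<open>z\<close>, for dominated convergence: the linear growth of the rates is absorbed by the decay of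
  the truncated exponential and of its derivative.\<close>
lemma generator_truncated_exp_bound:
  assumes l: "0 < l" and z: "0 \<le> z"
  shows "\<bar>generator (truncated_exp l n) z\<bar> \<le> 1 / (l * g) + l + 1"
proof -
  have ze: "z * exp (- (l * z)) \<le> 1 / l"
  proof -
    have "l * z \<le> exp (l * z)" using exp_ge_add_one_self[of "l * z"] by linarith
    hence "l * z * exp (- (l * z)) \<le> exp (l * z) * exp (- (l * z))" by (rule mult_right_mono) simp
    hence "l * (z * exp (- (l * z))) \<le> 1" by (simp add: exp_minus mult.assoc)
    thus ?thesis using l by (simp add: field_simps)
  qed
  have e1: "exp (- (l * z)) \<le> 1" using l z by simp
  have zg: "0 \<le> z + g" using z g_pos by simp
  have "exp (- (l * (z + g))) \<le> exp (- (l * z))" using l g_pos by simp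
  hence "truncated_exp l n (z + g) \<le> exp (- (l * z))" using truncated_exp_bounds(2)[OF l zg, of n] by linarith
  hence "\<bar>truncated_exp l n (z + g) - truncated_exp l n z\<bar> \<le> exp (- (l * z))"
    using truncated_exp_bounds(1)[OF l zg, of n] truncated_exp_bounds[OF l z, of n] by linarith
  hence d: "\<bar>(truncated_exp l n (z + g) - truncated_exp l n z) / g\<bar> \<le> exp (- (l * z)) / g"
    unfolding abs_divide using g_pos by (simp add: divide_right_mono)
  have "\<bar>p\<^sub>B * z\<bar> \<le> 1 * z" by (rule abs_mult_le) (use pB_pos pB_less_pA pA_less_1 z in auto)
  hence 1: "\<bar>p\<^sub>B * z * ((truncated_exp l n (z + g) - truncated_exp l n z) / g)\<bar> \<le> 1 * z * (exp (- (l * z)) / g)"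
    by (rule abs_mult_le[OF _ d])
  have 2: "1 * z * (exp (- (l * z)) / g) \<le> 1 / (l * g)"
    using divide_right_mono[OF ze, of g] g_pos by simp
  have "\<bar>1 - p\<^sub>A - p\<^sub>A * z\<bar> \<le> 1 + z"
  proof -
    have "0 \<le> p\<^sub>A * z" "p\<^sub>A * z \<le> z" using pA_pos pA_less_1 z by (auto simp: mult_left_le_one_le)
    thus ?thesis using pA_pos pA_less_1 z by linarith
  qed
  hence 3: "\<bar>(1 - p\<^sub>A - p\<^sub>A * z) * truncated_exp_deriv l n z\<bar> \<le> (1 + z) * (l * exp (- (l * z)))"
    by (rule abs_mult_le[OF _ truncated_exp_bounds(3)[OF l z]])
  have "l * (z * exp (- (l * z))) \<le> 1" using ze l by (simp add: field_simps)
  moreover have "l * exp (- (l * z)) \<le> l" using e1 l by (simp add: mult_left_le)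
  ultimately have 4: "(1 + z) * (l * exp (- (l * z))) \<le> l + 1" by (simp add: algebra_simps)
  show ?thesis unfolding generator_truncated_exp[OF z] using 1 2 3 4 by linarith
qed

end

text \<open>An arbitrary transition function of the process, not only the constructed one.\<close>
locale bandit_markov_process = bandit_rates +
  fixes P :: "real \<Rightarrow> real \<Rightarrow> real measure"
  assumes process: "markov_process_with_generator generator P"
begin

lemma P_kernel: "0 \<le> t \<Longrightarrow> P t \<in> half_line \<rightarrow>\<^sub>M prob_algebra half_line"
  using process unfolding markov_process_with_generator_def transition_function_def by blast

lemma P_prob: "0 \<le> t \<Longrightarrow> 0 \<le> y \<Longrightarrow> prob_space (P t y)" "0 \<le> t \<Longrightarrow> 0 \<le> y \<Longrightarrow> sets (P t y) = sets half_line"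
  using measurable_space[OF P_kernel, of t y] by (auto simp: space_prob_algebra)

text \<open>Taking expectations in the Markov property at time \<open>0\<close> identifies \<open>P t y\<close> with the law of the path at time \<open>t\<close>.\<close>
lemma path_measure:
  assumes y: "0 \<le> y"
  obtains Q :: "(real \<Rightarrow> real) measure" where "prob_space Q" "\<And>w. w \<in> space Q \<Longrightarrow> cadlag w"
    "\<And>t. 0 \<le> t \<Longrightarrow> (\<lambda>w. w t) \<in> Q \<rightarrow>\<^sub>M half_line" "AE w in Q. w 0 = y"
    "solves_martingale_problem generator Q (\<lambda>t w. w t)"
    "\<And>t k. 0 \<le> t \<Longrightarrow> k \<in> borel_measurable half_line \<Longrightarrow> (LINT z|P t y. k z) = (LINT w|Q. k (w t) :: real)"
proof -
  obtain Q :: "(real \<Rightarrow> real) measure" where Q: "prob_space Q" "\<forall>w\<in>space Q. cadlag w"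
    "markov_process Q half_line P (\<lambda>t w. w t)" "AE w in Q. w 0 = y"
    "solves_martingale_problem generator Q (\<lambda>t w. w t)"
    using process y unfolding markov_process_with_generator_def by blast
  have m: "\<And>t. 0 \<le> t \<Longrightarrow> (\<lambda>w. w t) \<in> Q \<rightarrow>\<^sub>M half_line" using Q(3) unfolding markov_process_def by blast
  interpret Q: prob_space Q by (rule Q)
  have law: "P t y = distr Q half_line (\<lambda>w. w t)" if t: "0 \<le> t" for t
  proof (rule measure_eqI)
    show "sets (P t y) = sets (distr Q half_line (\<lambda>w. w t))" using P_prob[OF t y] by simp
    interpret Pt: prob_space "P t y" by (rule P_prob[OF t y])
    fix D assume "D \<in> sets (P t y)"
    hence D: "D \<in> sets half_line" using P_prob[OF t y] by simp
    let ?F = "natural_filtration Q half_line (\<lambda>t w. w t) 0"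
    interpret F: sigma_finite_subalgebra Q ?F
      by (rule natural_filtration_sigma_finite[OF Q(1) m])
    have ev: "(\<lambda>w. w t) -` D \<inter> space Q \<in> sets Q" using measurable_sets[OF m[OF t] D] .
    have int: "integrable Q (indicator {w. w t \<in> D} :: _ \<Rightarrow> real)"
    proof -
      have "integrable Q (indicator ((\<lambda>w. w t) -` D \<inter> space Q) :: _ \<Rightarrow> real)"
        using ev by (intro integrable_real_indicator) (auto simp: Q.emeasure_eq_measure)
      moreover have "integrable Q (indicator ((\<lambda>w. w t) -` D \<inter> space Q) :: _ \<Rightarrow> real)
          = integrable Q (indicator {w. w t \<in> D} :: _ \<Rightarrow> real)"
        by (rule Bochner_Integration.integrable_cong) (auto simp: indicator_def)
      ultimately show ?thesis by simp
    qed
    have "Q.prob ((\<lambda>w. w t) -` D \<inter> space Q) = (LINT w|Q. indicator ((\<lambda>w. w t) -` D \<inter> space Q) w)"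
      using sets.sets_into_space[OF ev] by (simp add: Int_absorb2)
    also have "\<dots> = (LINT w|Q. indicator {w. w t \<in> D} w)"
      by (rule Bochner_Integration.integral_cong) (auto simp: indicator_def)
    also have "\<dots> = (LINT w|Q. real_cond_exp Q ?F (indicator {w. w t \<in> D}) w)"
      using F.real_cond_exp_int(2)[OF int] by simp
    also have "\<dots> = (LINT w|Q. measure (P t y) D)"
    proof (rule integral_cong_AE)
      have "AE w in Q. real_cond_exp Q ?F (indicator {w. w (0 + t) \<in> D}) w = measure (P t (w 0)) D"
        using Q(3) t D unfolding markov_process_def by blast
      with Q(4) show "AE w in Q. real_cond_exp Q ?F (indicator {w. w t \<in> D}) w = measure (P t y) D"
        by eventually_elim simp
    qed auto
    finally show "emeasure (P t y) D = emeasure (distr Q half_line (\<lambda>w. w t)) D"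
      using m[OF t] D by (simp add: emeasure_distr Q.emeasure_eq_measure Pt.emeasure_eq_measure Q.prob_space)
  qed
  have "(LINT z|P t y. k z) = (LINT w|Q. k (w t))" if "0 \<le> t" "k \<in> borel_measurable half_line" for t and k :: "real \<Rightarrow> real"
    unfolding law[OF that(1)] by (rule integral_distr[OF m[OF that(1)] that(2)])
  thus thesis using that[OF Q(1) _ m Q(4,5)] Q(2) by blast
qed

lemma P_right_continuous:
  fixes k :: "real \<Rightarrow> real"
  assumes y: "0 \<le> y" and s: "0 \<le> s" and k: "continuous_on {0..} k" and bd: "\<And>z. 0 \<le> z \<Longrightarrow> \<bar>k z\<bar> \<le> B"
  shows "((\<lambda>s. LINT z|P s y. k z) \<longlongrightarrow> (LINT z|P s y. k z)) (at_right s)"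
proof (rule path_measure[OF y])
  fix Q :: "(real \<Rightarrow> real) measure"
  assume Q: "prob_space Q" "\<And>w. w \<in> space Q \<Longrightarrow> cadlag w" "\<And>t. 0 \<le> t \<Longrightarrow> (\<lambda>w. w t) \<in> Q \<rightarrow>\<^sub>M half_line"
    and law: "\<And>t k. 0 \<le> t \<Longrightarrow> k \<in> borel_measurable half_line \<Longrightarrow> (LINT z|P t y. k z) = (LINT w|Q. k (w t) :: real)"
  interpret prob_space Q by (rule Q)
  have km: "k \<in> borel_measurable half_line" using k by (rule borel_measurable_half_line)
  have pos: "0 \<le> w t" if "w \<in> space Q" "0 \<le> t" for w t using measurable_space[OF Q(3)[OF that(2)] that(1)] by simp
  show ?thesis
  proof (rule tendsto_at_right_sequentially[of s "s + 1"])
    fix S assume S: "\<And>n. s < S n" "S \<longlonglongrightarrow> s"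
    have S0: "0 \<le> S n" for n using S(1)[of n] s by simp
    have "(\<lambda>n. LINT w|Q. k (w (S n))) \<longlonglongrightarrow> (LINT w|Q. k (w s))"
    proof (rule integral_dominated_convergence[where w="\<lambda>_. B"])
      show "(\<lambda>w. k (w s)) \<in> borel_measurable Q" using measurable_compose[OF Q(3)[OF s] km] .
      show "(\<lambda>w. k (w (S n))) \<in> borel_measurable Q" for n using measurable_compose[OF Q(3)[OF S0] km] .
      show "AE w in Q. (\<lambda>n. k (w (S n))) \<longlonglongrightarrow> k (w s)"
      proof (rule AE_I2)
        fix w assume w: "w \<in> space Q"
        have "filterlim S (at_right s) sequentially"
          unfolding filterlim_at using S by (auto intro!: always_eventually)
        from filterlim_compose[OF cadlag_path_compose_right_continuous[OF Q(2)[OF w] s pos[OF w] k] this]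
        show "(\<lambda>n. k (w (S n))) \<longlonglongrightarrow> k (w s)" .
      qed
      show "AE w in Q. norm (k (w (S n))) \<le> B" for n
        by (rule AE_I2) (use bd pos S0 in auto)
    qed auto
    thus "(\<lambda>n. LINT z|P (S n) y. k z) \<longlonglongrightarrow> (LINT z|P s y. k z)"
      using law[OF s km] law[OF S0 km] by simp
  qed simp
qed

lemma dynkin_C1:
  assumes y: "0 \<le> y" and t: "0 \<le> t" and f: "f \<in> C1_compact_half_line"
  shows "(LINT z|P t y. f z) = f y + (LINT s:{0..t}|lborel. (LINT z|P s y. generator f z))"
    and "set_integrable lborel {0..t} (\<lambda>s. LINT z|P s y. generator f z)"
proof -
  obtain f' B where cf: "continuous_on {0..} f" and cg: "continuous_on {0..} (generator f)"
    and B: "\<And>y. 0 \<le> y \<Longrightarrow> \<bar>f y\<bar> \<le> B" "\<And>y. 0 \<le> y \<Longrightarrow> \<bar>generator f y\<bar> \<le> B"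
    using C1_compact_half_line_facts[OF f] by metis
  obtain Q :: "(real \<Rightarrow> real) measure" where Q: "prob_space Q" "\<And>w. w \<in> space Q \<Longrightarrow> cadlag w"
    "\<And>t. 0 \<le> t \<Longrightarrow> (\<lambda>w. w t) \<in> Q \<rightarrow>\<^sub>M half_line" "AE w in Q. w 0 = y"
    "solves_martingale_problem generator Q (\<lambda>t w. w t)"
    and law: "\<And>t k. 0 \<le> t \<Longrightarrow> k \<in> borel_measurable half_line \<Longrightarrow> (LINT z|P t y. k z) = (LINT w|Q. k (w t) :: real)"
    using path_measure[OF y] by blast
  interpret prob_space Q by (rule Q)
  have fm: "f \<in> borel_measurable half_line" and gm: "generator f \<in> borel_measurable half_line"
    using cf cg by (auto intro: borel_measurable_half_line)
  have pos: "0 \<le> w s" if "w \<in> space Q" "0 \<le> s" for w s using measurable_space[OF Q(3)[OF that(2)] that(1)] by simp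
  have fQ: "(\<lambda>w. f (w s)) \<in> borel_measurable Q" "(\<lambda>w. generator f (w s)) \<in> borel_measurable Q" if "0 \<le> s" for s
    using measurable_compose[OF Q(3)[OF that] fm] measurable_compose[OF Q(3)[OF that] gm] by auto
  have fI: "integrable Q (\<lambda>w. f (w s))" if "0 \<le> s" for s
    by (rule integrable_const_bound[of _ B]) (use fQ[OF that] B pos that in auto)
  have J: "(\<lambda>(s, w). indicator {0..t} s * generator f (w s)) \<in> borel_measurable (borel \<Otimes>\<^sub>M Q)"
    by (rule right_continuous_joint_measurable[OF t fQ(2)], assumption)
      (rule cadlag_path_compose_right_continuous[OF Q(2) _ pos cg])
  have bq: "\<bar>generator f (w s)\<bar> \<le> B" if "0 \<le> s" "s \<le> t" "w \<in> space Q" for s w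
    by (rule B(2)[OF pos[OF that(3,1)]])
  have F1: "(LINT w|Q. (LINT s:{0..t}|lborel. generator f (w s))) = (LINT s:{0..t}|lborel. (LINT w|Q. generator f (w s)))"
    by (rule time_integral_Fubini(1)[OF Q(1) t J, where C=B]) (use bq in blast)
  have F2: "set_integrable lborel {0..t} (\<lambda>s. LINT w|Q. generator f (w s))"
    by (rule time_integral_Fubini(2)[OF Q(1) t J, where C=B]) (use bq in blast)
  have F4: "integrable Q (\<lambda>w. LINT s:{0..t}|lborel. generator f (w s))"
    by (rule time_integral_Fubini(4)[OF Q(1) t J, where C=B]) (use bq in blast)
  let ?Z = "\<lambda>t w. f (w t) - f (w 0) - (LINT s:{0..t}|lborel. generator f (w s))"
  have mart: "martingale_wrt Q (natural_filtration Q half_line (\<lambda>t w. w t)) ?Z"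
    using Q(5) f unfolding solves_martingale_problem_def by blast
  let ?F = "natural_filtration Q half_line (\<lambda>t w. w t) 0"
  interpret F0: sigma_finite_subalgebra Q ?F by (rule natural_filtration_sigma_finite[OF Q(1,3)])
  have Zi: "integrable Q (?Z t)"
    using mart[unfolded martingale_wrt_def, THEN conjunct1, rule_format, of t] t by simp
  have cond: "AE w in Q. real_cond_exp Q ?F (?Z t) w = ?Z 0 w"
    using mart[unfolded martingale_wrt_def, THEN conjunct2, rule_format, of 0 t] t by simp
  have Z0: "?Z 0 w = 0" for w :: "real \<Rightarrow> real"
  proof -
    have "(LINT s:{0..0}|lborel. generator f (w s)) = (LINT s|(lborel :: real measure). 0)"
      unfolding set_lebesgue_integral_def
    proof (rule integral_cong_AE)
      have "AE s in lborel. s \<noteq> (0::real)" by (rule AE_lborel_singleton)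
      thus "AE s in lborel. indicator {0..0} s *\<^sub>R generator f (w s) = 0"
        by eventually_elim (auto simp: indicator_def)
      have "(\<lambda>s. indicator {0} s * generator f (w 0)) \<in> borel_measurable lborel" by measurable
      moreover have "(\<lambda>s::real. indicator {0..0} s *\<^sub>R generator f (w s)) = (\<lambda>s. indicator {0} s * generator f (w 0))"
        by (auto simp: indicator_def)
      ultimately show "(\<lambda>s::real. indicator {0..0} s *\<^sub>R generator f (w s)) \<in> borel_measurable lborel" by simp
    qed simp
    thus ?thesis by simp
  qed
  have "expectation (?Z t) = expectation (real_cond_exp Q ?F (?Z t))"
    using F0.real_cond_exp_int(2)[OF Zi] by simp
  also have "\<dots> = expectation (\<lambda>w. 0)"
    by (rule integral_cong_AE) (use cond Z0 in auto)
  finally have "expectation (\<lambda>w. f (w t) - f (w 0)) - expectation (\<lambda>w. LINT s:{0..t}|lborel. generator f (w s)) = 0"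
    using fI[OF t] fI[of 0] F4 by (simp add: Bochner_Integration.integral_diff)
  moreover have "expectation (\<lambda>w. f (w 0)) = f y"
  proof -
    have "expectation (\<lambda>w. f (w 0)) = expectation (\<lambda>w. f y)"
      by (rule integral_cong_AE) (use Q(4) fQ[of 0] in \<open>auto elim!: eventually_mono\<close>)
    thus ?thesis using prob_space by simp
  qed
  ultimately have 1: "expectation (\<lambda>w. f (w t)) = f y + (LINT s:{0..t}|lborel. expectation (\<lambda>w. generator f (w s)))"
    using fI[OF t] fI[of 0] F1 by simp
  have eq: "(LINT w|Q. generator f (w s)) = (LINT z|P s y. generator f z)" if "0 \<le> s" for s
    using law[OF that gm] by simp
  show "(LINT z|P t y. f z) = f y + (LINT s:{0..t}|lborel. (LINT z|P s y. generator f z))"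
    unfolding law[OF t fm] 1 by (intro arg_cong[of _ _ "(+) (f y)"] set_lebesgue_integral_cong) (use eq in auto)
  show "set_integrable lborel {0..t} (\<lambda>s. LINT z|P s y. generator f z)"
    by (rule set_integrable_cong[THEN iffD1, OF refl refl _ F2]) (use eq in auto)
qed

lemma dynkin_exp:
  assumes y: "0 \<le> y" and t: "0 \<le> t" and l: "0 < l"
  shows "(LINT z|P t y. exp (- (l * z))) = exp (- (l * y)) + (LINT s:{0..t}|lborel. (LINT z|P s y. exp_generator l z))"
proof (rule LIMSEQ_unique)
  let ?f = "truncated_exp l"
  define B where "B = 1 / (l * g) + l + 1"
  have hm: "k \<in> borel_measurable (P s y)" if "0 \<le> s" "continuous_on {0..} k" for s and k :: "real \<Rightarrow> real"
    using borel_measurable_half_line[OF that(2)] measurable_cong_sets[OF P_prob(2)[OF that(1) y] refl] by blast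
  have sp: "z \<ge> 0" if "z \<in> space (P s y)" "0 \<le> s" for z s
    using that sets_eq_imp_space_eq[OF P_prob(2)[OF that(2) y]] by simp
  have cf: "continuous_on {0..} (?f n)" "continuous_on {0..} (generator (?f n))" for n
    using C1_compact_half_line_facts[OF truncated_exp_C1[OF l]] by metis+
  show "(\<lambda>n. LINT z|P t y. ?f n z) \<longlonglongrightarrow> (LINT z|P t y. exp (- (l * z)))"
  proof -
    interpret prob_space "P t y" by (rule P_prob[OF t y])
    show ?thesis
    proof (rule integral_dominated_convergence[where w="\<lambda>_. 1"])
      show "AE z in P t y. norm (?f n z) \<le> 1" for n
      proof (rule AE_I2)
        fix z assume "z \<in> space (P t y)"
        hence z: "0 \<le> z" using sp t by simp
        have "exp (- (l * z)) \<le> 1" using l z by simp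
        thus "norm (?f n z) \<le> 1" unfolding real_norm_def using truncated_exp_bounds(1,2)[OF l z, of n] by linarith
      qed
    qed (use t in \<open>auto intro!: hm cf truncated_exp_tendsto AE_I2 continuous_intros\<close>)
  qed
  have inner: "(\<lambda>n. LINT z|P s y. generator (?f n) z) \<longlonglongrightarrow> (LINT z|P s y. exp_generator l z)"
    "\<bar>LINT z|P s y. generator (?f n) z\<bar> \<le> B" if s: "0 \<le> s" for s n
  proof -
    interpret prob_space "P s y" by (rule P_prob[OF s y])
    have bd: "\<bar>generator (?f n) z\<bar> \<le> B" if "z \<in> space (P s y)" for n z
      unfolding B_def by (rule generator_truncated_exp_bound[OF l sp[OF that s]])
    show "(\<lambda>n. LINT z|P s y. generator (?f n) z) \<longlonglongrightarrow> (LINT z|P s y. exp_generator l z)"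
    proof (rule integral_dominated_convergence[where w="\<lambda>_. B"])
      show "AE z in P s y. (\<lambda>n. generator (?f n) z) \<longlonglongrightarrow> exp_generator l z"
        by (rule AE_I2) (rule generator_truncated_exp_tendsto[OF sp[OF _ s]])
      show "AE z in P s y. norm (generator (?f n) z) \<le> B" for n
        by (rule AE_I2) (use bd in simp)
    qed (use s in \<open>auto intro!: hm cf continuous_on_exp_generator\<close>)
    have i: "integrable (P s y) (generator (?f n))"
      by (rule integrable_const_bound[of _ B]) (use bd hm[OF s cf(2)] in auto)
    have "\<bar>LINT z|P s y. generator (?f n) z\<bar> \<le> (LINT z|P s y. \<bar>generator (?f n) z\<bar>)" by (rule integral_abs_bound)
    also have "\<dots> \<le> (LINT z|P s y. B)" by (rule integral_mono) (use i bd in auto)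
    finally show "\<bar>LINT z|P s y. generator (?f n) z\<bar> \<le> B" using prob_space by simp
  qed
  let ?K = "\<lambda>n s. indicator {0..t} s * (LINT z|P s y. generator (?f n) z)"
  have Km: "?K n \<in> borel_measurable lborel" for n
    using dynkin_C1(2)[OF y t truncated_exp_C1[OF l]] unfolding set_integrable_def real_scaleR_def
    by (rule borel_measurable_integrable)
  have Kl: "(\<lambda>n. ?K n s) \<longlonglongrightarrow> indicator {0..t} s * (LINT z|P s y. exp_generator l z)" for s
    using inner(1)[of s] by (cases "s \<in> {0..t}") (auto simp: indicator_def)
  have "(\<lambda>n. LINT s|lborel. ?K n s) \<longlonglongrightarrow> (LINT s|lborel. indicator {0..t} s * (LINT z|P s y. exp_generator l z))"
  proof (rule integral_dominated_convergence[where w="\<lambda>s. B * indicator {0..t} s"])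
    show "(\<lambda>s. indicator {0..t} s * (LINT z|P s y. exp_generator l z)) \<in> borel_measurable lborel"
      by (rule borel_measurable_LIMSEQ_real[OF Kl Km])
    show "integrable lborel (\<lambda>s. B * indicator {0..t} s :: real)"
      using t by (intro integrable_mult_right integrable_real_indicator) auto
    show "AE s in lborel. norm (?K n s) \<le> B * indicator {0..t} s" for n
      by (rule AE_I2) (use inner(2) in \<open>auto simp: indicator_def\<close>)
  qed (use Km Kl in auto)
  hence "(\<lambda>n. LINT s:{0..t}|lborel. (LINT z|P s y. generator (?f n) z)) \<longlonglongrightarrow> (LINT s:{0..t}|lborel. (LINT z|P s y. exp_generator l z))"
    by (simp add: set_lebesgue_integral_def)
  hence "(\<lambda>n. ?f n y + (LINT s:{0..t}|lborel. (LINT z|P s y. generator (?f n) z)))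
    \<longlonglongrightarrow> exp (- (l * y)) + (LINT s:{0..t}|lborel. (LINT z|P s y. exp_generator l z))"
    by (intro tendsto_add truncated_exp_tendsto)
  thus "(\<lambda>n. LINT z|P t y. ?f n z) \<longlonglongrightarrow> exp (- (l * y)) + (LINT s:{0..t}|lborel. (LINT z|P s y. exp_generator l z))"
    using dynkin_C1(1)[OF y t truncated_exp_C1[OF l]] by simp
qed

end

definition half_line_transform :: "real measure \<Rightarrow> real \<Rightarrow> real" where
  "half_line_transform \<kappa> l = (LINT z|\<kappa>. exp (- (l * z)))"

locale half_line_prob = prob_space \<kappa> for \<kappa> :: "real measure" +
  assumes sets_eq: "sets \<kappa> = sets half_line"
begin

lemma space_eq: "space \<kappa> = {0..}"
  using sets_eq_imp_space_eq[OF sets_eq] by simp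

lemma measurable_eq: "continuous_on {0..} k \<Longrightarrow> k \<in> borel_measurable \<kappa>" for k :: "real \<Rightarrow> real"
  using borel_measurable_half_line measurable_cong_sets[OF sets_eq refl] by blast

lemma integrable_bounded:
  fixes k :: "real \<Rightarrow> real"
  assumes "continuous_on {0..} k" "\<And>z. 0 \<le> z \<Longrightarrow> \<bar>k z\<bar> \<le> B"
  shows "integrable \<kappa> k" "\<bar>LINT z|\<kappa>. k z\<bar> \<le> B"
proof -
  show i: "integrable \<kappa> k"
    by (rule integrable_const_bound[of _ B]) (use assms measurable_eq space_eq in auto)
  have "\<bar>LINT z|\<kappa>. k z\<bar> \<le> (LINT z|\<kappa>. \<bar>k z\<bar>)" by (rule integral_abs_bound)
  also have "\<dots> \<le> (LINT z|\<kappa>. B)" by (rule integral_mono) (use i assms space_eq in auto)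
  finally show "\<bar>LINT z|\<kappa>. k z\<bar> \<le> B" using prob_space by simp
qed

lemma transform_int: "0 \<le> l \<Longrightarrow> integrable \<kappa> (\<lambda>z. exp (- (l * z)))"
  by (rule integrable_bounded[where B=1]) (auto intro!: continuous_intros)

lemma transform_0: "half_line_transform \<kappa> 0 = 1"
  using prob_space by (simp add: half_line_transform_def)

lemma continuous_on_transform: "continuous_on {0..} (half_line_transform \<kappa>)"
  unfolding continuous_on_sequentially
proof (intro ballI allI impI, elim conjE)
  fix a and x :: "nat \<Rightarrow> real"
  assume a: "a \<in> {0..}" "\<forall>n. x n \<in> {0..}" "x \<longlonglongrightarrow> a"
  have "(\<lambda>n. LINT z|\<kappa>. exp (- (x n * z))) \<longlonglongrightarrow> (LINT z|\<kappa>. exp (- (a * z)))"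
  proof (rule integral_dominated_convergence[where w="\<lambda>_. 1"])
    show "AE z in \<kappa>. (\<lambda>n. exp (- (x n * z))) \<longlonglongrightarrow> exp (- (a * z))"
      by (rule AE_I2) (intro tendsto_intros a)
    show "AE z in \<kappa>. norm (exp (- (x n * z))) \<le> 1" for n
      by (rule AE_I2) (use a space_eq in auto)
  qed (auto intro!: measurable_eq continuous_intros)
  thus "(half_line_transform \<kappa> \<circ> x) \<longlonglongrightarrow> half_line_transform \<kappa> a"
    by (simp add: half_line_transform_def[abs_def] o_def)
qed

text \<open>Minus the derivative of the Laplace transform; see \<open>DERIV_transform\<close>. It is finite for every \<open>l > 0\<close>, whether or not
  the law has a mean.\<close>
definition tilted_mean :: "real \<Rightarrow> real" where
  "tilted_mean l = (LINT z|\<kappa>. z * exp (- (l * z)))"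

lemma tilted_mean_int: assumes "0 < l" shows "integrable \<kappa> (\<lambda>z. z * exp (- (l * z)))"
proof (rule integrable_bounded[where B="1 / l"])
  fix z :: real assume z: "0 \<le> z"
  have "l * z \<le> exp (l * z)" using exp_ge_add_one_self[of "l * z"] by linarith
  hence "l * z * exp (- (l * z)) \<le> exp (l * z) * exp (- (l * z))" by (rule mult_right_mono) simp
  hence "l * (z * exp (- (l * z))) \<le> 1" by (simp add: exp_minus mult.assoc)
  thus "\<bar>z * exp (- (l * z))\<bar> \<le> 1 / l" using assms z by (simp add: field_simps)
qed (auto intro!: continuous_intros)

text \<open>The constant is uniform over all laws, which later makes difference quotients converge uniformly in time.\<close>
lemma transform_expansion:
  assumes l: "0 < l" and h: "\<bar>h\<bar> \<le> l / 2"
  shows "\<bar>half_line_transform \<kappa> (l + h) - half_line_transform \<kappa> l + h * tilted_mean l\<bar> \<le> 8 * h\<^sup>2 / l\<^sup>2"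
proof -
  have lh: "0 \<le> l + h" using l h by (auto simp: abs_le_iff)
  let ?k = "\<lambda>z. exp (- ((l + h) * z)) - exp (- (l * z)) + h * (z * exp (- (l * z)))"
  have "half_line_transform \<kappa> (l + h) - half_line_transform \<kappa> l + h * tilted_mean l = (LINT z|\<kappa>. ?k z)"
    unfolding half_line_transform_def tilted_mean_def
    using transform_int[OF lh] transform_int[of l] tilted_mean_int[OF l] l
    by (simp add: Bochner_Integration.integral_add Bochner_Integration.integral_diff)
  moreover have "\<bar>LINT z|\<kappa>. ?k z\<bar> \<le> 8 * h\<^sup>2 / l\<^sup>2"
  proof (rule integrable_bounded(2))
    fix z :: real assume z: "0 \<le> z"
    have u: "0 \<le> l * z" using l z by simp
    have "\<bar>h * z\<bar> \<le> l * z / 2 + 0"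
      using mult_right_mono[OF h z] z by (simp add: abs_mult)
    from exp_shift_bounds(2)[OF u this]
    have "\<bar>?k z\<bar> \<le> (h * z)\<^sup>2 * exp (- (l * z) / 2)" by (simp add: algebra_simps)
    also have "\<dots> = h\<^sup>2 / l\<^sup>2 * ((l * z) ^ 2 * exp (- (l * z) / 2))" using l by (simp add: power_mult_distrib)
    also have "\<dots> \<le> h\<^sup>2 / l\<^sup>2 * 8" by (intro mult_left_mono power_exp_half_bound[OF u]) auto
    finally show "\<bar>?k z\<bar> \<le> 8 * h\<^sup>2 / l\<^sup>2" by (simp add: mult.commute)
  qed (intro continuous_intros)
  ultimately show ?thesis by simp
qed

lemma DERIV_transform:
  assumes l: "0 < l" shows "(half_line_transform \<kappa> has_real_derivative - tilted_mean l) (at l)"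
  unfolding DERIV_def
proof (rule LIM_zero_cancel, rule Lim_null_comparison)
  show "eventually (\<lambda>h. norm ((half_line_transform \<kappa> (l + h) - half_line_transform \<kappa> l) / h - - tilted_mean l) \<le> 8 / l\<^sup>2 * \<bar>h\<bar>) (at 0)"
    unfolding eventually_at
  proof (intro exI[of _ "l / 2"] conjI ballI impI)
    fix h :: real assume h: "h \<noteq> 0 \<and> dist h 0 < l / 2"
    hence "\<bar>h\<bar> \<le> l / 2" by (simp add: dist_real_def)
    from transform_expansion[OF l this]
    have "\<bar>half_line_transform \<kappa> (l + h) - half_line_transform \<kappa> l + h * tilted_mean l\<bar> / \<bar>h\<bar> \<le> (8 * h\<^sup>2 / l\<^sup>2) / \<bar>h\<bar>"
      by (rule divide_right_mono) simp
    moreover have "(half_line_transform \<kappa> (l + h) - half_line_transform \<kappa> l) / h - - tilted_mean l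
      = (half_line_transform \<kappa> (l + h) - half_line_transform \<kappa> l + h * tilted_mean l) / h"
      using h by (simp add: add_divide_distrib)
    moreover have "(8 * h\<^sup>2 / l\<^sup>2) / \<bar>h\<bar> = 8 / l\<^sup>2 * \<bar>h\<bar>"
      using h l by (simp add: power2_eq_square abs_if)
    ultimately show "norm ((half_line_transform \<kappa> (l + h) - half_line_transform \<kappa> l) / h - - tilted_mean l) \<le> 8 / l\<^sup>2 * \<bar>h\<bar>"
      by (simp add: abs_divide)
  qed (use l in auto)
  have "((\<lambda>h. 8 / l\<^sup>2 * \<bar>h\<bar>) \<longlongrightarrow> 8 / l\<^sup>2 * \<bar>0\<bar>) (at (0::real))"
    by (intro tendsto_mult tendsto_const tendsto_rabs tendsto_ident_at)
  thus "((\<lambda>h. 8 / l\<^sup>2 * \<bar>h\<bar>) \<longlongrightarrow> 0) (at (0::real))" by simp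
qed

end

lemma half_line_prob_eqI:
  assumes "half_line_prob \<mu>" "half_line_prob \<nu>" and eq: "\<And>l. 0 \<le> l \<Longrightarrow> half_line_transform \<mu> l = half_line_transform \<nu> l"
  shows "\<mu> = \<nu>"
proof -
  interpret m: half_line_prob \<mu> by fact
  interpret n: half_line_prob \<nu> by fact
  have id: "(\<lambda>y. y) \<in> borel_measurable \<kappa>" if "half_line_prob \<kappa>" for \<kappa>
    by (rule half_line_prob.measurable_eq[OF that]) (rule continuous_on_id)
  have r: "real_distribution (distr \<kappa> borel (\<lambda>y. y))" "AE y in distr \<kappa> borel (\<lambda>y. y). 0 \<le> y"
    "(LINT y|distr \<kappa> borel (\<lambda>y. y). exp (- (l * y))) = half_line_transform \<kappa> l"
    if k: "half_line_prob \<kappa>" for \<kappa> l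
  proof -
    interpret k: half_line_prob \<kappa> by (rule k)
    show "real_distribution (distr \<kappa> borel (\<lambda>y. y))" using id[OF k] by (rule k.real_distribution_distr)
    show "AE y in distr \<kappa> borel (\<lambda>y. y). 0 \<le> y"
      using id[OF k] by (subst AE_distr_iff) (auto simp: k.space_eq intro!: AE_I2)
    show "(LINT y|distr \<kappa> borel (\<lambda>y. y). exp (- (l * y))) = half_line_transform \<kappa> l"
      using id[OF k] by (subst integral_distr) (auto simp: half_line_transform_def)
  qed
  have d: "distr \<mu> borel (\<lambda>y. y) = distr \<nu> borel (\<lambda>y. y)"
    by (rule Laplace_transform_determines_distribution[OF r(1,2)[OF assms(1)] r(1,2)[OF assms(2)]])
      (simp add: r(3)[OF assms(1)] r(3)[OF assms(2)] eq)
  show ?thesis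
  proof (rule measure_eqI)
    show "sets \<mu> = sets \<nu>" by (simp add: m.sets_eq n.sets_eq)
    fix D assume "D \<in> sets \<mu>"
    hence D: "D \<in> sets borel" "D \<subseteq> {0..}" unfolding m.sets_eq by (auto simp: sets_restrict_space)
    have "emeasure \<kappa> D = emeasure (distr \<kappa> borel (\<lambda>y. y)) D" if k: "half_line_prob \<kappa>" for \<kappa>
    proof -
      interpret k: half_line_prob \<kappa> by (rule k)
      show ?thesis using id[OF k] D by (subst emeasure_distr) (auto simp: k.space_eq Int_absorb2)
    qed
    thus "emeasure \<mu> D = emeasure \<nu> D" using d assms by simp
  qed
qed

lemma (in bandit_rates) integral_exp_generator:
  assumes k: "half_line_prob \<kappa>" and l: "0 < l"
  shows "(LINT z|\<kappa>. exp_generator l z)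
    = - (branching_rate l * half_line_prob.tilted_mean \<kappa> l) - (1 - p\<^sub>A) * l * half_line_transform \<kappa> l"
proof -
  interpret k: half_line_prob \<kappa> by (rule k)
  have "exp_generator l z = - branching_rate l * (z * exp (- (l * z))) - (1 - p\<^sub>A) * l * exp (- (l * z))" for z
    by (simp add: exp_generator_def algebra_simps)
  thus ?thesis
    using k.tilted_mean_int[OF l] k.transform_int[of l] l
    by (simp add: Bochner_Integration.integral_diff k.tilted_mean_def half_line_transform_def)
qed

context bandit_markov_process
begin

lemma evolved_prob:
  assumes m: "half_line_prob \<mu>" and t: "0 \<le> t" shows "half_line_prob (\<mu> \<bind> P t)"
proof -
  interpret m: half_line_prob \<mu> by (rule m)
  have "\<mu> \<in> space (prob_algebra half_line)"
    using m.sets_eq m.prob_space_axioms by (simp add: space_prob_algebra)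
  moreover have "(\<lambda>\<mu>. \<mu> \<bind> P t) \<in> prob_algebra half_line \<rightarrow>\<^sub>M prob_algebra half_line"
    using measurable_bind_prob_space[OF measurable_ident P_kernel[OF t]] by simp
  ultimately have "\<mu> \<bind> P t \<in> space (prob_algebra half_line)" using measurable_space by metis
  thus ?thesis by (simp add: space_prob_algebra half_line_prob_def half_line_prob_axioms_def)
qed

lemma P_integral_measurable:
  assumes "0 \<le> t" "k \<in> borel_measurable half_line"
  shows "(\<lambda>y. LINT z|P t y. k z :: real) \<in> borel_measurable half_line"
  using measurable_compose[OF measurable_prob_algebraD[OF P_kernel[OF assms(1)]] integral_measurable_subprob_algebra[OF assms(2)]] .

lemma integral_evolved:
  fixes k :: "real \<Rightarrow> real"
  assumes m: "half_line_prob \<mu>" and t: "0 \<le> t" and k: "k \<in> borel_measurable half_line" "\<And>z. 0 \<le> z \<Longrightarrow> \<bar>k z\<bar> \<le> B"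
  shows "(LINT z|(\<mu> \<bind> P t). k z) = (LINT y|\<mu>. LINT z|P t y. k z)"
proof -
  interpret m: half_line_prob \<mu> by (rule m)
  have K: "P t \<in> \<mu> \<rightarrow>\<^sub>M subprob_algebra half_line"
    using measurable_prob_algebraD[OF P_kernel[OF t]] measurable_cong_sets[OF m.sets_eq refl] by blast
  have ne: "space \<mu> \<noteq> {}" by (rule m.not_empty)
  interpret D: prob_space "distr \<mu> (subprob_algebra half_line) (P t)" by (rule m.prob_space_distr[OF K])
  have "(LINT z|(\<mu> \<bind> P t). k z) = (LINT z|join (distr \<mu> (subprob_algebra half_line) (P t)). k z)"
    by (simp add: bind_nonempty''[OF K ne])
  also have "\<dots> = (LINT N|distr \<mu> (subprob_algebra half_line) (P t). LINT z|N. k z)"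
  proof (rule integral_join[where B=B and B'=1])
    show "AE N in distr \<mu> (subprob_algebra half_line) (P t). emeasure N (space N) \<le> ennreal 1"
      by (rule AE_I2) (auto simp: space_subprob_algebra intro: subprob_space.emeasure_space_le_1)
  qed (use k in \<open>auto intro: D.finite_measure_axioms\<close>)
  also have "\<dots> = (LINT y|\<mu>. LINT z|P t y. k z)"
    by (rule integral_distr[OF K]) (rule integral_measurable_subprob_algebra[OF k(1)])
  finally show ?thesis .
qed

lemma dynkin_evolved:
  assumes m: "half_line_prob \<mu>" and t: "0 \<le> t" and l: "0 < l"
  shows "half_line_transform (\<mu> \<bind> P t) l = half_line_transform \<mu> l + integral {0..t} (\<lambda>s. LINT z|(\<mu> \<bind> P s). exp_generator l z)"
    and "(\<lambda>s. LINT z|(\<mu> \<bind> P s). exp_generator l z) integrable_on {0..t}"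
proof -
  interpret m: half_line_prob \<mu> by (rule m)
  let ?Y = "\<lambda>s y. LINT z|P s y. exp_generator l z"
  have egm: "exp_generator l \<in> borel_measurable half_line"
    by (rule borel_measurable_half_line) (rule continuous_on_exp_generator)
  have em: "(\<lambda>z. exp (- (l * z))) \<in> borel_measurable half_line"
    by (rule borel_measurable_half_line) (intro continuous_intros)
  have bd: "\<bar>exp_generator l z\<bar> \<le> 1 + l" if "0 \<le> z" for z using exp_generator_bound[of l z] l that by simp
  have hp: "half_line_prob (P s y)" if "0 \<le> s" "0 \<le> y" for s y
    using P_prob[OF that] by (simp add: half_line_prob_def half_line_prob_axioms_def)
  have bY: "\<bar>?Y s y\<bar> \<le> 1 + l" if "0 \<le> s" "0 \<le> y" for s y
    by (rule half_line_prob.integrable_bounded(2)[OF hp[OF that] continuous_on_exp_generator bd])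
  have Ym: "?Y s \<in> borel_measurable \<mu>" if "0 \<le> s" for s
    using P_integral_measurable[OF that egm] measurable_cong_sets[OF m.sets_eq refl] by blast
  have J: "(\<lambda>(s, y). indicator {0..t} s * ?Y s y) \<in> borel_measurable (borel \<Otimes>\<^sub>M \<mu>)"
    by (rule right_continuous_joint_measurable[OF t Ym], assumption,
        rule P_right_continuous[OF _ _ continuous_on_exp_generator bd]) (auto simp: m.space_eq)
  have bq: "\<bar>?Y s y\<bar> \<le> 1 + l" if "0 \<le> s" "s \<le> t" "y \<in> space \<mu>" for s y
    using bY that m.space_eq by auto
  note F = time_integral_Fubini[OF m.prob_space_axioms t J bq]
  have eq: "(LINT y|\<mu>. ?Y s y) = (LINT z|(\<mu> \<bind> P s). exp_generator l z)" if "0 \<le> s" for s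
    using integral_evolved[OF m that egm bd] by simp
  have si: "set_integrable lborel {0..t} (\<lambda>s. LINT z|(\<mu> \<bind> P s). exp_generator l z)"
    by (rule set_integrable_cong[THEN iffD1, OF refl refl _ F(2)]) (use eq in auto)
  show "(\<lambda>s. LINT z|(\<mu> \<bind> P s). exp_generator l z) integrable_on {0..t}"
    by (rule set_borel_integral_eq_integral(1)[OF si])
  have "half_line_transform (\<mu> \<bind> P t) l = (LINT y|\<mu>. LINT z|P t y. exp (- (l * z)))"
    unfolding half_line_transform_def by (rule integral_evolved[OF m t em, where B=1]) (use l in simp)
  also have "\<dots> = (LINT y|\<mu>. exp (- (l * y)) + (LINT s:{0..t}|lborel. ?Y s y))"
    by (rule Bochner_Integration.integral_cong[OF refl]) (use dynkin_exp[OF _ t l] m.space_eq in auto)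
  also have "\<dots> = half_line_transform \<mu> l + (LINT y|\<mu>. (LINT s:{0..t}|lborel. ?Y s y))"
    unfolding half_line_transform_def
    by (rule Bochner_Integration.integral_add[OF m.transform_int F(4)]) (use l in simp)
  also have "(LINT y|\<mu>. (LINT s:{0..t}|lborel. ?Y s y)) = (LINT s:{0..t}|lborel. (LINT y|\<mu>. ?Y s y))"
    by (rule F(1))
  also have "\<dots> = (LINT s:{0..t}|lborel. (LINT z|(\<mu> \<bind> P s). exp_generator l z))"
    by (rule set_lebesgue_integral_cong) (use eq in auto)
  also have "\<dots> = integral {0..t} (\<lambda>s. LINT z|(\<mu> \<bind> P s). exp_generator l z)"
    by (rule set_borel_integral_eq_integral(2)[OF si])
  finally show "half_line_transform (\<mu> \<bind> P t) l = half_line_transform \<mu> l + integral {0..t} (\<lambda>s. LINT z|(\<mu> \<bind> P s). exp_generator l z)" .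
qed

text \<open>Under a stationary law the mean of \<open>exp_generator l\<close> is zero, and that is the differential equation of
  \<open>limit_transform\<close>.\<close>
lemma stationary_transform:
  assumes "stationary_distribution half_line P \<mu>" and "0 \<le> l"
  shows "half_line_transform \<mu> l = limit_transform l"
proof -
  have m: "half_line_prob \<mu>" and st: "\<And>t. 0 \<le> t \<Longrightarrow> \<mu> \<bind> P t = \<mu>"
    using assms(1) unfolding stationary_distribution_def by (auto simp: half_line_prob_def half_line_prob_axioms_def)
  interpret m: half_line_prob \<mu> by (rule m)
  have zero: "(LINT z|\<mu>. exp_generator l z) = 0" if "0 < l" for l
  proof -
    have "integral {0..1} (\<lambda>s. LINT z|(\<mu> \<bind> P s). exp_generator l z) = integral {0..1::real} (\<lambda>s. LINT z|\<mu>. exp_generator l z)"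
      by (rule Henstock_Kurzweil_Integration.integral_cong) (simp add: st)
    thus ?thesis using dynkin_evolved(1)[OF m _ that, of 1] st[of 1] by simp
  qed
  show ?thesis
  proof (rule limit_transform_unique[OF m.continuous_on_transform m.transform_0 m.DERIV_transform _ assms(2)])
    fix l :: real assume l: "0 < l"
    show "branching_rate l * - m.tilted_mean l = (1 - p\<^sub>A) * l * half_line_transform \<mu> l"
      using integral_exp_generator[OF m l] zero[OF l] by simp
  qed
qed

text \<open>Let \<open>F\<close> be the transform at time \<open>t\<close> divided by \<open>limit_transform\<close>, minus \<open>1\<close>. It vanishes for \<open>t = 0\<close> and for \<open>l = 0\<close> and
  satisfies the transport equation \<open>dF/dt = branching_rate l * dF/dl\<close>. At a positive maximum of
  \<open>F - \<epsilon> * t\<close> over a rectangle with corner \<open>(0, 0)\<close>, the two left-sided derivatives are nonnegative, so \<open>dF/dt \<ge> \<epsilon>\<close> and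
  \<open>dF/dl \<ge> 0\<close>, while \<open>branching_rate\<close> is negative there: a contradiction. The same applies to \<open>- F\<close>.
  Only one-sided information at the maximum is used because it may lie on the far edges.\<close>
lemma transform_stationary:
  assumes m: "half_line_prob \<nu>" and h: "\<And>l. 0 \<le> l \<Longrightarrow> half_line_transform \<nu> l = limit_transform l"
    and t: "0 \<le> t" and l: "0 \<le> l"
  shows "half_line_transform (\<nu> \<bind> P t) l = limit_transform l"
proof -
  define H where "H t l = half_line_transform (\<nu> \<bind> P t) l" for t l
  define K where "K l t = (LINT z|(\<nu> \<bind> P t). exp_generator l z)" for l t
  have ev: "half_line_prob (\<nu> \<bind> P t)" if "0 \<le> t" for t by (rule evolved_prob[OF m that])
  have Kb: "\<bar>K l t\<bar> \<le> 1 + l" if "0 \<le> t" "0 < l" for t l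
    unfolding K_def
    by (rule half_line_prob.integrable_bounded(2)[OF ev[OF that(1)] continuous_on_exp_generator])
      (use exp_generator_bound that in auto)
  have HK: "H t l = limit_transform l + integral {0..t} (K l)" "K l integrable_on {0..t}" if "0 \<le> t" "0 < l" for t l
    using dynkin_evolved[OF m that] h[of l] that unfolding H_def K_def by auto
  have H0: "H t 0 = 1" if "0 \<le> t" for t unfolding H_def by (rule half_line_prob.transform_0[OF ev[OF that]])
  have Lip: "\<bar>H t l - H s l\<bar> \<le> (1 + l) * \<bar>t - s\<bar>" if st: "0 \<le> s" "0 \<le> t" "0 \<le> l" for s t l
  proof (cases "l = 0")
    case False
    hence l: "0 < l" using st by simp
    have *: "\<bar>H t l - H s l\<bar> \<le> (1 + l) * (t - s)" if "0 \<le> s" "s \<le> t" for s t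
    proof -
      have "integral {0..s} (K l) + integral {s..t} (K l) = integral {0..t} (K l)"
        by (rule Henstock_Kurzweil_Integration.integral_combine) (use that HK(2)[OF _ l] in auto)
      hence "H t l - H s l = integral {s..t} (K l)" using HK(1)[OF _ l] that by simp
      moreover have "norm (integral {s..t} (K l)) \<le> integral {s..t} (\<lambda>_. 1 + l)"
      proof (rule integral_norm_bound_integral)
        show "K l integrable_on {s..t}"
          by (rule integrable_on_subinterval[OF HK(2)[OF _ l, of t]]) (use that in auto)
      qed (use Kb[OF _ l] that in auto)
      ultimately show ?thesis using that by (simp add: mult.commute)
    qed
    show ?thesis using *[of s t] *[of t s] st by (cases "s \<le> t") (auto simp: abs_minus_commute)
  qed (use H0 st in simp)
  have cH: "continuous_on {0..} (\<lambda>t. H t l)" if "0 \<le> l" for l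
    by (rule lipschitz_on_continuous_on[of "1 + l"], rule lipschitz_onI)
      (use Lip that in \<open>auto simp: dist_real_def\<close>)
  define G where "G l t = half_line_prob.tilted_mean (\<nu> \<bind> P t) l" for l t
  have KG: "K l t = - (branching_rate l * G l t) - (1 - p\<^sub>A) * l * H t l" if "0 \<le> t" "0 < l" for t l
    unfolding K_def G_def H_def by (rule integral_exp_generator[OF ev[OF that(1)] that(2)])
  \<comment> \<open>\<open>G l\<close> is a limit of difference quotients in \<open>l\<close>, uniformly in time. Its continuity makes \<open>H\<close> differentiable in time.\<close>
  have cG: "continuous_on {0..} (G l)" if l: "0 < l" for l
  proof (rule uniform_limit_theorem)
    define e where "e n = l / (2 * real (Suc n))" for n
    have e: "0 < e n" "e n \<le> l / 2" for n using l by (auto simp: e_def field_simps)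
    show "\<forall>\<^sub>F n in sequentially. continuous_on {0..} (\<lambda>t. - ((H t (l + e n) - H t l) / e n))"
      using cH l e by (intro always_eventually allI continuous_intros) (auto simp: less_imp_le less_imp_neq[symmetric] add_nonneg_nonneg)
    show "uniform_limit {0..} (\<lambda>n t. - ((H t (l + e n) - H t l) / e n)) (G l) sequentially"
      unfolding uniform_limit_iff
    proof (intro allI impI)
      fix r :: real assume r: "r > 0"
      have "(\<lambda>n. 4 / l * inverse (real (Suc n))) \<longlonglongrightarrow> 4 / l * 0"
        by (intro tendsto_mult tendsto_const LIMSEQ_inverse_real_of_nat)
      hence "eventually (\<lambda>n. 4 / l * inverse (real (Suc n)) < r) sequentially"
        using r by (intro order_tendstoD) auto
      thus "\<forall>\<^sub>F n in sequentially. \<forall>t\<in>{0..}. dist (- ((H t (l + e n) - H t l) / e n)) (G l t) < r"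
      proof (eventually_elim, intro ballI)
        fix n t assume n: "4 / l * inverse (real (Suc n)) < r" and "t \<in> {0::real..}"
        hence t: "0 \<le> t" by simp
        have "\<bar>H t (l + e n) - H t l + e n * G l t\<bar> \<le> 8 * (e n)\<^sup>2 / l\<^sup>2"
          unfolding H_def G_def by (rule half_line_prob.transform_expansion[OF ev[OF t] l]) (use e[of n] in auto)
        hence "\<bar>H t (l + e n) - H t l + e n * G l t\<bar> / e n \<le> (8 * (e n)\<^sup>2 / l\<^sup>2) / e n"
          using e[of n] by (intro divide_right_mono) auto
        also have "(8 * (e n)\<^sup>2 / l\<^sup>2) / e n = 8 / l\<^sup>2 * e n" using e[of n] by (simp add: power2_eq_square)
        also have "\<dots> = 4 / l * inverse (real (Suc n))"
          using l unfolding e_def by (simp add: power2_eq_square field_simps del: of_nat_Suc)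
        finally have 1: "\<bar>H t (l + e n) - H t l + e n * G l t\<bar> / e n < r" using n by simp
        have "- ((H t (l + e n) - H t l) / e n) - G l t = - ((H t (l + e n) - H t l + e n * G l t) / e n)"
          using e[of n] by (simp add: add_divide_distrib)
        hence "\<bar>- ((H t (l + e n) - H t l) / e n) - G l t\<bar> = \<bar>H t (l + e n) - H t l + e n * G l t\<bar> / e n"
          using e[of n] by simp
        thus "dist (- ((H t (l + e n) - H t l) / e n)) (G l t) < r" using 1 by (simp only: dist_real_def)
      qed
    qed
  qed simp
  have cK: "continuous_on {0..} (K l)" if "0 < l" for l
  proof -
    have "continuous_on {0..} (\<lambda>t. - (branching_rate l * G l t) - (1 - p\<^sub>A) * l * H t l)"
      using that by (intro continuous_intros cG cH) auto
    thus ?thesis by (rule continuous_on_eq) (use KG that in auto)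
  qed
  have Ht: "((\<lambda>t. H t l) has_real_derivative K l t) (at t)" if "0 < t" "0 < l" for t l
  proof -
    have "((\<lambda>u. integral {0..u} (K l)) has_real_derivative K l t) (at t within {0..t+1})"
      by (rule integral_has_real_derivative) (use that in \<open>auto intro!: continuous_on_subset[OF cK]\<close>)
    moreover have "at t within {0..t+1} = at t" using that by (intro at_within_interior) auto
    ultimately have "((\<lambda>u. limit_transform l + integral {0..u} (K l)) has_real_derivative K l t) (at t)"
      by (auto intro!: derivative_eq_intros)
    moreover have "eventually (\<lambda>u. limit_transform l + integral {0..u} (K l) = H u l) (nhds t)"
      by (rule eventually_nhds_in_open[of "{0<..}", THEN eventually_mono]) (use HK(1) that in auto)
    ultimately show ?thesis by (simp add: DERIV_cong_ev)
  qed
  have Hl: "((\<lambda>l. H t l) has_real_derivative - G l t) (at l)" if "0 \<le> t" "0 < l" for t l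
    unfolding H_def G_def by (rule half_line_prob.DERIV_transform[OF ev[OF that(1)] that(2)])
  have le: "\<sigma> * (H t l / limit_transform l - 1) \<le> 0" if sg: "\<sigma> = 1 \<or> \<sigma> = -1" for \<sigma> :: real
  proof (rule ccontr)
    assume neg: "\<not> ?thesis"
    define F where "F s u = \<sigma> * (H s u / limit_transform u - 1)" for s u
    have Fp: "0 < F t l" using neg by (simp add: F_def)
    define \<epsilon> where "\<epsilon> = F t l / (2 * (t + 1))"
    have eps: "0 < \<epsilon>" "\<epsilon> * t < F t l"
    proof -
      show "0 < \<epsilon>" using Fp t by (simp add: \<epsilon>_def)
      hence "\<epsilon> * t < \<epsilon> * (2 * (t + 1))" using t by (intro mult_strict_left_mono) auto
      also have "\<dots> = F t l" using t by (simp add: \<epsilon>_def)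
      finally show "\<epsilon> * t < F t l" .
    qed
    define \<Theta> where "\<Theta> p = F (fst p) (snd p) - \<epsilon> * fst p" for p
    let ?S = "{0..t} \<times> {0..l}"
    have "continuous_on ?S (\<lambda>p. H (fst p) (snd p))"
      unfolding continuous_on_def
    proof
      fix p0 assume p0: "p0 \<in> ?S"
      obtain t0 l0 where tl: "p0 = (t0, l0)" "0 \<le> t0" "0 \<le> l0" using p0 by auto
      have "((\<lambda>p. H (fst p) (snd p) - H t0 (snd p)) \<longlongrightarrow> 0) (at p0 within ?S)"
      proof (rule Lim_null_comparison)
        show "eventually (\<lambda>p. norm (H (fst p) (snd p) - H t0 (snd p)) \<le> (1 + l) * \<bar>fst p - t0\<bar>) (at p0 within ?S)"
          unfolding eventually_at_filter
        proof (intro always_eventually allI impI)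
          fix p assume "p \<noteq> p0" "p \<in> ?S"
          hence p: "0 \<le> fst p" "0 \<le> snd p" "snd p \<le> l" by auto
          have "\<bar>H (fst p) (snd p) - H t0 (snd p)\<bar> \<le> (1 + snd p) * \<bar>fst p - t0\<bar>" by (rule Lip[OF tl(2) p(1,2)])
          also have "\<dots> \<le> (1 + l) * \<bar>fst p - t0\<bar>" using p by (intro mult_right_mono) auto
          finally show "norm (H (fst p) (snd p) - H t0 (snd p)) \<le> (1 + l) * \<bar>fst p - t0\<bar>" by simp
        qed
        have "((\<lambda>p. (1 + l) * \<bar>fst p - t0\<bar>) \<longlongrightarrow> (1 + l) * \<bar>fst p0 - t0\<bar>) (at p0 within ?S)"
          by (intro tendsto_intros)
        thus "((\<lambda>p. (1 + l) * \<bar>fst p - t0\<bar>) \<longlongrightarrow> 0) (at p0 within ?S)" using tl by simp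
      qed
      moreover have "((\<lambda>p. H t0 (snd p)) \<longlongrightarrow> H t0 (snd p0)) (at p0 within ?S)"
      proof (rule continuous_on_tendsto_compose[of "{0..}" "H t0"])
        show "continuous_on {0..} (H t0)" unfolding H_def
          by (rule half_line_prob.continuous_on_transform[OF ev[OF tl(2)]])
        show "\<forall>\<^sub>F p in at p0 within ?S. snd p \<in> {0..}"
          unfolding eventually_at_filter by (intro always_eventually) auto
        show "((\<lambda>p. snd p) \<longlongrightarrow> snd p0) (at p0 within ?S)" by (rule tendsto_snd[OF tendsto_ident_at])
      qed (use tl in auto)
      ultimately have "((\<lambda>p. (H (fst p) (snd p) - H t0 (snd p)) + H t0 (snd p)) \<longlongrightarrow> 0 + H t0 (snd p0)) (at p0 within ?S)"
        by (rule tendsto_add)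
      thus "((\<lambda>p. H (fst p) (snd p)) \<longlongrightarrow> H (fst p0) (snd p0)) (at p0 within ?S)" using tl by simp
    qed
    moreover have "continuous_on ?S (\<lambda>p. limit_transform (snd p))"
      by (rule continuous_on_compose2[OF continuous_on_limit_transform]) (auto intro!: continuous_intros)
    ultimately have "continuous_on ?S \<Theta>"
      unfolding \<Theta>_def F_def using limit_transform_pos by (intro continuous_intros) (auto simp: less_imp_neq[symmetric])
    then obtain p0 where p0: "p0 \<in> ?S" "\<And>p. p \<in> ?S \<Longrightarrow> \<Theta> p \<le> \<Theta> p0"
      using continuous_attains_sup[of ?S \<Theta>] t l by (auto simp: compact_Times)
    obtain t0 l0 where tl: "p0 = (t0, l0)" "0 \<le> t0" "t0 \<le> t" "0 \<le> l0" "l0 \<le> l" using p0(1) by auto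
    have mx: "F s u - \<epsilon> * s \<le> F t0 l0 - \<epsilon> * t0" if "0 \<le> s" "s \<le> t" "0 \<le> u" "u \<le> l" for s u
      using p0(2)[of "(s, u)"] that tl by (simp add: \<Theta>_def)
    have pos: "0 < F t0 l0 - \<epsilon> * t0" using mx[of t l] t l eps(2) by simp
    have F0l: "F 0 u = 0" if "0 \<le> u" for u
    proof (cases "u = 0")
      case False
      thus ?thesis using HK(1)[of 0 u] that limit_transform_pos[of u] by (simp add: F_def)
    qed (simp add: F_def H0)
    have Ft0: "F s 0 = 0" if "0 \<le> s" for s using H0[OF that] by (simp add: F_def)
    have t0: "0 < t0" using pos F0l[OF tl(4)] tl by (cases "t0 = 0") auto
    have l0: "0 < l0"
    proof (rule ccontr)
      assume "\<not> 0 < l0" hence "l0 = 0" using tl by simp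
      hence "F t0 l0 = 0" using Ft0 tl by simp
      moreover have "0 \<le> \<epsilon> * t0" using eps t0 by simp
      ultimately show False using pos by linarith
    qed
    let ?h = "limit_transform l0" and ?h' = "limit_transform_deriv l0" and ?R = "branching_rate l0"
    have hp: "0 < ?h" by (rule limit_transform_pos)
    define Dl where "Dl = \<sigma> * ((- G l0 t0 * ?h - H t0 l0 * ?h') / (?h * ?h))"
    have DFl: "((\<lambda>u. F t0 u) has_real_derivative Dl) (at l0)"
    proof -
      have "((\<lambda>u. H t0 u / limit_transform u) has_real_derivative (- G l0 t0 * ?h - H t0 l0 * ?h') / (?h * ?h)) (at l0)"
        using DERIV_divide[OF Hl[OF tl(2) l0] DERIV_limit_transform[OF l0]] hp by simp
      from DERIV_cmult[OF DERIV_diff[OF this DERIV_const[of 1]], of \<sigma>]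
      show ?thesis unfolding F_def Dl_def by simp
    qed
    have Dl0: "0 \<le> Dl"
    proof (rule ccontr)
      assume "\<not> 0 \<le> Dl"
      then obtain d where d: "d > 0" "\<And>e. 0 < e \<Longrightarrow> e < d \<Longrightarrow> F t0 l0 < F t0 (l0 - e)"
        using has_real_derivative_neg_dec_left[OF DFl] by auto
      define e where "e = min (d / 2) l0"
      have e: "0 < e" "e < d" "e \<le> l0" using d l0 by (auto simp: e_def)
      show False using d(2)[OF e(1,2)] mx[of t0 "l0 - e"] e tl by simp
    qed
    define Dt where "Dt = \<sigma> * (K l0 t0 / ?h) - \<epsilon>"
    have DFt: "((\<lambda>s. F s l0 - \<epsilon> * s) has_real_derivative Dt) (at t0)"
      using DERIV_diff[OF DERIV_cmult[OF DERIV_diff[OF DERIV_cdivide[OF Ht[OF t0 l0], of ?h] DERIV_const[of 1]], of \<sigma>] DERIV_cmult_Id[of \<epsilon>]]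
      unfolding F_def Dt_def by simp
    have Dt0: "0 \<le> Dt"
    proof (rule ccontr)
      assume "\<not> 0 \<le> Dt"
      then obtain d where d: "d > 0" "\<And>e. 0 < e \<Longrightarrow> e < d \<Longrightarrow> F t0 l0 - \<epsilon> * t0 < F (t0 - e) l0 - \<epsilon> * (t0 - e)"
        using has_real_derivative_neg_dec_left[OF DFt] by auto
      define e where "e = min (d / 2) t0"
      have e: "0 < e" "e < d" "e \<le> t0" using d t0 by (auto simp: e_def)
      show False using d(2)[OF e(1,2)] mx[of "t0 - e" l0] e tl by simp
    qed
    have ode: "?R * ?h' = (1 - p\<^sub>A) * l0 * ?h" by (rule limit_transform_ODE) (use l0 in simp)
    have "?R * Dl = \<sigma> * (- (?R * G l0 t0) * ?h - H t0 l0 * (?R * ?h')) / (?h * ?h)"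
      unfolding Dl_def by (simp add: algebra_simps)
    also have "\<dots> = \<sigma> * (K l0 t0 * ?h) / (?h * ?h)"
      unfolding ode KG[OF tl(2) l0] by (simp add: algebra_simps)
    also have "\<dots> = \<sigma> * (K l0 t0 / ?h)" using hp by simp
    finally have "\<sigma> * (K l0 t0 / ?h) \<le> 0"
      using Dl0 branching_rate_neg[OF l0] by (metis mult_nonpos_nonneg less_imp_le)
    thus False using Dt0 eps(1) unfolding Dt_def by linarith
  qed
  have "H t l / limit_transform l = 1" using le[of 1] le[of "-1"] by simp
  thus ?thesis using limit_transform_pos[of l] by (simp add: H_def field_simps)
qed

text \<open>Since \<open>transform_stationary\<close> gives invariance of every law with transform \<open>limit_transform\<close>, stationary laws are
  exactly those with this transform, and there is at most one.\<close>
lemma stationary_iff_transform: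
  assumes n: "half_line_prob \<nu>" and h: "\<And>l. 0 \<le> l \<Longrightarrow> half_line_transform \<nu> l = limit_transform l"
  shows "stationary_distribution half_line P \<mu> \<longleftrightarrow> \<mu> = \<nu>"
proof
  assume s: "stationary_distribution half_line P \<mu>"
  hence "half_line_prob \<mu>" unfolding stationary_distribution_def by (simp add: half_line_prob_def half_line_prob_axioms_def)
  thus "\<mu> = \<nu>" by (rule half_line_prob_eqI[OF _ n]) (simp add: h stationary_transform[OF s])
next
  assume m: "\<mu> = \<nu>"
  have "\<nu> \<bind> P t = \<nu>" if t: "0 \<le> t" for t
    by (rule half_line_prob_eqI[OF evolved_prob[OF n t] n]) (simp add: h transform_stationary[OF n h t])
  thus "stationary_distribution half_line P \<mu>"
    using n unfolding m stationary_distribution_def half_line_prob_def half_line_prob_axioms_def by simp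
qed

end

section \<open>Convergence to the stationary distribution\<close>

text \<open>The cut-off at \<open>0\<close> turns a law on the line that is supported in the half-line into a law on the half-line.\<close>
lemma (in bandit_rates) half_line_prob_of_real_distribution:
  assumes N: "real_distribution N" "AE y in N. 0 \<le> y"
  shows "half_line_prob (distr N half_line (max 0))"
    and "half_line_transform (distr N half_line (max 0)) l = (LINT y|N. exp (- (l * y)))"
    and "distr (distr N half_line (max 0)) borel (\<lambda>y. y) = N"
proof -
  interpret N: real_distribution N by (rule N(1))
  have m: "max 0 \<in> N \<rightarrow>\<^sub>M half_line"
    by (rule measurable_restrict_space2) auto
  have ae: "AE y in N. max 0 y = y" using N(2) by eventually_elim (rule max_absorb2)
  show "half_line_prob (distr N half_line (max 0))"
    using N.prob_space_distr[OF m] by (simp add: half_line_prob_def half_line_prob_axioms_def)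
  have e: "(\<lambda>z. exp (- (l * z))) \<in> borel_measurable half_line"
    by (rule borel_measurable_half_line) (intro continuous_intros)
  have "half_line_transform (distr N half_line (max 0)) l = (LINT y|N. exp (- (l * max 0 y)))"
    unfolding half_line_transform_def by (rule integral_distr[OF m e])
  also have "\<dots> = (LINT y|N. exp (- (l * y)))"
    by (rule integral_cong_AE) (measurable, rule ae[THEN AE_mp], simp)
  finally show "half_line_transform (distr N half_line (max 0)) l = (LINT y|N. exp (- (l * y)))" .
  have "distr (distr N half_line (max 0)) borel (\<lambda>y. y) = distr N borel ((\<lambda>y. y) \<circ> max 0)"
    by (rule distr_distr[OF _ m]) (rule borel_measurable_half_line, rule continuous_on_id)
  also have "\<dots> = distr N borel (\<lambda>y. y)"
    by (rule distr_cong_AE) (use ae in \<open>auto simp: o_def\<close>)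
  also have "\<dots> = N" by (rule distr_id2) simp
  finally show "distr (distr N half_line (max 0)) borel (\<lambda>y. y) = N" .
qed

theorem theorem4:
  fixes M :: "'a measure"
    and U :: "nat \<Rightarrow> 'a \<Rightarrow> real"
    and A B :: "nat \<Rightarrow> 'a set"
    and \<gamma> \<rho> :: "nat \<Rightarrow> real"
    and p\<^sub>A p\<^sub>B x g :: real
  assumes "prob_space M"
    and "0 < p\<^sub>B" and "p\<^sub>B < p\<^sub>A" and "p\<^sub>A < 1"
    and "\<And>n. n \<ge> 1 \<Longrightarrow> 0 < \<gamma> n \<and> \<gamma> n < 1"
    and "\<And>m n. 1 \<le> m \<Longrightarrow> m \<le> n \<Longrightarrow> \<gamma> n \<le> \<gamma> m"
    and "filterlim (\<lambda>n. \<Sum>k=1..n. \<gamma> k) at_top sequentially"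
    and "\<And>\<theta>. \<theta> > 0 \<Longrightarrow> summable (\<lambda>n. exp (- \<theta> / \<gamma> (Suc n)))"
    and "\<And>n. n \<ge> 1 \<Longrightarrow> 0 < \<rho> n \<and> \<gamma> n * \<rho> n < 1"
    and "prob_space.indep_vars M (\<lambda>_. borel) U {1..}"
    and "\<And>n. n \<ge> 1 \<Longrightarrow> distr M borel (U n) = uniform_measure lborel {0..1}"
    and "\<And>n. n \<ge> 1 \<Longrightarrow> A n \<in> sets M \<and> measure M (A n) = p\<^sub>A"
    and "\<And>n. n \<ge> 1 \<Longrightarrow> B n \<in> sets M \<and> measure M (B n) = p\<^sub>B"
    and "prob_space.indep_vars M (\<lambda>_. borel \<Otimes>\<^sub>M borel)
           (\<lambda>n \<omega>. (indicator (A n) \<omega> :: real, indicator (B n) \<omega> :: real)) {1..}"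
    and "independent_rvs M
           (PiM {1..} (\<lambda>_::nat. borel \<Otimes>\<^sub>M borel))
           (\<lambda>\<omega>. \<lambda>n\<in>{1..}. (indicator (A n) \<omega> :: real, indicator (B n) \<omega> :: real))
           (PiM {1..} (\<lambda>_::nat. borel))
           (\<lambda>\<omega>. \<lambda>n\<in>{1..}. U n \<omega>)"
    and "0 < x" and "x < 1"
    and "g > 0"
    and "(\<lambda>n. \<gamma> n - \<gamma> (n - 1)) \<in> o(\<lambda>n. (\<gamma> n)\<^sup>2)"
    and "(\<lambda>n. \<gamma> n / \<rho> n - g) \<in> o(\<gamma>)"
  shows "\<exists>\<nu>.
      (\<exists>P. markov_process_with_generator (bandit_generator p\<^sub>A p\<^sub>B g) P) \<and>
      (\<forall>P. markov_process_with_generator (bandit_generator p\<^sub>A p\<^sub>B g) P \<longrightarrow>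
         (\<forall>\<mu>. stationary_distribution half_line P \<mu> \<longleftrightarrow> \<mu> = \<nu>)) \<and>
      weak_conv_m
        (\<lambda>n. distr M borel (\<lambda>\<omega>. (1 - penalized_bandit \<gamma> \<rho> U A B x n \<omega>) / \<rho> n))
        (distr \<nu> borel (\<lambda>y. y))"
proof -
  interpret penalized_bandit_critical M p\<^sub>A p\<^sub>B g U A B \<gamma> \<rho> x
  proof (intro penalized_bandit_critical.intro penalized_bandit_model.intro bandit_rates.intro
      penalized_bandit_model_axioms.intro penalized_bandit_critical_axioms.intro)
    show "prob_space M" by fact
  qed (fact assms)+
  obtain N where N: "real_distribution N" "AE y in N. 0 \<le> y"
    and transform: "\<And>l. 0 \<le> l \<Longrightarrow> (LINT y|N. exp (- (l * y))) = limit_transform l"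
    and conv: "weak_conv_m (\<lambda>n. distr M borel (Y n)) N"
    by (rule limit_distribution, rule that)
  define \<nu> where "\<nu> = distr N half_line (max 0)"
  note \<nu> = half_line_prob_of_real_distribution[OF N, folded \<nu>_def]
  have stationary: "stationary_distribution half_line P \<mu> \<longleftrightarrow> \<mu> = \<nu>"
    if "markov_process_with_generator (bandit_generator p\<^sub>A p\<^sub>B g) P" for P \<mu>
  proof -
    interpret bandit_markov_process p\<^sub>A p\<^sub>B g P
      by (rule bandit_markov_process.intro[OF bandit_rates_axioms bandit_markov_process_axioms.intro[OF that]])
    show ?thesis by (rule stationary_iff_transform[OF \<nu>(1)]) (simp add: \<nu>(2) transform)
  qed
  have "weak_conv_m (\<lambda>n. distr M borel (\<lambda>\<omega>. (1 - X n \<omega>) / \<rho> n)) (distr \<nu> borel (\<lambda>y. y))"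
    using conv unfolding \<nu>(3) Y_def[abs_def] .
  thus ?thesis using exists_markov_process stationary by blast
qed

end
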